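(* Let $X_0,\ldots,X_n$ be a sample from a stationary FAR(1) process $X_{t+1}=\Psi(X_t)+\epsilon_{t+1}$, $-\infty<t<\infty$, in $\mathcal{H}$ with $\mathrm{E}X_t=0$, satisfying (i) $\{\epsilon_t\}$ are i.i.d. with $\mathrm{E}\epsilon_t=0$ and $\mathrm{E}\Vert\epsilon_t\Vert^4<\infty$; (ii) $\Psi$ is a Hilbert-Schmidt operator with $\Vert\Psi\Vert_{\mathcal{L}}<1$; (iii) the eigenvalues $\lambda_1>\lambda_2>\ldots$ of $\Gamma$ are all positive and have multiplicity 1. Put $a_1=\lambda_1-\lambda_2$ and $a_j=\min(\lambda_{j-1}-\lambda_j,\ \lambda_j-\lambda_{j+1})$ for $j\ge 2$. Suppose that $k_n\to\infty$, that $$\frac{k_n}{n}\sum_{j=1}^{k_n}\frac{1}{a_j^2}\to 0 \ (n\to\infty), \qquad \frac{1}{\lambda_{k_n}}=O\left(\frac{n^{1/4}}{(\log n)^{\beta}}\right)\ \text{ for some } \beta>\frac12,$$ and that $$\frac{1}{\lambda_{k_n}}\sum_{j=1}^{k_n}\frac{1}{a_j}=O\left(\frac{n^{1/4}}{(\log n)^{\beta}}\right)\ \text{ for some } \beta>1 .$$ Then $$n\, d_2^2\left(\hat C_n-C,\ \hat C_n^*-\hat C_n\hat\Pi_{k_n}\right)\to 0\quad\text{in probability as } n\to\infty .$$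
   Context: $\mathcal{H}$ is a separable Hilbert space with scalar product $\langle\cdot,\cdot\rangle$ and norm $\Vert\cdot\Vert$. For $y,z\in\mathcal{H}$, $y\otimes z$ is the linear operator $(y\otimes z)(x)=\langle y,x\rangle z$. $\Vert A\Vert_{\mathcal{L}}$ is the operator norm of a bounded linear operator $A$ on $\mathcal{H}$. A FAR(1) process is a sequence of $\mathcal{H}$-valued random variables with $X_{t+1}=\Psi(X_t)+\epsilon_{t+1}$, where $\Psi:\mathcal{H}\to\mathcal{H}$ is a linear operator and the innovations $\epsilon_t$ are i.i.d. $\mathcal{H}$-valued random variables. $\Gamma=\mathrm{E}\,X_t\otimes X_t$ is the covariance operator, with eigenvalues $\lambda_1\ge\lambda_2\ge\ldots$, and $C=\mathrm{E}\,X_t\otimes X_{t+1}$ is the lag-1 autocovariance operator. Estimates: $$\hat\Gamma_n=\frac1n\sum_{j=0}^{n-1}X_j\otimes X_j,\qquad \hat C_n=\frac1n\sum_{j=0}^{n-1}X_j\otimes X_{j+1}.$$ $\hat\lambda_1\ge\hat\lambda_2\ge\ldots$ and $\hat v_1,\hat v_2,\ldots$ are the eigenvalues and corresponding orthonormal eigenvectors of $\hat\Gamma_n$. $(k_n)$ is a sequence of positive integers, $\hat\Pi_{k_n}=\sum_{j=1}^{k_n}\hat v_j\otimes\hat v_j$ is the projection onto the span of the first $k_n$ eigenvectors of $\hat\Gamma_n$, $\hat\Gamma_n^\dagger=\sum_{j=1}^{k_n}\frac{1}{\hat\lambda_j}\hat v_j\otimes\hat v_j$, and $\hat\Psi_n=\hat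 C_n\hat\Gamma_n^\dagger$. Residual-based bootstrap: $\hat\epsilon_j=X_j-\hat\Psi_n(X_{j-1})$, $\tilde\epsilon_j=\hat\epsilon_j-\frac1n\sum_{k=1}^n\hat\epsilon_k$, $j=1,\ldots,n$, and $\hat F_n$ is the empirical distribution of $\tilde\epsilon_1,\ldots,\tilde\epsilon_n$. Conditionally on $X_0,\ldots,X_n$, the bootstrap innovations $\epsilon_1^*,\ldots,\epsilon_n^*$ are i.i.d. with distribution $\hat F_n$, and the bootstrap data are generated recursively by $X_t^*=\hat\Psi_n(X_{t-1}^* )+\epsilon_t^*$, $t=1,\ldots,n$, for some suitable initial value $X_0^*$ (popular choices are $X_0^*=X_0$ or $X_0^*=\mathrm{E}X_0=0$). The bootstrap lag-1 autocovariance operator estimate is $\hat C_n^*=\frac1n\sum_{t=0}^{n-1}X_t^*\otimes X_{t+1}^*$. Mallows metric for random bounded linear operators $A,B$ on $\mathcal{H}$: $d_2^2(A,B)=\inf\mathrm{E}\Vert A'-B'\Vert_{\mathcal{L}}^2$, the infimum being over all pairs of random operators $A',B'$ with the same marginal distributions as $A$ and $B$ respectively. In $d_2(\hat C_n-C,\hat C_n^*-\hat C_n\hat\Pi_{k_n})$ the first distribution is that of $\hat C_n-C$ and the second is the conditional distribution of $\hat C_n^*-\hat C_n\hat\Pi_{k_n}$ given $X_0,\ldots,X_n$; so this is a random quantity depending on $X_0,\ldots,X_n$. *)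

theory Defs
  imports "HOL-Probability.Probability" "HOL-Library.Landau_Symbols"
begin

section \<open>Operators on a Hilbert space\<close>

text \<open>
  Real separable Hilbert spaces are the types of sort
  \<open>{real_inner, banach, second_countable_topology}\<close>; \<open>'h \<Rightarrow>\<^sub>L 'h\<close> is the space of bounded
  operators with the operator norm. Sequences of eigenvalues, eigenvectors and gaps
  are indexed from 1; their values at index 0 are irrelevant. Division by 0 is 0.
\<close>

lift_definition tensor :: "'h::real_inner \<Rightarrow> 'h \<Rightarrow> ('h \<Rightarrow>\<^sub>L 'h)"
  is "\<lambda>y z x. (y \<bullet> x) *\<^sub>R z"
  by (rule bounded_linear_intros bounded_linear_inner_right)+

definition orthonormal_basis :: "'h::real_inner set \<Rightarrow> bool" where
  "orthonormal_basis B \<longleftrightarrow>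
     pairwise orthogonal B \<and> (\<forall>e\<in>B. norm e = 1) \<and> closure (span B) = UNIV"

text \<open>The sum below does not depend on the orthonormal basis.\<close>

definition hilbert_schmidt :: "('h::real_inner \<Rightarrow>\<^sub>L 'h) \<Rightarrow> bool" where
  "hilbert_schmidt A \<longleftrightarrow>
     (\<exists>B. orthonormal_basis B \<and> (\<lambda>e. (norm (blinfun_apply A e))\<^sup>2) summable_on B)"

definition eigenspace :: "('h::real_inner \<Rightarrow>\<^sub>L 'h) \<Rightarrow> real \<Rightarrow> 'h set" where
  "eigenspace A \<mu> = {x. blinfun_apply A x = \<mu> *\<^sub>R x}"

definition eigenvalue :: "('h::real_inner \<Rightarrow>\<^sub>L 'h) \<Rightarrow> real \<Rightarrow> bool" where
  "eigenvalue A \<mu> \<longleftrightarrow> (\<exists>x. x \<noteq> 0 \<and> blinfun_apply A x = \<mu> *\<^sub>R x)"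

text \<open>
  \<open>l 1 \<ge> l 2 \<ge> \<dots>\<close> are the eigenvalues, repeated according to multiplicity, of a non-negative compact
  self-adjoint operator \<open>A\<close>, and \<open>v 1, v 2, \<dots>\<close> are corresponding orthonormal eigenvectors.
  By the last conjunct every nonzero eigenvalue occurs with its full multiplicity. If \<open>A\<close> has finite
  rank the list continues with eigenvectors for the eigenvalue 0.
\<close>

definition eigen_listing ::
  "('h::real_inner \<Rightarrow>\<^sub>L 'h) \<Rightarrow> (nat \<Rightarrow> real) \<Rightarrow> (nat \<Rightarrow> 'h) \<Rightarrow> bool" where
  "eigen_listing A l v \<longleftrightarrow>
     (\<forall>i\<ge>1. \<forall>j\<ge>i. l j \<le> l i) \<and>
     (\<forall>i\<ge>1. \<forall>j\<ge>1. v i \<bullet> v j = (if i = j then 1 else 0)) \<and>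
     (\<forall>j\<ge>1. blinfun_apply A (v j) = l j *\<^sub>R v j) \<and>
     (\<forall>\<mu>. \<mu> \<noteq> 0 \<longrightarrow> eigenspace A \<mu> = span {v j |j. 1 \<le> j \<and> l j = \<mu>})"

definition spectral_gap :: "(nat \<Rightarrow> real) \<Rightarrow> nat \<Rightarrow> real" where
  "spectral_gap l j =
     (if j = 1 then l 1 - l 2 else min (l (j - 1) - l j) (l j - l (j + 1)))"


section \<open>Probability\<close>

text \<open>
  Expectation of a random operator, taken pointwise: \<open>(E A) x = E (A x)\<close>. The operator space is not
  separable in general, so the Bochner integral of the library is not available on it.
\<close>

definition op_expectation ::
  "'a measure \<Rightarrow> ('a \<Rightarrow> ('h::{real_inner, banach, second_countable_topology} \<Rightarrow>\<^sub>L 'h))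
     \<Rightarrow> ('h \<Rightarrow>\<^sub>L 'h)" where
  "op_expectation M A = Blinfun (\<lambda>x. \<integral>\<omega>. blinfun_apply (A \<omega>) x \<partial>M)"

lemma op_expectation_apply:
  fixes A :: "'a \<Rightarrow> ('h::{real_inner, banach, second_countable_topology} \<Rightarrow>\<^sub>L 'h)"
  assumes int: "\<And>x. integrable M (\<lambda>\<omega>. blinfun_apply (A \<omega>) x)"
    and norm: "integrable M (\<lambda>\<omega>. norm (A \<omega>))"
  shows "blinfun_apply (op_expectation M A) x = (\<integral>\<omega>. blinfun_apply (A \<omega>) x \<partial>M)"
proof -
  have "bounded_linear (\<lambda>x. \<integral>\<omega>. blinfun_apply (A \<omega>) x \<partial>M)"
  proof (rule bounded_linear_intro[where K = "\<integral>\<omega>. norm (A \<omega>) \<partial>M"])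
    fix x y :: 'h and r :: real
    show "(\<integral>\<omega>. blinfun_apply (A \<omega>) (x + y) \<partial>M)
        = (\<integral>\<omega>. blinfun_apply (A \<omega>) x \<partial>M) + (\<integral>\<omega>. blinfun_apply (A \<omega>) y \<partial>M)"
      by (simp add: blinfun.add_right int)
    show "(\<integral>\<omega>. blinfun_apply (A \<omega>) (r *\<^sub>R x) \<partial>M) = r *\<^sub>R (\<integral>\<omega>. blinfun_apply (A \<omega>) x \<partial>M)"
      by (simp add: blinfun.scaleR_right)
    have "norm (\<integral>\<omega>. blinfun_apply (A \<omega>) x \<partial>M) \<le> (\<integral>\<omega>. norm (blinfun_apply (A \<omega>) x) \<partial>M)"
      by (rule integral_norm_bound)
    also have "\<dots> \<le> (\<integral>\<omega>. norm x * norm (A \<omega>) \<partial>M)"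
      by (intro integral_mono integrable_norm int integrable_mult_right norm)
        (metis norm_blinfun mult.commute)
    finally show "norm (\<integral>\<omega>. blinfun_apply (A \<omega>) x \<partial>M) \<le> norm x * (\<integral>\<omega>. norm (A \<omega>) \<partial>M)"
      by simp
  qed
  then show ?thesis
    by (simp add: op_expectation_def bounded_linear_Blinfun_apply)
qed

definition strictly_stationary :: "'a measure \<Rightarrow> (int \<Rightarrow> 'a \<Rightarrow> 'h::topological_space) \<Rightarrow> bool" where
  "strictly_stationary M X \<longleftrightarrow>
     (\<forall>t. X t \<in> borel_measurable M) \<and>
     (\<forall>h. distr M (\<Pi>\<^sub>M t\<in>UNIV. borel) (\<lambda>\<omega> t. X (t + h) \<omega>)
        = distr M (\<Pi>\<^sub>M t\<in>UNIV. borel) (\<lambda>\<omega> t. X t \<omega>))"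

definition iid :: "'a measure \<Rightarrow> (int \<Rightarrow> 'a \<Rightarrow> 'h::topological_space) \<Rightarrow> bool" where
  "iid M e \<longleftrightarrow>
     prob_space.indep_vars M (\<lambda>_. borel) e UNIV \<and>
     (\<forall>s t. distr M borel (e s) = distr M borel (e t))"

text \<open>
  Outer measure is used in the next two definitions because \<open>Y n\<close> need not be known to be measurable;
  for measurable \<open>Y n\<close> these are the usual notions.
\<close>

definition tendsto_zero_in_prob :: "'a measure \<Rightarrow> (nat \<Rightarrow> 'a \<Rightarrow> ennreal) \<Rightarrow> bool" where
  "tendsto_zero_in_prob M Y \<longleftrightarrow>
     (\<forall>\<delta>>0. (\<lambda>n. outer_measure_of M {\<omega> \<in> space M. Y n \<omega> > ennreal \<delta>}) \<longlonglongrightarrow> 0)"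

definition bounded_in_prob :: "'a measure \<Rightarrow> (nat \<Rightarrow> 'a \<Rightarrow> 'h::real_normed_vector) \<Rightarrow> bool" where
  "bounded_in_prob M Y \<longleftrightarrow>
     (\<forall>\<delta>>0. \<exists>K. \<forall>\<^sub>F n in sequentially.
       outer_measure_of M {\<omega> \<in> space M. norm (Y n \<omega>) > K} \<le> ennreal \<delta>)"

text \<open>
  The squared Mallows metric between the distributions \<open>\<mu>\<close> and \<open>\<nu>\<close> of two random operators. The infimum
  is over pairs \<open>(A, B)\<close> of random operators on a common probability space \<open>N\<close>. Taking the sample space
  to be the type of pairs of operators is no restriction: the pair can be transported along
  \<open>s \<mapsto> (A s, B s)\<close>, with the pushed-forward \<open>\<sigma>\<close>-algebra. Measurability of the distance has to be
  demanded since the operator space need not be separable.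
\<close>

definition mallows_coupling ::
  "('h::real_normed_vector \<Rightarrow>\<^sub>L 'h) measure \<Rightarrow> ('h \<Rightarrow>\<^sub>L 'h) measure
     \<Rightarrow> (('h \<Rightarrow>\<^sub>L 'h) \<times> ('h \<Rightarrow>\<^sub>L 'h)) measure
     \<Rightarrow> (('h \<Rightarrow>\<^sub>L 'h) \<times> ('h \<Rightarrow>\<^sub>L 'h) \<Rightarrow> ('h \<Rightarrow>\<^sub>L 'h))
     \<Rightarrow> (('h \<Rightarrow>\<^sub>L 'h) \<times> ('h \<Rightarrow>\<^sub>L 'h) \<Rightarrow> ('h \<Rightarrow>\<^sub>L 'h)) \<Rightarrow> bool" where
  "mallows_coupling \<mu> \<nu> N A B \<longleftrightarrow>
     prob_space N \<and>
     A \<in> borel_measurable N \<and> B \<in> borel_measurable N \<and>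
     (\<lambda>s. norm (A s - B s)) \<in> borel_measurable N \<and>
     distr N borel A = \<mu> \<and> distr N borel B = \<nu>"

definition mallows_sq ::
  "('h::real_normed_vector \<Rightarrow>\<^sub>L 'h) measure \<Rightarrow> ('h \<Rightarrow>\<^sub>L 'h) measure \<Rightarrow> ennreal" where
  "mallows_sq \<mu> \<nu> =
     (INF (N, A, B) \<in> {(N, A, B). mallows_coupling \<mu> \<nu> N A B}.
        \<integral>\<^sup>+s. ennreal ((norm (A s - B s))\<^sup>2) \<partial>N)"


section \<open>Estimators and the residual bootstrap\<close>

text \<open>
  Throughout, \<open>x\<close> is the data \<open>x 0, \<dots>, x n\<close>; the argument \<open>k\<close> is the number of eigenvectors used and
  \<open>l\<close>, \<open>v\<close> are the eigenvalues and eigenvectors of \<open>Gamma_hat n x\<close>.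
\<close>

definition sample :: "(int \<Rightarrow> 'a \<Rightarrow> 'h) \<Rightarrow> nat \<Rightarrow> 'a \<Rightarrow> nat \<Rightarrow> 'h" where
  "sample X n \<omega> = restrict (\<lambda>j. X (int j) \<omega>) {0..n}"

definition Gamma_hat :: "nat \<Rightarrow> (nat \<Rightarrow> 'h::real_inner) \<Rightarrow> ('h \<Rightarrow>\<^sub>L 'h)" where
  "Gamma_hat n x = (1 / real n) *\<^sub>R (\<Sum>j<n. tensor (x j) (x j))"

definition C_hat :: "nat \<Rightarrow> (nat \<Rightarrow> 'h::real_inner) \<Rightarrow> ('h \<Rightarrow>\<^sub>L 'h)" where
  "C_hat n x = (1 / real n) *\<^sub>R (\<Sum>j<n. tensor (x j) (x (j + 1)))"

definition Pi_hat :: "nat \<Rightarrow> (nat \<Rightarrow> 'h::real_inner) \<Rightarrow> ('h \<Rightarrow>\<^sub>L 'h)" where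
  "Pi_hat k v = (\<Sum>j=1..k. tensor (v j) (v j))"

definition Gamma_dagger ::
  "nat \<Rightarrow> (nat \<Rightarrow> real) \<Rightarrow> (nat \<Rightarrow> 'h::real_inner) \<Rightarrow> ('h \<Rightarrow>\<^sub>L 'h)" where
  "Gamma_dagger k l v = (\<Sum>j=1..k. (1 / l j) *\<^sub>R tensor (v j) (v j))"

definition Psi_hat ::
  "nat \<Rightarrow> (nat \<Rightarrow> 'h::real_inner) \<Rightarrow> nat \<Rightarrow> (nat \<Rightarrow> real) \<Rightarrow> (nat \<Rightarrow> 'h) \<Rightarrow> ('h \<Rightarrow>\<^sub>L 'h)" where
  "Psi_hat n x k l v = C_hat n x o\<^sub>L Gamma_dagger k l v"

definition residual :: "('h::real_inner \<Rightarrow>\<^sub>L 'h) \<Rightarrow> (nat \<Rightarrow> 'h) \<Rightarrow> nat \<Rightarrow> 'h" where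
  "residual P x j = x j - blinfun_apply P (x (j - 1))"

definition centered_residual ::
  "nat \<Rightarrow> ('h::real_inner \<Rightarrow>\<^sub>L 'h) \<Rightarrow> (nat \<Rightarrow> 'h) \<Rightarrow> nat \<Rightarrow> 'h" where
  "centered_residual n P x j =
     residual P x j - (1 / real n) *\<^sub>R (\<Sum>i=1..n. residual P x i)"

definition F_hat :: "nat \<Rightarrow> ('h::real_inner \<Rightarrow>\<^sub>L 'h) \<Rightarrow> (nat \<Rightarrow> 'h) \<Rightarrow> 'h pmf" where
  "F_hat n P x = map_pmf (centered_residual n P x) (pmf_of_set {1..n})"

primrec boot_path :: "('h::real_inner \<Rightarrow>\<^sub>L 'h) \<Rightarrow> 'h \<Rightarrow> (nat \<Rightarrow> 'h) \<Rightarrow> nat \<Rightarrow> 'h" where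
  "boot_path P x0 e 0 = x0"
| "boot_path P x0 e (Suc t) = blinfun_apply P (boot_path P x0 e t) + e (Suc t)"

text \<open>
  The conditional distribution of \<open>C_hat\<^sup>* - C_hat \<circ> Pi_hat\<close> given the data \<open>x\<close>: with \<open>x\<close> fixed, the only
  randomness is in the bootstrap innovations \<open>e 1, \<dots>, e n\<close>, which are i.i.d. draws from \<open>F_hat\<close>.
\<close>

definition boot_law ::
  "nat \<Rightarrow> (nat \<Rightarrow> 'h::real_inner) \<Rightarrow> nat \<Rightarrow> (nat \<Rightarrow> real) \<Rightarrow> (nat \<Rightarrow> 'h) \<Rightarrow> 'h
     \<Rightarrow> ('h \<Rightarrow>\<^sub>L 'h) measure" where
  "boot_law n x k l v x0 =
     distr (measure_pmf (Pi_pmf {1..n} 0 (\<lambda>_. F_hat n (Psi_hat n x k l v) x))) borel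
       (\<lambda>e. C_hat n (boot_path (Psi_hat n x k l v) x0 e) - (C_hat n x o\<^sub>L Pi_hat k v))"

end

theory Submission
  imports Defs
begin

text \<open>
  Averaging the recursion \<open>X (t + 1) = \<Psi> (X t) + eps (t + 1)\<close> against \<open>X t\<close> gives \<open>C_hat = \<Psi> Gamma_hat + U\<close> with the
  average \<open>U\<close> of \<open>X t \<otimes> eps (t + 1)\<close>, and averaging its square gives the stationarity equation
  \<open>Gamma_hat = \<Psi> Gamma_hat \<Psi>' + noise\<close>, where \<open>\<Psi>'\<close> is the adjoint. The covariance \<open>\<Gamma>\<close> satisfies the same equation with the
  covariance of the innovations instead of the noise. So \<open>C_hat - C = \<Psi> (Gamma_hat - \<Gamma>) + U\<close> is a function of \<open>\<Psi>\<close>, of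
  the centered noise and of \<open>U\<close>, and since \<open>\<Psi>\<close> is a contraction this function is Lipschitz
  (\<open>stationarity_perturbation\<close>).

  The bootstrap error has the same form, with \<open>Psi_hat\<close> for \<open>\<Psi>\<close> and with the empirical covariance \<open>Gamma_hat\<close> of the data
  in the role of \<open>\<Gamma>\<close>. Indeed \<open>C_hat Pi_hat = Psi_hat Gamma_hat\<close>, and since the normal equations make fitted values and
  residuals uncorrelated, \<open>Gamma_hat\<close> satisfies the stationarity equation for \<open>Psi_hat\<close> and the covariance of the centered
  residuals, up to an error of order \<open>1 / n\<close> (\<open>Gamma_hat_bootstrap_stationarity\<close>). This explains the centering of the
  bootstrap estimate at \<open>C_hat Pi_hat\<close>.

  Now let both processes run on one probability space, with innovations that are coupled at each time and independent in
  time. Then the difference of the two values of \<open>U\<close>, and of the two centered noises, is an average of martingale differences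
  up to a boundary term. The operator norm is at most the Hilbert-Schmidt norm, for which second moments of martingale
  differences add up. Hence \<open>n\<close> times the mean squared distance of the errors is at most a constant times
  \<open>(norm (\<Psi> - Psi_hat))\<^sup>2 + \<tau> + 1 / n\<close>, for \<open>\<tau> \<le> 1\<close>, if \<open>\<tau>\<^sup>2\<close> bounds the mean fourth power of the distance of coupled
  innovations (\<open>cross_sum_coupling\<close>, \<open>noise_coupling\<close>, \<open>bootstrap_bound\<close>).

  It remains to make the two distances small with probability close to 1. The estimate \<open>Psi_hat\<close> is consistent
  in operator norm (\<open>Psi_hat_consistent\<close>): \<open>1 / (lam (k n) * sqrt n)\<close> tends to 0, and the projections \<open>Pi_hat\<close> tend
  strongly to the identity because \<open>\<Gamma>\<close> is injective and \<open>k n\<close> tends to infinity. The residuals are then close to the innovations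
  (\<open>residual_bounds\<close>), whose empirical distribution can be coupled with their distribution by a partition into finitely
  many small cells (\<open>empirical_coupling_prob\<close>). All these facts are deterministic statements about data with certain
  bounds, combined in \<open>bootstrap_close_on_good_data\<close>. The bound on the initial value is assumed, and the others hold
  with probability close to 1 by Markov's inequality.
\<close>

section \<open>Hilbert space: projections, adjoints, tensors\<close>

text \<open>The minimising sequence for the distance to the subspace is Cauchy by the parallelogram law;
  the difference between the point and the limit is the desired normal vector.\<close>

lemma orthogonal_to_closed_subspace:
  fixes S :: "'h::{real_inner, banach} set"
  assumes sub: "subspace S" and cl: "closed S" and x: "x \<notin> S"
  obtains z where "z \<noteq> 0" "\<And>s. s \<in> S \<Longrightarrow> z \<bullet> s = 0"
proof -
  define d where "d = infdist x S"
  have S0: "S \<noteq> {}" using subspace_0[OF sub] by auto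
  have d0: "d \<ge> 0" by (simp add: d_def infdist_nonneg)
  have d_le: "d \<le> norm (x - s)" if "s \<in> S" for s
    using infdist_le[OF that, of x] by (simp add: d_def dist_norm)
  have "\<exists>s\<in>S. (norm (x - s))\<^sup>2 < d\<^sup>2 + 1 / real (Suc n)" for n
  proof -
    have "d < sqrt (d\<^sup>2 + 1 / real (Suc n))" using d0 by (simp add: real_less_rsqrt)
    then have "(INF s\<in>S. dist x s) < sqrt (d\<^sup>2 + 1 / real (Suc n))"
      using S0 by (simp add: d_def infdist_def)
    then obtain s where "s \<in> S" "dist x s < sqrt (d\<^sup>2 + 1 / real (Suc n))"
      using cInf_lessD[of "dist x ` S"] S0 by blast
    moreover have "(dist x s)\<^sup>2 < (sqrt (d\<^sup>2 + 1 / real (Suc n)))\<^sup>2"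
      using calculation(2) by (intro power_strict_mono) auto
    ultimately show ?thesis by (auto simp: dist_norm)
  qed
  then obtain s where s: "\<And>n. s n \<in> S" "\<And>n. (norm (x - s n))\<^sup>2 < d\<^sup>2 + 1 / real (Suc n)"
    by metis
  have par: "(norm (s m - s n))\<^sup>2 \<le> 2 / real (Suc m) + 2 / real (Suc n)" for m n
  proof -
    have "(1/2) *\<^sub>R (s m + s n) \<in> S" using s sub by (simp add: subspace_add subspace_scale)
    then have "d\<^sup>2 \<le> (norm (x - (1/2) *\<^sub>R (s m + s n)))\<^sup>2" using d_le d0 by (intro power_mono)
    moreover have "(norm (s m - s n))\<^sup>2 = 2 * (norm (x - s m))\<^sup>2 + 2 * (norm (x - s n))\<^sup>2
      - 4 * (norm (x - (1/2) *\<^sub>R (s m + s n)))\<^sup>2"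
      by (simp add: power2_norm_eq_inner algebra_simps inner_commute)
    ultimately show ?thesis using s(2)[of m] s(2)[of n] by simp
  qed
  have "Cauchy s"
  proof (rule metric_CauchyI)
    fix e :: real assume e: "e > 0"
    obtain N :: nat where N: "real N > 4 / e\<^sup>2" using reals_Archimedean2 by blast
    show "\<exists>M. \<forall>m\<ge>M. \<forall>n\<ge>M. dist (s m) (s n) < e"
    proof (intro exI allI impI)
      fix m n assume mn: "m \<ge> N" "n \<ge> N"
      have N': "real (Suc N) > 4 / e\<^sup>2" using N by simp
      have "2 / real (Suc m) \<le> 2 / real (Suc N)" "2 / real (Suc n) \<le> 2 / real (Suc N)"
        using mn by (auto intro!: divide_left_mono)
      then have "(norm (s m - s n))\<^sup>2 \<le> 4 / real (Suc N)" using par[of m n] by simp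
      also have "\<dots> < e\<^sup>2" using N' e by (simp add: field_simps)
      finally show "dist (s m) (s n) < e"
        using e by (simp add: dist_norm power2_less_imp_less)
    qed
  qed
  then obtain p where p: "s \<longlonglongrightarrow> p" using Cauchy_convergent convergent_def by blast
  have pS: "p \<in> S" using closed_sequentially[OF cl _ p] s by auto
  have "(\<lambda>n. (norm (x - s n))\<^sup>2) \<longlonglongrightarrow> (norm (x - p))\<^sup>2" by (intro tendsto_intros p)
  moreover have "(\<lambda>n. d\<^sup>2 + 1 / real (Suc n)) \<longlonglongrightarrow> d\<^sup>2 + 0"
    by (intro tendsto_intros LIMSEQ_Suc[OF lim_1_over_n])
  ultimately have pd: "(norm (x - p))\<^sup>2 \<le> d\<^sup>2"
    using s(2) by (intro LIMSEQ_le[where X = "\<lambda>n. (norm (x - s n))\<^sup>2"]) (auto intro: less_imp_le)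
  show ?thesis
  proof
    show "x - p \<noteq> 0" using pS x by auto
    fix t assume t: "t \<in> S"
    show "(x - p) \<bullet> t = 0"
    proof (cases "t = 0")
      case False
      define c where "c = ((x - p) \<bullet> t) / (t \<bullet> t)"
      have "p + c *\<^sub>R t \<in> S" using t pS sub by (simp add: subspace_add subspace_scale)
      then have "d\<^sup>2 \<le> (norm (x - (p + c *\<^sub>R t)))\<^sup>2" using d_le d0 by (intro power_mono)
      with pd have "(norm (x - p))\<^sup>2 \<le> (norm (x - (p + c *\<^sub>R t)))\<^sup>2" by (rule order_trans)
      also have "\<dots> = (norm (x - p))\<^sup>2 - 2 * c * ((x - p) \<bullet> t) + c\<^sup>2 * (t \<bullet> t)"
        unfolding power2_norm_eq_inner by (simp add: algebra_simps inner_commute power2_eq_square)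
      also have "\<dots> = (norm (x - p))\<^sup>2 - ((x - p) \<bullet> t)\<^sup>2 / (t \<bullet> t)"
        using False by (simp add: c_def power2_eq_square)
      finally have "((x - p) \<bullet> t)\<^sup>2 / (t \<bullet> t) \<le> 0" by simp
      moreover have "t \<bullet> t > 0" using False by simp
      ultimately have "((x - p) \<bullet> t)\<^sup>2 \<le> 0" by (simp add: divide_le_0_iff)
      then show ?thesis by simp
    qed simp
  qed
qed

text \<open>A functional is the inner product with a multiple of a vector normal to its kernel.\<close>

lemma riesz_representation:
  fixes f :: "'h::{real_inner, banach} \<Rightarrow> real"
  assumes f: "bounded_linear f"
  shows "\<exists>z. \<forall>x. f x = z \<bullet> x"
proof (cases "\<forall>x. f x = 0")
  case False
  interpret bounded_linear f by fact
  have "subspace {x. f x = 0}" by (simp add: subspace_def add scaleR zero)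
  moreover have "closed {x. f x = 0}"
    by (intro closed_Collect_eq continuous_intros linear_continuous_on f)
  moreover obtain x0 where "x0 \<notin> {x. f x = 0}" using False by auto
  ultimately obtain z where z: "z \<noteq> 0" "\<And>s. s \<in> {x. f x = 0} \<Longrightarrow> z \<bullet> s = 0"
    by (rule orthogonal_to_closed_subspace) blast
  have fz: "f z \<noteq> 0" using z(1) z(2)[of z] by auto
  have "f x = ((f z / (z \<bullet> z)) *\<^sub>R z) \<bullet> x" for x
  proof -
    have "f (x - (f x / f z) *\<^sub>R z) = 0" using fz by (simp add: diff scaleR)
    then have "z \<bullet> (x - (f x / f z) *\<^sub>R z) = 0" using z(2) by simp
    then show ?thesis using fz z(1) by (simp add: inner_diff_right field_simps)
  qed
  then show ?thesis by blast
qed (auto intro: exI[of _ 0])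

lemma adjoint_exists:
  fixes A :: "'h::{real_inner, banach} \<Rightarrow>\<^sub>L 'h"
  obtains A' :: "'h \<Rightarrow>\<^sub>L 'h" where "\<And>x y. A x \<bullet> y = x \<bullet> A' y" "norm A' \<le> norm A"
proof -
  have "\<exists>z. \<forall>x. A x \<bullet> y = x \<bullet> z" for y
  proof -
    have "bounded_linear (\<lambda>x. A x \<bullet> y)"
      by (intro bounded_linear_compose[OF bounded_linear_inner_left] blinfun.bounded_linear_right)
    from riesz_representation[OF this] show ?thesis by (auto simp: inner_commute)
  qed
  then obtain g where g: "\<And>x y. A x \<bullet> y = x \<bullet> g y" by metis
  have ng: "norm (g y) \<le> norm y * norm A" for y
  proof (cases "g y = 0")
    case False
    have "norm (g y) * norm (g y) = A (g y) \<bullet> y"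
      by (simp add: g power2_norm_eq_inner flip: power2_eq_square)
    also have "\<dots> \<le> norm (A (g y)) * norm y" by (rule norm_cauchy_schwarz)
    also have "\<dots> \<le> (norm A * norm (g y)) * norm y" by (intro mult_right_mono norm_blinfun) auto
    finally show ?thesis using False by (simp add: mult.left_commute mult.commute)
  qed simp
  have "bounded_linear g"
  proof (rule bounded_linear_intro[of _ "norm A"])
    show "g (x + y) = g x + g y" for x y
      by (rule vector_eq_ldot[THEN iffD1]) (auto simp: inner_add_right g[symmetric])
    show "g (r *\<^sub>R x) = r *\<^sub>R g x" for r x
      by (rule vector_eq_ldot[THEN iffD1]) (auto simp: g[symmetric])
  qed (rule ng)
  then have "blinfun_apply (Blinfun g) = g" by (rule bounded_linear_Blinfun_apply)
  then show ?thesis using ng g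
    by (intro that[of "Blinfun g"]) (auto intro!: norm_blinfun_bound simp: mult.commute)
qed

lemma subspace_closure_real:
  fixes S :: "'v::real_normed_vector set"
  assumes S: "subspace S"
  shows "subspace (closure S)"
  unfolding subspace_def
proof (intro conjI ballI allI)
  show "0 \<in> closure S" using subspace_0[OF S] closure_subset by blast
next
  fix x y assume "x \<in> closure S" "y \<in> closure S"
  then obtain f g where "\<And>n. f n \<in> S" "f \<longlonglongrightarrow> x" "\<And>n. g n \<in> S" "g \<longlonglongrightarrow> y"
    by (auto simp: closure_sequential)
  then show "x + y \<in> closure S"
    unfolding closure_sequential using S
    by (intro exI[of _ "\<lambda>n. f n + g n"]) (auto intro: tendsto_add subspace_add)
next
  fix c x assume "x \<in> closure S"
  then obtain f where "\<And>n. f n \<in> S" "f \<longlonglongrightarrow> x" by (auto simp: closure_sequential)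
  then show "c *\<^sub>R x \<in> closure S"
    unfolding closure_sequential using S
    by (intro exI[of _ "\<lambda>n. c *\<^sub>R f n"]) (auto intro: tendsto_scaleR subspace_scale)
qed

text \<open>A vector orthogonal to the range of a symmetric operator lies in its kernel.\<close>

lemma dense_range_if_symmetric_injective:
  fixes A :: "'h::{real_inner, banach} \<Rightarrow>\<^sub>L 'h"
  assumes sym: "\<And>x y. A x \<bullet> y = x \<bullet> A y" and inj: "\<And>x. A x = 0 \<Longrightarrow> x = 0" and e: "e > 0"
  shows "\<exists>y. norm (x - A y) < e"
proof -
  have "x \<in> closure (range A)"
  proof (rule ccontr)
    assume "x \<notin> closure (range A)"
    moreover have "subspace (closure (range A))"
      by (intro subspace_closure_real linear_subspace_image)
        (auto simp: bounded_linear.linear blinfun.bounded_linear_right)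
    ultimately obtain z where z: "z \<noteq> 0" "\<And>s. s \<in> closure (range A) \<Longrightarrow> z \<bullet> s = 0"
      using orthogonal_to_closed_subspace[of "closure (range A)" x] by auto
    have "A z \<bullet> A z = 0" using z(2)[of "A (A z)"] closure_subset[of "range A"] by (auto simp: sym)
    then show False using inj z by auto
  qed
  then show ?thesis using e by (auto simp: closure_approachable dist_norm norm_minus_commute)
qed

lemma tensor_apply [simp]: "blinfun_apply (tensor y z) x = (y \<bullet> x) *\<^sub>R z"
  by transfer simp

lemma norm_tensor_le: "norm (tensor y z) \<le> norm y * norm z"
proof (rule norm_blinfun_bound)
  fix x show "norm (blinfun_apply (tensor y z) x) \<le> norm y * norm z * norm x"
    using mult_right_mono[OF Cauchy_Schwarz_ineq2[of y x] norm_ge_zero[of z]]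
    by (simp add: algebra_simps)
qed auto

interpretation tensor: bounded_bilinear tensor
proof
  show "\<exists>K. \<forall>a b. norm (tensor a b) \<le> norm a * norm b * K"
    using norm_tensor_le by (intro exI[of _ 1]) auto
qed (auto intro!: blinfun_eqI simp: algebra_simps blinfun.add_left blinfun.scaleR_left)

lemma norm_le_of_adjoint:
  fixes A B :: "'h::real_inner \<Rightarrow>\<^sub>L 'h"
  assumes "\<And>x y. A x \<bullet> y = x \<bullet> B y"
  shows "norm A \<le> norm B"
proof (rule norm_blinfun_bound)
  fix x
  have "norm (A x) * norm (A x) = x \<bullet> B (A x)"
    by (simp add: power2_norm_eq_inner assms flip: power2_eq_square)
  also have "\<dots> \<le> norm x * norm (B (A x))" by (rule norm_cauchy_schwarz)
  also have "\<dots> \<le> norm x * (norm B * norm (A x))" by (intro mult_left_mono norm_blinfun) auto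
  finally have "norm (A x) * norm (A x) \<le> norm x * (norm B * norm (A x))" .
  then show "norm (A x) \<le> norm B * norm x"
    by (cases "A x = 0") (auto simp: algebra_simps)
qed simp

section \<open>Hilbert-Schmidt norm\<close>

text \<open>Squared Hilbert-Schmidt norm in the basis \<open>B\<close>, with value \<open>\<infinity>\<close> for operators that are not
  Hilbert-Schmidt. It dominates the operator norm and, in contrast to it, is a sum of squared vector norms, so
  that second moments of orthogonal random operators add up.\<close>

definition hs_sq :: "'h::real_inner set \<Rightarrow> ('h \<Rightarrow>\<^sub>L 'h) \<Rightarrow> ennreal" where
  "hs_sq B A = (\<integral>\<^sup>+e. ennreal ((norm (A e))\<^sup>2) \<partial>count_space B)"

lemma orthonormal_sum_norm:
  fixes v :: "'i \<Rightarrow> 'h::real_inner"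
  assumes "finite F" and "\<And>i j. i \<in> F \<Longrightarrow> j \<in> F \<Longrightarrow> v i \<bullet> v j = (if i = j then 1 else 0)"
  shows "(norm (\<Sum>i\<in>F. c i *\<^sub>R v i))\<^sup>2 = (\<Sum>i\<in>F. (c i)\<^sup>2)"
proof -
  have "(norm (\<Sum>i\<in>F. c i *\<^sub>R v i))\<^sup>2 = (\<Sum>i\<in>F. c i * (v i \<bullet> (\<Sum>j\<in>F. c j *\<^sub>R v j)))"
    by (simp add: power2_norm_eq_inner inner_sum_left)
  also have "\<dots> = (\<Sum>i\<in>F. \<Sum>j\<in>F. c i * (c j * (v i \<bullet> v j)))"
    by (simp only: inner_sum_right inner_scaleR_right sum_distrib_left)
  also have "\<dots> = (\<Sum>i\<in>F. \<Sum>j\<in>F. if i = j then c i * c i else 0)"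
    using assms(2) by (intro sum.cong refl) auto
  finally show ?thesis using assms(1) by (simp add: power2_eq_square)
qed

lemma bessel_inequality:
  fixes v :: "'i \<Rightarrow> 'h::real_inner"
  assumes fin: "finite F" and on: "\<And>i j. i \<in> F \<Longrightarrow> j \<in> F \<Longrightarrow> v i \<bullet> v j = (if i = j then 1 else 0)"
  shows "(\<Sum>i\<in>F. (x \<bullet> v i)\<^sup>2) \<le> (norm x)\<^sup>2"
proof -
  let ?p = "\<Sum>i\<in>F. (x \<bullet> v i) *\<^sub>R v i"
  have "x \<bullet> ?p = (\<Sum>i\<in>F. (x \<bullet> v i)\<^sup>2)" by (simp add: inner_sum_right power2_eq_square)
  moreover have "(norm ?p)\<^sup>2 = (\<Sum>i\<in>F. (x \<bullet> v i)\<^sup>2)" by (rule orthonormal_sum_norm[OF assms])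
  moreover have "0 \<le> (norm (x - ?p))\<^sup>2" by simp
  moreover have "(norm (x - ?p))\<^sup>2 = (norm x)\<^sup>2 - 2 * (x \<bullet> ?p) + (norm ?p)\<^sup>2"
    by (simp add: power2_norm_eq_inner algebra_simps inner_commute)
  ultimately show ?thesis by linarith
qed

lemma orthonormal_basis_inner:
  assumes "orthonormal_basis B" "e \<in> B" "f \<in> B"
  shows "e \<bullet> f = (if e = f then 1 else 0)"
  using assms by (auto simp: orthonormal_basis_def pairwise_def orthogonal_def norm_eq_1)

lemma countable_orthonormal_basis:
  fixes B :: "'h::{real_inner, second_countable_topology} set"
  assumes B: "orthonormal_basis B"
  shows "countable B"
proof -
  have dist: "dist e f = sqrt 2" if "e \<in> B" "f \<in> B" "e \<noteq> f" for e f
    using that orthonormal_basis_inner[OF B, of e f] orthonormal_basis_inner[OF B, of e e]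
      orthonormal_basis_inner[OF B, of f f]
    by (simp add: dist_norm norm_eq_sqrt_inner algebra_simps inner_commute)
  have disj: "disjnt (ball e (1/2)) (ball f (1/2))" if "e \<in> B" "f \<in> B" "e \<noteq> f" for e f
  proof -
    have "dist e f \<ge> 1" using dist[OF that] by simp
    show ?thesis
      unfolding disjnt_iff
    proof (intro allI notI)
      fix x assume "x \<in> ball e (1/2) \<and> x \<in> ball f (1/2)"
      then have "dist e x < 1/2" "dist f x < 1/2" by auto
      then show False using \<open>dist e f \<ge> 1\<close> dist_triangle[of e f x] dist_commute[of f x] by linarith
    qed
  qed
  have "countable ((\<lambda>e. ball e (1/2)) ` B)"
    by (rule countable_disjoint_open_subsets) (auto simp: pairwise_def intro!: disj)
  moreover have "inj_on (\<lambda>e::'h. ball e (1/2)) B"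
  proof (rule inj_onI, rule ccontr)
    fix e f :: 'h assume a: "e \<in> B" "f \<in> B" "ball e (1/2) = ball f (1/2)" "e \<noteq> f"
    have "e \<in> ball e (1/2)" by simp
    then show False using disj[OF a(1,2,4)] a(3) by (auto simp: disjnt_def)
  qed
  ultimately show ?thesis by (rule countable_image_inj_on)
qed

lemma nn_integral_count_space_le_of_finite:
  assumes "countable B" and fin: "\<And>F. finite F \<Longrightarrow> F \<subseteq> B \<Longrightarrow> (\<Sum>e\<in>F. f e) \<le> (c::ennreal)"
  shows "(\<integral>\<^sup>+e. f e \<partial>count_space B) \<le> c"
proof (cases "finite B")
  case True
  then show ?thesis using fin[of B] by (simp add: nn_integral_count_space_finite)
next
  case False
  note bij = bij_betw_from_nat_into[OF assms(1) False]
  have "(\<integral>\<^sup>+e. f e \<partial>count_space B) = (\<Sum>n. f (from_nat_into B n))"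
    by (simp add: nn_integral_bij_count_space[symmetric, OF bij] nn_integral_count_space_nat)
  also have "\<dots> = (SUP n. \<Sum>i<n. f (from_nat_into B i))" by (rule suminf_eq_SUP)
  also have "\<dots> \<le> c"
  proof (rule SUP_least)
    fix n
    have "(\<Sum>i<n. f (from_nat_into B i)) = (\<Sum>e\<in>from_nat_into B ` {..<n}. f e)"
      using bij by (subst sum.reindex) (auto simp: bij_betw_def intro: inj_on_subset)
    also have "\<dots> \<le> c" using bij by (intro fin) (auto simp: bij_betw_def)
    finally show "(\<Sum>i<n. f (from_nat_into B i)) \<le> c" .
  qed
  finally show ?thesis .
qed

lemma sum_le_nn_integral_count_space:
  assumes "finite F" "F \<subseteq> B"
  shows "(\<Sum>e\<in>F. f e) \<le> (\<integral>\<^sup>+e. f e \<partial>count_space B)"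
proof -
  have "(\<Sum>e\<in>F. f e) = (\<integral>\<^sup>+e. f e * indicator F e \<partial>count_space B)"
    using assms by (subst nn_integral_count_space'[of F]) auto
  also have "\<dots> \<le> (\<integral>\<^sup>+e. f e \<partial>count_space B)" by (intro nn_integral_mono) (auto simp: indicator_def)
  finally show ?thesis .
qed

text \<open>On the span of the basis this is the Cauchy-Schwarz inequality for the coordinates, and the span is
  dense.\<close>

lemma norm_le_hs_sq:
  fixes A :: "'h::{real_inner, banach, second_countable_topology} \<Rightarrow>\<^sub>L 'h"
  assumes B: "orthonormal_basis B"
  shows "ennreal ((norm A)\<^sup>2) \<le> hs_sq B A"
proof (cases "hs_sq B A")
  case (real s)
  have fin: "(\<Sum>e\<in>F. (norm (A e))\<^sup>2) \<le> s" if "finite F" "F \<subseteq> B" for F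
    using sum_le_nn_integral_count_space[OF that, of "\<lambda>e. ennreal ((norm (A e))\<^sup>2)"] real
    by (simp add: hs_sq_def[symmetric] ennreal_le_iff)
  have sp: "norm (A x) \<le> sqrt s * norm x" if "x \<in> span B" for x
  proof -
    from that obtain F u where F: "finite F" "F \<subseteq> B" "x = (\<Sum>e\<in>F. u e *\<^sub>R e)"
      unfolding span_explicit by blast
    have nx: "(norm x)\<^sup>2 = (\<Sum>e\<in>F. (u e)\<^sup>2)"
      unfolding F(3) using F(1,2) orthonormal_basis_inner[OF B]
      by (intro orthonormal_sum_norm) (simp_all add: subset_iff)
    have "norm (A x) \<le> (\<Sum>e\<in>F. \<bar>u e\<bar> * norm (A e))"
      unfolding F(3) by (simp add: blinfun.sum_right blinfun.scaleR_right) (rule sum_norm_le, simp)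
    then have "(norm (A x))\<^sup>2 \<le> (\<Sum>e\<in>F. \<bar>u e\<bar> * norm (A e))\<^sup>2" by (intro power_mono) auto
    also have "\<dots> \<le> (\<Sum>e\<in>F. \<bar>u e\<bar>\<^sup>2) * (\<Sum>e\<in>F. (norm (A e))\<^sup>2)" by (rule Cauchy_Schwarz_ineq_sum)
    also have "\<dots> \<le> (norm x)\<^sup>2 * s" using fin[OF F(1,2)] nx by (simp add: mult_left_mono sum_nonneg)
    also have "\<dots> = (sqrt s * norm x)\<^sup>2" using real by (simp add: power_mult_distrib)
    finally show ?thesis by (rule power2_le_imp_le) (use real in simp)
  qed
  have "closed {x. norm (A x) \<le> sqrt s * norm x}"
    by (intro closed_Collect_le continuous_intros)
  then have "closure (span B) \<subseteq> {x. norm (A x) \<le> sqrt s * norm x}"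
    using sp by (intro closure_minimal) auto
  then have "norm (A x) \<le> sqrt s * norm x" for x using B by (auto simp: orthonormal_basis_def)
  then have "norm A \<le> sqrt s" using real by (intro norm_blinfun_bound) auto
  then have "(norm A)\<^sup>2 \<le> (sqrt s)\<^sup>2" by (intro power_mono) auto
  then have "(norm A)\<^sup>2 \<le> s" using real by simp
  then show ?thesis using real by (simp add: ennreal_leI)
qed simp

lemma hs_sq_tensor_le:
  fixes a b :: "'h::{real_inner, second_countable_topology}"
  assumes B: "orthonormal_basis B"
  shows "hs_sq B (tensor a b) \<le> ennreal ((norm a)\<^sup>2 * (norm b)\<^sup>2)"
  unfolding hs_sq_def
proof (rule nn_integral_count_space_le_of_finite[OF countable_orthonormal_basis[OF B]])
  fix F assume F: "finite F" "F \<subseteq> B"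
  have "(\<Sum>e\<in>F. (a \<bullet> e)\<^sup>2) \<le> (norm a)\<^sup>2"
    using F orthonormal_basis_inner[OF B]
    by (intro bessel_inequality[where v = "\<lambda>e. e"]) (simp_all add: subset_iff)
  then have "(\<Sum>e\<in>F. (a \<bullet> e)\<^sup>2) * (norm b)\<^sup>2 \<le> (norm a)\<^sup>2 * (norm b)\<^sup>2"
    by (intro mult_right_mono) auto
  then show "(\<Sum>e\<in>F. ennreal ((norm (blinfun_apply (tensor a b) e))\<^sup>2)) \<le> ennreal ((norm a)\<^sup>2 * (norm b)\<^sup>2)"
    by (simp add: ennreal_leI power_mult_distrib flip: sum_distrib_right)
qed

lemma norm_add_sq_le:
  fixes x y :: "'v::real_normed_vector"
  shows "(norm (x + y))\<^sup>2 \<le> 2 * (norm x)\<^sup>2 + 2 * (norm y)\<^sup>2"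
proof -
  have "(norm (x + y))\<^sup>2 \<le> (norm x + norm y)\<^sup>2" by (intro power_mono norm_triangle_ineq) auto
  also have "\<dots> \<le> 2 * (norm x)\<^sup>2 + 2 * (norm y)\<^sup>2"
    using zero_le_power2[of "norm x - norm y"] by (simp add: power2_sum power2_diff)
  finally show ?thesis .
qed

lemma hs_sq_add_le:
  fixes A A' :: "'h::{real_inner, second_countable_topology} \<Rightarrow>\<^sub>L 'h"
  shows "hs_sq B (A + A') \<le> 2 * hs_sq B A + 2 * hs_sq B A'"
proof -
  have "hs_sq B (A + A') \<le>
    (\<integral>\<^sup>+e. 2 * ennreal ((norm (A e))\<^sup>2) + 2 * ennreal ((norm (A' e))\<^sup>2) \<partial>count_space B)"
    unfolding hs_sq_def
  proof (rule nn_integral_mono)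
    fix e
    have "ennreal ((norm ((A + A') e))\<^sup>2) \<le> ennreal (2 * (norm (A e))\<^sup>2 + 2 * (norm (A' e))\<^sup>2)"
      by (intro ennreal_leI) (auto simp: blinfun.add_left intro: norm_add_sq_le)
    then show "ennreal ((norm ((A + A') e))\<^sup>2) \<le> 2 * ennreal ((norm (A e))\<^sup>2) + 2 * ennreal ((norm (A' e))\<^sup>2)"
      by (simp add: ennreal_mult)
  qed
  also have "\<dots> = 2 * hs_sq B A + 2 * hs_sq B A'"
    by (simp add: hs_sq_def nn_integral_add nn_integral_cmult)
  finally show ?thesis .
qed

section \<open>Consistency of the autoregression estimate\<close>

subsection \<open>Leading eigenvectors of a compact operator\<close>

definition compact_operator :: "('h::real_inner \<Rightarrow>\<^sub>L 'h) \<Rightarrow> bool" where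
  "compact_operator A \<longleftrightarrow>
     (\<forall>u::nat \<Rightarrow> 'h. bounded (range u) \<longrightarrow> (\<exists>r y. strict_mono r \<and> (\<lambda>n. A (u (r n))) \<longlonglongrightarrow> y))"

lemma compact_operator_tensor: "compact_operator (tensor a b)"
  unfolding compact_operator_def
proof (intro allI impI)
  fix u :: "nat \<Rightarrow> 'a" assume "bounded (range u)"
  then have "bounded ((\<lambda>y. a \<bullet> y) ` range u)"
    by (rule bounded_linear_image) (rule bounded_linear_inner_right)
  then have "bounded (range (\<lambda>n. a \<bullet> u n))" by (simp add: image_image)
  from bounded_imp_convergent_subsequence[OF this] obtain y r where
    "strict_mono r" "((\<lambda>n. a \<bullet> u n) \<circ> r) \<longlonglongrightarrow> y" by auto
  then show "\<exists>r y. strict_mono r \<and> (\<lambda>n. blinfun_apply (tensor a b) (u (r n))) \<longlonglongrightarrow> y"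
    by (intro exI[of _ r] exI[of _ "y *\<^sub>R b"]) (auto simp: o_def intro: tendsto_scaleR)
qed

lemma compact_operator_add:
  assumes "compact_operator A" "compact_operator A'"
  shows "compact_operator (A + A')"
  unfolding compact_operator_def
proof (intro allI impI)
  fix u :: "nat \<Rightarrow> 'a" assume u: "bounded (range u)"
  obtain r y where r: "strict_mono r" "(\<lambda>n. A (u (r n))) \<longlonglongrightarrow> y"
    using assms(1) u by (auto simp: compact_operator_def)
  have "bounded (range (\<lambda>n. u (r n)))" by (rule bounded_subset[OF u]) auto
  then obtain r' y' where r': "strict_mono r'" "(\<lambda>n. A' (u (r (r' n)))) \<longlonglongrightarrow> y'"
    using assms(2) unfolding compact_operator_def by blast
  have "strict_mono (\<lambda>n. r (r' n))" using r(1) r'(1) by (auto simp: strict_mono_def)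
  moreover have "(\<lambda>n. A (u (r (r' n)))) \<longlonglongrightarrow> y"
    using LIMSEQ_subseq_LIMSEQ[OF r(2) r'(1)] by (simp add: o_def)
  ultimately show "\<exists>r y. strict_mono r \<and> (\<lambda>n. blinfun_apply (A + A') (u (r n))) \<longlonglongrightarrow> y"
    using r'(2) by (intro exI[of _ "\<lambda>n. r (r' n)"] exI[of _ "y + y'"])
      (auto simp: blinfun.add_left intro!: tendsto_add)
qed

lemma compact_operator_scaleR:
  assumes "compact_operator A"
  shows "compact_operator (c *\<^sub>R A)"
  unfolding compact_operator_def
proof (intro allI impI)
  fix u :: "nat \<Rightarrow> 'a" assume "bounded (range u)"
  then obtain r y where "strict_mono r" "(\<lambda>n. A (u (r n))) \<longlonglongrightarrow> y"
    using assms by (auto simp: compact_operator_def)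
  then show "\<exists>r y. strict_mono r \<and> (\<lambda>n. blinfun_apply (c *\<^sub>R A) (u (r n))) \<longlonglongrightarrow> y"
    by (intro exI[of _ r] exI[of _ "c *\<^sub>R y"]) (auto simp: blinfun.scaleR_left intro: tendsto_scaleR)
qed

lemma compact_operator_zero: "compact_operator 0"
  using compact_operator_tensor[of 0 0] by (simp add: tensor.zero_left)

lemma compact_operator_sum:
  assumes "\<And>i. i \<in> I \<Longrightarrow> compact_operator (f i)"
  shows "compact_operator (\<Sum>i\<in>I. f i)"
  using assms
  by (induction I rule: infinite_finite_induct) (simp_all add: compact_operator_add compact_operator_zero)

text \<open>A compact symmetric non-negative operator attains its norm: along a norming sequence of unit
  vectors \<open>u\<close> one has \<open>A (A u) \<approx> \<mu>\<^sup>2 u\<close>, and a limit satisfies \<open>(A - \<mu>) (A + \<mu>) u = 0\<close>. Since \<open>- \<mu>\<close>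
  cannot be an eigenvalue, \<open>(A + \<mu>) u\<close> is an eigenvector.\<close>

lemma compact_symmetric_top_eigenvector:
  fixes A :: "'h::{real_inner, banach} \<Rightarrow>\<^sub>L 'h"
  assumes sym: "\<And>x y. A x \<bullet> y = x \<bullet> A y" and pos: "\<And>x. A x \<bullet> x \<ge> 0"
    and cpt: "compact_operator A" and "A \<noteq> 0"
  shows "\<exists>u. u \<noteq> 0 \<and> A u = norm A *\<^sub>R u"
proof -
  define \<mu> where "\<mu> = norm A"
  have \<mu>: "\<mu> > 0" using \<open>A \<noteq> 0\<close> by (simp add: \<mu>_def)
  have "\<exists>u. norm u = 1 \<and> norm (A u) > \<mu> - 1 / real (Suc n)" for n
  proof (rule ccontr)
    assume no: "\<nexists>u. norm u = 1 \<and> norm (A u) > \<mu> - 1 / real (Suc n)"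
    define c where "c = max 0 (\<mu> - 1 / real (Suc n))"
    have "norm (A x) \<le> c * norm x" for x
    proof (cases "x = 0")
      case False
      have "norm (A ((1 / norm x) *\<^sub>R x)) \<le> \<mu> - 1 / real (Suc n)" using no False
        by (auto simp: not_less dest: spec[of _ "(1 / norm x) *\<^sub>R x"])
      also have "\<dots> \<le> c" by (simp add: c_def)
      finally show ?thesis using False by (simp add: blinfun.scaleR_right field_simps)
    qed simp
    then have "norm A \<le> c" by (intro norm_blinfun_bound) (auto simp: c_def)
    then show False using \<mu> by (auto simp: c_def \<mu>_def max_def split: if_splits)
  qed
  then obtain u where u: "\<And>n. norm (u n) = 1" "\<And>n. norm (A (u n)) > \<mu> - 1 / real (Suc n)" by metis
  have Au: "norm (A (u n)) \<le> \<mu>" for n using norm_blinfun[of A "u n"] u(1) by (simp add: \<mu>_def)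
  have lim: "(\<lambda>n. norm (A (u n))) \<longlonglongrightarrow> \<mu>"
  proof (rule tendsto_sandwich)
    show "(\<lambda>n. \<mu> - 1 / real (Suc n)) \<longlonglongrightarrow> \<mu>"
      using tendsto_diff[OF tendsto_const[of \<mu>] LIMSEQ_Suc[OF lim_1_over_n]] by simp
    show "\<forall>\<^sub>F n in sequentially. \<mu> - 1 / real (Suc n) \<le> norm (A (u n))"
      by (intro always_eventually allI less_imp_le u(2))
    show "\<forall>\<^sub>F n in sequentially. norm (A (u n)) \<le> \<mu>" using Au by auto
  qed simp
  have near: "(norm (A (A (u n)) - \<mu>\<^sup>2 *\<^sub>R u n))\<^sup>2 \<le> \<mu>\<^sup>2 * (\<mu>\<^sup>2 - (norm (A (u n)))\<^sup>2)" for n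
  proof -
    have "norm (A (A (u n))) \<le> \<mu> * norm (A (u n))" using norm_blinfun[of A "A (u n)"] by (simp add: \<mu>_def)
    then have "(norm (A (A (u n))))\<^sup>2 \<le> \<mu>\<^sup>2 * (norm (A (u n)))\<^sup>2"
      by (metis norm_ge_zero power_mono power_mult_distrib)
    moreover have "A (A (u n)) \<bullet> u n = (norm (A (u n)))\<^sup>2" by (simp add: sym power2_norm_eq_inner)
    moreover have "(norm (A (A (u n)) - \<mu>\<^sup>2 *\<^sub>R u n))\<^sup>2
      = (norm (A (A (u n))))\<^sup>2 - 2 * \<mu>\<^sup>2 * (A (A (u n)) \<bullet> u n) + \<mu>\<^sup>2 * \<mu>\<^sup>2 * (norm (u n))\<^sup>2"
      unfolding power2_norm_eq_inner by (simp add: algebra_simps inner_commute)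
    ultimately show ?thesis by (simp add: u(1) algebra_simps)
  qed
  have "(\<lambda>n. \<mu>\<^sup>2 * (\<mu>\<^sup>2 - (norm (A (u n)))\<^sup>2)) \<longlonglongrightarrow> \<mu>\<^sup>2 * (\<mu>\<^sup>2 - \<mu>\<^sup>2)" by (intro tendsto_intros lim)
  then have small: "(\<lambda>n. \<mu>\<^sup>2 * (\<mu>\<^sup>2 - (norm (A (u n)))\<^sup>2)) \<longlonglongrightarrow> 0" by simp
  have "(\<lambda>n. (norm (A (A (u n)) - \<mu>\<^sup>2 *\<^sub>R u n))\<^sup>2) \<longlonglongrightarrow> 0"
    by (rule tendsto_sandwich[OF _ _ tendsto_const small]) (use near in auto)
  then have diff: "(\<lambda>n. A (A (u n)) - \<mu>\<^sup>2 *\<^sub>R u n) \<longlonglongrightarrow> 0"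
    using tendsto_real_sqrt[of "\<lambda>n. (norm (A (A (u n)) - \<mu>\<^sup>2 *\<^sub>R u n))\<^sup>2" 0 sequentially]
    by (simp add: tendsto_norm_zero_iff)
  have "bounded (range u)" using u(1) by (auto simp: bounded_iff intro!: exI[of _ 1])
  then obtain r w where r: "strict_mono r" "(\<lambda>n. A (u (r n))) \<longlonglongrightarrow> w"
    using cpt by (auto simp: compact_operator_def)
  have "(\<lambda>n. A (A (u (r n))) - (A (A (u (r n))) - \<mu>\<^sup>2 *\<^sub>R u (r n))) \<longlonglongrightarrow> A w - 0"
    using LIMSEQ_subseq_LIMSEQ[OF diff r(1)] by (intro tendsto_intros r(2)) (simp add: o_def)
  then have "(\<lambda>n. (1 / \<mu>\<^sup>2) *\<^sub>R (\<mu>\<^sup>2 *\<^sub>R u (r n))) \<longlonglongrightarrow> (1 / \<mu>\<^sup>2) *\<^sub>R A w"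
    by (intro tendsto_intros) simp
  then have ulim: "(\<lambda>n. u (r n)) \<longlonglongrightarrow> (1 / \<mu>\<^sup>2) *\<^sub>R A w" using \<mu> by simp
  define u0 where "u0 = (1 / \<mu>\<^sup>2) *\<^sub>R A w"
  have "(\<lambda>n. norm (u (r n))) \<longlonglongrightarrow> norm u0" using ulim unfolding u0_def by (intro tendsto_norm)
  then have "norm u0 = 1" using u(1) LIMSEQ_unique[OF tendsto_const[of 1]] by simp
  then have "u0 \<noteq> 0" by auto
  have "(\<lambda>n. A (u (r n))) \<longlonglongrightarrow> A u0" using ulim unfolding u0_def by (intro tendsto_intros)
  then have "w = A u0" using r(2) LIMSEQ_unique by blast
  then have AA: "A (A u0) = \<mu>\<^sup>2 *\<^sub>R u0" using \<mu> by (simp add: u0_def)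
  define y where "y = A u0 + \<mu> *\<^sub>R u0"
  have "A y = \<mu> *\<^sub>R y"
    by (simp add: y_def blinfun.add_right blinfun.scaleR_right AA power2_eq_square algebra_simps)
  moreover have "y \<noteq> 0"
  proof
    assume "y = 0"
    then have "A u0 = - (\<mu> *\<^sub>R u0)" by (simp add: y_def eq_neg_iff_add_eq_0)
    then have "A u0 \<bullet> u0 = - \<mu> * (u0 \<bullet> u0)" by simp
    moreover have "\<mu> * (u0 \<bullet> u0) > 0" using \<open>u0 \<noteq> 0\<close> \<mu> by (intro mult_pos_pos) auto
    ultimately show False using pos[of u0] by simp
  qed
  ultimately show ?thesis unfolding \<mu>_def by blast
qed

subsection \<open>The empirical covariance operator\<close>

lemma Gamma_hat_apply: "Gamma_hat n x u = (1 / real n) *\<^sub>R (\<Sum>j<n. (x j \<bullet> u) *\<^sub>R x j)"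
  by (simp add: Gamma_hat_def blinfun.scaleR_left blinfun.sum_left)

lemma Gamma_hat_symmetric: "Gamma_hat n x u \<bullet> w = u \<bullet> Gamma_hat n x w"
  by (simp add: Gamma_hat_apply inner_sum_left inner_sum_right inner_commute mult.commute)

lemma Gamma_hat_quadratic: "Gamma_hat n x u \<bullet> u = (1 / real n) * (\<Sum>j<n. (x j \<bullet> u)\<^sup>2)"
  by (simp add: Gamma_hat_apply inner_sum_left power2_eq_square)

lemma Gamma_hat_nonneg: "Gamma_hat n x u \<bullet> u \<ge> 0"
  by (simp add: Gamma_hat_quadratic sum_nonneg)

lemma compact_operator_Gamma_hat: "compact_operator (Gamma_hat n x)"
  unfolding Gamma_hat_def
  by (intro compact_operator_scaleR compact_operator_sum compact_operator_tensor)

lemma eigen_listingD: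
  assumes "eigen_listing A l v"
  shows "\<And>i j. 1 \<le> i \<Longrightarrow> i \<le> j \<Longrightarrow> l j \<le> l i"
    "\<And>i j. 1 \<le> i \<Longrightarrow> 1 \<le> j \<Longrightarrow> v i \<bullet> v j = (if i = j then 1 else 0)"
    "\<And>j. 1 \<le> j \<Longrightarrow> A (v j) = l j *\<^sub>R v j"
    "\<And>\<mu>. \<mu> \<noteq> 0 \<Longrightarrow> eigenspace A \<mu> = span {v j |j. 1 \<le> j \<and> l j = \<mu>}"
  using assms by (simp_all add: eigen_listing_def)

lemma Pi_hat_apply: "Pi_hat k v u = (\<Sum>j=1..k. (v j \<bullet> u) *\<^sub>R v j)"
  by (simp add: Pi_hat_def blinfun.sum_left)

lemma Pi_hat_symmetric: "Pi_hat k v u \<bullet> w = u \<bullet> Pi_hat k v w"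
  by (simp add: Pi_hat_apply inner_sum_left inner_sum_right inner_commute mult.commute)

lemma Pi_hat_inner:
  assumes "eigen_listing A l v" "1 \<le> i" "i \<le> k"
  shows "v i \<bullet> Pi_hat k v u = v i \<bullet> u"
proof -
  have "v i \<bullet> Pi_hat k v u = (\<Sum>j=1..k. (v j \<bullet> u) * (v i \<bullet> v j))"
    by (simp add: Pi_hat_apply inner_sum_right)
  also have "\<dots> = (\<Sum>j=1..k. if j = i then v i \<bullet> u else 0)"
    using eigen_listingD(2)[OF assms(1), of i] assms(2) by (intro sum.cong) auto
  finally show ?thesis using assms by simp
qed

lemma norm_minus_Pi_hat_le:
  assumes L: "eigen_listing A l v"
  shows "norm (u - Pi_hat k v u) \<le> norm u"
proof -
  have "Pi_hat k v u \<bullet> Pi_hat k v u = (\<Sum>j=1..k. (v j \<bullet> u) * (v j \<bullet> Pi_hat k v u))"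
    by (subst Pi_hat_apply) (simp add: inner_sum_left)
  also have "\<dots> = (\<Sum>j=1..k. (v j \<bullet> u) * (v j \<bullet> u))"
    using Pi_hat_inner[OF L] by (intro sum.cong) auto
  also have "\<dots> = Pi_hat k v u \<bullet> u" by (simp add: Pi_hat_apply inner_sum_left)
  finally have "(norm (u - Pi_hat k v u))\<^sup>2 = (norm u)\<^sup>2 - (norm (Pi_hat k v u))\<^sup>2"
    by (simp add: power2_norm_eq_inner algebra_simps inner_commute)
  then have "(norm (u - Pi_hat k v u))\<^sup>2 \<le> (norm u)\<^sup>2" by simp
  then show ?thesis by (rule power2_le_imp_le) simp
qed

text \<open>Removing the \<open>k\<close> leading eigenvectors leaves a symmetric compact operator. An eigenvector for
  its norm is orthogonal to \<open>v 1, \<dots>, v k\<close>, hence an eigenvector of the original operator, and its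
  eigenvalue appears in the list at a position after \<open>k\<close>.\<close>

lemma eigen_listing_tail_norm:
  fixes A :: "'h::{real_inner, banach} \<Rightarrow>\<^sub>L 'h"
  assumes L: "eigen_listing A l v"
    and sym: "\<And>x y. A x \<bullet> y = x \<bullet> A y" and pos: "\<And>x. A x \<bullet> x \<ge> 0" and cpt: "compact_operator A"
  shows "norm (A x - Pi_hat k v (A x)) \<le> l (Suc k) * norm x"
proof -
  note v = eigen_listingD(2)[OF L] and Av = eigen_listingD(3)[OF L]
  define R where "R = A + (-1) *\<^sub>R (\<Sum>j=1..k. l j *\<^sub>R tensor (v j) (v j))"
  have vA: "v j \<bullet> A u = l j * (v j \<bullet> u)" if "1 \<le> j" for j u
    using sym[of "v j" u] Av[OF that] by simp
  have R: "R u = A u - Pi_hat k v (A u)" for u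
    by (simp add: R_def blinfun.add_left blinfun.scaleR_left blinfun.sum_left blinfun.diff_left
        blinfun.minus_left Pi_hat_apply vA mult.commute)
  have R': "R u = A (u - Pi_hat k v u)" for u
  proof -
    have "A (Pi_hat k v u) = Pi_hat k v (A u)"
      by (simp add: Pi_hat_apply blinfun.sum_right blinfun.scaleR_right vA Av mult.commute)
    then show ?thesis by (simp add: R blinfun.diff_right)
  qed
  have vR: "v j \<bullet> R u = 0" if "1 \<le> j" "j \<le> k" for j u
    using Pi_hat_inner[OF L that] by (simp add: R inner_diff_right)
  have l0: "l (Suc k) \<ge> 0"
    using pos[of "v (Suc k)"] Av[of "Suc k"] v[of "Suc k" "Suc k"] by simp
  have "norm R \<le> l (Suc k)"
  proof (cases "R = 0")
    case False
    have symR: "R u \<bullet> w = u \<bullet> R w" for u w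
      using sym[of u "w - Pi_hat k v w"]
      by (simp add: R'[of w]) (simp add: R inner_diff_left inner_diff_right sym Pi_hat_symmetric)
    moreover have "R u \<bullet> u \<ge> 0" for u
    proof -
      have "R u \<bullet> Pi_hat k v u = 0"
        using vR by (simp add: Pi_hat_apply inner_sum_right inner_commute[of "R u"])
      then have "R u \<bullet> u = A (u - Pi_hat k v u) \<bullet> (u - Pi_hat k v u)"
        by (simp add: R'[symmetric] inner_diff_right)
      then show ?thesis using pos by simp
    qed
    moreover have "compact_operator R"
      unfolding R_def by (intro compact_operator_add compact_operator_scaleR compact_operator_sum
          compact_operator_tensor cpt)
    ultimately obtain u where u: "u \<noteq> 0" "R u = norm R *\<^sub>R u"
      using compact_symmetric_top_eigenvector[of R] False by blast
    have vu: "v j \<bullet> u = 0" if "1 \<le> j" "j \<le> k" for j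
      using vR[OF that, of u] u(2) False by simp
    then have "Pi_hat k v u = 0" by (simp add: Pi_hat_apply)
    then have "A u = norm R *\<^sub>R u" using R'[of u] u(2) by simp
    then have us: "u \<in> span {v j |j. 1 \<le> j \<and> l j = norm R}"
      using eigen_listingD(4)[OF L, of "norm R"] False by (auto simp: eigenspace_def)
    have "\<exists>j>k. l j = norm R"
    proof (rule ccontr)
      assume "\<nexists>j. k < j \<and> l j = norm R"
      then have "orthogonal u y" if "y \<in> {v j |j. 1 \<le> j \<and> l j = norm R}" for y
      proof -
        from that obtain j where j: "y = v j" "1 \<le> j" "l j = norm R" by auto
        then have "j \<le> k" using \<open>\<nexists>j. k < j \<and> l j = norm R\<close> not_le by blast
        then show ?thesis using vu[OF j(2)] j(1) by (simp add: orthogonal_def inner_commute)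
      qed
      then have "orthogonal u u" using us by (rule orthogonal_to_span[rotated])
      then show False using u(1) by (simp add: orthogonal_def)
    qed
    then obtain j where "k < j" "l j = norm R" by blast
    then show ?thesis using eigen_listingD(1)[OF L, of "Suc k" j] by simp
  qed (use l0 in simp)
  then have "norm R * norm x \<le> l (Suc k) * norm x" by (rule mult_right_mono) simp
  with norm_blinfun[of R x] show ?thesis unfolding R by (rule order_trans)
qed

text \<open>A linear map from a space of dimension \<open>k\<close> to one of smaller dimension has a nontrivial kernel.\<close>

lemma finite_dim_kernel:
  fixes w :: "nat \<Rightarrow> 'h::real_inner" and f :: "'h \<Rightarrow> 'h"
  assumes f: "linear f" and range: "range f \<subseteq> span V" and V: "finite V" "card V < k"
    and w: "\<And>i j. 1 \<le> i \<Longrightarrow> 1 \<le> j \<Longrightarrow> w i \<bullet> w j = (if i = j then 1 else 0)"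
  obtains c where "(\<Sum>i=1..k. c i *\<^sub>R w i) \<noteq> 0" "f (\<Sum>i=1..k. c i *\<^sub>R w i) = 0"
proof -
  define W where "W = w ` {1..k}"
  have inj: "inj_on w {1..k}"
  proof (rule inj_onI)
    fix i j assume ij: "i \<in> {1..k}" "j \<in> {1..k}" "w i = w j"
    then have "w i \<bullet> w j = 1" using w[of j j] by simp
    then show "i = j" using w[of i j] ij(1,2) by (cases "i = j") auto
  qed
  have "pairwise orthogonal W"
    unfolding W_def by (rule pairwise_imageI) (simp add: orthogonal_def w)
  moreover have "0 \<notin> W"
  proof
    assume "0 \<in> W"
    then obtain i where "1 \<le> i" "w i = 0" by (auto simp: W_def)
    then show False using w[of i i] by simp
  qed
  ultimately have ind: "independent W" by (rule pairwise_orthogonal_independent)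
  have "\<not> inj_on f (span W)"
  proof
    assume i: "inj_on f (span W)"
    then have "independent (f ` W)" by (rule linear_independent_injective_image[OF f ind])
    moreover have "f ` W \<subseteq> span V" using range by auto
    ultimately have "card (f ` W) \<le> card V" using independent_span_bound[OF V(1)] by blast
    moreover have "card (f ` W) = card W"
      using i by (intro card_image) (rule inj_on_subset[OF _ span_superset])
    moreover have "card W = k" using inj by (simp add: W_def card_image)
    ultimately show False using V(2) by simp
  qed
  then obtain x y where xy: "x \<in> span W" "y \<in> span W" "f x = f y" "x \<noteq> y" by (auto simp: inj_on_def)
  then have "x - y \<in> span W" by (intro span_diff)
  then obtain u where "x - y = (\<Sum>z\<in>W. u z *\<^sub>R z)" by (auto simp: span_finite W_def)
  also have "\<dots> = (\<Sum>i=1..k. u (w i) *\<^sub>R w i)" unfolding W_def by (subst sum.reindex[OF inj]) simp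
  finally have e: "x - y = (\<Sum>i=1..k. u (w i) *\<^sub>R w i)" .
  have "f (x - y) = 0" using xy(3) by (simp add: linear_diff[OF f])
  then show ?thesis using xy(4) e by (intro that[of "\<lambda>i. u (w i)"]) auto
qed

text \<open>The lower Weyl inequality: among the combinations of \<open>k\<close> orthonormal eigenvectors of \<open>\<Gamma>\<close> there is
  one orthogonal to the first \<open>k - 1\<close> vectors of the list.\<close>

lemma eigen_listing_weyl_lower:
  fixes A \<Gamma> :: "'h::{real_inner, banach} \<Rightarrow>\<^sub>L 'h"
  assumes L: "eigen_listing A l v"
    and sym: "\<And>x y. A x \<bullet> y = x \<bullet> A y" and pos: "\<And>x. A x \<bullet> x \<ge> 0" and cpt: "compact_operator A"
    and w: "\<And>i j. 1 \<le> i \<Longrightarrow> 1 \<le> j \<Longrightarrow> w i \<bullet> w j = (if i = j then 1 else 0)"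
    and \<Gamma>w: "\<And>i. 1 \<le> i \<Longrightarrow> \<Gamma> (w i) = lam i *\<^sub>R w i"
    and lam: "\<And>i. 1 \<le> i \<Longrightarrow> i \<le> k \<Longrightarrow> lam k \<le> lam i" and k: "k \<ge> 1"
  shows "lam k \<le> l k + norm (A - \<Gamma>)"
proof -
  obtain m where m: "k = Suc m" using k by (cases k) auto
  have "range (Pi_hat m v) \<subseteq> span (v ` {1..m})"
    unfolding Pi_hat_apply by (intro image_subsetI span_sum span_scale span_base) auto
  moreover have "card (v ` {1..m}) < k" using card_image_le[of "{1..m}" v] m by simp
  ultimately obtain c where c: "(\<Sum>i=1..k. c i *\<^sub>R w i) \<noteq> 0" "Pi_hat m v (\<Sum>i=1..k. c i *\<^sub>R w i) = 0"
    using finite_dim_kernel[of "Pi_hat m v" "v ` {1..m}" k w] w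
      bounded_linear.linear[OF blinfun.bounded_linear_right] by blast
  define z where "z = (\<Sum>i=1..k. c i *\<^sub>R w i)"
  have zw: "z \<bullet> w i = c i" if "i \<in> {1..k}" for i
  proof -
    have "z \<bullet> w i = (\<Sum>j=1..k. if j = i then c i else 0)"
      unfolding z_def inner_sum_left using that w by (intro sum.cong) auto
    then show ?thesis using that by simp
  qed
  have nz: "(norm z)\<^sup>2 = (\<Sum>i=1..k. (c i)\<^sup>2)"
    unfolding z_def by (rule orthonormal_sum_norm) (auto simp: w)
  have "\<Gamma> z = (\<Sum>i=1..k. (c i * lam i) *\<^sub>R w i)"
    unfolding z_def by (simp add: blinfun.sum_right blinfun.scaleR_right \<Gamma>w)
  then have "\<Gamma> z \<bullet> z = (\<Sum>i=1..k. (c i * lam i) * c i)"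
    by (subst inner_commute) (simp add: inner_sum_right zw)
  also have "\<dots> \<ge> (\<Sum>i=1..k. lam k * (c i)\<^sup>2)"
    using mult_right_mono[OF lam zero_le_power2]
    by (intro sum_mono) (simp add: power2_eq_square mult.commute mult.left_commute)
  finally have "lam k * (norm z)\<^sup>2 \<le> \<Gamma> z \<bullet> z" by (simp add: nz sum_distrib_left)
  moreover have "A z \<bullet> z \<le> l k * (norm z)\<^sup>2"
  proof -
    have "Pi_hat m v (A z) \<bullet> z = 0"
      using c(2) unfolding z_def[symmetric] by (simp add: Pi_hat_symmetric)
    then have "A z \<bullet> z = (A z - Pi_hat m v (A z)) \<bullet> z" by (simp add: inner_diff_left)
    also have "\<dots> \<le> norm (A z - Pi_hat m v (A z)) * norm z" by (rule norm_cauchy_schwarz)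
    also have "\<dots> \<le> (l k * norm z) * norm z"
      using eigen_listing_tail_norm[OF L sym pos cpt, of z m] m by (intro mult_right_mono) auto
    finally show ?thesis by (simp add: power2_eq_square)
  qed
  moreover have "\<Gamma> z \<bullet> z - A z \<bullet> z \<le> norm (A - \<Gamma>) * (norm z)\<^sup>2"
  proof -
    have "\<Gamma> z \<bullet> z - A z \<bullet> z = (\<Gamma> - A) z \<bullet> z" by (simp add: blinfun.diff_left inner_diff_left)
    also have "\<dots> \<le> norm ((\<Gamma> - A) z) * norm z" by (rule norm_cauchy_schwarz)
    also have "\<dots> \<le> (norm (\<Gamma> - A) * norm z) * norm z" by (intro mult_right_mono norm_blinfun) auto
    finally show ?thesis by (simp add: power2_eq_square norm_minus_commute)
  qed
  ultimately have "lam k * (norm z)\<^sup>2 \<le> (l k + norm (A - \<Gamma>)) * (norm z)\<^sup>2" by (simp add: algebra_simps)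
  moreover have "(norm z)\<^sup>2 > 0" using c(1) by (simp add: z_def)
  ultimately show ?thesis by (simp add: mult_le_cancel_right)
qed

text \<open>The first \<open>k\<close> eigenvalues are at least \<open>l k\<close>, and their sum is at most the trace, which is the
  average of the squared norms.\<close>

lemma Gamma_hat_eigenvalue_le:
  assumes L: "eigen_listing (Gamma_hat n x) l v"
  shows "real k * l k \<le> (1 / real n) * (\<Sum>t<n. (norm (x t))\<^sup>2)"
proof -
  note D = eigen_listingD[OF L]
  have lj: "l j = (1 / real n) * (\<Sum>t<n. (x t \<bullet> v j)\<^sup>2)" if "1 \<le> j" for j
    using D(3)[OF that] D(2)[OF that that] Gamma_hat_quadratic[of n x "v j"] by simp
  have "real k * l k = (\<Sum>j=1..k. l k)" by simp
  also have "\<dots> \<le> (\<Sum>j=1..k. l j)" by (intro sum_mono D(1)) auto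
  also have "\<dots> = (\<Sum>j=1..k. (1 / real n) * (\<Sum>t<n. (x t \<bullet> v j)\<^sup>2))" by (intro sum.cong lj) auto
  also have "\<dots> = (1 / real n) * (\<Sum>t<n. \<Sum>j=1..k. (x t \<bullet> v j)\<^sup>2)"
    by (subst sum.swap) (simp add: sum_distrib_left)
  also have "\<dots> \<le> (1 / real n) * (\<Sum>t<n. (norm (x t))\<^sup>2)"
    using D(2) by (intro mult_left_mono sum_mono bessel_inequality) auto
  finally show ?thesis .
qed

lemma blinfun_compose_assoc: "(A o\<^sub>L B) o\<^sub>L C = A o\<^sub>L (B o\<^sub>L C)"
  by (rule blinfun_eqI) simp

lemma blinfun_compose_add: "(A + B) o\<^sub>L C = (A o\<^sub>L C) + (B o\<^sub>L C)"
  by (rule blinfun_eqI) (simp add: blinfun.add_left)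

lemma Gamma_dagger_apply: "Gamma_dagger k l v u = (\<Sum>j=1..k. ((1 / l j) * (v j \<bullet> u)) *\<^sub>R v j)"
  by (simp add: Gamma_dagger_def blinfun.sum_left blinfun.scaleR_left)

lemma Gamma_dagger_inverse:
  assumes L: "eigen_listing A l v" and sym: "\<And>x y. A x \<bullet> y = x \<bullet> A y" and pos: "l k > 0"
  shows "A o\<^sub>L Gamma_dagger k l v = Pi_hat k v" "Gamma_dagger k l v o\<^sub>L A = Pi_hat k v"
proof -
  note D = eigen_listingD[OF L]
  have l: "l j \<noteq> 0" if "j \<in> {1..k}" for j using D(1)[of j k] that pos by auto
  have vA: "v j \<bullet> A u = l j * (v j \<bullet> u)" if "1 \<le> j" for j u
    using sym[of "v j" u] D(3)[OF that] by simp
  show "A o\<^sub>L Gamma_dagger k l v = Pi_hat k v"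
    by (rule blinfun_eqI) (use l in \<open>auto simp: Gamma_dagger_apply Pi_hat_apply blinfun.sum_right
      blinfun.scaleR_right D(3) intro!: sum.cong\<close>)
  show "Gamma_dagger k l v o\<^sub>L A = Pi_hat k v"
    by (rule blinfun_eqI) (use l in \<open>auto simp: Gamma_dagger_apply Pi_hat_apply vA intro!: sum.cong\<close>)
qed

lemma norm_Gamma_dagger_le:
  assumes L: "eigen_listing A l v" and pos: "l k > 0"
  shows "norm (Gamma_dagger k l v) \<le> 1 / l k"
proof (rule norm_blinfun_bound)
  note D = eigen_listingD[OF L]
  fix u
  have "(norm (Gamma_dagger k l v u))\<^sup>2 = (\<Sum>j=1..k. ((1 / l j) * (v j \<bullet> u))\<^sup>2)"
    unfolding Gamma_dagger_apply using D(2) by (intro orthonormal_sum_norm) auto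
  also have "\<dots> \<le> (\<Sum>j=1..k. (1 / l k)\<^sup>2 * (u \<bullet> v j)\<^sup>2)"
  proof (rule sum_mono)
    fix j assume "j \<in> {1..k}"
    then have "l k \<le> l j" using D(1)[of j k] by auto
    then have "(1 / l j)\<^sup>2 \<le> (1 / l k)\<^sup>2" using pos by (intro power_mono) (auto simp: frac_le)
    then show "((1 / l j) * (v j \<bullet> u))\<^sup>2 \<le> (1 / l k)\<^sup>2 * (u \<bullet> v j)\<^sup>2"
      by (simp only: power_mult_distrib inner_commute[of u]) (rule mult_right_mono, auto)
  qed
  also have "\<dots> = (1 / l k)\<^sup>2 * (\<Sum>j=1..k. (u \<bullet> v j)\<^sup>2)" by (simp only: sum_distrib_left)
  also have "\<dots> \<le> (1 / l k)\<^sup>2 * (norm u)\<^sup>2"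
    using D(2) by (intro mult_left_mono bessel_inequality) auto
  finally have "(norm (Gamma_dagger k l v u))\<^sup>2 \<le> (1 / l k * norm u)\<^sup>2" by (simp only: power_mult_distrib)
  then show "norm (Gamma_dagger k l v u) \<le> 1 / l k * norm u"
    by (rule power2_le_imp_le) (use pos in simp)
qed (use pos in simp)

subsection \<open>Convergence of the estimate\<close>

text \<open>After removal of finitely many basis vectors the Hilbert-Schmidt norm of the rest is a small tail of
  the convergent series.\<close>

lemma hilbert_schmidt_finite_approx:
  fixes A :: "'h::{real_inner, banach, second_countable_topology} \<Rightarrow>\<^sub>L 'h"
  assumes B: "orthonormal_basis B" and sm: "(\<lambda>e. (norm (A e))\<^sup>2) summable_on B" and e: "\<eta> > 0"
  obtains F where "finite F" "F \<subseteq> B" "norm (A - (A o\<^sub>L (\<Sum>e\<in>F. tensor e e))) \<le> \<eta>"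
proof -
  define s where "s = infsum (\<lambda>e. (norm (A e))\<^sup>2) B"
  have "((\<lambda>e. (norm (A e))\<^sup>2) has_sum s) B" using sm by (simp add: s_def)
  then have "(sum (\<lambda>e. (norm (A e))\<^sup>2) \<longlongrightarrow> s) (finite_subsets_at_top B)" by (simp add: has_sum_def)
  then have "\<forall>\<^sub>F F in finite_subsets_at_top B. s - \<eta>\<^sup>2 < (\<Sum>e\<in>F. (norm (A e))\<^sup>2)"
    using e by (intro order_tendstoD(1)) auto
  then obtain F where F: "finite F" "F \<subseteq> B" "s - \<eta>\<^sup>2 < (\<Sum>e\<in>F. (norm (A e))\<^sup>2)"
    by (auto simp: eventually_finite_subsets_at_top)
  define R where "R = A - (A o\<^sub>L (\<Sum>e\<in>F. tensor e e))"
  have R: "R e = (if e \<in> F then 0 else A e)" if "e \<in> B" for e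
  proof -
    have "(\<Sum>f\<in>F. tensor f f) e = (\<Sum>f\<in>F. if f = e then e else 0)"
      using that F(2) orthonormal_basis_inner[OF B]
      by (auto simp: blinfun.sum_left subset_iff intro!: sum.cong)
    then show ?thesis using F(1) by (simp add: R_def blinfun.diff_left)
  qed
  have "hs_sq B R \<le> ennreal (\<eta>\<^sup>2)"
    unfolding hs_sq_def
  proof (rule nn_integral_count_space_le_of_finite[OF countable_orthonormal_basis[OF B]])
    fix G assume G: "finite G" "G \<subseteq> B"
    have "(\<Sum>e\<in>G. (norm (R e))\<^sup>2) = (\<Sum>e\<in>G - F. (norm (A e))\<^sup>2)"
      using G R by (intro sum.mono_neutral_cong_right) (auto simp: subset_iff)
    also have "\<dots> = (\<Sum>e\<in>G \<union> F. (norm (A e))\<^sup>2) - (\<Sum>e\<in>F. (norm (A e))\<^sup>2)"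
      using G F by (subst sum_diff[symmetric]) (auto intro!: sum.cong)
    also have "\<dots> \<le> \<eta>\<^sup>2"
    proof -
      have "(\<Sum>e\<in>G \<union> F. (norm (A e))\<^sup>2) \<le> s"
        unfolding s_def using G F by (intro finite_sum_le_infsum[OF sm]) auto
      then show ?thesis using F(3) by simp
    qed
    finally show "(\<Sum>e\<in>G. ennreal ((norm (R e))\<^sup>2)) \<le> ennreal (\<eta>\<^sup>2)" by (simp add: ennreal_leI)
  qed
  with norm_le_hs_sq[OF B, of R] have "ennreal ((norm R)\<^sup>2) \<le> ennreal (\<eta>\<^sup>2)" by (rule order_trans)
  then have "(norm R)\<^sup>2 \<le> \<eta>\<^sup>2" by (subst (asm) ennreal_le_iff) auto
  then have "norm R \<le> \<eta>" by (rule power2_le_imp_le) (use e in simp)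
  then show ?thesis using that[OF F(1,2)] by (simp add: R_def)
qed

lemma distinct_eigenvectors_orthonormal:
  fixes \<Gamma> :: "'h::{real_inner, banach} \<Rightarrow>\<^sub>L 'h" and lam :: "nat \<Rightarrow> real"
  assumes sym: "\<And>x y. \<Gamma> x \<bullet> y = x \<bullet> \<Gamma> y" and ev: "\<And>j. 1 \<le> j \<Longrightarrow> eigenvalue \<Gamma> (lam j)"
    and inj: "inj_on lam {1..}"
  obtains w where "\<And>j. 1 \<le> j \<Longrightarrow> \<Gamma> (w j) = lam j *\<^sub>R w j"
    "\<And>i j. 1 \<le> i \<Longrightarrow> 1 \<le> j \<Longrightarrow> w i \<bullet> w j = (if i = j then 1 else (0::real))"
proof -
  have "\<exists>w. \<Gamma> w = lam j *\<^sub>R w \<and> norm w = 1" if j: "1 \<le> j" for j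
  proof -
    obtain y where "y \<noteq> 0" "\<Gamma> y = lam j *\<^sub>R y" using ev[OF j] by (auto simp: eigenvalue_def)
    then show ?thesis
      by (intro exI[of _ "(1 / norm y) *\<^sub>R y"]) (simp add: blinfun.scaleR_right)
  qed
  then obtain w where w: "\<And>j. 1 \<le> j \<Longrightarrow> \<Gamma> (w j) = lam j *\<^sub>R w j" "\<And>j. 1 \<le> j \<Longrightarrow> norm (w j) = 1"
    by metis
  have "w i \<bullet> w j = 0" if "1 \<le> i" "1 \<le> j" "i \<noteq> j" for i j
  proof -
    have "lam i * (w i \<bullet> w j) = lam j * (w i \<bullet> w j)"
      using sym[of "w i" "w j"] w(1) that by simp
    moreover have "lam i \<noteq> lam j" using inj that by (auto dest: inj_onD)
    ultimately show ?thesis by simp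
  qed
  then show ?thesis using w by (intro that[of w]) (auto simp: norm_eq_1)
qed

text \<open>On data for which \<open>Gamma_hat\<close> and \<open>C_hat - \<Psi> Gamma_hat\<close> are within their stochastic order
  \<open>1 / sqrt n\<close>, the estimate \<open>Psi_hat\<close> is close to \<open>\<Psi>\<close>, uniformly in the data. The identity
  \<open>Psi_hat = \<Psi> Pi_hat + (C_hat - \<Psi> Gamma_hat) Gamma_dagger\<close> leaves two terms. The second is at most a constant
  times \<open>1 / (lam (k n) * sqrt n)\<close>, since \<open>l (k n) \<ge> lam (k n) / 2\<close> by the Weyl inequality. For the first it
  suffices, \<open>\<Psi>\<close> being a limit of finite rank operators, that \<open>Pi_hat\<close> tends to the identity on the dense range of
  \<open>\<Gamma>\<close>. There \<open>\<Gamma>\<close> can be replaced by \<open>Gamma_hat\<close>, and \<open>(1 - Pi_hat) Gamma_hat\<close> has norm at most \<open>l (k n + 1)\<close>,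
  which is at most the trace of \<open>Gamma_hat\<close> divided by \<open>k n + 1\<close>.\<close>

lemma Psi_hat_consistent:
  fixes \<Psi> \<Gamma> :: "'h::{real_inner, banach, second_countable_topology} \<Rightarrow>\<^sub>L 'h"
    and lam :: "nat \<Rightarrow> real" and k :: "nat \<Rightarrow> nat"
  assumes HS: "hilbert_schmidt \<Psi>"
    and sym: "\<And>x y. \<Gamma> x \<bullet> y = x \<bullet> \<Gamma> y" and inj: "\<And>x. \<Gamma> x = 0 \<Longrightarrow> x = 0"
    and ev: "\<And>j. 1 \<le> j \<Longrightarrow> eigenvalue \<Gamma> (lam j)"
    and dec: "\<And>j. 1 \<le> j \<Longrightarrow> lam (j + 1) < lam j" and pos: "\<And>j. 1 \<le> j \<Longrightarrow> 0 < lam j"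
    and k1: "\<And>n. 1 \<le> k n" and klim: "filterlim k at_top sequentially"
    and rate: "(\<lambda>n. 1 / lam (k n) / sqrt (real n)) \<longlonglongrightarrow> 0"
    and K: "K \<ge> 0" and \<eta>: "\<eta> > 0"
  shows "\<forall>\<^sub>F n in sequentially. \<forall>x l v. eigen_listing (Gamma_hat n x) l v \<longrightarrow>
    real n * (norm (Gamma_hat n x - \<Gamma>))\<^sup>2 \<le> K \<longrightarrow>
    real n * (norm (C_hat n x - (\<Psi> o\<^sub>L Gamma_hat n x)))\<^sup>2 \<le> K \<longrightarrow>
    (1 / real n) * (\<Sum>t<n. (norm (x t))\<^sup>2) \<le> K \<longrightarrow>
      norm (Psi_hat n x (k n) l v - \<Psi>) \<le> \<eta> \<and>
      C_hat n x o\<^sub>L Pi_hat (k n) v = Psi_hat n x (k n) l v o\<^sub>L Gamma_hat n x"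
proof -
  have anti: "lam j \<le> lam i" if "1 \<le> i" "i \<le> j" for i j
    using that(2,1)
  proof (induction j rule: dec_induct)
    case (step m)
    then show ?case using dec[of m] by simp
  qed simp
  have strict: "lam j < lam i" if "1 \<le> i" "i < j" for i j
    using anti[of "i + 1" j] dec[of i] that by simp
  have "inj_on lam {1..}"
  proof (rule inj_onI)
    fix i j assume "i \<in> {1..}" "j \<in> {1..}" "lam i = lam j"
    then show "i = j" using strict[of i j] strict[of j i] by (metis atLeast_iff less_irrefl nat_neq_iff)
  qed
  then obtain w where w: "\<And>j. 1 \<le> j \<Longrightarrow> \<Gamma> (w j) = lam j *\<^sub>R w j"
    "\<And>i j. 1 \<le> i \<Longrightarrow> 1 \<le> j \<Longrightarrow> w i \<bullet> w j = (if i = j then 1 else (0::real))"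
    using distinct_eigenvectors_orthonormal[where lam = lam and \<Gamma> = \<Gamma>, OF sym ev] by blast
  obtain B where B: "orthonormal_basis B" "(\<lambda>e. (norm (\<Psi> e))\<^sup>2) summable_on B"
    using HS by (auto simp: hilbert_schmidt_def)
  obtain F where F: "finite F" "F \<subseteq> B" "norm (\<Psi> - (\<Psi> o\<^sub>L (\<Sum>e\<in>F. tensor e e))) \<le> \<eta> / 4"
    using hilbert_schmidt_finite_approx[OF B, of "\<eta> / 4"] \<eta> by auto
  \<comment> \<open>\<open>c\<close> is chosen such that the approximation errors \<open>\<eta> / (4 * c)\<close> of the \<open>card F\<close> basis vectors by elements
    of the range of \<open>\<Gamma>\<close> contribute at most \<open>\<eta> / 4\<close>.\<close>
  define c where "c = norm \<Psi> * real (card F) + 1"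
  have c: "c > 0" by (simp add: c_def add_nonneg_pos)
  have "\<exists>y. norm (e - \<Gamma> y) < \<eta> / (4 * c)" for e
    by (rule dense_range_if_symmetric_injective[OF sym inj]) (use c \<eta> in simp_all)
  then obtain y where y: "\<And>e. norm (e - \<Gamma> (y e)) < \<eta> / (4 * c)" by metis
  \<comment> \<open>\<open>\<delta> n\<close> bounds both stochastic errors; \<open>b n\<close> is the resulting bound for \<open>Psi_hat - \<Psi>\<close>: a finite rank
    approximation of \<open>\<Psi>\<close>, the defect of the projection on the finitely many vectors \<open>e \<in> F\<close>, and the
    second term of the identity.\<close>
  define \<delta> where "\<delta> n = sqrt K / sqrt (real n)" for n :: nat
  define b where "b n = \<eta> / 4 + norm \<Psi> * (\<Sum>e\<in>F. \<eta> / (4 * c) + (\<delta> n + K / real (Suc (k n))) * norm (y e))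
    + 2 * sqrt K * (1 / lam (k n) / sqrt (real n))" for n
  have \<delta>: "\<delta> \<longlonglongrightarrow> 0"
  proof -
    have "(\<lambda>n. sqrt (K * (1 / real n))) \<longlonglongrightarrow> sqrt (K * 0)"
      by (intro tendsto_intros lim_1_over_n)
    then show ?thesis by (simp add: \<delta>_def[abs_def] real_sqrt_divide)
  qed
  have kinv: "(\<lambda>n. K / real (Suc (k n))) \<longlonglongrightarrow> 0"
  proof -
    have "(\<lambda>m. K * (1 / real (Suc m))) \<longlonglongrightarrow> K * 0" by (intro tendsto_intros LIMSEQ_Suc[OF lim_1_over_n])
    from filterlim_compose[OF this klim] show ?thesis by simp
  qed
  have "b \<longlonglongrightarrow> \<eta> / 4 + norm \<Psi> * (\<Sum>e\<in>F. \<eta> / (4 * c) + (0 + 0) * norm (y e)) + 2 * sqrt K * 0"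
    unfolding b_def by (intro tendsto_intros \<delta> kinv rate)
  moreover have "\<eta> / 4 + norm \<Psi> * (\<Sum>e\<in>F. \<eta> / (4 * c) + (0 + 0) * norm (y e)) + 2 * sqrt K * 0 < \<eta>"
  proof -
    have "norm \<Psi> * (real (card F) * (\<eta> / (4 * c))) \<le> c * (\<eta> / (4 * c))"
      unfolding mult.assoc[symmetric] by (intro mult_right_mono) (use c \<eta> in \<open>auto simp: c_def\<close>)
    also have "\<dots> = \<eta> / 4" using c by simp
    finally show ?thesis using \<eta>
      by (simp only: add_0_left mult_zero_left sum_constant mult_zero_right add_0_right)
  qed
  ultimately have ev1: "\<forall>\<^sub>F n in sequentially. b n < \<eta>" by (rule order_tendstoD(2))
  have "(\<lambda>n. sqrt K * (1 / lam (k n) / sqrt (real n))) \<longlonglongrightarrow> sqrt K * 0" by (intro tendsto_intros rate)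
  then have "\<forall>\<^sub>F n in sequentially. sqrt K * (1 / lam (k n) / sqrt (real n)) < 1 / 2"
    by (rule order_tendstoD(2)) simp
  then have ev2: "\<forall>\<^sub>F n in sequentially. \<delta> n \<le> lam (k n) / 2"
  proof eventually_elim
    case (elim n)
    have "lam (k n) > 0" using pos k1 by simp
    then have "\<delta> n = lam (k n) * (sqrt K * (1 / lam (k n) / sqrt (real n)))" by (simp add: \<delta>_def)
    also have "\<dots> \<le> lam (k n) * (1 / 2)"
      using elim \<open>lam (k n) > 0\<close> by (intro mult_left_mono) auto
    finally show ?case by simp
  qed
  show ?thesis
    using ev1 ev2 eventually_gt_at_top[of 0]
  proof eventually_elim
    case (elim n)
    show ?case
    proof (intro allI impI)
      fix x :: "nat \<Rightarrow> 'h" and l v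
      assume L: "eigen_listing (Gamma_hat n x) l v"
        and G: "real n * (norm (Gamma_hat n x - \<Gamma>))\<^sup>2 \<le> K"
        and U: "real n * (norm (C_hat n x - (\<Psi> o\<^sub>L Gamma_hat n x)))\<^sup>2 \<le> K"
        and X: "(1 / real n) * (\<Sum>t<n. (norm (x t))\<^sup>2) \<le> K"
      define G' where "G' = Gamma_hat n x"
      define U' where "U' = C_hat n x - (\<Psi> o\<^sub>L G')"
      define P where "P = Pi_hat (k n) v"
      note cpt = compact_operator_Gamma_hat[of n x] and symG = Gamma_hat_symmetric[of n x]
        and posG = Gamma_hat_nonneg[of n x]
      have root: "norm Z \<le> \<delta> n" if "real n * (norm Z)\<^sup>2 \<le> K" for Z :: "'h \<Rightarrow>\<^sub>L 'h"
      proof (rule power2_le_imp_le)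
        show "(norm Z)\<^sup>2 \<le> (\<delta> n)\<^sup>2" using that elim K by (simp add: \<delta>_def power_divide field_simps)
      qed (use K in \<open>simp add: \<delta>_def\<close>)
      have nG: "norm (G' - \<Gamma>) \<le> \<delta> n" using root[OF G] by (simp add: G'_def)
      have nU: "norm U' \<le> \<delta> n" using root[OF U] by (simp add: U'_def G'_def)
      have "lam (k n) \<le> l (k n) + norm (G' - \<Gamma>)"
        unfolding G'_def using anti k1
        by (intro eigen_listing_weyl_lower[OF L symG posG cpt w(2) w(1)]) auto
      then have lk: "lam (k n) / 2 \<le> l (k n)" using nG elim(2) by simp
      have lam0: "lam (k n) > 0" using pos k1 by simp
      then have l0: "l (k n) > 0" using lk by simp
      note inv = Gamma_dagger_inverse[OF L symG l0]
      have "C_hat n x o\<^sub>L P = Psi_hat n x (k n) l v o\<^sub>L Gamma_hat n x"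
        by (simp add: Psi_hat_def blinfun_compose_assoc inv(2) P_def)
      moreover have "norm (Psi_hat n x (k n) l v - \<Psi>) \<le> b n"
      proof -
        have "C_hat n x = U' + (\<Psi> o\<^sub>L G')" by (simp add: U'_def)
        then have "Psi_hat n x (k n) l v = (U' o\<^sub>L Gamma_dagger (k n) l v) + (\<Psi> o\<^sub>L P)"
          unfolding Psi_hat_def P_def inv(1)[symmetric] G'_def
          by (simp add: blinfun_compose_add blinfun_compose_assoc)
        then have "Psi_hat n x (k n) l v - \<Psi> = (U' o\<^sub>L Gamma_dagger (k n) l v) - (\<Psi> - (\<Psi> o\<^sub>L P))"
          by simp
        also have "norm \<dots> \<le> norm (U' o\<^sub>L Gamma_dagger (k n) l v) + norm (\<Psi> - (\<Psi> o\<^sub>L P))"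
          by (rule norm_triangle_ineq4)
        also have "norm (U' o\<^sub>L Gamma_dagger (k n) l v) \<le> norm U' * norm (Gamma_dagger (k n) l v)"
          by (rule norm_blinfun_compose)
        also have "\<dots> \<le> \<delta> n * (1 / l (k n))"
          using nU norm_Gamma_dagger_le[OF L l0] by (intro mult_mono) (auto simp: \<delta>_def K)
        also have "\<dots> \<le> \<delta> n * (2 / lam (k n))"
          using lk lam0 l0 by (intro mult_left_mono) (auto simp: field_simps \<delta>_def K)
        also have "\<dots> = 2 * sqrt K * (1 / lam (k n) / sqrt (real n))" by (simp add: \<delta>_def mult.commute)
        also have "norm (\<Psi> - (\<Psi> o\<^sub>L P)) \<le> \<eta> / 4 +
            norm \<Psi> * (\<Sum>e\<in>F. \<eta> / (4 * c) + (\<delta> n + K / real (Suc (k n))) * norm (y e))"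
        proof (rule norm_blinfun_bound)
          fix u
          have e: "norm (e - P e) \<le> \<eta> / (4 * c) + (\<delta> n + K / real (Suc (k n))) * norm (y e)" for e
          proof -
            have "l (Suc (k n)) \<le> K / real (Suc (k n))"
              using order_trans[OF Gamma_hat_eigenvalue_le[OF L, of "Suc (k n)"] X]
              by (simp add: field_simps)
            have "e - P e = ((e - \<Gamma> (y e)) - P (e - \<Gamma> (y e)))
              + (((\<Gamma> - G') (y e)) - P ((\<Gamma> - G') (y e))) + (G' (y e) - P (G' (y e)))"
              by (simp add: blinfun.diff_right blinfun.diff_left)
            also have "norm \<dots> \<le> norm ((e - \<Gamma> (y e)) - P (e - \<Gamma> (y e)))
              + norm (((\<Gamma> - G') (y e)) - P ((\<Gamma> - G') (y e))) + norm (G' (y e) - P (G' (y e)))"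
              by (intro norm_triangle_le add_right_mono norm_triangle_ineq)
            also have "\<dots> \<le> norm (e - \<Gamma> (y e)) + norm ((\<Gamma> - G') (y e)) + l (Suc (k n)) * norm (y e)"
              unfolding P_def G'_def
              by (intro add_mono norm_minus_Pi_hat_le[OF L] eigen_listing_tail_norm[OF L symG posG cpt])
            also have "\<dots> \<le> \<eta> / (4 * c) + \<delta> n * norm (y e) + K / real (Suc (k n)) * norm (y e)"
            proof (intro add_mono)
              show "norm (e - \<Gamma> (y e)) \<le> \<eta> / (4 * c)" using y[of e] by simp
              show "norm ((\<Gamma> - G') (y e)) \<le> \<delta> n * norm (y e)"
                using norm_blinfun[of "\<Gamma> - G'" "y e"] mult_right_mono[OF nG norm_ge_zero[of "y e"]]
                by (simp add: norm_minus_commute)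
              show "l (Suc (k n)) * norm (y e) \<le> K / real (Suc (k n)) * norm (y e)"
                by (intro mult_right_mono) (fact, simp)
            qed
            finally show ?thesis by (simp add: algebra_simps)
          qed
          define F' where "F' = (\<Sum>e\<in>F. tensor e e)"
          have "(\<Psi> - (\<Psi> o\<^sub>L P)) u = (\<Psi> - (\<Psi> o\<^sub>L F')) (u - P u) + \<Psi> (F' (u - P u))"
            by (simp add: blinfun.diff_left blinfun.diff_right)
          also have "norm \<dots> \<le> norm ((\<Psi> - (\<Psi> o\<^sub>L F')) (u - P u)) + norm (\<Psi> (F' (u - P u)))"
            by (rule norm_triangle_ineq)
          finally have 1: "norm ((\<Psi> - (\<Psi> o\<^sub>L P)) u)
            \<le> norm ((\<Psi> - (\<Psi> o\<^sub>L F')) (u - P u)) + norm (\<Psi> (F' (u - P u)))" .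
          have "norm ((\<Psi> - (\<Psi> o\<^sub>L F')) (u - P u)) \<le> norm (\<Psi> - (\<Psi> o\<^sub>L F')) * norm (u - P u)"
            by (rule norm_blinfun)
          also have "\<dots> \<le> \<eta> / 4 * norm u"
            using F(3) norm_minus_Pi_hat_le[OF L, of u "k n"] \<eta> by (intro mult_mono) (auto simp: F'_def P_def)
          finally have 2: "norm ((\<Psi> - (\<Psi> o\<^sub>L F')) (u - P u)) \<le> \<eta> / 4 * norm u" .
          have "norm (F' (u - P u)) \<le> (\<Sum>e\<in>F. norm (e - P e) * norm u)"
          proof -
            have "F' (u - P u) = (\<Sum>e\<in>F. ((e - P e) \<bullet> u) *\<^sub>R e)"
              by (simp add: F'_def blinfun.sum_left inner_diff_left inner_diff_right P_def Pi_hat_symmetric)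
            moreover have "norm (((e - P e) \<bullet> u) *\<^sub>R e) \<le> norm (e - P e) * norm u" if "e \<in> F" for e
            proof -
              have "norm e = 1" using that F(2) B(1) by (auto simp: orthonormal_basis_def)
              then show ?thesis using Cauchy_Schwarz_ineq2[of "e - P e" u] by simp
            qed
            ultimately show ?thesis by (simp add: sum_norm_le)
          qed
          also have "\<dots> \<le> (\<Sum>e\<in>F. \<eta> / (4 * c) + (\<delta> n + K / real (Suc (k n))) * norm (y e)) * norm u"
            unfolding sum_distrib_right using e by (intro sum_mono mult_right_mono) auto
          finally have "norm \<Psi> * norm (F' (u - P u)) \<le> norm \<Psi> *
            ((\<Sum>e\<in>F. \<eta> / (4 * c) + (\<delta> n + K / real (Suc (k n))) * norm (y e)) * norm u)"
            by (intro mult_left_mono) auto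
          with norm_blinfun[of \<Psi> "F' (u - P u)"] have 3: "norm (\<Psi> (F' (u - P u))) \<le> norm \<Psi> *
            ((\<Sum>e\<in>F. \<eta> / (4 * c) + (\<delta> n + K / real (Suc (k n))) * norm (y e)) * norm u)"
            by (rule order_trans)
          show "norm ((\<Psi> - (\<Psi> o\<^sub>L P)) u) \<le> (\<eta> / 4 +
            norm \<Psi> * (\<Sum>e\<in>F. \<eta> / (4 * c) + (\<delta> n + K / real (Suc (k n))) * norm (y e))) * norm u"
            using 1 2 3 unfolding distrib_right mult.assoc[symmetric] by linarith
        next
          show "0 \<le> \<eta> / 4 +
            norm \<Psi> * (\<Sum>e\<in>F. \<eta> / (4 * c) + (\<delta> n + K / real (Suc (k n))) * norm (y e))"
            using \<eta> c K by (intro add_nonneg_nonneg mult_nonneg_nonneg sum_nonneg) (auto simp: \<delta>_def)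
        qed
        finally show ?thesis by (simp add: b_def)
      qed
      ultimately show "norm (Psi_hat n x (k n) l v - \<Psi>) \<le> \<eta> \<and>
          C_hat n x o\<^sub>L Pi_hat (k n) v = Psi_hat n x (k n) l v o\<^sub>L Gamma_hat n x"
        using elim(1) by (simp add: P_def)
    qed
  qed
qed

section \<open>Second moments of random operators\<close>

text \<open>For a non-negative random variable, a bound on the mean always comes with integrability; the
  two are propagated together.\<close>

definition mean_le :: "'a measure \<Rightarrow> ('a \<Rightarrow> real) \<Rightarrow> real \<Rightarrow> bool" where
  "mean_le M f a \<longleftrightarrow> integrable M f \<and> (\<forall>\<omega>\<in>space M. 0 \<le> f \<omega>) \<and> (\<integral>\<omega>. f \<omega> \<partial>M) \<le> a"

lemma mean_leD:
  assumes "mean_le M f a"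
  shows "integrable M f" "f \<in> borel_measurable M" "\<And>\<omega>. \<omega> \<in> space M \<Longrightarrow> 0 \<le> f \<omega>" "(\<integral>\<omega>. f \<omega> \<partial>M) \<le> a" "0 \<le> a"
proof -
  have *: "integrable M f" "(\<And>\<omega>. \<omega> \<in> space M \<Longrightarrow> 0 \<le> f \<omega>)" "(\<integral>\<omega>. f \<omega> \<partial>M) \<le> a"
    using assms by (auto simp: mean_le_def)
  show "integrable M f" "f \<in> borel_measurable M" "\<And>\<omega>. \<omega> \<in> space M \<Longrightarrow> 0 \<le> f \<omega>" "(\<integral>\<omega>. f \<omega> \<partial>M) \<le> a"
    using * by auto
  have "0 \<le> (\<integral>\<omega>. f \<omega> \<partial>M)" by (rule Bochner_Integration.integral_nonneg) (rule *)
  then show "0 \<le> a" using *(3) by simp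
qed

lemma mean_le_add:
  assumes "mean_le M f a" "mean_le M g b"
  shows "mean_le M (\<lambda>\<omega>. f \<omega> + g \<omega>) (a + b)"
  using assms by (auto simp: mean_le_def intro!: add_mono)

lemma mean_le_cmult:
  assumes "mean_le M f a" "0 \<le> c"
  shows "mean_le M (\<lambda>\<omega>. c * f \<omega>) (c * a)"
  using assms by (auto simp: mean_le_def intro!: mult_left_mono)

lemma mean_le_mono:
  assumes g: "mean_le M g b" and f: "f \<in> borel_measurable M" "\<And>\<omega>. \<omega> \<in> space M \<Longrightarrow> 0 \<le> f \<omega>"
    and le: "\<And>\<omega>. \<omega> \<in> space M \<Longrightarrow> f \<omega> \<le> g \<omega>" and "b \<le> c"
  shows "mean_le M f c"
proof -
  note g' = mean_leD[OF g]
  have int: "integrable M f"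
  proof (rule Bochner_Integration.integrable_bound[OF g'(1) f(1)], rule AE_I2)
    fix \<omega> assume "\<omega> \<in> space M"
    then show "norm (f \<omega>) \<le> norm (g \<omega>)" using f(2)[of \<omega>] le[of \<omega>] by simp
  qed
  have "(\<integral>\<omega>. f \<omega> \<partial>M) \<le> (\<integral>\<omega>. g \<omega> \<partial>M)" by (intro integral_mono int g'(1) le)
  then show ?thesis using int f(2) g'(4) \<open>b \<le> c\<close> by (auto simp: mean_le_def)
qed

lemma mean_le_weaken: "mean_le M f a \<Longrightarrow> a \<le> b \<Longrightarrow> mean_le M f b"
  by (auto simp: mean_le_def)

lemma mean_le_sum:
  assumes "\<And>i. i \<in> I \<Longrightarrow> mean_le M (f i) (a i)"
  shows "mean_le M (\<lambda>\<omega>. \<Sum>i\<in>I. f i \<omega>) (\<Sum>i\<in>I. a i)"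
  using assms by (auto simp: mean_le_def intro!: sum_nonneg sum_mono)

lemma (in prob_space) mean_le_const: "0 \<le> c \<Longrightarrow> mean_le M (\<lambda>_. c) c"
  by (simp add: mean_le_def prob_space)

lemma mean_leI_nn:
  assumes f: "f \<in> borel_measurable M" "\<And>\<omega>. \<omega> \<in> space M \<Longrightarrow> 0 \<le> f \<omega>"
    and le: "(\<integral>\<^sup>+\<omega>. ennreal (f \<omega>) \<partial>M) \<le> ennreal a" and a: "0 \<le> a"
  shows "mean_le M f a"
proof -
  have int: "integrable M f"
    using f le by (intro integrableI_bounded) (auto simp: le_less_trans[OF _ ennreal_less_top]
      cong: nn_integral_cong_simp)
  have "ennreal (\<integral>\<omega>. f \<omega> \<partial>M) = (\<integral>\<^sup>+\<omega>. ennreal (f \<omega>) \<partial>M)"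
    using f(2) by (intro nn_integral_eq_integral[symmetric] int AE_I2)
  with le have "ennreal (\<integral>\<omega>. f \<omega> \<partial>M) \<le> ennreal a" by simp
  then show ?thesis using int f(2) a by (simp add: mean_le_def)
qed

lemma mean_le_nn_integral:
  assumes "mean_le M f a"
  shows "(\<integral>\<^sup>+\<omega>. ennreal (f \<omega>) \<partial>M) \<le> ennreal a"
proof -
  note f = mean_leD[OF assms]
  have "(\<integral>\<^sup>+\<omega>. ennreal (f \<omega>) \<partial>M) = ennreal (\<integral>\<omega>. f \<omega> \<partial>M)"
    using f(3) by (intro nn_integral_eq_integral f(1) AE_I2)
  then show ?thesis using f(4) by (simp add: ennreal_leI)
qed

lemma (in prob_space) mean_le_markov:
  assumes f: "mean_le M f a" and K: "K > 0"
  shows "emeasure M {\<omega>\<in>space M. f \<omega> > K} \<le> ennreal (a / K)"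
proof -
  note D = mean_leD[OF f]
  have [measurable]: "f \<in> borel_measurable M" by (rule D)
  have "prob {\<omega>\<in>space M. f \<omega> > K} \<le> prob {\<omega>\<in>space M. f \<omega> \<ge> K}" by (intro finite_measure_mono) auto
  also have "\<dots> \<le> (\<integral>\<omega>. f \<omega> \<partial>M) / K"
    using D(3) by (intro integral_Markov_inequality_measure[where A = "{}", OF D(1)] K AE_I2) auto
  also have "\<dots> \<le> a / K" using D(4) K by (simp add: divide_right_mono)
  finally show ?thesis by (simp add: emeasure_eq_measure ennreal_leI)
qed

text \<open>The operator norm is a supremum over a countable dense set of arguments; the space of operators itself
  need not be separable.\<close>

lemma borel_measurable_norm_blinfun:
  fixes A :: "'a \<Rightarrow> ('h::{real_normed_vector, second_countable_topology} \<Rightarrow>\<^sub>L 'h)"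
  assumes A [measurable]: "\<And>x. (\<lambda>\<omega>. blinfun_apply (A \<omega>) x) \<in> borel_measurable M"
  shows "(\<lambda>\<omega>. norm (A \<omega>)) \<in> borel_measurable M"
proof (rule borel_measurableI_le)
  fix c :: real
  obtain D :: "'h set" where D: "countable D" "\<And>X. open X \<Longrightarrow> X \<noteq> {} \<Longrightarrow> \<exists>d\<in>D. d \<in> X"
    using countable_dense_setE by blast
  have dense: "closure D = UNIV"
  proof -
    have "x \<in> closure D" for x
      unfolding closure_approachable
    proof (intro allI impI)
      fix e :: real assume "e > 0"
      then show "\<exists>y\<in>D. dist y x < e" using D(2)[of "ball x e"] by (auto simp: dist_commute)
    qed
    then show ?thesis by blast
  qed
  show "{\<omega> \<in> space M. norm (A \<omega>) \<le> c} \<in> sets M"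
  proof (cases "c \<ge> 0")
    case True
    have "norm (A \<omega>) \<le> c \<longleftrightarrow> (\<forall>x\<in>D. norm (A \<omega> x) \<le> c * norm x)" for \<omega>
    proof
      assume "norm (A \<omega>) \<le> c"
      then show "\<forall>x\<in>D. norm (A \<omega> x) \<le> c * norm x"
        using order_trans[OF norm_blinfun mult_right_mono] by (metis norm_ge_zero)
    next
      assume *: "\<forall>x\<in>D. norm (A \<omega> x) \<le> c * norm x"
      have "closed {x. norm (A \<omega> x) \<le> c * norm x}"
        by (intro closed_Collect_le continuous_intros)
      then have "closure D \<subseteq> {x. norm (A \<omega> x) \<le> c * norm x}"
        using * by (intro closure_minimal) auto
      then show "norm (A \<omega>) \<le> c" using True dense by (intro norm_blinfun_bound) auto
    qed
    then have "{\<omega> \<in> space M. norm (A \<omega>) \<le> c} = {\<omega> \<in> space M. \<forall>x\<in>D. norm (A \<omega> x) \<le> c * norm x}"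
      by simp
    also have "\<dots> \<in> sets M" using D(1) by measurable
    finally show ?thesis .
  next
    case False
    then have "{\<omega> \<in> space M. norm (A \<omega>) \<le> c} = {}" by (auto simp: not_le intro: less_le_trans)
    then show ?thesis by (simp only: sets.empty_sets)
  qed
qed

text \<open>By Fubini, the inner product can be integrated over the centered factor first.\<close>

lemma (in prob_space) indep_zero_mean:
  fixes W e :: "'a \<Rightarrow> 'h::{real_inner, banach, second_countable_topology}"
  assumes ind: "indep_var borel W borel e" and W: "integrable M W" and e: "integrable M e"
    and e0: "(\<integral>\<omega>. e \<omega> \<partial>M) = 0"
  shows "integrable M (\<lambda>\<omega>. W \<omega> \<bullet> e \<omega>)" "(\<integral>\<omega>. W \<omega> \<bullet> e \<omega> \<partial>M) = 0"
proof -
  have [measurable]: "W \<in> borel_measurable M" "e \<in> borel_measurable M" using W e by auto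
  have "indep_var borel (norm \<circ> W) borel (norm \<circ> e)"
    by (rule indep_var_compose[OF ind]) auto
  then have "integrable M (\<lambda>\<omega>. (norm \<circ> W) \<omega> * (norm \<circ> e) \<omega>)"
    by (rule indep_var_integrable) (use W e in \<open>simp_all add: comp_def\<close>)
  then show int: "integrable M (\<lambda>\<omega>. W \<omega> \<bullet> e \<omega>)"
    by (rule Bochner_Integration.integrable_bound) (auto simp: Cauchy_Schwarz_ineq2)
  let ?F = "distr M borel W" and ?G = "distr M borel e"
  interpret F: prob_space ?F by (rule prob_space_distr) simp
  interpret G: prob_space ?G by (rule prob_space_distr) simp
  interpret FG: pair_prob_space ?F ?G ..
  have eq: "?F \<Otimes>\<^sub>M ?G = distr M (borel \<Otimes>\<^sub>M borel) (\<lambda>\<omega>. (W \<omega>, e \<omega>))"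
    using ind by (simp add: indep_var_distribution_eq)
  have [measurable]: "(\<lambda>p. fst p \<bullet> snd p) \<in> borel_measurable (borel \<Otimes>\<^sub>M (borel :: 'h measure))"
    by measurable
  have intp: "integrable (?F \<Otimes>\<^sub>M ?G) (\<lambda>p. fst p \<bullet> snd p)"
    unfolding eq using int by (subst integrable_distr_eq) auto
  have "(\<integral>\<omega>. W \<omega> \<bullet> e \<omega> \<partial>M) = (\<integral>p. fst p \<bullet> snd p \<partial>(?F \<Otimes>\<^sub>M ?G))"
    unfolding eq by (subst integral_distr) auto
  also have "\<dots> = (\<integral>w. (\<integral>x. fst (w, x) \<bullet> snd (w, x) \<partial>?G) \<partial>?F)"
    by (rule FG.integral_fst'[symmetric]) (rule intp)
  also have "\<dots> = (\<integral>w. 0 \<partial>?F)"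
  proof (rule Bochner_Integration.integral_cong[OF refl])
    fix w
    have "integrable ?G (\<lambda>x. x)" using e by (subst integrable_distr_eq) auto
    then have "(\<integral>x. w \<bullet> x \<partial>?G) = w \<bullet> (\<integral>x. x \<partial>?G)" by (intro integral_inner_right) auto
    also have "(\<integral>x. x \<partial>?G) = 0" using e0 by (subst integral_distr) auto
    finally show "(\<integral>x. fst (w, x) \<bullet> snd (w, x) \<partial>?G) = 0" by simp
  qed
  finally show "(\<integral>\<omega>. W \<omega> \<bullet> e \<omega> \<partial>M) = 0" by simp
qed

lemma integrable_inner_of_square:
  fixes Y Z :: "'a \<Rightarrow> 'h::{real_inner, second_countable_topology}"
  assumes [measurable]: "Y \<in> borel_measurable M" "Z \<in> borel_measurable M"
    and "integrable M (\<lambda>\<omega>. (norm (Y \<omega>))\<^sup>2)" "integrable M (\<lambda>\<omega>. (norm (Z \<omega>))\<^sup>2)"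
  shows "integrable M (\<lambda>\<omega>. Y \<omega> \<bullet> Z \<omega>)" "integrable M (\<lambda>\<omega>. norm (Y \<omega>) * norm (Z \<omega>))"
proof -
  have *: "norm y * norm z \<le> (norm y)\<^sup>2 + (norm z)\<^sup>2" for y z :: 'h
    using zero_le_power2[of "norm y - norm z"] mult_nonneg_nonneg[OF norm_ge_zero[of y] norm_ge_zero[of z]]
    unfolding power2_diff by linarith
  have i: "integrable M (\<lambda>\<omega>. (norm (Y \<omega>))\<^sup>2 + (norm (Z \<omega>))\<^sup>2)" using assms by simp
  show "integrable M (\<lambda>\<omega>. norm (Y \<omega>) * norm (Z \<omega>))"
    by (rule Bochner_Integration.integrable_bound[OF i]) (auto simp: *)
  then show "integrable M (\<lambda>\<omega>. Y \<omega> \<bullet> Z \<omega>)"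
    by (rule Bochner_Integration.integrable_bound) (auto simp: Cauchy_Schwarz_ineq2)
qed

lemma (in prob_space) integrable_of_square:
  fixes Z :: "'a \<Rightarrow> 'h::{real_inner, banach, second_countable_topology}"
  assumes [measurable]: "Z \<in> borel_measurable M" and "integrable M (\<lambda>\<omega>. (norm (Z \<omega>))\<^sup>2)"
  shows "integrable M Z"
proof -
  have *: "y \<le> 1 + y\<^sup>2" for y :: real
  proof -
    have "0 \<le> (y - 1/2) * (y - 1/2)" by simp
    also have "\<dots> = y * y - y + 1/4" by (simp add: algebra_simps)
    finally show ?thesis unfolding power2_eq_square by linarith
  qed
  have i: "integrable M (\<lambda>\<omega>. 1 + (norm (Z \<omega>))\<^sup>2)" using assms by simp
  show ?thesis by (rule Bochner_Integration.integrable_bound[OF i]) (auto simp: *)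
qed

lemma integral_norm_sq_sum_orthogonal:
  fixes Z :: "nat \<Rightarrow> 'a \<Rightarrow> 'h::{real_inner, banach, second_countable_topology}"
  assumes [measurable]: "\<And>t. t < n \<Longrightarrow> Z t \<in> borel_measurable M"
    and L2: "\<And>t. t < n \<Longrightarrow> integrable M (\<lambda>\<omega>. (norm (Z t \<omega>))\<^sup>2)"
    and orth: "\<And>s t. s < t \<Longrightarrow> t < n \<Longrightarrow> (\<integral>\<omega>. Z s \<omega> \<bullet> Z t \<omega> \<partial>M) = 0"
  shows "integrable M (\<lambda>\<omega>. (norm (\<Sum>t<n. Z t \<omega>))\<^sup>2) \<and>
    (\<integral>\<omega>. (norm (\<Sum>t<n. Z t \<omega>))\<^sup>2 \<partial>M) = (\<Sum>t<n. \<integral>\<omega>. (norm (Z t \<omega>))\<^sup>2 \<partial>M)"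
  using assms
proof (induction n)
  case (Suc n)
  define S where "S \<omega> = (\<Sum>t<n. Z t \<omega>)" for \<omega>
  have IH: "integrable M (\<lambda>\<omega>. (norm (S \<omega>))\<^sup>2)"
    "(\<integral>\<omega>. (norm (S \<omega>))\<^sup>2 \<partial>M) = (\<Sum>t<n. \<integral>\<omega>. (norm (Z t \<omega>))\<^sup>2 \<partial>M)"
    using Suc.IH Suc.prems unfolding S_def by auto
  have Zn: "integrable M (\<lambda>\<omega>. (norm (Z n \<omega>))\<^sup>2)" by (rule Suc.prems) simp
  have int: "integrable M (\<lambda>\<omega>. Z t \<omega> \<bullet> Z n \<omega>)" if "t < n" for t
    using that by (intro integrable_inner_of_square Suc.prems) auto
  have cross: "integrable M (\<lambda>\<omega>. S \<omega> \<bullet> Z n \<omega>)" "(\<integral>\<omega>. S \<omega> \<bullet> Z n \<omega> \<partial>M) = 0"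
    unfolding S_def inner_sum_left using int Suc.prems(3) by auto
  have e: "(norm (\<Sum>t<Suc n. Z t \<omega>))\<^sup>2 = (norm (S \<omega>))\<^sup>2 + (norm (Z n \<omega>))\<^sup>2 + 2 * (S \<omega> \<bullet> Z n \<omega>)" for \<omega>
    unfolding S_def by (simp add: power2_norm_eq_inner inner_add_left inner_add_right inner_commute)
  show ?case unfolding e using IH Zn cross by simp
qed simp

text \<open>Centering decreases the second moment of the image of every basis vector.\<close>

lemma (in prob_space) nn_integral_hs_sq_centered:
  fixes A :: "'a \<Rightarrow> ('h::{real_inner, banach, second_countable_topology} \<Rightarrow>\<^sub>L 'h)"
    and K :: "'h \<Rightarrow>\<^sub>L 'h"
  assumes B: "orthonormal_basis B" and [measurable]: "\<And>x. (\<lambda>\<omega>. A \<omega> x) \<in> borel_measurable M"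
    and L2: "\<And>x. integrable M (\<lambda>\<omega>. (norm (A \<omega> x))\<^sup>2)" and K: "\<And>x. (\<integral>\<omega>. A \<omega> x \<partial>M) = K x"
  shows "(\<integral>\<^sup>+\<omega>. hs_sq B (A \<omega> - K) \<partial>M) \<le> (\<integral>\<^sup>+\<omega>. hs_sq B (A \<omega>) \<partial>M)"
proof -
  have cnt: "countable B" by (rule countable_orthonormal_basis[OF B])
  have "(\<integral>\<^sup>+\<omega>. ennreal ((norm ((A \<omega> - K) e))\<^sup>2) \<partial>M) \<le> (\<integral>\<^sup>+\<omega>. ennreal ((norm (A \<omega> e))\<^sup>2) \<partial>M)" for e
  proof -
    have i1: "integrable M (\<lambda>\<omega>. A \<omega> e)" by (rule integrable_of_square) (auto simp: L2)
    have i2: "integrable M (\<lambda>\<omega>. A \<omega> e \<bullet> K e)" using i1 by simp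
    have eq: "(norm ((A \<omega> - K) e))\<^sup>2 = (norm (A \<omega> e))\<^sup>2 - 2 * (A \<omega> e \<bullet> K e) + (norm (K e))\<^sup>2" for \<omega>
      by (simp add: blinfun.diff_left power2_norm_eq_inner inner_diff_left inner_diff_right inner_commute)
    have "(\<integral>\<omega>. A \<omega> e \<bullet> K e \<partial>M) = K e \<bullet> K e" using i1 K by simp
    then have "(\<integral>\<omega>. (norm ((A \<omega> - K) e))\<^sup>2 \<partial>M) = (\<integral>\<omega>. (norm (A \<omega> e))\<^sup>2 \<partial>M) - (norm (K e))\<^sup>2"
      unfolding eq using L2[of e] i2 by (simp add: prob_space power2_norm_eq_inner)
    then have "(\<integral>\<omega>. (norm ((A \<omega> - K) e))\<^sup>2 \<partial>M) \<le> (\<integral>\<omega>. (norm (A \<omega> e))\<^sup>2 \<partial>M)" by simp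
    moreover have "integrable M (\<lambda>\<omega>. (norm ((A \<omega> - K) e))\<^sup>2)" unfolding eq using L2[of e] i2 by simp
    ultimately show ?thesis using L2[of e] by (simp add: nn_integral_eq_integral ennreal_leI)
  qed
  then have "(\<integral>\<^sup>+e. (\<integral>\<^sup>+\<omega>. ennreal ((norm ((A \<omega> - K) e))\<^sup>2) \<partial>M) \<partial>count_space B)
    \<le> (\<integral>\<^sup>+e. (\<integral>\<^sup>+\<omega>. ennreal ((norm (A \<omega> e))\<^sup>2) \<partial>M) \<partial>count_space B)"
    by (rule nn_integral_mono)
  then show ?thesis
    unfolding hs_sq_def
    by (subst (1 2) nn_integral_count_space_nn_integral[OF cnt]) (simp_all add: blinfun.diff_left)
qed

text \<open>Orthogonality of increments is inherited by the images of each basis vector, so that the mean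
  squared Hilbert-Schmidt norm of a sum of martingale differences is the sum of theirs.\<close>

lemma mean_le_norm_sum_orthogonal:
  fixes A :: "nat \<Rightarrow> 'a \<Rightarrow> ('h::{real_inner, banach, second_countable_topology} \<Rightarrow>\<^sub>L 'h)"
  assumes B: "orthonormal_basis B"
    and [measurable]: "\<And>t x. t < n \<Longrightarrow> (\<lambda>\<omega>. A t \<omega> x) \<in> borel_measurable M"
    and L2: "\<And>t x. t < n \<Longrightarrow> integrable M (\<lambda>\<omega>. (norm (A t \<omega> x))\<^sup>2)"
    and orth: "\<And>s t x. s < t \<Longrightarrow> t < n \<Longrightarrow> (\<integral>\<omega>. A s \<omega> x \<bullet> A t \<omega> x \<partial>M) = 0"
    and hs: "\<And>t. t < n \<Longrightarrow> (\<integral>\<^sup>+\<omega>. hs_sq B (A t \<omega>) \<partial>M) \<le> ennreal (a t)" "\<And>t. t < n \<Longrightarrow> 0 \<le> a t"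
  shows "mean_le M (\<lambda>\<omega>. (norm (\<Sum>t<n. A t \<omega>))\<^sup>2) (\<Sum>t<n. a t)"
proof (rule mean_leI_nn)
  have cnt: "countable B" by (rule countable_orthonormal_basis[OF B])
  have [measurable]: "(\<lambda>\<omega>. (\<Sum>t<n. A t \<omega>) x) \<in> borel_measurable M" for x
    by (simp add: blinfun.sum_left)
  show "(\<lambda>\<omega>. (norm (\<Sum>t<n. A t \<omega>))\<^sup>2) \<in> borel_measurable M"
    by (intro borel_measurable_power borel_measurable_norm_blinfun) simp
  have "(\<integral>\<^sup>+\<omega>. ennreal ((norm (\<Sum>t<n. A t \<omega>))\<^sup>2) \<partial>M) \<le> (\<integral>\<^sup>+\<omega>. hs_sq B (\<Sum>t<n. A t \<omega>) \<partial>M)"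
    by (intro nn_integral_mono norm_le_hs_sq B)
  also have "\<dots> = (\<integral>\<^sup>+e. (\<integral>\<^sup>+\<omega>. ennreal ((norm ((\<Sum>t<n. A t \<omega>) e))\<^sup>2) \<partial>M) \<partial>count_space B)"
    unfolding hs_sq_def by (rule nn_integral_count_space_nn_integral[OF cnt]) measurable
  also have "\<dots> = (\<integral>\<^sup>+e. (\<Sum>t<n. \<integral>\<^sup>+\<omega>. ennreal ((norm (A t \<omega> e))\<^sup>2) \<partial>M) \<partial>count_space B)"
  proof (rule nn_integral_cong)
    fix e
    have *: "integrable M (\<lambda>\<omega>. (norm (\<Sum>t<n. A t \<omega> e))\<^sup>2)"
      "(\<integral>\<omega>. (norm (\<Sum>t<n. A t \<omega> e))\<^sup>2 \<partial>M) = (\<Sum>t<n. \<integral>\<omega>. (norm (A t \<omega> e))\<^sup>2 \<partial>M)"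
      using integral_norm_sq_sum_orthogonal[of n "\<lambda>t \<omega>. A t \<omega> e" M] L2 orth by auto
    have "(\<integral>\<^sup>+\<omega>. ennreal ((norm ((\<Sum>t<n. A t \<omega>) e))\<^sup>2) \<partial>M)
      = ennreal (\<Sum>t<n. \<integral>\<omega>. (norm (A t \<omega> e))\<^sup>2 \<partial>M)"
      unfolding blinfun.sum_left using * by (simp add: nn_integral_eq_integral)
    also have "\<dots> = (\<Sum>t<n. ennreal (\<integral>\<omega>. (norm (A t \<omega> e))\<^sup>2 \<partial>M))"
      by (rule sum_ennreal[symmetric]) simp
    also have "\<dots> = (\<Sum>t<n. \<integral>\<^sup>+\<omega>. ennreal ((norm (A t \<omega> e))\<^sup>2) \<partial>M)"
      using L2 by (intro sum.cong refl nn_integral_eq_integral[symmetric]) auto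
    finally show "(\<integral>\<^sup>+\<omega>. ennreal ((norm ((\<Sum>t<n. A t \<omega>) e))\<^sup>2) \<partial>M)
      = (\<Sum>t<n. \<integral>\<^sup>+\<omega>. ennreal ((norm (A t \<omega> e))\<^sup>2) \<partial>M)" .
  qed
  also have "\<dots> = (\<Sum>t<n. \<integral>\<^sup>+e. (\<integral>\<^sup>+\<omega>. ennreal ((norm (A t \<omega> e))\<^sup>2) \<partial>M) \<partial>count_space B)"
    by (rule nn_integral_sum) simp
  also have "\<dots> = (\<Sum>t<n. \<integral>\<^sup>+\<omega>. hs_sq B (A t \<omega>) \<partial>M)"
    unfolding hs_sq_def
    by (intro sum.cong refl nn_integral_count_space_nn_integral[OF cnt, symmetric]) measurable
  also have "\<dots> \<le> (\<Sum>t<n. ennreal (a t))" using hs(1) by (intro sum_mono) auto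
  also have "\<dots> = ennreal (\<Sum>t<n. a t)" using hs(2) by (intro sum_ennreal) auto
  finally show "(\<integral>\<^sup>+\<omega>. ennreal ((norm (\<Sum>t<n. A t \<omega>))\<^sup>2) \<partial>M) \<le> ennreal (\<Sum>t<n. a t)" .
qed (use hs(2) in \<open>auto intro: sum_nonneg\<close>)

section \<open>Two coupled autoregressions\<close>

definition cross_sum :: "nat \<Rightarrow> (nat \<Rightarrow> 'h::real_inner) \<Rightarrow> (nat \<Rightarrow> 'h) \<Rightarrow> ('h \<Rightarrow>\<^sub>L 'h)" where
  "cross_sum n x e = (1 / real n) *\<^sub>R (\<Sum>t<n. tensor (x t) (e (Suc t)))"

text \<open>The part of the empirical covariance of an autoregressive path that is not explained by applying
  the autoregression operator on both sides.\<close>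

definition noise ::
  "nat \<Rightarrow> ('h::real_inner \<Rightarrow>\<^sub>L 'h) \<Rightarrow> (nat \<Rightarrow> 'h) \<Rightarrow> (nat \<Rightarrow> 'h) \<Rightarrow> ('h \<Rightarrow>\<^sub>L 'h)" where
  "noise n A x e = cross_sum n (\<lambda>t. A (x t)) e + (1 / real n) *\<^sub>R (\<Sum>t<n. tensor (e (Suc t)) (A (x t)))
     + (1 / real n) *\<^sub>R (\<Sum>t<n. tensor (e (Suc t)) (e (Suc t)))
     + (1 / real n) *\<^sub>R (tensor (x 0) (x 0) - tensor (x n) (x n))"

lemma boot_path_cong:
  "(\<And>i. i \<le> t \<Longrightarrow> e i = e' i) \<Longrightarrow> boot_path A (e 0) e t = boot_path A (e' 0) e' t"
  by (induction t) auto

lemma measurable_boot_path: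
  fixes A :: "'h::{real_inner, second_countable_topology} \<Rightarrow>\<^sub>L 'h"
  assumes "\<And>i. i \<le> t \<Longrightarrow> (\<lambda>\<omega>. e \<omega> i) \<in> borel_measurable M"
  shows "(\<lambda>\<omega>. boot_path A (e \<omega> 0) (e \<omega>) t) \<in> borel_measurable M"
  using assms
proof (induction t)
  case (Suc t)
  have "(\<lambda>\<omega>. A (boot_path A (e \<omega> 0) (e \<omega>) t)) \<in> borel_measurable M"
    using Suc by (intro measurable_compose[OF Suc.IH]) (auto intro!: borel_measurable_continuous_onI continuous_intros)
  then show ?case using Suc.prems by simp
qed simp

lemma square_le_fourth: "x\<^sup>2 \<le> 1 + (x::real) ^ 4"
proof -
  have "0 \<le> (x\<^sup>2 - 1/2)\<^sup>2" by simp
  also have "\<dots> = x ^ 4 - x\<^sup>2 + 1/4" by (simp add: power2_eq_square power4_eq_xxxx algebra_simps)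
  finally show ?thesis by linarith
qed

text \<open>Convexity of the square, for the convex combination \<open>\<rho> * a + (1 - \<rho>) * (b / (1 - \<rho>))\<close>.\<close>

lemma contraction_square:
  fixes a b \<rho> :: real
  assumes "0 \<le> \<rho>" "\<rho> < 1"
  shows "(\<rho> * a + b)\<^sup>2 \<le> \<rho> * a\<^sup>2 + 1 / (1 - \<rho>) * b\<^sup>2"
proof -
  have "0 \<le> \<rho> * (1 - \<rho>) * (a - b / (1 - \<rho>))\<^sup>2" using assms by simp
  also have "\<dots> = \<rho> * a\<^sup>2 + 1 / (1 - \<rho>) * b\<^sup>2 - (\<rho> * a + b)\<^sup>2"
    using assms by (simp add: power2_eq_square divide_simps) (simp add: algebra_simps)
  finally show ?thesis by simp
qed

text \<open>Convexity of the fourth power, for the same convex combination as in the previous lemma.\<close>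

lemma contraction_fourth:
  fixes a b \<rho> :: real
  assumes \<rho>: "0 \<le> \<rho>" "\<rho> < 1"
  shows "(\<rho> * a + b) ^ 4 \<le> \<rho> * a ^ 4 + (1 / (1 - \<rho>)) ^ 3 * b ^ 4"
proof -
  have "(\<rho> * a + b) ^ 4 = ((\<rho> * a + b)\<^sup>2)\<^sup>2" by simp
  also have "\<dots> \<le> (\<rho> * a\<^sup>2 + 1 / (1 - \<rho>) * b\<^sup>2)\<^sup>2"
    by (intro power_mono contraction_square \<rho>) simp
  also have "\<dots> \<le> \<rho> * (a\<^sup>2)\<^sup>2 + 1 / (1 - \<rho>) * (1 / (1 - \<rho>) * b\<^sup>2)\<^sup>2"
    by (rule contraction_square[OF \<rho>])
  also have "\<dots> = \<rho> * a ^ 4 + (1 / (1 - \<rho>)) ^ 3 * b ^ 4"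
    by (simp add: power_mult_distrib power2_eq_square power3_eq_cube power4_eq_xxxx mult.assoc)
  finally show ?thesis .
qed

text \<open>One step multiplies the fourth moment by \<open>\<rho>\<close> and adds \<open>\<kappa> ^ 3 * m\<close>; the fixed point of this recursion
  is \<open>\<kappa> ^ 4 * m\<close>.\<close>

lemma (in prob_space) boot_path_fourth_moment:
  fixes A :: "'h::{real_inner, banach, second_countable_topology} \<Rightarrow>\<^sub>L 'h" and \<rho> :: real
  defines "\<kappa> \<equiv> 1 / (1 - \<rho>)"
  assumes e [measurable]: "\<And>t. (\<lambda>\<omega>. e \<omega> t) \<in> borel_measurable M"
    and mom: "\<And>t. mean_le M (\<lambda>\<omega>. norm (e \<omega> t) ^ 4) m" and A: "norm A \<le> \<rho>" and rho: "0 \<le> \<rho>" "\<rho> < 1"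
  shows "mean_le M (\<lambda>\<omega>. norm (boot_path A (e \<omega> 0) (e \<omega>) t) ^ 4) (\<kappa> ^ 4 * m)"
proof (induction t)
  have m0: "0 \<le> m" using mean_leD(5)[OF mom] .
  have kap: "1 \<le> \<kappa>" "\<rho> * \<kappa> + 1 = \<kappa>" using rho by (simp_all add: \<kappa>_def field_simps)
  {
    case 0
    have "1 * m \<le> \<kappa> ^ 4 * m" by (intro mult_right_mono one_le_power kap m0)
    then show ?case using mean_le_weaken[OF mom[of 0]] by simp
  next
    case (Suc t)
    let ?x = "\<lambda>\<omega>. boot_path A (e \<omega> 0) (e \<omega>) t"
    have [measurable]: "?x \<in> borel_measurable M" by (rule measurable_boot_path) simp
    have Ax [measurable]: "(\<lambda>\<omega>. A (?x \<omega>)) \<in> borel_measurable M"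
      by (rule measurable_compose[of ?x]) (auto intro!: borel_measurable_continuous_onI continuous_intros)
    have "(\<rho> * \<kappa> + 1) * (\<kappa> ^ 3 * m) = \<kappa> * (\<kappa> ^ 3 * m)" by (simp only: kap(2))
    then have eq: "\<rho> * (\<kappa> ^ 4 * m) + \<kappa> ^ 3 * m = \<kappa> ^ 4 * m"
      by (simp add: algebra_simps power3_eq_cube power4_eq_xxxx)
    have "mean_le M (\<lambda>\<omega>. \<rho> * norm (?x \<omega>) ^ 4 + \<kappa> ^ 3 * norm (e \<omega> (Suc t)) ^ 4)
      (\<rho> * (\<kappa> ^ 4 * m) + \<kappa> ^ 3 * m)"
      using rho kap by (intro mean_le_add mean_le_cmult Suc mom) auto
    then show ?case
    proof (rule mean_le_mono)
      fix \<omega>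
      have "norm (A (?x \<omega>)) \<le> \<rho> * norm (?x \<omega>)"
        using norm_blinfun[of A "?x \<omega>"] mult_right_mono[OF A norm_ge_zero[of "?x \<omega>"]] by simp
      then have "norm (A (?x \<omega>) + e \<omega> (Suc t)) \<le> \<rho> * norm (?x \<omega>) + norm (e \<omega> (Suc t))"
        using norm_triangle_ineq[of "A (?x \<omega>)" "e \<omega> (Suc t)"] by simp
      then have "norm (A (?x \<omega>) + e \<omega> (Suc t)) ^ 4 \<le> (\<rho> * norm (?x \<omega>) + norm (e \<omega> (Suc t))) ^ 4"
        by (intro power_mono) auto
      also have "\<dots> \<le> \<rho> * norm (?x \<omega>) ^ 4 + \<kappa> ^ 3 * norm (e \<omega> (Suc t)) ^ 4"
        unfolding \<kappa>_def by (rule contraction_fourth[OF rho])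
      finally show "norm (boot_path A (e \<omega> 0) (e \<omega>) (Suc t)) ^ 4
        \<le> \<rho> * norm (?x \<omega>) ^ 4 + \<kappa> ^ 3 * norm (e \<omega> (Suc t)) ^ 4" by simp
    qed (use eq in simp_all)
  }
qed

lemma norm_transpose_sum:
  "norm (\<Sum>i\<in>I. tensor (b i) (a i)) = norm (\<Sum>i\<in>I. tensor (a i) (b i))"
  by (rule antisym; rule norm_le_of_adjoint)
    (simp_all add: blinfun.sum_left inner_sum_left inner_sum_right mult.commute inner_commute)

lemma norm_add4_sq_le:
  fixes a b c d :: "'v::real_normed_vector"
  shows "(norm (a + b + c + d))\<^sup>2 \<le> 4 * ((norm a)\<^sup>2 + (norm b)\<^sup>2 + (norm c)\<^sup>2 + (norm d)\<^sup>2)"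
  using norm_add_sq_le[of "a + b" "c + d"] norm_add_sq_le[of a b] norm_add_sq_le[of c d]
  by (simp add: add.assoc)

lemma hs_sq_tensor_diff_le:
  fixes a b c d :: "'h::{real_inner, second_countable_topology}"
  assumes B: "orthonormal_basis B"
  shows "hs_sq B (tensor a b - tensor c d)
    \<le> ennreal (2 * ((norm (a - c))\<^sup>2 * (norm b)\<^sup>2) + 2 * ((norm c)\<^sup>2 * (norm (b - d))\<^sup>2))"
proof -
  have "tensor a b - tensor c d = tensor (a - c) b + tensor c (b - d)"
    by (simp add: tensor.diff_left tensor.diff_right)
  then have "hs_sq B (tensor a b - tensor c d) \<le> 2 * hs_sq B (tensor (a - c) b) + 2 * hs_sq B (tensor c (b - d))"
    using hs_sq_add_le[of B "tensor (a - c) b" "tensor c (b - d)"] by simp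
  also have "\<dots> \<le> 2 * ennreal ((norm (a - c))\<^sup>2 * (norm b)\<^sup>2) + 2 * ennreal ((norm c)\<^sup>2 * (norm (b - d))\<^sup>2)"
    by (intro add_mono mult_left_mono hs_sq_tensor_le[OF B]) auto
  also have "\<dots> = ennreal (2 * ((norm (a - c))\<^sup>2 * (norm b)\<^sup>2)) + ennreal (2 * ((norm c)\<^sup>2 * (norm (b - d))\<^sup>2))"
    by (subst (1 2) ennreal_mult) auto
  also have "\<dots> = ennreal (2 * ((norm (a - c))\<^sup>2 * (norm b)\<^sup>2) + 2 * ((norm c)\<^sup>2 * (norm (b - d))\<^sup>2))"
    by (rule ennreal_plus[symmetric]) auto
  finally show ?thesis .
qed

text \<open>Two autoregressions on one probability space, with operators \<open>P\<close> and \<open>Q\<close>. The pairs \<open>\<zeta> t\<close> of their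
  innovations are independent in \<open>t\<close>, with any dependence within a pair. The pair \<open>\<zeta> 0\<close> consists of the initial
  values, which are subject to the moment bounds only. The two processes are close if \<open>\<eta>\<close>, \<open>\<tau>\<close> and \<open>1 / n\<close> are small, the last because the initial values are forgotten.\<close>

locale coupled_path = prob_space M
  for M :: "'a measure" +
  fixes \<zeta> :: "nat \<Rightarrow> 'a \<Rightarrow> 'h::{real_inner, banach, second_countable_topology} \<times> 'h"
    and P Q S1 S2 :: "'h \<Rightarrow>\<^sub>L 'h" and B :: "'h set" and \<rho> m \<tau> \<eta> :: real
  assumes basis: "orthonormal_basis B"
    and indep: "indep_vars (\<lambda>_. borel) \<zeta> UNIV"
    and mean1: "\<And>t. 1 \<le> t \<Longrightarrow> (\<integral>\<omega>. fst (\<zeta> t \<omega>) \<partial>M) = 0"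
    and mean2: "\<And>t. 1 \<le> t \<Longrightarrow> (\<integral>\<omega>. snd (\<zeta> t \<omega>) \<partial>M) = 0"
    and mom1: "\<And>t. mean_le M (\<lambda>\<omega>. norm (fst (\<zeta> t \<omega>)) ^ 4) m"
    and mom2: "\<And>t. mean_le M (\<lambda>\<omega>. norm (snd (\<zeta> t \<omega>)) ^ 4) m"
    and mom_diff: "\<And>t. 1 \<le> t \<Longrightarrow> mean_le M (\<lambda>\<omega>. norm (fst (\<zeta> t \<omega>) - snd (\<zeta> t \<omega>)) ^ 4) (\<tau>\<^sup>2)"
    and cov1: "\<And>t x. 1 \<le> t \<Longrightarrow> (\<integral>\<omega>. (fst (\<zeta> t \<omega>) \<bullet> x) *\<^sub>R fst (\<zeta> t \<omega>) \<partial>M) = S1 x"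
    and cov2: "\<And>t x. 1 \<le> t \<Longrightarrow> (\<integral>\<omega>. (snd (\<zeta> t \<omega>) \<bullet> x) *\<^sub>R snd (\<zeta> t \<omega>) \<partial>M) = S2 x"
    and rho: "0 \<le> \<rho>" "\<rho> < 1" and tau: "0 < \<tau>"
    and P: "norm P \<le> \<rho>" and Q: "norm Q \<le> \<rho>" and PQ: "norm (P - Q) \<le> \<eta>"
begin

text \<open>\<open>kap\<close> is the sum of the geometric series of \<open>\<rho>\<close>; \<open>L\<close> bounds the second and fourth moments of
  both paths.\<close>

definition kap where "kap = 1 / (1 - \<rho>)"
definition L where "L = kap ^ 4 * (1 + m)"

definition e1 where "e1 \<omega> i = fst (\<zeta> i \<omega>)"
definition e2 where "e2 \<omega> i = snd (\<zeta> i \<omega>)"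
definition X where "X \<omega> = boot_path P (e1 \<omega> 0) (e1 \<omega>)"
definition Y where "Y \<omega> = boot_path Q (e2 \<omega> 0) (e2 \<omega>)"

lemma kap: "1 \<le> kap" "\<rho> * kap + 1 = kap" "0 < kap"
  using rho by (simp_all add: kap_def field_simps)

lemma m0: "0 \<le> m" using mean_leD(5)[OF mom1] .

lemma L_ge: "1 + m \<le> L" "1 \<le> L"
proof -
  have "1 \<le> kap ^ 4" using kap(1) by (rule one_le_power)
  then have "1 * (1 + m) \<le> kap ^ 4 * (1 + m)" by (rule mult_right_mono) (use m0 in simp)
  then show "1 + m \<le> L" by (simp add: L_def)
  then show "1 \<le> L" using m0 by simp
qed

lemma rv [measurable]: "\<zeta> t \<in> borel_measurable M"
  using indep by (auto simp: indep_vars_def)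

lemma rv12 [measurable]:
  "(\<lambda>\<omega>. e1 \<omega> t) \<in> borel_measurable M" "(\<lambda>\<omega>. e2 \<omega> t) \<in> borel_measurable M"
  "(\<lambda>\<omega>. X \<omega> t) \<in> borel_measurable M" "(\<lambda>\<omega>. Y \<omega> t) \<in> borel_measurable M"
proof -
  have c: "fst \<in> borel_measurable (borel :: ('h \<times> 'h) measure)" "snd \<in> borel_measurable (borel :: ('h \<times> 'h) measure)"
    by (auto intro!: borel_measurable_continuous_onI continuous_intros)
  show e: "(\<lambda>\<omega>. e1 \<omega> t) \<in> borel_measurable M" "(\<lambda>\<omega>. e2 \<omega> t) \<in> borel_measurable M" for t
    unfolding e1_def e2_def using c by (auto intro: measurable_compose[OF rv])
  show "(\<lambda>\<omega>. X \<omega> t) \<in> borel_measurable M" "(\<lambda>\<omega>. Y \<omega> t) \<in> borel_measurable M"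
    unfolding X_def Y_def by (auto intro!: measurable_boot_path e)
qed

lemma measurable_apply [measurable (raw)]:
  fixes A :: "'h \<Rightarrow>\<^sub>L 'h"
  assumes "f \<in> borel_measurable N"
  shows "(\<lambda>\<omega>. A (f \<omega>)) \<in> borel_measurable N"
  using assms by (rule measurable_compose) (auto intro!: borel_measurable_continuous_onI continuous_intros)

lemma e_moments:
  "mean_le M (\<lambda>\<omega>. norm (e1 \<omega> t) ^ 4) m" "mean_le M (\<lambda>\<omega>. norm (e2 \<omega> t) ^ 4) m"
  "mean_le M (\<lambda>\<omega>. (norm (e1 \<omega> t))\<^sup>2) (1 + m)" "mean_le M (\<lambda>\<omega>. (norm (e2 \<omega> t))\<^sup>2) (1 + m)"
proof -
  show 4: "mean_le M (\<lambda>\<omega>. norm (e1 \<omega> t) ^ 4) m" "mean_le M (\<lambda>\<omega>. norm (e2 \<omega> t) ^ 4) m"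
    using mom1 mom2 by (simp_all add: e1_def e2_def)
  show "mean_le M (\<lambda>\<omega>. (norm (e1 \<omega> t))\<^sup>2) (1 + m)"
    by (rule mean_le_mono[OF mean_le_add[OF mean_le_const[of 1] 4(1)]]) (auto simp: square_le_fourth)
  show "mean_le M (\<lambda>\<omega>. (norm (e2 \<omega> t))\<^sup>2) (1 + m)"
    by (rule mean_le_mono[OF mean_le_add[OF mean_le_const[of 1] 4(2)]]) (auto simp: square_le_fourth)
qed

lemma e_diff_moments:
  assumes "1 \<le> t"
  shows "mean_le M (\<lambda>\<omega>. norm (e1 \<omega> t - e2 \<omega> t) ^ 4) (\<tau>\<^sup>2)"
    "mean_le M (\<lambda>\<omega>. (norm (e1 \<omega> t - e2 \<omega> t))\<^sup>2) \<tau>"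
proof -
  show 4: "mean_le M (\<lambda>\<omega>. norm (e1 \<omega> t - e2 \<omega> t) ^ 4) (\<tau>\<^sup>2)"
    using mom_diff[OF assms] by (simp add: e1_def e2_def)
  \<comment> \<open>the second moment is at most the root of the fourth, by the inequality of the means\<close>
  have le: "x\<^sup>2 \<le> \<tau> / 2 + 1 / (2 * \<tau>) * x ^ 4" for x :: real
  proof -
    have "0 \<le> (x\<^sup>2 - \<tau>)\<^sup>2 / (2 * \<tau>)" using tau by simp
    also have "\<dots> = \<tau> / 2 + 1 / (2 * \<tau>) * x ^ 4 - x\<^sup>2"
      using tau by (simp add: power2_eq_square power4_eq_xxxx divide_simps) (simp add: algebra_simps)
    finally show ?thesis by simp
  qed
  have "mean_le M (\<lambda>\<omega>. \<tau> / 2 + 1 / (2 * \<tau>) * norm (e1 \<omega> t - e2 \<omega> t) ^ 4) (\<tau> / 2 + 1 / (2 * \<tau>) * \<tau>\<^sup>2)"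
    by (intro mean_le_add mean_le_const mean_le_cmult 4) (use tau in auto)
  then show "mean_le M (\<lambda>\<omega>. (norm (e1 \<omega> t - e2 \<omega> t))\<^sup>2) \<tau>"
  proof (rule mean_le_mono)
    show "\<tau> / 2 + 1 / (2 * \<tau>) * \<tau>\<^sup>2 \<le> \<tau>" using tau by (simp add: power2_eq_square)
    show "(norm (e1 \<omega> t - e2 \<omega> t))\<^sup>2 \<le> \<tau> / 2 + 1 / (2 * \<tau>) * norm (e1 \<omega> t - e2 \<omega> t) ^ 4" for \<omega>
      by (rule le)
  qed simp_all
qed

lemma XY_moments:
  "mean_le M (\<lambda>\<omega>. norm (X \<omega> t) ^ 4) L" "mean_le M (\<lambda>\<omega>. norm (Y \<omega> t) ^ 4) L"
  "mean_le M (\<lambda>\<omega>. (norm (X \<omega> t))\<^sup>2) L" "mean_le M (\<lambda>\<omega>. (norm (Y \<omega> t))\<^sup>2) L"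
proof -
  have 4: "mean_le M (\<lambda>\<omega>. norm (X \<omega> t) ^ 4) (kap ^ 4 * m)" "mean_le M (\<lambda>\<omega>. norm (Y \<omega> t) ^ 4) (kap ^ 4 * m)"
    unfolding X_def Y_def kap_def by (intro boot_path_fourth_moment e_moments P Q rv12 rho)+
  have k: "1 \<le> kap ^ 4" by (intro one_le_power kap)
  then have le: "kap ^ 4 * m \<le> L" "1 + kap ^ 4 * m \<le> L" by (simp_all add: L_def algebra_simps)
  show "mean_le M (\<lambda>\<omega>. norm (X \<omega> t) ^ 4) L" "mean_le M (\<lambda>\<omega>. norm (Y \<omega> t) ^ 4) L"
    using 4 le(1) by (auto intro: mean_le_weaken)
  show "mean_le M (\<lambda>\<omega>. (norm (X \<omega> t))\<^sup>2) L"
    by (rule mean_le_mono[OF mean_le_add[OF mean_le_const[of 1] 4(1)]]) (auto simp: square_le_fourth le)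
  show "mean_le M (\<lambda>\<omega>. (norm (Y \<omega> t))\<^sup>2) L"
    by (rule mean_le_mono[OF mean_le_add[OF mean_le_const[of 1] 4(2)]]) (auto simp: square_le_fourth le)
qed

text \<open>The solution of the recursion for the mean squared distance of the paths: the distance of the initial
  values decays geometrically, and each step adds a multiple of \<open>\<eta>\<^sup>2 + \<tau>\<close>.\<close>

definition dXY where "dXY t = \<rho> ^ t * (4 * (1 + m)) + 2 * kap\<^sup>2 * (\<eta>\<^sup>2 * L + \<tau>)"

lemma operator_diff_sq_le:
  "(norm (P x - Q y))\<^sup>2 \<le> 2 * (norm (x - y))\<^sup>2 + 2 * \<eta>\<^sup>2 * (norm x)\<^sup>2"
proof -
  have "norm (Q (x - y)) \<le> 1 * norm (x - y)"
    using norm_blinfun[of Q "x - y"] mult_right_mono[of "norm Q" 1 "norm (x - y)"] Q rho by simp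
  then have 1: "(norm (Q (x - y)))\<^sup>2 \<le> (norm (x - y))\<^sup>2" by (intro power_mono) auto
  have "norm ((P - Q) x) \<le> \<eta> * norm x"
    using norm_blinfun[of "P - Q" x] mult_right_mono[OF PQ norm_ge_zero[of x]] by simp
  then have "(norm ((P - Q) x))\<^sup>2 \<le> (\<eta> * norm x)\<^sup>2" by (intro power_mono) auto
  then have 2: "(norm ((P - Q) x))\<^sup>2 \<le> \<eta>\<^sup>2 * (norm x)\<^sup>2" by (simp add: power_mult_distrib)
  have "P x - Q y = Q (x - y) + (P - Q) x" by (simp add: blinfun.diff_right blinfun.diff_left)
  then have "(norm (P x - Q y))\<^sup>2 \<le> 2 * (norm (Q (x - y)))\<^sup>2 + 2 * (norm ((P - Q) x))\<^sup>2"
    using norm_add_sq_le[of "Q (x - y)" "(P - Q) x"] by simp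
  then show ?thesis using 1 2 by linarith
qed

text \<open>The distance of the paths contracts by \<open>\<rho>\<close> in every step, up to the difference of the
  operators and of the innovations.\<close>

lemma XY_diff: "mean_le M (\<lambda>\<omega>. (norm (X \<omega> t - Y \<omega> t))\<^sup>2) (dXY t)"
proof (induction t)
  case 0
  have "mean_le M (\<lambda>\<omega>. 2 * (norm (e1 \<omega> 0))\<^sup>2 + 2 * (norm (e2 \<omega> 0))\<^sup>2) (2 * (1 + m) + 2 * (1 + m))"
    by (intro mean_le_add mean_le_cmult e_moments) auto
  then show ?case
  proof (rule mean_le_mono)
    show "2 * (1 + m) + 2 * (1 + m) \<le> dXY 0"
      using kap L_ge tau by (simp add: dXY_def)
    show "(norm (X \<omega> 0 - Y \<omega> 0))\<^sup>2 \<le> 2 * (norm (e1 \<omega> 0))\<^sup>2 + 2 * (norm (e2 \<omega> 0))\<^sup>2" for \<omega>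
      using norm_add_sq_le[of "e1 \<omega> 0" "- e2 \<omega> 0"] by (simp add: X_def Y_def)
  qed auto
next
  case (Suc t)
  define w where "w = \<eta>\<^sup>2 * L + \<tau>"
  have "(\<rho> * kap + 1) * (2 * kap * w) = kap * (2 * kap * w)" by (simp only: kap(2))
  then have eq: "\<rho> * dXY t + kap * (2 * \<eta>\<^sup>2 * L + 2 * \<tau>) = dXY (Suc t)"
    unfolding dXY_def w_def[symmetric] by (simp add: algebra_simps power2_eq_square w_def)
  have "mean_le M (\<lambda>\<omega>. \<rho> * (norm (X \<omega> t - Y \<omega> t))\<^sup>2
      + kap * (2 * \<eta>\<^sup>2 * (norm (X \<omega> t))\<^sup>2 + 2 * (norm (e1 \<omega> (Suc t) - e2 \<omega> (Suc t)))\<^sup>2))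
    (\<rho> * dXY t + kap * (2 * \<eta>\<^sup>2 * L + 2 * \<tau>))"
    using rho kap by (intro mean_le_add mean_le_cmult Suc XY_moments e_diff_moments) auto
  then show ?case unfolding eq
  proof (rule mean_le_mono)
    fix \<omega>
    define u where "u = X \<omega> t - Y \<omega> t"
    define v where "v = (P - Q) (X \<omega> t) + (e1 \<omega> (Suc t) - e2 \<omega> (Suc t))"
    have "norm (Q u) \<le> \<rho> * norm u"
      using norm_blinfun[of Q u] mult_right_mono[OF Q norm_ge_zero[of u]] by simp
    moreover have "X \<omega> (Suc t) - Y \<omega> (Suc t) = Q u + v"
      by (simp add: X_def Y_def u_def v_def blinfun.diff_right blinfun.diff_left)
    ultimately have "norm (X \<omega> (Suc t) - Y \<omega> (Suc t)) \<le> \<rho> * norm u + norm v"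
      using norm_triangle_ineq[of "Q u" v] by simp
    then have "(norm (X \<omega> (Suc t) - Y \<omega> (Suc t)))\<^sup>2 \<le> (\<rho> * norm u + norm v)\<^sup>2"
      by (intro power_mono) auto
    also have "\<dots> \<le> \<rho> * (norm u)\<^sup>2 + kap * (norm v)\<^sup>2"
      unfolding kap_def by (rule contraction_square[OF rho])
    also have "(norm v)\<^sup>2 \<le> 2 * \<eta>\<^sup>2 * (norm (X \<omega> t))\<^sup>2 + 2 * (norm (e1 \<omega> (Suc t) - e2 \<omega> (Suc t)))\<^sup>2"
    proof -
      have "norm ((P - Q) (X \<omega> t)) \<le> \<eta> * norm (X \<omega> t)"
        using norm_blinfun[of "P - Q" "X \<omega> t"] mult_right_mono[OF PQ norm_ge_zero[of "X \<omega> t"]] by simp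
      then have "(norm ((P - Q) (X \<omega> t)))\<^sup>2 \<le> (\<eta> * norm (X \<omega> t))\<^sup>2" by (intro power_mono) auto
      then show ?thesis
        using norm_add_sq_le[of "(P - Q) (X \<omega> t)" "e1 \<omega> (Suc t) - e2 \<omega> (Suc t)"]
        by (simp add: v_def power_mult_distrib)
    qed
    finally show "(norm (X \<omega> (Suc t) - Y \<omega> (Suc t)))\<^sup>2 \<le> \<rho> * (norm (X \<omega> t - Y \<omega> t))\<^sup>2
      + kap * (2 * \<eta>\<^sup>2 * (norm (X \<omega> t))\<^sup>2 + 2 * (norm (e1 \<omega> (Suc t) - e2 \<omega> (Suc t)))\<^sup>2)"
      using kap by (simp add: u_def mult_left_mono)
  qed auto
qed

text \<open>The geometric part has a sum that does not grow with \<open>n\<close>, so it is negligible in averages.\<close>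

lemma sum_dXY_le: "(\<Sum>t<n. dXY t) \<le> 4 * L * kap\<^sup>2 * (1 + real n * (\<eta>\<^sup>2 + \<tau>))"
proof -
  have "(\<Sum>t<n. \<rho> ^ t) = (1 - \<rho> ^ n) / (1 - \<rho>)" using rho by (subst sum_gp_strict) auto
  also have "\<dots> \<le> 1 / (1 - \<rho>)" using rho by (intro divide_right_mono) auto
  finally have g: "(\<Sum>t<n. \<rho> ^ t) \<le> kap" by (simp add: kap_def)
  have k2: "kap \<le> kap\<^sup>2" using mult_left_mono[of 1 kap kap] kap by (simp add: power2_eq_square)
  have "(\<Sum>t<n. dXY t) = (\<Sum>t<n. \<rho> ^ t) * (4 * (1 + m)) + real n * (2 * kap\<^sup>2 * (\<eta>\<^sup>2 * L + \<tau>))"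
    by (simp add: dXY_def sum.distrib sum_distrib_right)
  also have "(\<Sum>t<n. \<rho> ^ t) * (4 * (1 + m)) \<le> kap\<^sup>2 * (4 * L)"
    using g k2 L_ge m0 by (intro mult_mono) auto
  also have "real n * (2 * kap\<^sup>2 * (\<eta>\<^sup>2 * L + \<tau>)) \<le> real n * (4 * kap\<^sup>2 * (L * (\<eta>\<^sup>2 + \<tau>)))"
  proof (intro mult_left_mono mult_mono)
    show "\<eta>\<^sup>2 * L + \<tau> \<le> L * (\<eta>\<^sup>2 + \<tau>)"
      using mult_right_mono[of 1 L \<tau>] L_ge tau by (simp add: algebra_simps)
  qed (use L_ge tau in auto)
  finally show ?thesis by (simp add: algebra_simps)
qed

text \<open>Functions of the past, given as functions of the whole input sequence that depend on it only up to time \<open>t\<close>.\<close>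

definition past :: "nat \<Rightarrow> ((nat \<Rightarrow> 'h \<times> 'h) \<Rightarrow> 'b::topological_space) \<Rightarrow> bool" where
  "past t g \<longleftrightarrow> g \<in> borel_measurable (PiM {..t} (\<lambda>_. borel)) \<and> (\<forall>f. g (restrict f {..t}) = g f)"

lemma past_mono:
  assumes "past s g" "s \<le> t" shows "past t g"
proof -
  have "restrict (restrict f {..t}) {..s} = restrict f {..s}" for f :: "nat \<Rightarrow> 'h \<times> 'h"
    using assms(2) by (auto simp: fun_eq_iff)
  then have 1: "g (restrict f {..t}) = g f" for f using assms(1) unfolding past_def by metis
  have r: "(\<lambda>f. restrict f {..s}) \<in> measurable (PiM {..t} (\<lambda>_. borel)) (PiM {..s} (\<lambda>_. borel :: ('h \<times> 'h) measure))"
    by (rule measurable_restrict_subset) (use assms(2) in simp)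
  have "g \<in> borel_measurable (PiM {..s} (\<lambda>_. borel))" using assms(1) by (simp add: past_def)
  from measurable_compose[OF r this]
  have "(\<lambda>f. g (restrict f {..s})) \<in> borel_measurable (PiM {..t} (\<lambda>_. borel))" .
  moreover have "(\<lambda>f. g (restrict f {..s})) = g" using assms(1) by (auto simp: past_def)
  ultimately show ?thesis using 1 by (simp add: past_def)
qed

lemma past_measurable: "past t g \<Longrightarrow> (\<lambda>\<omega>. g (\<lambda>i. \<zeta> i \<omega>)) \<in> borel_measurable M"
proof -
  assume g: "past t g"
  have r: "(\<lambda>\<omega>. restrict (\<lambda>i. \<zeta> i \<omega>) {..t}) \<in> measurable M (PiM {..t} (\<lambda>_. borel))"
    by (rule measurable_restrict) simp
  have "g \<in> borel_measurable (PiM {..t} (\<lambda>_. borel))" using g by (simp add: past_def)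
  from measurable_compose[OF r this]
  have "(\<lambda>\<omega>. g (restrict (\<lambda>i. \<zeta> i \<omega>) {..t})) \<in> borel_measurable M" .
  then show ?thesis using g by (simp add: past_def)
qed

lemma past_indep:
  assumes g: "past t g" and h: "h \<in> measurable borel borel"
  shows "indep_var borel (\<lambda>\<omega>. g (\<lambda>i. \<zeta> i \<omega>)) borel (\<lambda>\<omega>. h (\<zeta> (Suc t) \<omega>))"
proof -
  have "indep_var (PiM {..t} (\<lambda>_. borel)) (\<lambda>\<omega>. restrict (\<lambda>i. \<zeta> i \<omega>) {..t})
      (PiM {Suc t} (\<lambda>_. borel)) (\<lambda>\<omega>. restrict (\<lambda>i. \<zeta> i \<omega>) {Suc t})"
    by (rule indep_var_restrict[OF indep]) auto
  moreover have "g \<in> measurable (PiM {..t} (\<lambda>_. borel)) borel" using g by (simp add: past_def)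
  moreover have "(\<lambda>f. h (f (Suc t))) \<in> measurable (PiM {Suc t} (\<lambda>_. borel)) borel"
    by (rule measurable_compose[where f = "\<lambda>f. f (Suc t)" and g = h, OF measurable_component_singleton h]) simp
  ultimately have "indep_var borel (g \<circ> (\<lambda>\<omega>. restrict (\<lambda>i. \<zeta> i \<omega>) {..t}))
      borel ((\<lambda>f. h (f (Suc t))) \<circ> (\<lambda>\<omega>. restrict (\<lambda>i. \<zeta> i \<omega>) {Suc t}))"
    by (rule indep_var_compose)
  then show ?thesis using g by (simp add: comp_def past_def)
qed

lemma past_compose:
  assumes g: "past t g" and k: "k \<in> measurable borel borel"
  shows "past t (\<lambda>f. k (g f))"
proof -
  have "g \<in> borel_measurable (PiM {..t} (\<lambda>_. borel))" using g by (simp add: past_def)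
  from measurable_compose[OF this k] show ?thesis using g by (simp add: past_def)
qed

text \<open>The present input is independent of the past, so second moments multiply.\<close>

lemma past_product:
  fixes g :: "(nat \<Rightarrow> 'h \<times> 'h) \<Rightarrow> 'h"
  assumes g: "past t g" and h: "h \<in> borel_measurable borel" "\<And>z. 0 \<le> h z"
    and 1: "mean_le M (\<lambda>\<omega>. (norm (g (\<lambda>i. \<zeta> i \<omega>)))\<^sup>2) a" and 2: "mean_le M (\<lambda>\<omega>. h (\<zeta> (Suc t) \<omega>)) b"
  shows "mean_le M (\<lambda>\<omega>. (norm (g (\<lambda>i. \<zeta> i \<omega>)))\<^sup>2 * h (\<zeta> (Suc t) \<omega>)) (a * b)"
proof -
  have "past t (\<lambda>f. (norm (g f))\<^sup>2)" by (rule past_compose[OF g]) simp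
  from past_indep[OF this h(1)]
  have ind: "indep_var borel (\<lambda>\<omega>. (norm (g (\<lambda>i. \<zeta> i \<omega>)))\<^sup>2) borel (\<lambda>\<omega>. h (\<zeta> (Suc t) \<omega>))" .
  note i = indep_var_integrable[OF ind mean_leD(1)[OF 1] mean_leD(1)[OF 2]]
    indep_var_lebesgue_integral[OF ind mean_leD(1)[OF 1] mean_leD(1)[OF 2]]
  have "(\<integral>\<omega>. (norm (g (\<lambda>i. \<zeta> i \<omega>)))\<^sup>2 * h (\<zeta> (Suc t) \<omega>) \<partial>M) \<le> a * b"
    unfolding i(2) using mean_leD[OF 1] mean_leD[OF 2] h(2)
    by (intro mult_mono) (auto intro!: Bochner_Integration.integral_nonneg)
  then show ?thesis using i(1) h(2) by (simp add: mean_le_def)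
qed

lemma past_fst_snd:
  assumes "s \<le> t"
  shows "past t (\<lambda>f. fst (f s))" "past t (\<lambda>f. snd (f s))"
proof -
  have *: "(\<lambda>f. f s) \<in> measurable (PiM {..t} (\<lambda>_. borel)) (borel :: ('h \<times> 'h) measure)"
    using assms by (intro measurable_component_singleton) auto
  show "past t (\<lambda>f. fst (f s))" "past t (\<lambda>f. snd (f s))"
    using assms unfolding past_def
    by (auto intro!: measurable_compose[OF *] borel_measurable_continuous_onI continuous_intros)
qed

lemma past_path:
  assumes "s \<le> t"
  shows "past t (\<lambda>f. boot_path P (fst (f 0)) (\<lambda>i. fst (f i)) s)"
    "past t (\<lambda>f. boot_path Q (snd (f 0)) (\<lambda>i. snd (f i)) s)"
proof -
  have fst_past: "past t (\<lambda>f. fst (f i))" and snd_past: "past t (\<lambda>f. snd (f i))" if "i \<le> s" for i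
    using past_fst_snd[of i t] that assms by simp_all
  have "boot_path P (fst (restrict f {..t} 0)) (\<lambda>i. fst (restrict f {..t} i)) s
      = boot_path P (fst (f 0)) (\<lambda>i. fst (f i)) s" for f :: "nat \<Rightarrow> 'h \<times> 'h"
    using assms by (intro boot_path_cong[of s "\<lambda>i. fst (restrict f {..t} i)" "\<lambda>i. fst (f i)"]) auto
  moreover have "boot_path Q (snd (restrict f {..t} 0)) (\<lambda>i. snd (restrict f {..t} i)) s
      = boot_path Q (snd (f 0)) (\<lambda>i. snd (f i)) s" for f :: "nat \<Rightarrow> 'h \<times> 'h"
    using assms by (intro boot_path_cong[of s "\<lambda>i. snd (restrict f {..t} i)" "\<lambda>i. snd (f i)"]) auto
  moreover have "(\<lambda>f. boot_path P (fst (f 0)) (\<lambda>i. fst (f i)) s) \<in> borel_measurable (PiM {..t} (\<lambda>_. borel :: ('h \<times> 'h) measure))"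
    by (rule measurable_boot_path[where e = "\<lambda>f i. fst (f i)"])
      (use fst_past in \<open>auto simp: past_def\<close>)
  moreover have "(\<lambda>f. boot_path Q (snd (f 0)) (\<lambda>i. snd (f i)) s) \<in> borel_measurable (PiM {..t} (\<lambda>_. borel :: ('h \<times> 'h) measure))"
    by (rule measurable_boot_path[where e = "\<lambda>f i. snd (f i)"])
      (use snd_past in \<open>auto simp: past_def\<close>)
  ultimately show "past t (\<lambda>f. boot_path P (fst (f 0)) (\<lambda>i. fst (f i)) s)"
    "past t (\<lambda>f. boot_path Q (snd (f 0)) (\<lambda>i. snd (f i)) s)"
    by (simp_all add: past_def)
qed

text \<open>The summands are martingale differences: given the past, the innovations are centered and the other
  factor is fixed. Hence the second moments add up, and those of the single summands are obtained from
  \<open>a \<otimes> e1 - c \<otimes> e2 = (a - c) \<otimes> e1 + c \<otimes> (e1 - e2)\<close>.\<close>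

lemma martingale_operator_mean_le:
  fixes a c :: "nat \<Rightarrow> (nat \<Rightarrow> 'h \<times> 'h) \<Rightarrow> 'h"
  defines "Z \<equiv> \<lambda>\<omega> i. \<zeta> i \<omega>"
  assumes past: "\<And>t. past t (a t)" "\<And>t. past t (c t)"
    and d: "\<And>t. mean_le M (\<lambda>\<omega>. (norm (a t (Z \<omega>) - c t (Z \<omega>)))\<^sup>2) (d t)"
    and K: "\<And>t. mean_le M (\<lambda>\<omega>. (norm (c t (Z \<omega>)))\<^sup>2) K"
  shows "mean_le M (\<lambda>\<omega>. (norm (\<Sum>t<n. tensor (a t (Z \<omega>)) (e1 \<omega> (Suc t)) - tensor (c t (Z \<omega>)) (e2 \<omega> (Suc t))))\<^sup>2)
    (\<Sum>t<n. 2 * (1 + m) * d t + 2 * K * \<tau>)"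
proof (rule mean_le_norm_sum_orthogonal[OF basis])
  define A where "A t \<omega> = tensor (a t (Z \<omega>)) (e1 \<omega> (Suc t)) - tensor (c t (Z \<omega>)) (e2 \<omega> (Suc t))" for t \<omega>
  have meas [measurable]: "(\<lambda>\<omega>. a t (Z \<omega>)) \<in> borel_measurable M" "(\<lambda>\<omega>. c t (Z \<omega>)) \<in> borel_measurable M" for t
    using past_measurable[OF past(1)] past_measurable[OF past(2)] unfolding Z_def by simp_all
  have A: "A t \<omega> x = (a t (Z \<omega>) \<bullet> x) *\<^sub>R e1 \<omega> (Suc t) - (c t (Z \<omega>) \<bullet> x) *\<^sub>R e2 \<omega> (Suc t)" for t \<omega> x
    by (simp add: A_def blinfun.diff_left)
  show measA [measurable]: "(\<lambda>\<omega>. blinfun_apply (tensor (a t (Z \<omega>)) (e1 \<omega> (Suc t)) - tensor (c t (Z \<omega>)) (e2 \<omega> (Suc t))) x)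
      \<in> borel_measurable M" for t x
    unfolding A_def[symmetric] A by measurable
  have a2: "mean_le M (\<lambda>\<omega>. (norm (a t (Z \<omega>)))\<^sup>2) (2 * d t + 2 * K)" for t
  proof (rule mean_le_mono[OF mean_le_add[OF mean_le_cmult[OF d[of t], of 2] mean_le_cmult[OF K[of t], of 2]]])
    show "(norm (a t (Z \<omega>)))\<^sup>2 \<le> 2 * (norm (a t (Z \<omega>) - c t (Z \<omega>)))\<^sup>2 + 2 * (norm (c t (Z \<omega>)))\<^sup>2" for \<omega>
      using norm_add_sq_le[of "a t (Z \<omega>) - c t (Z \<omega>)" "c t (Z \<omega>)"] by simp
  qed auto
  have fs: "(\<lambda>z. norm (fst z) ^ 2) \<in> borel_measurable (borel :: ('h \<times> 'h) measure)"
    "(\<lambda>z. norm (snd z) ^ 2) \<in> borel_measurable (borel :: ('h \<times> 'h) measure)"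
    "(\<lambda>z. norm (fst z - snd z) ^ 2) \<in> borel_measurable (borel :: ('h \<times> 'h) measure)"
    by (auto intro!: borel_measurable_continuous_onI continuous_intros)
  have prod1: "mean_le M (\<lambda>\<omega>. (norm (g (Z \<omega>)))\<^sup>2 * (norm (e1 \<omega> (Suc t)))\<^sup>2) (b * (1 + m))"
    "mean_le M (\<lambda>\<omega>. (norm (g (Z \<omega>)))\<^sup>2 * (norm (e2 \<omega> (Suc t)))\<^sup>2) (b * (1 + m))"
    "mean_le M (\<lambda>\<omega>. (norm (g (Z \<omega>)))\<^sup>2 * (norm (e1 \<omega> (Suc t) - e2 \<omega> (Suc t)))\<^sup>2) (b * \<tau>)"
    if "past t g" "mean_le M (\<lambda>\<omega>. (norm (g (Z \<omega>)))\<^sup>2) b" for g :: "(nat \<Rightarrow> 'h \<times> 'h) \<Rightarrow> 'h" and b t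
    using past_product[OF that(1) fs(1) _ that(2)[unfolded Z_def], of "1 + m"]
      past_product[OF that(1) fs(2) _ that(2)[unfolded Z_def], of "1 + m"]
      past_product[OF that(1) fs(3) _ that(2)[unfolded Z_def], of \<tau>]
      e_moments(3,4)[of "Suc t"] e_diff_moments(2)[of "Suc t"]
    by (simp_all add: Z_def e1_def e2_def)
  have L2: "integrable M (\<lambda>\<omega>. (norm (A t \<omega> x))\<^sup>2)" for t x
  proof -
    have i: "mean_le M (\<lambda>\<omega>. (2 * (norm x)\<^sup>2) * ((norm (a t (Z \<omega>)))\<^sup>2 * (norm (e1 \<omega> (Suc t)))\<^sup>2)
        + (2 * (norm x)\<^sup>2) * ((norm (c t (Z \<omega>)))\<^sup>2 * (norm (e2 \<omega> (Suc t)))\<^sup>2))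
      ((2 * (norm x)\<^sup>2) * ((2 * d t + 2 * K) * (1 + m)) + (2 * (norm x)\<^sup>2) * (K * (1 + m)))"
      by (intro mean_le_add mean_le_cmult prod1 a2 K past) auto
    have cs: "(norm ((y \<bullet> x) *\<^sub>R z))\<^sup>2 \<le> (norm x)\<^sup>2 * ((norm y)\<^sup>2 * (norm z)\<^sup>2)" for y z :: 'h
    proof -
      have "\<bar>y \<bullet> x\<bar> * norm z \<le> (norm y * norm x) * norm z"
        by (intro mult_right_mono Cauchy_Schwarz_ineq2) simp
      then have "(\<bar>y \<bullet> x\<bar> * norm z)\<^sup>2 \<le> ((norm y * norm x) * norm z)\<^sup>2" by (intro power_mono) auto
      then show ?thesis by (simp add: power_mult_distrib mult.assoc mult.left_commute)
    qed
    have "mean_le M (\<lambda>\<omega>. (norm (A t \<omega> x))\<^sup>2)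
      ((2 * (norm x)\<^sup>2) * ((2 * d t + 2 * K) * (1 + m)) + (2 * (norm x)\<^sup>2) * (K * (1 + m)))"
    proof (rule mean_le_mono[OF i])
      show "(\<lambda>\<omega>. (norm (A t \<omega> x))\<^sup>2) \<in> borel_measurable M" unfolding A by measurable
      fix \<omega>
      have "(norm (A t \<omega> x))\<^sup>2 \<le> 2 * (norm ((a t (Z \<omega>) \<bullet> x) *\<^sub>R e1 \<omega> (Suc t)))\<^sup>2
          + 2 * (norm ((c t (Z \<omega>) \<bullet> x) *\<^sub>R e2 \<omega> (Suc t)))\<^sup>2"
        using norm_add_sq_le[of "(a t (Z \<omega>) \<bullet> x) *\<^sub>R e1 \<omega> (Suc t)" "- ((c t (Z \<omega>) \<bullet> x) *\<^sub>R e2 \<omega> (Suc t))"]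
        unfolding A by simp
      also have "\<dots> \<le> (2 * (norm x)\<^sup>2) * ((norm (a t (Z \<omega>)))\<^sup>2 * (norm (e1 \<omega> (Suc t)))\<^sup>2)
        + (2 * (norm x)\<^sup>2) * ((norm (c t (Z \<omega>)))\<^sup>2 * (norm (e2 \<omega> (Suc t)))\<^sup>2)"
        unfolding mult.assoc by (intro add_mono mult_left_mono cs) auto
      finally show "(norm (A t \<omega> x))\<^sup>2 \<le> (2 * (norm x)\<^sup>2) * ((norm (a t (Z \<omega>)))\<^sup>2 * (norm (e1 \<omega> (Suc t)))\<^sup>2)
        + (2 * (norm x)\<^sup>2) * ((norm (c t (Z \<omega>)))\<^sup>2 * (norm (e2 \<omega> (Suc t)))\<^sup>2)" .
    qed auto
    then show ?thesis by (rule mean_leD)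
  qed
  show "integrable M (\<lambda>\<omega>. (norm (blinfun_apply (tensor (a t (Z \<omega>)) (e1 \<omega> (Suc t)) - tensor (c t (Z \<omega>)) (e2 \<omega> (Suc t))) x))\<^sup>2)"
    for t x using L2 unfolding A_def .
  show "(\<integral>\<omega>. blinfun_apply (tensor (a s (Z \<omega>)) (e1 \<omega> (Suc s)) - tensor (c s (Z \<omega>)) (e2 \<omega> (Suc s))) x
      \<bullet> blinfun_apply (tensor (a t (Z \<omega>)) (e1 \<omega> (Suc t)) - tensor (c t (Z \<omega>)) (e2 \<omega> (Suc t))) x \<partial>M) = 0"
    if st: "s < t" for s t x
  proof -
    \<comment> \<open>the earlier increment as a function of the inputs up to time \<open>t\<close>\<close>
    define F where "F f = (a s f \<bullet> x) *\<^sub>R fst (f (Suc s)) - (c s f \<bullet> x) *\<^sub>R snd (f (Suc s))" for f :: "nat \<Rightarrow> 'h \<times> 'h"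
    have F: "past t F"
    proof -
      have p: "past t (a s)" "past t (c s)" "past t (\<lambda>f. fst (f (Suc s)))" "past t (\<lambda>f. snd (f (Suc s)))"
        using st past_mono[OF past(1)[of s]] past_mono[OF past(2)[of s]] past_fst_snd[of "Suc s" t] by auto
      have "F \<in> borel_measurable (PiM {..t} (\<lambda>_. borel))"
        using p unfolding past_def F_def[abs_def] by (intro borel_measurable_diff borel_measurable_scaleR borel_measurable_inner) auto
      moreover have "F (restrict f {..t}) = F f" for f
        using p st unfolding past_def F_def by simp
      ultimately show ?thesis by (simp add: past_def)
    qed
    have FA: "F (Z \<omega>) = A s \<omega> x" for \<omega> by (simp add: F_def A Z_def e1_def e2_def)
    have zero: "integrable M (\<lambda>\<omega>. ((g (Z \<omega>) \<bullet> x) *\<^sub>R F (Z \<omega>)) \<bullet> e \<omega>)"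
      "(\<integral>\<omega>. ((g (Z \<omega>) \<bullet> x) *\<^sub>R F (Z \<omega>)) \<bullet> e \<omega> \<partial>M) = 0"
      if g: "past t g" "mean_le M (\<lambda>\<omega>. (norm (g (Z \<omega>)))\<^sup>2) b"
        and e: "h \<in> borel_measurable borel" "e = (\<lambda>\<omega>. h (\<zeta> (Suc t) \<omega>))" "mean_le M (\<lambda>\<omega>. (norm (e \<omega>))\<^sup>2) b'"
          "(\<integral>\<omega>. e \<omega> \<partial>M) = 0" for g :: "(nat \<Rightarrow> 'h \<times> 'h) \<Rightarrow> 'h" and h :: "'h \<times> 'h \<Rightarrow> 'h" and e b b'
    proof -
      have [measurable]: "(\<lambda>\<omega>. g (Z \<omega>)) \<in> borel_measurable M" "(\<lambda>\<omega>. F (Z \<omega>)) \<in> borel_measurable M"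
        using past_measurable[OF g(1)] past_measurable[OF F] unfolding Z_def by simp_all
      have "past t (\<lambda>f. (g f \<bullet> x) *\<^sub>R F f)"
        using g(1) F unfolding past_def by (auto intro!: borel_measurable_scaleR borel_measurable_inner)
      then have ind: "indep_var borel (\<lambda>\<omega>. (g (Z \<omega>) \<bullet> x) *\<^sub>R F (Z \<omega>)) borel e"
        using past_indep[of t "\<lambda>f. (g f \<bullet> x) *\<^sub>R F f" h] e(1,2) by (simp add: Z_def)
      have "integrable M (\<lambda>\<omega>. norm (g (Z \<omega>)) * norm (F (Z \<omega>)))"
        by (rule integrable_inner_of_square) (use mean_leD(1)[OF g(2)] L2[of s x] in \<open>simp_all add: FA[symmetric]\<close>)
      then have "integrable M (\<lambda>\<omega>. norm x * (norm (g (Z \<omega>)) * norm (F (Z \<omega>))))" by simp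
      then have W: "integrable M (\<lambda>\<omega>. (g (Z \<omega>) \<bullet> x) *\<^sub>R F (Z \<omega>))"
      proof (rule Bochner_Integration.integrable_bound)
        show "AE \<omega> in M. norm ((g (Z \<omega>) \<bullet> x) *\<^sub>R F (Z \<omega>)) \<le> norm (norm x * (norm (g (Z \<omega>)) * norm (F (Z \<omega>))))"
        proof (rule AE_I2)
          fix \<omega>
          have "\<bar>g (Z \<omega>) \<bullet> x\<bar> * norm (F (Z \<omega>)) \<le> (norm (g (Z \<omega>)) * norm x) * norm (F (Z \<omega>))"
            by (intro mult_right_mono Cauchy_Schwarz_ineq2) simp
          then show "norm ((g (Z \<omega>) \<bullet> x) *\<^sub>R F (Z \<omega>)) \<le> norm (norm x * (norm (g (Z \<omega>)) * norm (F (Z \<omega>))))"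
            by (simp add: mult_ac abs_mult)
        qed
      qed simp
      have "e \<in> borel_measurable M" unfolding e(2) by (rule measurable_compose[OF rv e(1)])
      then have "integrable M e" using mean_leD(1)[OF e(3)] by (rule integrable_of_square)
      from indep_zero_mean[OF ind W this e(4)]
      show "integrable M (\<lambda>\<omega>. ((g (Z \<omega>) \<bullet> x) *\<^sub>R F (Z \<omega>)) \<bullet> e \<omega>)"
        "(\<integral>\<omega>. ((g (Z \<omega>) \<bullet> x) *\<^sub>R F (Z \<omega>)) \<bullet> e \<omega> \<partial>M) = 0" .
    qed
    have m: "fst \<in> borel_measurable (borel :: ('h \<times> 'h) measure)" "snd \<in> borel_measurable (borel :: ('h \<times> 'h) measure)"
      by (auto intro!: borel_measurable_continuous_onI continuous_intros)
    note z1 = zero[OF past(1) a2 m(1), of "\<lambda>\<omega>. e1 \<omega> (Suc t)", OF _ e_moments(3)]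
      and z2 = zero[OF past(2) K m(2), of "\<lambda>\<omega>. e2 \<omega> (Suc t)", OF _ e_moments(4)]
    have z: "integrable M (\<lambda>\<omega>. ((a t (Z \<omega>) \<bullet> x) *\<^sub>R F (Z \<omega>)) \<bullet> e1 \<omega> (Suc t))"
      "(\<integral>\<omega>. ((a t (Z \<omega>) \<bullet> x) *\<^sub>R F (Z \<omega>)) \<bullet> e1 \<omega> (Suc t) \<partial>M) = 0"
      "integrable M (\<lambda>\<omega>. ((c t (Z \<omega>) \<bullet> x) *\<^sub>R F (Z \<omega>)) \<bullet> e2 \<omega> (Suc t))"
      "(\<integral>\<omega>. ((c t (Z \<omega>) \<bullet> x) *\<^sub>R F (Z \<omega>)) \<bullet> e2 \<omega> (Suc t) \<partial>M) = 0"
      using z1 z2 mean1[of "Suc t"] mean2[of "Suc t"] by (simp_all add: e1_def e2_def)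
    have "A s \<omega> x \<bullet> A t \<omega> x = ((a t (Z \<omega>) \<bullet> x) *\<^sub>R F (Z \<omega>)) \<bullet> e1 \<omega> (Suc t)
        - ((c t (Z \<omega>) \<bullet> x) *\<^sub>R F (Z \<omega>)) \<bullet> e2 \<omega> (Suc t)" for \<omega>
      unfolding FA by (subst A[of t]) (simp add: inner_diff_right)
    then have "(\<integral>\<omega>. A s \<omega> x \<bullet> A t \<omega> x \<partial>M) = 0"
      using z by simp
    then show ?thesis unfolding A_def .
  qed
  show "(\<integral>\<^sup>+\<omega>. hs_sq B (tensor (a t (Z \<omega>)) (e1 \<omega> (Suc t)) - tensor (c t (Z \<omega>)) (e2 \<omega> (Suc t))) \<partial>M)
      \<le> ennreal (2 * (1 + m) * d t + 2 * K * \<tau>)" for t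
  proof -
    have ac: "past t (\<lambda>f. a t f - c t f)"
      using past(1)[of t] past(2)[of t] unfolding past_def by auto
    have "mean_le M (\<lambda>\<omega>. 2 * ((norm (a t (Z \<omega>) - c t (Z \<omega>)))\<^sup>2 * (norm (e1 \<omega> (Suc t)))\<^sup>2)
       + 2 * ((norm (c t (Z \<omega>)))\<^sup>2 * (norm (e1 \<omega> (Suc t) - e2 \<omega> (Suc t)))\<^sup>2)) (2 * (d t * (1 + m)) + 2 * (K * \<tau>))"
      by (intro mean_le_add mean_le_cmult prod1(1)[OF ac] prod1(3)[OF past(2)] d K) auto
    note n = mean_le_nn_integral[OF this]
    have "hs_sq B (tensor (a t (Z \<omega>)) (e1 \<omega> (Suc t)) - tensor (c t (Z \<omega>)) (e2 \<omega> (Suc t)))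
      \<le> ennreal (2 * ((norm (a t (Z \<omega>) - c t (Z \<omega>)))\<^sup>2 * (norm (e1 \<omega> (Suc t)))\<^sup>2)
       + 2 * ((norm (c t (Z \<omega>)))\<^sup>2 * (norm (e1 \<omega> (Suc t) - e2 \<omega> (Suc t)))\<^sup>2))" for \<omega>
      by (rule hs_sq_tensor_diff_le[OF basis])
    then have "(\<integral>\<^sup>+\<omega>. hs_sq B (tensor (a t (Z \<omega>)) (e1 \<omega> (Suc t)) - tensor (c t (Z \<omega>)) (e2 \<omega> (Suc t))) \<partial>M)
      \<le> ennreal (2 * (d t * (1 + m)) + 2 * (K * \<tau>))"
      by (intro order_trans[OF nn_integral_mono n])
    then show ?thesis by (simp add: mult_ac)
  qed
  show "0 \<le> 2 * (1 + m) * d t + 2 * K * \<tau>" for t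
    using mean_leD(5)[OF d[of t]] mean_leD(5)[OF K[of t]] tau m0 by simp
qed

lemma L_kap_ge: "L \<le> L\<^sup>2 * kap\<^sup>2" "L * kap\<^sup>2 \<le> L\<^sup>2 * kap\<^sup>2" "1 \<le> kap\<^sup>2"
proof -
  show k: "1 \<le> kap\<^sup>2" by (rule one_le_power[OF kap(1)])
  have LL: "L \<le> L\<^sup>2" using mult_left_mono[of 1 L L] L_ge by (simp add: power2_eq_square)
  then show "L * kap\<^sup>2 \<le> L\<^sup>2 * kap\<^sup>2" by (rule mult_right_mono) simp
  have "L * 1 \<le> L * kap\<^sup>2" using k L_ge by (intro mult_left_mono) auto
  also have "\<dots> \<le> L\<^sup>2 * kap\<^sup>2" by fact
  finally show "L \<le> L\<^sup>2 * kap\<^sup>2" by simp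
qed

text \<open>The common rate of all coupling errors below.\<close>

definition theta where "theta n = \<eta>\<^sup>2 + \<tau> + \<tau>\<^sup>2 + 1 / real n"

lemma theta_ge: "\<eta>\<^sup>2 \<le> theta n" "\<tau> \<le> theta n" "1 / real n \<le> theta n" "0 \<le> theta n" "1 / real n + \<eta>\<^sup>2 + \<tau> \<le> theta n"
  using tau by (simp_all add: theta_def add_nonneg_nonneg)

lemma mean_dXY_le: "0 < n \<Longrightarrow> (\<Sum>t<n. dXY t) / real n \<le> 4 * L * kap\<^sup>2 * theta n"
proof -
  assume n: "0 < n"
  have "(\<Sum>t<n. dXY t) / real n \<le> (4 * L * kap\<^sup>2 * (1 + real n * (\<eta>\<^sup>2 + \<tau>))) / real n"
    by (intro divide_right_mono sum_dXY_le) simp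
  also have "\<dots> = 4 * L * kap\<^sup>2 * (1 / real n + \<eta>\<^sup>2 + \<tau>)" using n by (simp add: field_simps)
  also have "\<dots> \<le> 4 * L * kap\<^sup>2 * theta n" using L_ge theta_ge(5) by (intro mult_left_mono) auto
  finally show ?thesis .
qed

lemma scaled_sum_bound:
  assumes n: "0 < n" and F: "mean_le M (\<lambda>\<omega>. (norm (F \<omega> :: 'h \<Rightarrow>\<^sub>L 'h))\<^sup>2) (\<Sum>t<n. u t)"
  shows "mean_le M (\<lambda>\<omega>. real n * (norm ((1 / real n) *\<^sub>R F \<omega>))\<^sup>2) ((\<Sum>t<n. u t) / real n)"
proof -
  have "mean_le M (\<lambda>\<omega>. (1 / real n) * (norm (F \<omega>))\<^sup>2) ((1 / real n) * (\<Sum>t<n. u t))"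
    by (intro mean_le_cmult F) simp
  then show ?thesis using n by (simp add: power_mult_distrib power2_eq_square)
qed

lemma X_conv: "boot_path P (fst (\<zeta> 0 \<omega>)) (\<lambda>i. fst (\<zeta> i \<omega>)) t = X \<omega> t"
  and Y_conv: "boot_path Q (snd (\<zeta> 0 \<omega>)) (\<lambda>i. snd (\<zeta> i \<omega>)) t = Y \<omega> t"
  by (simp_all add: X_def Y_def e1_def[abs_def] e2_def[abs_def])

lemma cross_sum_diff:
  "cross_sum n x e - cross_sum n y f = (1 / real n) *\<^sub>R (\<Sum>t<n. tensor (x t) (e (Suc t)) - tensor (y t) (f (Suc t)))"
  by (simp add: cross_sum_def sum_subtractf scaleR_diff_right)

text \<open>A sum of \<open>n\<close> martingale differences of size \<open>theta n\<close>, divided by \<open>n\<close>, has second moment of order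
  \<open>theta n / n\<close>.\<close>

theorem cross_sum_coupling:
  assumes n: "0 < n"
  shows "mean_le M (\<lambda>\<omega>. real n * (norm (cross_sum n (X \<omega>) (e1 \<omega>) - cross_sum n (Y \<omega>) (e2 \<omega>)))\<^sup>2)
    (10 * (L\<^sup>2 * kap\<^sup>2 * theta n))"
proof -
  note mart = martingale_operator_mean_le[of "\<lambda>t f. boot_path P (fst (f 0)) (\<lambda>i. fst (f i)) t"
      "\<lambda>t f. boot_path Q (snd (f 0)) (\<lambda>i. snd (f i)) t" dXY L n, unfolded X_conv Y_conv,
      OF past_path(1)[OF order_refl] past_path(2)[OF order_refl] XY_diff XY_moments(4)]
  have "mean_le M (\<lambda>\<omega>. real n * (norm (cross_sum n (X \<omega>) (e1 \<omega>) - cross_sum n (Y \<omega>) (e2 \<omega>)))\<^sup>2)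
    ((\<Sum>t<n. 2 * (1 + m) * dXY t + 2 * L * \<tau>) / real n)"
    unfolding cross_sum_diff by (rule scaled_sum_bound[OF n mart])
  moreover have "(\<Sum>t<n. 2 * (1 + m) * dXY t + 2 * L * \<tau>) / real n \<le> 10 * (L\<^sup>2 * kap\<^sup>2 * theta n)"
  proof -
    have "(\<Sum>t<n. 2 * (1 + m) * dXY t + 2 * L * \<tau>) / real n
      = 2 * (1 + m) * ((\<Sum>t<n. dXY t) / real n) + 2 * L * \<tau>"
      using n by (simp add: sum.distrib sum_distrib_left[symmetric] add_divide_distrib)
    also have "\<dots> \<le> 2 * L * (4 * L * kap\<^sup>2 * theta n) + 2 * L * theta n"
      using mean_dXY_le[OF n] L_ge theta_ge m0 less_imp_le[OF tau]
      by (intro add_mono mult_mono) (auto intro!: divide_nonneg_nonneg sum_nonneg mean_leD(5)[OF XY_diff])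
    also have "\<dots> = 8 * (L\<^sup>2 * kap\<^sup>2 * theta n) + 2 * (L * theta n)" by (simp add: power2_eq_square)
    also have "L * theta n \<le> L\<^sup>2 * kap\<^sup>2 * theta n" by (rule mult_right_mono[OF L_kap_ge(1) theta_ge(4)])
    finally show ?thesis by (simp add: mult_ac)
  qed
  ultimately show ?thesis by (rule mean_le_weaken)
qed

lemma noise_linear_part:
  assumes n: "0 < n"
  shows "mean_le M (\<lambda>\<omega>. real n * (norm (cross_sum n (\<lambda>t. P (X \<omega> t)) (e1 \<omega>) - cross_sum n (\<lambda>t. Q (Y \<omega> t)) (e2 \<omega>)))\<^sup>2)
    (22 * (L\<^sup>2 * kap\<^sup>2 * theta n))"
proof -
  have d: "mean_le M (\<lambda>\<omega>. (norm (P (X \<omega> t) - Q (Y \<omega> t)))\<^sup>2) (2 * dXY t + 2 * \<eta>\<^sup>2 * L)" for t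
    by (rule mean_le_mono[OF mean_le_add[OF mean_le_cmult[OF XY_diff[of t], of 2]
          mean_le_cmult[OF XY_moments(3)[of t], of "2 * \<eta>\<^sup>2"]]]) (auto simp: operator_diff_sq_le)
  have c: "mean_le M (\<lambda>\<omega>. (norm (Q (Y \<omega> t)))\<^sup>2) L" for t
  proof (rule mean_le_mono[OF XY_moments(4)[of t]])
    fix \<omega>
    have "norm (Q (Y \<omega> t)) \<le> 1 * norm (Y \<omega> t)"
      using norm_blinfun[of Q "Y \<omega> t"] mult_right_mono[of "norm Q" 1 "norm (Y \<omega> t)"] Q rho by simp
    then show "(norm (Q (Y \<omega> t)))\<^sup>2 \<le> (norm (Y \<omega> t))\<^sup>2" by (intro power_mono) auto
  qed auto
  have ops: "(\<lambda>x. P x) \<in> borel_measurable borel" "(\<lambda>x. Q x) \<in> borel_measurable borel"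
    by (auto intro!: borel_measurable_continuous_onI continuous_intros)
  have pp: "past t (\<lambda>f. P (boot_path P (fst (f 0)) (\<lambda>i. fst (f i)) t))"
    "past t (\<lambda>f. Q (boot_path Q (snd (f 0)) (\<lambda>i. snd (f i)) t))" for t
    by (rule past_compose[OF past_path(1)[OF order_refl] ops(1)] past_compose[OF past_path(2)[OF order_refl] ops(2)])+
  note mart = martingale_operator_mean_le[of "\<lambda>t f. P (boot_path P (fst (f 0)) (\<lambda>i. fst (f i)) t)"
      "\<lambda>t f. Q (boot_path Q (snd (f 0)) (\<lambda>i. snd (f i)) t)" "\<lambda>t. 2 * dXY t + 2 * \<eta>\<^sup>2 * L" L n, unfolded X_conv Y_conv,
      OF pp d c]
  have "mean_le M (\<lambda>\<omega>. real n * (norm (cross_sum n (\<lambda>t. P (X \<omega> t)) (e1 \<omega>) - cross_sum n (\<lambda>t. Q (Y \<omega> t)) (e2 \<omega>)))\<^sup>2)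
    ((\<Sum>t<n. 2 * (1 + m) * (2 * dXY t + 2 * \<eta>\<^sup>2 * L) + 2 * L * \<tau>) / real n)"
    unfolding cross_sum_diff by (rule scaled_sum_bound[OF n mart])
  moreover have "(\<Sum>t<n. 2 * (1 + m) * (2 * dXY t + 2 * \<eta>\<^sup>2 * L) + 2 * L * \<tau>) / real n \<le> 22 * (L\<^sup>2 * kap\<^sup>2 * theta n)"
  proof -
    have "(\<Sum>t<n. 2 * (1 + m) * (2 * dXY t + 2 * \<eta>\<^sup>2 * L) + 2 * L * \<tau>) / real n
      = 2 * (1 + m) * (2 * ((\<Sum>t<n. dXY t) / real n) + 2 * \<eta>\<^sup>2 * L) + 2 * L * \<tau>"
    proof -
      have "(\<Sum>t<n. 2 * (1 + m) * (2 * dXY t + 2 * \<eta>\<^sup>2 * L) + 2 * L * \<tau>)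
        = 2 * (1 + m) * (2 * (\<Sum>t<n. dXY t) + real n * (2 * \<eta>\<^sup>2 * L)) + real n * (2 * L * \<tau>)"
        by (simp add: sum.distrib flip: sum_distrib_left)
      then show ?thesis using n by (simp add: field_simps)
    qed
    also have "\<dots> \<le> 2 * L * (2 * (4 * L * kap\<^sup>2 * theta n) + 2 * theta n * L) + 2 * L * theta n"
      using mean_dXY_le[OF n] L_ge theta_ge m0 less_imp_le[OF tau]
      by (intro add_mono mult_mono)
        (auto intro!: add_nonneg_nonneg divide_nonneg_nonneg sum_nonneg mean_leD(5)[OF XY_diff])
    also have "\<dots> = 16 * (L\<^sup>2 * kap\<^sup>2 * theta n) + 4 * (L\<^sup>2 * theta n) + 2 * (L * theta n)"
      by (simp add: power2_eq_square algebra_simps)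
    also have "L * theta n \<le> L\<^sup>2 * kap\<^sup>2 * theta n" by (rule mult_right_mono[OF L_kap_ge(1) theta_ge(4)])
    also have "L\<^sup>2 * theta n \<le> L\<^sup>2 * kap\<^sup>2 * theta n"
      using L_kap_ge(3) mult_left_mono[of 1 "kap\<^sup>2" "L\<^sup>2"] by (intro mult_right_mono theta_ge(4)) auto
    finally show ?thesis by (simp add: mult_ac)
  qed
  ultimately show ?thesis by (rule mean_le_weaken)
qed

text \<open>The summands are centered and independent. The difference of \<open>e1 \<otimes> e1\<close> and \<open>e2 \<otimes> e2\<close> involves products
  of squares of \<open>e1 - e2\<close> and of the innovations, which are dependent; their expectation is controlled by the
  fourth moments.\<close>

lemma noise_quadratic_part:
  assumes n: "0 < n"
  shows "mean_le M (\<lambda>\<omega>. real n * (norm ((1 / real n) *\<^sub>R (\<Sum>t<n. tensor (e1 \<omega> (Suc t)) (e1 \<omega> (Suc t))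
      - tensor (e2 \<omega> (Suc t)) (e2 \<omega> (Suc t)) - (S1 - S2))))\<^sup>2) (2 * (L\<^sup>2 * kap\<^sup>2 * theta n))"
proof -
  define A where "A t \<omega> = tensor (e1 \<omega> (Suc t)) (e1 \<omega> (Suc t)) - tensor (e2 \<omega> (Suc t)) (e2 \<omega> (Suc t))" for t \<omega>
  have A: "A t \<omega> x = (e1 \<omega> (Suc t) \<bullet> x) *\<^sub>R e1 \<omega> (Suc t) - (e2 \<omega> (Suc t) \<bullet> x) *\<^sub>R e2 \<omega> (Suc t)" for t \<omega> x
    by (simp add: A_def blinfun.diff_left)
  have mA [measurable]: "(\<lambda>\<omega>. A t \<omega> x) \<in> borel_measurable M" for t x unfolding A by measurable
  have cs: "(norm ((y \<bullet> x) *\<^sub>R y))\<^sup>2 \<le> (norm x)\<^sup>2 * norm y ^ 4" for x y :: 'h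
  proof -
    have "\<bar>y \<bullet> x\<bar> * norm y \<le> (norm y * norm x) * norm y"
      by (intro mult_right_mono Cauchy_Schwarz_ineq2) simp
    then have "(\<bar>y \<bullet> x\<bar> * norm y)\<^sup>2 \<le> ((norm y * norm x) * norm y)\<^sup>2" by (intro power_mono) auto
    then show ?thesis by (simp add: power2_eq_square power4_eq_xxxx mult_ac)
  qed
  have L2A: "integrable M (\<lambda>\<omega>. (norm (A t \<omega> x))\<^sup>2)" for t x
  proof -
    have i: "mean_le M (\<lambda>\<omega>. 2 * (norm x)\<^sup>2 * norm (e1 \<omega> (Suc t)) ^ 4 + 2 * (norm x)\<^sup>2 * norm (e2 \<omega> (Suc t)) ^ 4)
      (2 * (norm x)\<^sup>2 * m + 2 * (norm x)\<^sup>2 * m)"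
      by (intro mean_le_add mean_le_cmult e_moments) auto
    have "mean_le M (\<lambda>\<omega>. (norm (A t \<omega> x))\<^sup>2) (2 * (norm x)\<^sup>2 * m + 2 * (norm x)\<^sup>2 * m)"
    proof (rule mean_le_mono[OF i])
      fix \<omega>
      show "(norm (A t \<omega> x))\<^sup>2 \<le> 2 * (norm x)\<^sup>2 * norm (e1 \<omega> (Suc t)) ^ 4 + 2 * (norm x)\<^sup>2 * norm (e2 \<omega> (Suc t)) ^ 4"
        using norm_add_sq_le[of "(e1 \<omega> (Suc t) \<bullet> x) *\<^sub>R e1 \<omega> (Suc t)" "- ((e2 \<omega> (Suc t) \<bullet> x) *\<^sub>R e2 \<omega> (Suc t))"]
          cs[of "e1 \<omega> (Suc t)" x] cs[of "e2 \<omega> (Suc t)" x]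
        unfolding A by simp
    qed auto
    then show ?thesis by (rule mean_leD)
  qed
  have intA: "integrable M (\<lambda>\<omega>. A t \<omega> x)" for t x by (rule integrable_of_square[OF mA L2A])
  have meanA: "(\<integral>\<omega>. A t \<omega> x \<partial>M) = (S1 - S2) x" for t x
  proof -
    have *: "integrable M (\<lambda>\<omega>. (e \<omega> \<bullet> x) *\<^sub>R e \<omega>)"
      if [measurable]: "e \<in> borel_measurable M" and e4: "mean_le M (\<lambda>\<omega>. norm (e \<omega>) ^ 4) m" for e :: "'a \<Rightarrow> 'h"
    proof (rule integrable_of_square)
      have "mean_le M (\<lambda>\<omega>. (norm ((e \<omega> \<bullet> x) *\<^sub>R e \<omega>))\<^sup>2) ((norm x)\<^sup>2 * m)"
        by (rule mean_le_mono[OF mean_le_cmult[OF e4, of "(norm x)\<^sup>2"]]) (use cs[of _ x] in auto)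
      then show "integrable M (\<lambda>\<omega>. (norm ((e \<omega> \<bullet> x) *\<^sub>R e \<omega>))\<^sup>2)" by (rule mean_leD)
    qed simp
    have "(\<integral>\<omega>. A t \<omega> x \<partial>M) = (\<integral>\<omega>. (e1 \<omega> (Suc t) \<bullet> x) *\<^sub>R e1 \<omega> (Suc t) \<partial>M) - (\<integral>\<omega>. (e2 \<omega> (Suc t) \<bullet> x) *\<^sub>R e2 \<omega> (Suc t) \<partial>M)"
      unfolding A by (intro Bochner_Integration.integral_diff * e_moments rv12)
    also have "\<dots> = (S1 - S2) x"
      using cov1[of "Suc t" x] cov2[of "Suc t" x] by (simp add: e1_def e2_def blinfun.diff_left)
    finally show ?thesis .
  qed
  have mC [measurable]: "(\<lambda>\<omega>. (A t \<omega> - (S1 - S2)) x) \<in> borel_measurable M" for t x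
    by (simp add: blinfun.diff_left[of "A t _"])
  have L2C: "integrable M (\<lambda>\<omega>. (norm ((A t \<omega> - (S1 - S2)) x))\<^sup>2)" for t x
  proof (rule Bochner_Integration.integrable_bound)
    show "integrable M (\<lambda>\<omega>. 2 * (norm (A t \<omega> x))\<^sup>2 + 2 * (norm ((S1 - S2) x))\<^sup>2)" using L2A by simp
    show "AE \<omega> in M. norm ((norm ((A t \<omega> - (S1 - S2)) x))\<^sup>2) \<le> norm (2 * (norm (A t \<omega> x))\<^sup>2 + 2 * (norm ((S1 - S2) x))\<^sup>2)"
      using norm_add_sq_le[of "A t _ x" "- ((S1 - S2) x)"]
      by (intro AE_I2) (simp add: blinfun.diff_left[of "A t _"])
  qed simp
  have "mean_le M (\<lambda>\<omega>. (norm (\<Sum>t<n. A t \<omega> - (S1 - S2)))\<^sup>2) (\<Sum>t<n. 2 * \<tau> * (1 + m))"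
  proof (rule mean_le_norm_sum_orthogonal[OF basis mC L2C])
    fix s t :: nat and x :: 'h assume st: "s < t"
    define h where "h z = ((fst z \<bullet> x) *\<^sub>R fst z - (snd z \<bullet> x) *\<^sub>R snd z) - (S1 - S2) x" for z :: "'h \<times> 'h"
    have h: "h \<in> borel_measurable borel"
      unfolding h_def[abs_def] by (intro borel_measurable_continuous_onI continuous_intros)
    have hA: "h (\<zeta> (Suc t) \<omega>) = (A t \<omega> - (S1 - S2)) x" for t \<omega>
      by (simp add: h_def blinfun.diff_left[of "A t _"] A e1_def e2_def)
    have "past t (\<lambda>f. f (Suc s))"
      using st by (auto simp: past_def intro!: measurable_component_singleton)
    then have "past t (\<lambda>f. h (f (Suc s)))" by (rule past_compose) (rule h)
    from past_indep[OF this h]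
    have ind: "indep_var borel (\<lambda>\<omega>. (A s \<omega> - (S1 - S2)) x) borel (\<lambda>\<omega>. (A t \<omega> - (S1 - S2)) x)"
      by (simp only: hA)
    have "(\<integral>\<omega>. (A t \<omega> - (S1 - S2)) x \<partial>M) = 0"
      unfolding blinfun.diff_left[of "A t _"] using intA meanA by (simp add: prob_space)
    then show "(\<integral>\<omega>. (A s \<omega> - (S1 - S2)) x \<bullet> (A t \<omega> - (S1 - S2)) x \<partial>M) = 0"
      by (intro indep_zero_mean(2)[OF ind] integrable_of_square[OF mC L2C])
  next
    fix t :: nat
    have c: "(\<integral>\<^sup>+\<omega>. hs_sq B (A t \<omega> - (S1 - S2)) \<partial>M) \<le> (\<integral>\<^sup>+\<omega>. hs_sq B (A t \<omega>) \<partial>M)"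
      by (rule nn_integral_hs_sq_centered[OF basis mA L2A meanA])
    define D where "D \<omega> = norm (e1 \<omega> (Suc t) - e2 \<omega> (Suc t))" for \<omega>
    \<comment> \<open>the weight \<open>\<tau>\<close> balances the fourth moment \<open>\<tau>\<^sup>2\<close> of the difference against the bounded fourth moment\<close>
    have amgm: "2 * (u\<^sup>2 * v\<^sup>2) \<le> \<tau> * v ^ 4 + 1 / \<tau> * u ^ 4" for u v :: real
    proof -
      have "0 \<le> (\<tau> * v\<^sup>2 - u\<^sup>2)\<^sup>2 / \<tau>" using tau by simp
      also have "\<dots> = \<tau> * v ^ 4 + 1 / \<tau> * u ^ 4 - 2 * (u\<^sup>2 * v\<^sup>2)"
        using tau by (simp add: power2_eq_square power4_eq_xxxx field_simps)
      finally show ?thesis by simp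
    qed
    have D4: "mean_le M (\<lambda>\<omega>. D \<omega> ^ 4) (\<tau>\<^sup>2)" unfolding D_def by (rule e_diff_moments) simp
    have "mean_le M (\<lambda>\<omega>. (\<tau> * norm (e1 \<omega> (Suc t)) ^ 4 + 1 / \<tau> * D \<omega> ^ 4) + (\<tau> * norm (e2 \<omega> (Suc t)) ^ 4 + 1 / \<tau> * D \<omega> ^ 4))
      ((\<tau> * m + 1 / \<tau> * \<tau>\<^sup>2) + (\<tau> * m + 1 / \<tau> * \<tau>\<^sup>2))"
      by (intro mean_le_add mean_le_cmult e_moments D4) (use tau in auto)
    note n4 = mean_le_nn_integral[OF this]
    have "(\<integral>\<^sup>+\<omega>. hs_sq B (A t \<omega>) \<partial>M) \<le> (\<integral>\<^sup>+\<omega>. ennreal ((\<tau> * norm (e1 \<omega> (Suc t)) ^ 4 + 1 / \<tau> * D \<omega> ^ 4)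
      + (\<tau> * norm (e2 \<omega> (Suc t)) ^ 4 + 1 / \<tau> * D \<omega> ^ 4)) \<partial>M)"
    proof (rule nn_integral_mono)
      fix \<omega>
      have "hs_sq B (A t \<omega>) \<le> ennreal (2 * ((D \<omega>)\<^sup>2 * (norm (e1 \<omega> (Suc t)))\<^sup>2) + 2 * ((norm (e2 \<omega> (Suc t)))\<^sup>2 * (D \<omega>)\<^sup>2))"
        unfolding A_def D_def by (rule hs_sq_tensor_diff_le[OF basis])
      also have "\<dots> \<le> ennreal ((\<tau> * norm (e1 \<omega> (Suc t)) ^ 4 + 1 / \<tau> * D \<omega> ^ 4)
        + (\<tau> * norm (e2 \<omega> (Suc t)) ^ 4 + 1 / \<tau> * D \<omega> ^ 4))"
        using amgm[of "D \<omega>" "norm (e1 \<omega> (Suc t))"] amgm[of "D \<omega>" "norm (e2 \<omega> (Suc t))"]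
        by (intro ennreal_leI add_mono) (simp_all add: mult.commute)
      finally show "hs_sq B (A t \<omega>) \<le> \<dots>" .
    qed
    with c n4 have "(\<integral>\<^sup>+\<omega>. hs_sq B (A t \<omega> - (S1 - S2)) \<partial>M) \<le> ennreal ((\<tau> * m + 1 / \<tau> * \<tau>\<^sup>2) + (\<tau> * m + 1 / \<tau> * \<tau>\<^sup>2))"
      by (meson order_trans)
    also have "(\<tau> * m + 1 / \<tau> * \<tau>\<^sup>2) + (\<tau> * m + 1 / \<tau> * \<tau>\<^sup>2) = 2 * \<tau> * (1 + m)"
      using tau by (simp add: power2_eq_square algebra_simps)
    finally show "(\<integral>\<^sup>+\<omega>. hs_sq B (A t \<omega> - (S1 - S2)) \<partial>M) \<le> ennreal (2 * \<tau> * (1 + m))" .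
    show "0 \<le> 2 * \<tau> * (1 + m)" using tau m0 by simp
  qed
  from scaled_sum_bound[OF n this]
  have "mean_le M (\<lambda>\<omega>. real n * (norm ((1 / real n) *\<^sub>R (\<Sum>t<n. A t \<omega> - (S1 - S2))))\<^sup>2) (2 * (\<tau> * (1 + m)))"
    using n by (simp add: mult.assoc)
  then have "mean_le M (\<lambda>\<omega>. real n * (norm ((1 / real n) *\<^sub>R (\<Sum>t<n. A t \<omega> - (S1 - S2))))\<^sup>2) (2 * (L\<^sup>2 * kap\<^sup>2 * theta n))"
  proof (rule mean_le_weaken)
    have "\<tau> * (1 + m) \<le> theta n * L" using L_ge theta_ge m0 tau by (intro mult_mono) auto
    also have "\<dots> \<le> L\<^sup>2 * kap\<^sup>2 * theta n" using mult_right_mono[OF L_kap_ge(1) theta_ge(4)] by (simp add: mult.commute)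
    finally show "2 * (\<tau> * (1 + m)) \<le> 2 * (L\<^sup>2 * kap\<^sup>2 * theta n)" by simp
  qed
  then show ?thesis by (simp add: A_def)
qed

text \<open>Four terms with bounded second moments, divided by \<open>n\<close>.\<close>

lemma noise_boundary_part:
  assumes n: "0 < n"
  shows "mean_le M (\<lambda>\<omega>. real n * (norm ((1 / real n) *\<^sub>R (tensor (X \<omega> 0) (X \<omega> 0) - tensor (X \<omega> n) (X \<omega> n)
      - tensor (Y \<omega> 0) (Y \<omega> 0) + tensor (Y \<omega> n) (Y \<omega> n))))\<^sup>2) (16 * (L\<^sup>2 * kap\<^sup>2 * theta n))"
proof -
  have t: "(norm (tensor x x))\<^sup>2 \<le> norm x ^ 4" for x :: 'h
  proof -
    have "(norm (tensor x x))\<^sup>2 \<le> (norm x * norm x)\<^sup>2" by (intro power_mono norm_tensor_le) simp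
    then show ?thesis by (simp add: power2_eq_square power4_eq_xxxx mult_ac)
  qed
  have "mean_le M (\<lambda>\<omega>. (4 / real n) * (norm (X \<omega> 0) ^ 4 + norm (X \<omega> n) ^ 4 + norm (Y \<omega> 0) ^ 4 + norm (Y \<omega> n) ^ 4))
    ((4 / real n) * (L + L + L + L))"
    by (intro mean_le_cmult mean_le_add XY_moments) simp
  then show ?thesis
  proof (rule mean_le_mono)
    fix \<omega>
    have "(norm (tensor (X \<omega> 0) (X \<omega> 0) - tensor (X \<omega> n) (X \<omega> n)
      - tensor (Y \<omega> 0) (Y \<omega> 0) + tensor (Y \<omega> n) (Y \<omega> n)))\<^sup>2
      \<le> 4 * ((norm (tensor (X \<omega> 0) (X \<omega> 0)))\<^sup>2 + (norm (tensor (X \<omega> n) (X \<omega> n)))\<^sup>2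
        + (norm (tensor (Y \<omega> 0) (Y \<omega> 0)))\<^sup>2 + (norm (tensor (Y \<omega> n) (Y \<omega> n)))\<^sup>2)"
      using norm_add4_sq_le[of "tensor (X \<omega> 0) (X \<omega> 0)" "- tensor (X \<omega> n) (X \<omega> n)"
          "- tensor (Y \<omega> 0) (Y \<omega> 0)" "tensor (Y \<omega> n) (Y \<omega> n)"] by simp
    also have "\<dots> \<le> 4 * (norm (X \<omega> 0) ^ 4 + norm (X \<omega> n) ^ 4 + norm (Y \<omega> 0) ^ 4 + norm (Y \<omega> n) ^ 4)"
      by (intro mult_left_mono add_mono t) simp
    finally show "real n * (norm ((1 / real n) *\<^sub>R (tensor (X \<omega> 0) (X \<omega> 0) - tensor (X \<omega> n) (X \<omega> n)
      - tensor (Y \<omega> 0) (Y \<omega> 0) + tensor (Y \<omega> n) (Y \<omega> n))))\<^sup>2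
      \<le> (4 / real n) * (norm (X \<omega> 0) ^ 4 + norm (X \<omega> n) ^ 4 + norm (Y \<omega> 0) ^ 4 + norm (Y \<omega> n) ^ 4)"
      using n by (simp add: power_mult_distrib power2_eq_square divide_right_mono)
  next
    show "(\<lambda>\<omega>. real n * (norm ((1 / real n) *\<^sub>R (tensor (X \<omega> 0) (X \<omega> 0) - tensor (X \<omega> n) (X \<omega> n)
      - tensor (Y \<omega> 0) (Y \<omega> 0) + tensor (Y \<omega> n) (Y \<omega> n))))\<^sup>2) \<in> borel_measurable M"
      by (intro borel_measurable_times borel_measurable_power borel_measurable_norm_blinfun)
        (simp_all add: blinfun.scaleR_left blinfun.diff_left blinfun.add_left)
    have "1 / real n * L \<le> theta n * L" using theta_ge(3) L_ge by (intro mult_right_mono) auto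
    also have "\<dots> \<le> L\<^sup>2 * kap\<^sup>2 * theta n" using mult_right_mono[OF L_kap_ge(1) theta_ge(4)] by (simp add: mult.commute)
    finally show "(4 / real n) * (L + L + L + L) \<le> 16 * (L\<^sup>2 * kap\<^sup>2 * theta n)" by simp
  qed simp
qed

text \<open>The second part of the noise is the adjoint of the first one, and both have the same norm.\<close>

theorem noise_coupling:
  assumes n: "0 < n"
  shows "mean_le M (\<lambda>\<omega>. real n * (norm ((noise n P (X \<omega>) (e1 \<omega>) - S1) - (noise n Q (Y \<omega>) (e2 \<omega>) - S2)))\<^sup>2)
    (248 * (L\<^sup>2 * kap\<^sup>2 * theta n))"
proof -
  define T1 where "T1 \<omega> = cross_sum n (\<lambda>t. P (X \<omega> t)) (e1 \<omega>) - cross_sum n (\<lambda>t. Q (Y \<omega> t)) (e2 \<omega>)" for \<omega>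
  define T2 where "T2 \<omega> = (1 / real n) *\<^sub>R ((\<Sum>t<n. tensor (e1 \<omega> (Suc t)) (P (X \<omega> t))) - (\<Sum>t<n. tensor (e2 \<omega> (Suc t)) (Q (Y \<omega> t))))" for \<omega>
  define T3 where "T3 \<omega> = (1 / real n) *\<^sub>R (\<Sum>t<n. tensor (e1 \<omega> (Suc t)) (e1 \<omega> (Suc t))
      - tensor (e2 \<omega> (Suc t)) (e2 \<omega> (Suc t)) - (S1 - S2))" for \<omega>
  define T4 where "T4 \<omega> = (1 / real n) *\<^sub>R (tensor (X \<omega> 0) (X \<omega> 0) - tensor (X \<omega> n) (X \<omega> n)
      - tensor (Y \<omega> 0) (Y \<omega> 0) + tensor (Y \<omega> n) (Y \<omega> n))" for \<omega>
  have T12: "norm (T2 \<omega>) = norm (T1 \<omega>)" for \<omega>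
  proof (rule antisym; rule norm_le_of_adjoint)
    show "T2 \<omega> x \<bullet> y = x \<bullet> T1 \<omega> y" "T1 \<omega> x \<bullet> y = x \<bullet> T2 \<omega> y" for x y
      by (simp_all add: T1_def T2_def cross_sum_def blinfun.diff_left blinfun.scaleR_left blinfun.sum_left
          inner_diff_left inner_diff_right inner_sum_left inner_sum_right inner_commute mult_ac algebra_simps)
  qed
  have T: "(noise n P (X \<omega>) (e1 \<omega>) - S1) - (noise n Q (Y \<omega>) (e2 \<omega>) - S2) = T1 \<omega> + T2 \<omega> + T3 \<omega> + T4 \<omega>" for \<omega>
    using n by (simp add: noise_def T1_def T2_def T3_def T4_def sum_subtractf scaleR_diff_right scaleR_add_right
        sum_constant_scaleR)
  have "mean_le M (\<lambda>\<omega>. 4 * (2 * (real n * (norm (T1 \<omega>))\<^sup>2) + real n * (norm (T3 \<omega>))\<^sup>2 + real n * (norm (T4 \<omega>))\<^sup>2))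
    (4 * (2 * (22 * (L\<^sup>2 * kap\<^sup>2 * theta n)) + 2 * (L\<^sup>2 * kap\<^sup>2 * theta n) + 16 * (L\<^sup>2 * kap\<^sup>2 * theta n)))"
    unfolding T1_def T3_def T4_def
    by (intro mean_le_cmult mean_le_add noise_linear_part noise_quadratic_part noise_boundary_part n) simp_all
  then show ?thesis
  proof (rule mean_le_mono)
    fix \<omega>
    have "(norm (T1 \<omega> + T2 \<omega> + T3 \<omega> + T4 \<omega>))\<^sup>2 \<le> 4 * (2 * (norm (T1 \<omega>))\<^sup>2 + (norm (T3 \<omega>))\<^sup>2 + (norm (T4 \<omega>))\<^sup>2)"
      using norm_add4_sq_le[of "T1 \<omega>" "T2 \<omega>" "T3 \<omega>" "T4 \<omega>"] by (simp add: T12)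
    then have "real n * (norm (T1 \<omega> + T2 \<omega> + T3 \<omega> + T4 \<omega>))\<^sup>2
      \<le> real n * (4 * (2 * (norm (T1 \<omega>))\<^sup>2 + (norm (T3 \<omega>))\<^sup>2 + (norm (T4 \<omega>))\<^sup>2))" by (rule mult_left_mono) simp
    then show "real n * (norm ((noise n P (X \<omega>) (e1 \<omega>) - S1) - (noise n Q (Y \<omega>) (e2 \<omega>) - S2)))\<^sup>2
      \<le> 4 * (2 * (real n * (norm (T1 \<omega>))\<^sup>2) + real n * (norm (T3 \<omega>))\<^sup>2 + real n * (norm (T4 \<omega>))\<^sup>2)"
      unfolding T by (simp add: algebra_simps)
  next
    show "(\<lambda>\<omega>. real n * (norm ((noise n P (X \<omega>) (e1 \<omega>) - S1) - (noise n Q (Y \<omega>) (e2 \<omega>) - S2)))\<^sup>2) \<in> borel_measurable M"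
      by (intro borel_measurable_times borel_measurable_power borel_measurable_norm_blinfun)
        (simp_all add: noise_def cross_sum_def blinfun.scaleR_left blinfun.diff_left blinfun.add_left blinfun.sum_left)
  qed simp_all
qed

end

section \<open>Comparison of the bootstrap with the process\<close>

subsection \<open>Algebra of empirical covariances\<close>

lemma sum_shift_tensor:
  fixes x :: "nat \<Rightarrow> 'h::real_inner"
  shows "(\<Sum>t<n. tensor (x (Suc t)) (x (Suc t))) = (\<Sum>t<n. tensor (x t) (x t)) - tensor (x 0) (x 0) + tensor (x n) (x n)"
  by (induction n) auto

lemma C_hat_autoregression:
  fixes A :: "'h::real_inner \<Rightarrow>\<^sub>L 'h"
  assumes "\<And>t. t < n \<Longrightarrow> x (Suc t) = A (x t) + e (Suc t)"
  shows "C_hat n x = (A o\<^sub>L Gamma_hat n x) + cross_sum n x e"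
proof (rule blinfun_eqI)
  fix u
  have "C_hat n x u = (1 / real n) *\<^sub>R (\<Sum>t<n. (x t \<bullet> u) *\<^sub>R x (Suc t))"
    by (simp add: C_hat_def blinfun.scaleR_left blinfun.sum_left)
  also have "(\<Sum>t<n. (x t \<bullet> u) *\<^sub>R x (Suc t)) = (\<Sum>t<n. (x t \<bullet> u) *\<^sub>R A (x t)) + (\<Sum>t<n. (x t \<bullet> u) *\<^sub>R e (Suc t))"
    by (simp add: assms scaleR_add_right sum.distrib)
  finally show "C_hat n x u = ((A o\<^sub>L Gamma_hat n x) + cross_sum n x e) u"
    by (simp add: cross_sum_def Gamma_hat_def blinfun.scaleR_left blinfun.sum_left blinfun.add_left
        blinfun.scaleR_right blinfun.sum_right scaleR_add_right)
qed

text \<open>Insert the recursion into both factors of \<open>x (Suc t) \<otimes> x (Suc t)\<close>. The shift of the time index by one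
  leaves the boundary term of the noise.\<close>

lemma Gamma_hat_autoregression:
  fixes A A' :: "'h::real_inner \<Rightarrow>\<^sub>L 'h"
  assumes ar: "\<And>t. t < n \<Longrightarrow> x (Suc t) = A (x t) + e (Suc t)" and adj: "\<And>u w. A u \<bullet> w = u \<bullet> A' w"
  shows "Gamma_hat n x = (A o\<^sub>L Gamma_hat n x o\<^sub>L A') + noise n A x e"
proof -
  have "(A o\<^sub>L (\<Sum>t<n. tensor (x t) (x t)) o\<^sub>L A') = (\<Sum>t<n. tensor (A (x t)) (A (x t)))"
    by (rule blinfun_eqI) (simp add: blinfun.sum_left blinfun.sum_right blinfun.scaleR_right adj)
  moreover have "(\<Sum>t<n. tensor (x (Suc t)) (x (Suc t))) = (\<Sum>t<n. tensor (A (x t)) (A (x t)))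
    + (\<Sum>t<n. tensor (A (x t)) (e (Suc t))) + (\<Sum>t<n. tensor (e (Suc t)) (A (x t))) + (\<Sum>t<n. tensor (e (Suc t)) (e (Suc t)))"
    by (simp add: ar tensor.add_left tensor.add_right sum.distrib)
  ultimately have "(\<Sum>t<n. tensor (x t) (x t)) = (A o\<^sub>L (\<Sum>t<n. tensor (x t) (x t)) o\<^sub>L A')
    + (\<Sum>t<n. tensor (A (x t)) (e (Suc t))) + (\<Sum>t<n. tensor (e (Suc t)) (A (x t))) + (\<Sum>t<n. tensor (e (Suc t)) (e (Suc t)))
    + (tensor (x 0) (x 0) - tensor (x n) (x n))"
    using sum_shift_tensor[of x n] by (simp add: algebra_simps)
  then have "(1 / real n) *\<^sub>R (\<Sum>t<n. tensor (x t) (x t)) = (1 / real n) *\<^sub>R ((A o\<^sub>L (\<Sum>t<n. tensor (x t) (x t)) o\<^sub>L A')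
    + (\<Sum>t<n. tensor (A (x t)) (e (Suc t))) + (\<Sum>t<n. tensor (e (Suc t)) (A (x t))) + (\<Sum>t<n. tensor (e (Suc t)) (e (Suc t)))
    + (tensor (x 0) (x 0) - tensor (x n) (x n)))" by (rule arg_cong)
  moreover have "(1 / real n) *\<^sub>R (A o\<^sub>L (\<Sum>t<n. tensor (x t) (x t)) o\<^sub>L A') = (A o\<^sub>L Gamma_hat n x o\<^sub>L A')"
    by (rule blinfun_eqI) (simp add: Gamma_hat_def blinfun.scaleR_left blinfun.scaleR_right)
  ultimately show ?thesis
    by (simp add: Gamma_hat_def noise_def cross_sum_def scaleR_add_right add.assoc)
qed

text \<open>The operator \<open>Q\<close> solves the normal equations on the range of the projection \<open>p\<close>, so the residuals are
  empirically uncorrelated with the projected data, and \<open>Q\<close> is a function of the projected data.\<close>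

lemma fitted_residual_uncorrelated:
  fixes Q Q' p :: "'h::{real_inner, banach} \<Rightarrow>\<^sub>L 'h"
  assumes adj: "\<And>u w. Q u \<bullet> w = u \<bullet> Q' w"
    and normal: "C_hat n x o\<^sub>L p = Q o\<^sub>L Gamma_hat n x" and proj: "\<And>u w. p u \<bullet> w = u \<bullet> p w" "Q o\<^sub>L p = Q"
  shows "cross_sum n (\<lambda>t. Q (x t)) (residual Q x) = 0"
proof -
  have "p (Q' w) = Q' w" for w
  proof (rule vector_eq_ldot[THEN iffD1], rule allI)
    fix u
    have "u \<bullet> p (Q' w) = Q (p u) \<bullet> w" by (simp add: adj proj(1)[symmetric])
    also have "Q (p u) = Q u" using proj(2) by (metis blinfun_apply_blinfun_compose)
    finally show "u \<bullet> p (Q' w) = u \<bullet> Q' w" by (simp add: adj)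
  qed
  then have *: "C_hat n x (Q' u) = Q (Gamma_hat n x (Q' u))" for u
    using normal by (metis blinfun_apply_blinfun_compose)
  show ?thesis
  proof (rule blinfun_eqI)
    fix u
    have "cross_sum n (\<lambda>t. Q (x t)) (residual Q x) u
      = (1 / real n) *\<^sub>R (\<Sum>t<n. (x t \<bullet> Q' u) *\<^sub>R x (Suc t)) - (1 / real n) *\<^sub>R (\<Sum>t<n. (x t \<bullet> Q' u) *\<^sub>R Q (x t))"
      by (simp add: cross_sum_def residual_def blinfun.scaleR_left blinfun.sum_left adj scaleR_diff_right sum_subtractf)
    also have "(1 / real n) *\<^sub>R (\<Sum>t<n. (x t \<bullet> Q' u) *\<^sub>R x (Suc t)) = C_hat n x (Q' u)"
      by (simp add: C_hat_def blinfun.scaleR_left blinfun.sum_left)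
    also have "(1 / real n) *\<^sub>R (\<Sum>t<n. (x t \<bullet> Q' u) *\<^sub>R Q (x t)) = Q (Gamma_hat n x (Q' u))"
      by (simp add: Gamma_hat_apply blinfun.scaleR_right blinfun.sum_right)
    finally show "cross_sum n (\<lambda>t. Q (x t)) (residual Q x) u = blinfun_apply 0 u" by (simp add: *)
  qed
qed

definition residual_mean :: "nat \<Rightarrow> ('h::real_inner \<Rightarrow>\<^sub>L 'h) \<Rightarrow> (nat \<Rightarrow> 'h) \<Rightarrow> 'h" where
  "residual_mean n Q x = (1 / real n) *\<^sub>R (\<Sum>i=1..n. residual Q x i)"

definition residual_cov :: "nat \<Rightarrow> ('h::real_inner \<Rightarrow>\<^sub>L 'h) \<Rightarrow> (nat \<Rightarrow> 'h) \<Rightarrow> ('h \<Rightarrow>\<^sub>L 'h)" where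
  "residual_cov n Q x = (1 / real n) *\<^sub>R (\<Sum>j=1..n. tensor (centered_residual n Q x j) (centered_residual n Q x j))"

text \<open>The error, of order \<open>1 / n\<close>, with which the empirical covariance of the data is the stationary covariance
  of the bootstrap process.\<close>

definition cov_bias :: "nat \<Rightarrow> ('h::real_inner \<Rightarrow>\<^sub>L 'h) \<Rightarrow> (nat \<Rightarrow> 'h) \<Rightarrow> ('h \<Rightarrow>\<^sub>L 'h)" where
  "cov_bias n Q x = tensor (residual_mean n Q x) (residual_mean n Q x)
     + (1 / real n) *\<^sub>R (tensor (x 0) (x 0) - tensor (x n) (x n))"

lemma sum_1_Suc: "(\<Sum>j=1..n. f j) = (\<Sum>t<n. f (Suc t))" for f :: "nat \<Rightarrow> 'b::comm_monoid_add"
  by (induction n) simp_all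

lemma centered_residual_sum:
  assumes "0 < n" shows "(\<Sum>j=1..n. centered_residual n Q x j) = 0"
  using assms by (simp add: centered_residual_def sum_subtractf sum_constant_scaleR)

lemma residual_cov_eq:
  assumes n: "0 < n"
  shows "residual_cov n Q x = (1 / real n) *\<^sub>R (\<Sum>j=1..n. tensor (residual Q x j) (residual Q x j))
     - tensor (residual_mean n Q x) (residual_mean n Q x)"
proof -
  let ?r = "residual Q x" and ?m = "residual_mean n Q x"
  have s: "(\<Sum>j=1..n. ?r j) = real n *\<^sub>R ?m" using n by (simp add: residual_mean_def)
  have c: "centered_residual n Q x j = ?r j - ?m" for j by (simp add: centered_residual_def residual_mean_def)
  have "(\<Sum>j=1..n. tensor (centered_residual n Q x j) (centered_residual n Q x j))
    = (\<Sum>j=1..n. tensor (?r j) (?r j) - tensor (?r j) ?m - tensor ?m (?r j) + tensor ?m ?m)"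
    by (intro sum.cong refl) (simp add: c tensor.diff_left tensor.diff_right)
  also have "\<dots> = (\<Sum>j=1..n. tensor (?r j) (?r j)) - tensor (\<Sum>j=1..n. ?r j) ?m - tensor ?m (\<Sum>j=1..n. ?r j) + real n *\<^sub>R tensor ?m ?m"
    by (simp add: sum.distrib sum_subtractf tensor.sum_left tensor.sum_right sum_constant_scaleR)
  also have "\<dots> = (\<Sum>j=1..n. tensor (?r j) (?r j)) - real n *\<^sub>R tensor ?m ?m"
    unfolding s by (simp add: tensor.scaleR_left tensor.scaleR_right)
  finally show ?thesis using n by (simp add: residual_cov_def scaleR_diff_right)
qed

text \<open>In the bootstrap, the empirical covariance of the data has the role that the true covariance has for the
  process: it satisfies the stationarity equation, as the mixed terms of fitted values and residuals vanish.\<close>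

lemma Gamma_hat_bootstrap_stationarity:
  fixes Q Q' p :: "'h::{real_inner, banach} \<Rightarrow>\<^sub>L 'h"
  assumes n: "0 < n" and adj: "\<And>u w. Q u \<bullet> w = u \<bullet> Q' w"
    and normal: "C_hat n x o\<^sub>L p = Q o\<^sub>L Gamma_hat n x" and proj: "\<And>u w. p u \<bullet> w = u \<bullet> p w" "Q o\<^sub>L p = Q"
  shows "Gamma_hat n x = (Q o\<^sub>L Gamma_hat n x o\<^sub>L Q') + residual_cov n Q x + cov_bias n Q x"
proof -
  have zero: "cross_sum n (\<lambda>t. Q (x t)) (residual Q x) = 0"
    by (rule fitted_residual_uncorrelated[OF adj normal proj])
  have "norm ((1 / real n) *\<^sub>R (\<Sum>t<n. tensor (residual Q x (Suc t)) (Q (x t))))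
      = norm (cross_sum n (\<lambda>t. Q (x t)) (residual Q x))"
    by (simp add: cross_sum_def norm_transpose_sum)
  then have zero': "(1 / real n) *\<^sub>R (\<Sum>t<n. tensor (residual Q x (Suc t)) (Q (x t))) = 0"
    by (simp only: zero norm_zero norm_eq_zero)
  have "Gamma_hat n x = (Q o\<^sub>L Gamma_hat n x o\<^sub>L Q') + noise n Q x (residual Q x)"
    by (rule Gamma_hat_autoregression[OF _ adj]) (simp add: residual_def)
  also have "noise n Q x (residual Q x) = (1 / real n) *\<^sub>R (\<Sum>t<n. tensor (residual Q x (Suc t)) (residual Q x (Suc t)))
     + (1 / real n) *\<^sub>R (tensor (x 0) (x 0) - tensor (x n) (x n))"
    unfolding noise_def zero zero' by simp
  finally show ?thesis
    unfolding residual_cov_eq[OF n] cov_bias_def sum_1_Suc by (simp add: add.assoc)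
qed

lemma stationarity_norm_le:
  fixes P P' H V :: "'h::real_inner \<Rightarrow>\<^sub>L 'h"
  assumes H: "H = (P o\<^sub>L H o\<^sub>L P') + V" and adj: "\<And>u w. P u \<bullet> w = u \<bullet> P' w"
    and \<rho>: "0 \<le> \<rho>" "\<rho> < 1" and P: "norm P \<le> \<rho>"
  shows "norm H \<le> 1 / (1 - \<rho>) * norm V"
proof -
  have "norm P' \<le> \<rho>"
    using norm_le_of_adjoint[of P' P] adj P by (metis inner_commute order_trans)
  then have P': "norm P' \<le> 1" using \<rho> by simp
  have "norm H \<le> norm (P o\<^sub>L H o\<^sub>L P') + norm V" using norm_triangle_ineq[of "P o\<^sub>L H o\<^sub>L P'" V] H by simp
  also have "norm (P o\<^sub>L H o\<^sub>L P') \<le> norm (P o\<^sub>L H) * norm P'" by (rule norm_blinfun_compose)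
  also have "\<dots> \<le> (norm P * norm H) * 1" by (intro mult_mono norm_blinfun_compose P') simp_all
  also have "\<dots> \<le> \<rho> * norm H" using mult_right_mono[OF P norm_ge_zero[of H]] by simp
  finally have "(1 - \<rho>) * norm H \<le> norm V" by (simp add: algebra_simps)
  then show ?thesis using \<rho> by (simp add: field_simps)
qed

text \<open>Solutions of the stationarity equation depend in a Lipschitz way on the contraction and on the
  inhomogeneous term. The left hand side is the form that the difference of two errors of autocovariances takes.\<close>

lemma stationarity_perturbation:
  fixes P Q P' Q' H H' V V' D :: "'h::real_inner \<Rightarrow>\<^sub>L 'h"
  assumes H: "H = (P o\<^sub>L H o\<^sub>L P') + V" and H': "H' = (Q o\<^sub>L H' o\<^sub>L Q') + V'"
    and adj: "\<And>u w. P u \<bullet> w = u \<bullet> P' w" "\<And>u w. Q u \<bullet> w = u \<bullet> Q' w"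
    and \<rho>: "0 \<le> \<rho>" "\<rho> < 1" and P: "norm P \<le> \<rho>" and Q: "norm Q \<le> \<rho>" and PQ: "norm (P - Q) \<le> \<eta>"
  defines "\<kappa> \<equiv> 1 / (1 - \<rho>)"
  shows "norm ((P o\<^sub>L H) - (Q o\<^sub>L H') + D) \<le> 3 * \<eta> * \<kappa>\<^sup>2 * norm V + \<kappa> * norm (V - V') + norm D"
proof -
  have adj': "P' u \<bullet> w = u \<bullet> P w" "Q' u \<bullet> w = u \<bullet> Q w" for u w
    using adj(1)[of w u] adj(2)[of w u] by (simp_all add: inner_commute)
  have P': "norm P' \<le> \<rho>" and Q': "norm Q' \<le> \<rho>"
    using norm_le_of_adjoint[OF adj'(1)] norm_le_of_adjoint[OF adj'(2)] P Q by auto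
  have PQ': "norm (P' - Q') \<le> \<eta>"
    using norm_le_of_adjoint[of "P' - Q'" "P - Q"] PQ
    by (simp add: blinfun.diff_left inner_diff_left inner_diff_right adj')
  have \<eta>: "0 \<le> \<eta>" using PQ norm_ge_zero order_trans by blast
  have \<kappa>: "\<kappa> \<ge> 1" "(1 - \<rho>) * \<kappa> = 1" using \<rho> by (simp_all add: \<kappa>_def)
  have nc: "norm (A o\<^sub>L B o\<^sub>L C) \<le> a * norm B * c" if "norm A \<le> a" "norm C \<le> c" for A B C :: "'h \<Rightarrow>\<^sub>L 'h" and a c
  proof -
    have a0: "0 \<le> a" using that(1) norm_ge_zero order_trans by blast
    have "norm (A o\<^sub>L B o\<^sub>L C) \<le> norm (A o\<^sub>L B) * norm C" by (rule norm_blinfun_compose)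
    also have "\<dots> \<le> (norm A * norm B) * norm C" by (intro mult_right_mono norm_blinfun_compose) simp
    also have "\<dots> \<le> (a * norm B) * c" using that a0 by (intro mult_mono) auto
    finally show ?thesis .
  qed
  have absorb: "y \<le> \<kappa> * z" if "y \<le> \<rho> * y * \<rho> + z" "0 \<le> y" for y z :: real
  proof -
    have "\<rho> * y * \<rho> \<le> \<rho> * y * 1" using \<rho> that(2) by (intro mult_left_mono) auto
    then have "(1 - \<rho>) * y \<le> z" using that(1) by (simp add: algebra_simps)
    then have "\<kappa> * ((1 - \<rho>) * y) \<le> \<kappa> * z" using \<kappa> by (intro mult_left_mono) auto
    moreover have "\<kappa> * ((1 - \<rho>) * y) = ((1 - \<rho>) * \<kappa>) * y" by (simp only: mult_ac)
    then have "\<kappa> * ((1 - \<rho>) * y) = y" using \<kappa>(2) by simp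
    ultimately show ?thesis by simp
  qed
  have "norm H \<le> norm (P o\<^sub>L H o\<^sub>L P') + norm V" using norm_triangle_ineq[of "P o\<^sub>L H o\<^sub>L P'" V] H by simp
  also have "norm (P o\<^sub>L H o\<^sub>L P') \<le> \<rho> * norm H * \<rho>" by (rule nc[OF P P'])
  finally have nH: "norm H \<le> \<kappa> * norm V" by (intro absorb) auto
  have "H - H' = ((P - Q) o\<^sub>L H o\<^sub>L P') + (Q o\<^sub>L H o\<^sub>L (P' - Q')) + (Q o\<^sub>L (H - H') o\<^sub>L Q') + (V - V')"
  proof (rule blinfun_eqI)
    fix u
    have h: "H u = P (H (P' u)) + V u" "H' u = Q (H' (Q' u)) + V' u"
      using arg_cong[OF H, of "\<lambda>A. A u"] arg_cong[OF H', of "\<lambda>A. A u"] by (simp_all add: blinfun.add_left)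
    show "(H - H') u = (((P - Q) o\<^sub>L H o\<^sub>L P') + (Q o\<^sub>L H o\<^sub>L (P' - Q')) + (Q o\<^sub>L (H - H') o\<^sub>L Q') + (V - V')) u"
      by (simp add: blinfun.diff_left blinfun.add_left blinfun.diff_right) (simp add: h)
  qed
  then have "norm (H - H') \<le> norm ((P - Q) o\<^sub>L H o\<^sub>L P') + norm (Q o\<^sub>L H o\<^sub>L (P' - Q')) + norm (Q o\<^sub>L (H - H') o\<^sub>L Q') + norm (V - V')"
    by (metis norm_add_leD norm_triangle_ineq norm_triangle_le add_mono order_refl)
  also have "\<dots> \<le> \<eta> * norm H * \<rho> + \<rho> * norm H * \<eta> + \<rho> * norm (H - H') * \<rho> + norm (V - V')"
    by (intro add_mono nc PQ P' Q PQ' Q') simp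
  finally have "norm (H - H') \<le> \<kappa> * (2 * \<eta> * norm H * \<rho> + norm (V - V'))"
    by (intro absorb) (simp_all add: algebra_simps)
  also have "\<dots> \<le> \<kappa> * (2 * \<eta> * (\<kappa> * norm V) * 1 + norm (V - V'))"
    using \<kappa> \<rho> \<eta> nH by (intro mult_left_mono add_mono mult_mono) auto
  finally have nHH: "norm (H - H') \<le> \<kappa> * (2 * \<eta> * (\<kappa> * norm V) + norm (V - V'))" by simp
  have "(P o\<^sub>L H) - (Q o\<^sub>L H') + D = ((P - Q) o\<^sub>L H) + (Q o\<^sub>L (H - H')) + D"
    by (rule blinfun_eqI) (simp add: blinfun.diff_left blinfun.add_left blinfun.diff_right)
  then have "norm ((P o\<^sub>L H) - (Q o\<^sub>L H') + D) \<le> norm ((P - Q) o\<^sub>L H) + norm (Q o\<^sub>L (H - H')) + norm D"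
    using norm_triangle_ineq[of "((P - Q) o\<^sub>L H) + (Q o\<^sub>L (H - H'))" D] norm_triangle_ineq[of "(P - Q) o\<^sub>L H" "Q o\<^sub>L (H - H')"] by simp
  also have "norm ((P - Q) o\<^sub>L H) \<le> \<eta> * (\<kappa> * norm V)"
    using norm_blinfun_compose[of "P - Q" H] mult_mono[OF PQ nH \<eta>] by simp
  also have "norm (Q o\<^sub>L (H - H')) \<le> 1 * (\<kappa> * (2 * \<eta> * (\<kappa> * norm V) + norm (V - V')))"
  proof -
    have "norm (Q o\<^sub>L (H - H')) \<le> norm Q * norm (H - H')" by (rule norm_blinfun_compose)
    also have "\<dots> \<le> 1 * (\<kappa> * (2 * \<eta> * (\<kappa> * norm V) + norm (V - V')))" using Q \<rho> nHH by (intro mult_mono) auto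
    finally show ?thesis .
  qed
  also have "\<eta> * (\<kappa> * norm V) + 1 * (\<kappa> * (2 * \<eta> * (\<kappa> * norm V) + norm (V - V'))) + norm D
    \<le> 3 * \<eta> * \<kappa>\<^sup>2 * norm V + \<kappa> * norm (V - V') + norm D"
  proof -
    have "\<kappa> * (\<eta> * norm V) \<le> \<kappa>\<^sup>2 * (\<eta> * norm V)"
      using \<kappa>(1) \<eta> mult_left_mono[of 1 \<kappa> \<kappa>] by (intro mult_right_mono) (auto simp: power2_eq_square)
    then show ?thesis by (simp add: algebra_simps power2_eq_square)
  qed
  finally show ?thesis by simp
qed

subsection \<open>Couplings\<close>

text \<open>Any coupling can be transported to the space of pairs of operators, with the largest
  \<open>\<sigma>\<close>-algebra that makes the transport measurable.\<close>

lemma mallows_sq_le_of_coupling: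
  fixes A B :: "'b \<Rightarrow> ('h::real_normed_vector \<Rightarrow>\<^sub>L 'h)"
  assumes N: "prob_space N" and A: "A \<in> borel_measurable N" and B: "B \<in> borel_measurable N"
    and AB: "(\<lambda>s. norm (A s - B s)) \<in> borel_measurable N"
  shows "mallows_sq (distr N borel A) (distr N borel B) \<le> (\<integral>\<^sup>+s. ennreal ((norm (A s - B s))\<^sup>2) \<partial>N)"
proof -
  define f where "f s = (A s, B s)" for s
  define S where "S = {T. f -` T \<inter> space N \<in> sets N}"
  define N' where "N' = distr N (sigma UNIV S) f"
  have f: "f \<in> measurable N (sigma UNIV S)" by (rule measurable_measure_of) (auto simp: S_def)
  have meas: "g \<in> borel_measurable N'" if "(\<lambda>s. g (f s)) \<in> borel_measurable N" for g :: "_ \<Rightarrow> 'c::topological_space"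
  proof (rule measurableI)
    fix T :: "'c set" assume "T \<in> sets borel"
    then have "(\<lambda>s. g (f s)) -` T \<inter> space N \<in> sets N" using that by (rule measurable_sets[rotated])
    then have "g -` T \<in> S" by (simp add: S_def vimage_def)
    then show "g -` T \<inter> space N' \<in> sets N'" by (simp add: N'_def)
  qed simp
  have m: "fst \<in> borel_measurable N'" "snd \<in> borel_measurable N'" "(\<lambda>p. norm (fst p - snd p)) \<in> borel_measurable N'"
    by (rule meas; use A B AB in \<open>simp add: f_def\<close>)+
  have "distr N' borel fst = distr N borel A" "distr N' borel snd = distr N borel B"
    using m f unfolding N'_def by (subst distr_distr; simp add: comp_def f_def)+
  moreover have "prob_space N'" unfolding N'_def by (rule prob_space.prob_space_distr[OF N f])
  ultimately have "mallows_coupling (distr N borel A) (distr N borel B) N' fst snd"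
    using m by (simp add: mallows_coupling_def)
  then have "mallows_sq (distr N borel A) (distr N borel B) \<le> (\<integral>\<^sup>+p. ennreal ((norm (fst p - snd p))\<^sup>2) \<partial>N')"
    unfolding mallows_sq_def by (intro INF_lower2[of "(N', fst, snd)"]) auto
  also have "\<dots> = (\<integral>\<^sup>+s. ennreal ((norm (A s - B s))\<^sup>2) \<partial>N)"
    using m(3) f unfolding N'_def by (subst nn_integral_distr) (auto simp: f_def)
  finally show ?thesis .
qed

lemma nn_integral_finite_range:
  assumes c: "c \<in> measurable G (count_space UNIV)" and fin: "finite_measure G"
    and le: "\<And>y. y \<in> space G \<Longrightarrow> c y \<le> (m::nat)" and h: "\<And>i. 0 \<le> h i"
  shows "(\<integral>\<^sup>+y. ennreal (h (c y)) \<partial>G) = ennreal (\<Sum>i\<le>m. h i * measure G {y\<in>space G. c y = i})"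
proof -
  interpret finite_measure G by fact
  have "(\<integral>\<^sup>+y. ennreal (h (c y)) \<partial>G) = (\<integral>\<^sup>+y. (\<Sum>i\<le>m. ennreal (h i) * indicator {y\<in>space G. c y = i} y) \<partial>G)"
  proof (rule nn_integral_cong)
    fix y assume y: "y \<in> space G"
    have "(\<Sum>i\<le>m. ennreal (h i) * indicator {y\<in>space G. c y = i} y) = (\<Sum>i\<le>m. if i = c y then ennreal (h (c y)) else 0)"
      using y by (intro sum.cong) (auto simp: indicator_def)
    then show "ennreal (h (c y)) = (\<Sum>i\<le>m. ennreal (h i) * indicator {y\<in>space G. c y = i} y)"
      using le[OF y] by simp
  qed
  also have "\<dots> = (\<Sum>i\<le>m. ennreal (h i) * emeasure G {y\<in>space G. c y = i})"
    using c by (subst nn_integral_sum) (auto simp: nn_integral_cmult_indicator)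
  also have "\<dots> = (\<Sum>i\<le>m. ennreal (h i * measure G {y\<in>space G. c y = i}))"
    using h by (intro sum.cong) (auto simp: emeasure_eq_measure ennreal_mult)
  also have "\<dots> = ennreal (\<Sum>i\<le>m. h i * measure G {y\<in>space G. c y = i})"
    using h by (intro sum_ennreal) auto
  finally show ?thesis .
qed

text \<open>Two probability measures whose spaces are divided into the same finite number of cells can be coupled
  such that the cells agree except on an event whose probability is at most the \<open>L\<^sup>1\<close> distance of the cell
  probabilities: the coupling is the density, with respect to the product measure, that redistributes the mass within
  each pair of cells according to the maximal coupling of the two cell distributions.\<close>

lemma cell_coupling:
  fixes c1 :: "'a \<Rightarrow> nat" and c2 :: "'b \<Rightarrow> nat"
  assumes F: "prob_space F" and G: "prob_space G"
    and c1 [measurable]: "c1 \<in> measurable F (count_space UNIV)" and c2 [measurable]: "c2 \<in> measurable G (count_space UNIV)"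
    and le1: "\<And>x. x \<in> space F \<Longrightarrow> c1 x \<le> m" and le2: "\<And>y. y \<in> space G \<Longrightarrow> c2 y \<le> m"
  obtains \<pi> where "sets \<pi> = sets (F \<Otimes>\<^sub>M G)" "prob_space \<pi>" "distr \<pi> F fst = F" "distr \<pi> G snd = G"
    "emeasure \<pi> {z\<in>space \<pi>. c1 (fst z) \<noteq> c2 (snd z)}
      \<le> ennreal (\<Sum>i\<le>m. \<bar>measure F {x\<in>space F. c1 x = i} - measure G {y\<in>space G. c2 y = i}\<bar>)"
proof -
  interpret F: prob_space F by fact
  interpret G: prob_space G by fact
  interpret FG: pair_prob_space F G ..
  define p where "p i = F.prob {x\<in>space F. c1 x = i}" for i
  define q where "q i = G.prob {y\<in>space G. c2 y = i}" for i
  define r where "r i = min (p i) (q i)" for i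
  define s where "s = 1 - (\<Sum>i\<le>m. r i)"
  \<comment> \<open>\<open>r\<close> is the common part of the two cell distributions and is placed on the diagonal; the remainders,
    of mass \<open>s\<close> each, are coupled independently. Division by 0 makes the second term vanish if \<open>s = 0\<close>.\<close>
  define g where "g i j = (if p i = 0 \<or> q j = 0 then 0
    else ((if i = j then r i else 0) + (p i - r i) * (q j - r j) / s) / (p i * q j))" for i j
  have fr1: "(\<integral>\<^sup>+x. ennreal (h (c1 x)) \<partial>F) = ennreal (\<Sum>i\<le>m. h i * p i)" if "\<And>i. 0 \<le> h i" for h
    unfolding p_def by (rule nn_integral_finite_range[OF c1 F.finite_measure_axioms le1 that])
  have fr2: "(\<integral>\<^sup>+y. ennreal (h (c2 y)) \<partial>G) = ennreal (\<Sum>i\<le>m. h i * q i)" if "\<And>i. 0 \<le> h i" for h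
    unfolding q_def by (rule nn_integral_finite_range[OF c2 G.finite_measure_axioms le2 that])
  have p1: "(\<Sum>i\<le>m. p i) = 1" using fr1[of "\<lambda>_. 1"] by (simp add: F.emeasure_space_1)
  have q1: "(\<Sum>i\<le>m. q i) = 1" using fr2[of "\<lambda>_. 1"] by (simp add: G.emeasure_space_1)
  have nn: "0 \<le> p i" "0 \<le> q i" "0 \<le> r i" "r i \<le> p i" "r i \<le> q i" for i by (auto simp: p_def q_def r_def)
  have s1: "(\<Sum>i\<le>m. p i - r i) = s" "(\<Sum>i\<le>m. q i - r i) = s" by (simp_all add: sum_subtractf p1 q1 s_def)
  have s0: "0 \<le> s" unfolding s1(1)[symmetric] using nn by (intro sum_nonneg) auto
  have zero: "p i - r i = 0" "q i - r i = 0" if "s = 0" "i \<le> m" for i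
    using s1 that nn sum_nonneg_eq_0_iff[of "{..m}" "\<lambda>i. p i - r i"] sum_nonneg_eq_0_iff[of "{..m}" "\<lambda>i. q i - r i"] by auto
  have g0: "0 \<le> g i j" for i j unfolding g_def using nn s0 by (auto intro!: divide_nonneg_nonneg add_nonneg_nonneg mult_nonneg_nonneg)
  have gq: "g i j * q j = ((if i = j then r i else 0) + (p i - r i) * (q j - r j) / s) / p i" if "p i \<noteq> 0" for i j
    using that nn[of j] by (auto simp: g_def r_def)
  have gp: "g i j * p i = ((if i = j then r i else 0) + (p i - r i) * (q j - r j) / s) / q j" if "q j \<noteq> 0" for i j
    using that nn[of i] by (auto simp: g_def r_def)
  have row: "(\<Sum>j\<le>m. g i j * q j) = 1" if "i \<le> m" "p i \<noteq> 0" for i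
  proof -
    have "(\<Sum>j\<le>m. g i j * q j) = ((\<Sum>j\<le>m. if i = j then r i else 0) + (p i - r i) * (\<Sum>j\<le>m. q j - r j) / s) / p i"
      by (simp add: gq[OF that(2)] sum_divide_distrib[symmetric] sum.distrib sum_distrib_left)
    also have "\<dots> = (r i + (p i - r i) * s / s) / p i" using that(1) s1 by simp
    also have "\<dots> = 1" using that zero[of i] by (cases "s = 0") auto
    finally show ?thesis .
  qed
  have col: "(\<Sum>i\<le>m. g i j * p i) = 1" if "j \<le> m" "q j \<noteq> 0" for j
  proof -
    have "(\<Sum>i\<le>m. g i j * p i) = ((\<Sum>i\<le>m. if i = j then r i else 0) + (\<Sum>i\<le>m. p i - r i) * (q j - r j) / s) / q j"
      by (simp add: gp[OF that(2)] sum_divide_distrib[symmetric] sum.distrib sum_distrib_right)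
    also have "\<dots> = (r j + s * (q j - r j) / s) / q j" using that(1) s1 by simp
    also have "\<dots> = 1" using that zero[of j] by (cases "s = 0") auto
    finally show ?thesis .
  qed
  define w where "w z = g (c1 (fst z)) (c2 (snd z))" for z
  have cells: "(\<lambda>z. (c1 (fst z), c2 (snd z))) \<in> measurable (F \<Otimes>\<^sub>M G) (count_space (UNIV :: (nat \<times> nat) set))"
  proof -
    have "(\<lambda>z. (c1 (fst z), c2 (snd z))) \<in> measurable (F \<Otimes>\<^sub>M G) (count_space UNIV \<Otimes>\<^sub>M count_space UNIV)" by measurable
    then show ?thesis by (simp add: pair_measure_countable)
  qed
  have [measurable]: "w \<in> borel_measurable (F \<Otimes>\<^sub>M G)"
  proof -
    have "(\<lambda>z. (\<lambda>(i, j). g i j) (c1 (fst z), c2 (snd z))) \<in> borel_measurable (F \<Otimes>\<^sub>M G)"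
      by (rule measurable_compose[OF cells]) simp
    then show ?thesis by (simp add: w_def[abs_def])
  qed
  define \<pi> where "\<pi> = density (F \<Otimes>\<^sub>M G) (\<lambda>z. ennreal (w z))"
  have AE1: "AE x in F. p (c1 x) \<noteq> 0"
  proof -
    have "AE x in F. \<forall>i\<in>{..m}. p i = 0 \<longrightarrow> c1 x \<noteq> i"
    proof (rule AE_finite_allI)
      fix i assume "i \<in> {..m}"
      show "AE x in F. p i = 0 \<longrightarrow> c1 x \<noteq> i"
      proof (cases "p i = 0")
        case True
        then have "AE x in F. \<not> c1 x = i"
          by (subst AE_iff_measurable[OF _ refl]) (auto simp: p_def F.emeasure_eq_measure)
        then show ?thesis by auto
      qed simp
    qed simp
    then show ?thesis using AE_space by eventually_elim (use le1 in auto)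
  qed
  have AE2: "AE y in G. q (c2 y) \<noteq> 0"
  proof -
    have "AE y in G. \<forall>i\<in>{..m}. q i = 0 \<longrightarrow> c2 y \<noteq> i"
    proof (rule AE_finite_allI)
      fix i assume "i \<in> {..m}"
      show "AE y in G. q i = 0 \<longrightarrow> c2 y \<noteq> i"
      proof (cases "q i = 0")
        case True
        then have "AE y in G. \<not> c2 y = i"
          by (subst AE_iff_measurable[OF _ refl]) (auto simp: q_def G.emeasure_eq_measure)
        then show ?thesis by auto
      qed simp
    qed simp
    then show ?thesis using AE_space by eventually_elim (use le2 in auto)
  qed
  have inner1: "(\<integral>\<^sup>+y. ennreal (g i (c2 y)) \<partial>G) = ennreal (\<Sum>j\<le>m. g i j * q j)" for i
    by (rule fr2) (rule g0)
  have inner2: "(\<integral>\<^sup>+x. ennreal (g (c1 x) j) \<partial>F) = ennreal (\<Sum>i\<le>m. g i j * p i)" for j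
    by (rule fr1) (rule g0)
  have meas1: "(\<lambda>y. ennreal (g i (c2 y))) \<in> borel_measurable G" for i
    by (rule measurable_compose[OF c2]) simp
  have meas2: "(\<lambda>x. ennreal (g (c1 x) j)) \<in> borel_measurable F" for j
    by (rule measurable_compose[OF c1]) simp
  have e1: "emeasure \<pi> (fst -` A \<inter> space \<pi>) = emeasure F A" if [measurable]: "A \<in> sets F" for A
  proof -
    have [measurable]: "fst -` A \<inter> space (F \<Otimes>\<^sub>M G) \<in> sets (F \<Otimes>\<^sub>M G)" by measurable
    have "emeasure \<pi> (fst -` A \<inter> space \<pi>) = (\<integral>\<^sup>+z. ennreal (w z) * indicator (fst -` A \<inter> space (F \<Otimes>\<^sub>M G)) z \<partial>(F \<Otimes>\<^sub>M G))"
      unfolding \<pi>_def by (subst emeasure_density) auto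
    also have "\<dots> = (\<integral>\<^sup>+z. indicator A (fst z) * ennreal (w z) \<partial>(F \<Otimes>\<^sub>M G))"
      by (intro nn_integral_cong) (auto simp: indicator_def)
    also have "\<dots> = (\<integral>\<^sup>+x. (\<integral>\<^sup>+y. indicator A x * ennreal (g (c1 x) (c2 y)) \<partial>G) \<partial>F)"
      by (subst G.nn_integral_fst[symmetric]) (auto simp: w_def)
    also have "\<dots> = (\<integral>\<^sup>+x. indicator A x * ennreal (\<Sum>j\<le>m. g (c1 x) j * q j) \<partial>F)"
      by (intro nn_integral_cong) (simp add: nn_integral_cmult[OF meas1] inner1)
    also have "\<dots> = (\<integral>\<^sup>+x. indicator A x \<partial>F)"
    proof (rule nn_integral_cong_AE)
      show "AE x in F. indicator A x * ennreal (\<Sum>j\<le>m. g (c1 x) j * q j) = indicator A x"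
        using AE1 AE_space by eventually_elim (simp add: row le1)
    qed
    finally show ?thesis by simp
  qed
  have e2: "emeasure \<pi> (snd -` A \<inter> space \<pi>) = emeasure G A" if [measurable]: "A \<in> sets G" for A
  proof -
    have [measurable]: "snd -` A \<inter> space (F \<Otimes>\<^sub>M G) \<in> sets (F \<Otimes>\<^sub>M G)" by measurable
    have "emeasure \<pi> (snd -` A \<inter> space \<pi>) = (\<integral>\<^sup>+z. ennreal (w z) * indicator (snd -` A \<inter> space (F \<Otimes>\<^sub>M G)) z \<partial>(F \<Otimes>\<^sub>M G))"
      unfolding \<pi>_def by (subst emeasure_density) auto
    also have "\<dots> = (\<integral>\<^sup>+z. indicator A (snd z) * ennreal (w z) \<partial>(F \<Otimes>\<^sub>M G))"
      by (intro nn_integral_cong) (auto simp: indicator_def)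
    also have "\<dots> = (\<integral>\<^sup>+y. (\<integral>\<^sup>+x. indicator A y * ennreal (g (c1 x) (c2 y)) \<partial>F) \<partial>G)"
      by (subst FG.nn_integral_snd[symmetric]) (auto simp: w_def)
    also have "\<dots> = (\<integral>\<^sup>+y. indicator A y * ennreal (\<Sum>i\<le>m. g i (c2 y) * p i) \<partial>G)"
      by (intro nn_integral_cong) (simp add: nn_integral_cmult[OF meas2] inner2)
    also have "\<dots> = (\<integral>\<^sup>+y. indicator A y \<partial>G)"
    proof (rule nn_integral_cong_AE)
      show "AE y in G. indicator A y * ennreal (\<Sum>i\<le>m. g i (c2 y) * p i) = indicator A y"
        using AE2 AE_space by eventually_elim (simp add: col le2)
    qed
    finally show ?thesis by simp
  qed
  have sets: "sets \<pi> = sets (F \<Otimes>\<^sub>M G)" by (simp add: \<pi>_def)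
  have m12 [measurable]: "fst \<in> measurable \<pi> F" "snd \<in> measurable \<pi> G"
    by (simp_all add: \<pi>_def)
  have "prob_space \<pi>"
  proof
    have "fst -` space F \<inter> space \<pi> = space \<pi>" by (auto simp: \<pi>_def space_pair_measure)
    then show "emeasure \<pi> (space \<pi>) = 1" using e1[of "space F"] F.emeasure_space_1 by simp
  qed
  moreover have "distr \<pi> F fst = F" by (rule measure_eqI) (auto simp: emeasure_distr e1)
  moreover have "distr \<pi> G snd = G" by (rule measure_eqI) (auto simp: emeasure_distr e2)
  moreover have "emeasure \<pi> {z\<in>space \<pi>. c1 (fst z) \<noteq> c2 (snd z)} \<le> ennreal (\<Sum>i\<le>m. \<bar>p i - q i\<bar>)"
  proof -
    define h where "h i j = (if i = j then 0 else g i j)" for i j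
    have h0: "0 \<le> h i j" for i j by (simp add: h_def g0)
    have "{z\<in>space (F \<Otimes>\<^sub>M G). c1 (fst z) \<noteq> c2 (snd z)}
      = (\<lambda>z. (c1 (fst z), c2 (snd z))) -` {(i, j). i \<noteq> j} \<inter> space (F \<Otimes>\<^sub>M G)" by auto
    then have [measurable]: "{z\<in>space (F \<Otimes>\<^sub>M G). c1 (fst z) \<noteq> c2 (snd z)} \<in> sets (F \<Otimes>\<^sub>M G)"
      using measurable_sets[OF cells, of "{(i, j). i \<noteq> j}"] by simp
    have "emeasure \<pi> {z\<in>space \<pi>. c1 (fst z) \<noteq> c2 (snd z)}
      = (\<integral>\<^sup>+z. ennreal (w z) * indicator {z\<in>space (F \<Otimes>\<^sub>M G). c1 (fst z) \<noteq> c2 (snd z)} z \<partial>(F \<Otimes>\<^sub>M G))"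
      unfolding \<pi>_def by (subst emeasure_density) auto
    also have "\<dots> = (\<integral>\<^sup>+x. (\<integral>\<^sup>+y. ennreal (w (x, y)) * indicator {z\<in>space (F \<Otimes>\<^sub>M G). c1 (fst z) \<noteq> c2 (snd z)} (x, y) \<partial>G) \<partial>F)"
      by (rule G.nn_integral_fst[symmetric]) measurable
    also have "\<dots> = (\<integral>\<^sup>+x. (\<integral>\<^sup>+y. ennreal (h (c1 x) (c2 y)) \<partial>G) \<partial>F)"
      by (intro nn_integral_cong) (auto simp: h_def w_def indicator_def space_pair_measure)
    also have "\<dots> = (\<integral>\<^sup>+x. ennreal (\<Sum>j\<le>m. h (c1 x) j * q j) \<partial>F)"
      by (rule nn_integral_cong) (rule fr2, rule h0)
    also have "\<dots> = ennreal (\<Sum>i\<le>m. (\<Sum>j\<le>m. h i j * q j) * p i)"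
      using fr1[of "\<lambda>i. \<Sum>j\<le>m. h i j * q j"] h0 nn by (simp add: sum_nonneg)
    also have "\<dots> \<le> ennreal (\<Sum>i\<le>m. \<Sum>j\<le>m. (p i - r i) * (q j - r j) / s)"
    proof (rule ennreal_leI, rule sum_mono)
      fix i
      have "h i j * q j * p i \<le> (p i - r i) * (q j - r j) / s" for j
      proof (cases "i = j \<or> p i = 0")
        case True
        have "0 \<le> (p i - r i) * (q j - r j) / s" using nn s0 by simp
        moreover have "h i j * q j * p i = 0" using True by (auto simp: h_def)
        ultimately show ?thesis by linarith
      next
        case False
        then show ?thesis using gq[of i j] by (simp add: h_def)
      qed
      then show "(\<Sum>j\<le>m. h i j * q j) * p i \<le> (\<Sum>j\<le>m. (p i - r i) * (q j - r j) / s)"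
        unfolding sum_distrib_right by (intro sum_mono) auto
    qed
    also have "(\<Sum>i\<le>m. \<Sum>j\<le>m. (p i - r i) * (q j - r j) / s) = (\<Sum>i\<le>m. p i - r i) * (\<Sum>j\<le>m. q j - r j) / s"
      by (simp only: sum_divide_distrib[symmetric] sum_product)
    also have "\<dots> = (\<Sum>i\<le>m. p i - r i)" unfolding s1 by simp
    also have "ennreal (\<Sum>i\<le>m. p i - r i) \<le> ennreal (\<Sum>i\<le>m. \<bar>p i - q i\<bar>)"
      by (intro ennreal_leI sum_mono) (auto simp: r_def)
    finally show ?thesis .
  qed
  ultimately show ?thesis using sets by (intro that) (auto simp: p_def q_def)
qed

lemma sum_fourth_le: "(a + b) ^ 4 \<le> 8 * a ^ 4 + 8 * (b::real) ^ 4"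
proof -
  have *: "(u + v)\<^sup>2 \<le> 2 * u\<^sup>2 + 2 * v\<^sup>2" for u v :: real
    using zero_le_power2[of "u - v"] unfolding power2_sum power2_diff by linarith
  have "(a + b) ^ 4 = ((a + b)\<^sup>2)\<^sup>2" by simp
  also have "\<dots> \<le> (2 * a\<^sup>2 + 2 * b\<^sup>2)\<^sup>2" by (intro power_mono *) simp
  also have "\<dots> \<le> 2 * (2 * a\<^sup>2)\<^sup>2 + 2 * (2 * b\<^sup>2)\<^sup>2" by (rule *)
  also have "\<dots> = 8 * a ^ 4 + 8 * b ^ 4" by (simp add: power_mult_distrib)
  finally show ?thesis .
qed

lemma norm_add_fourth_le:
  fixes x y :: "'v::real_normed_vector"
  shows "norm (x + y) ^ 4 \<le> 8 * norm x ^ 4 + 8 * norm y ^ 4"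
proof -
  have "norm (x + y) ^ 4 \<le> (norm x + norm y) ^ 4" by (intro power_mono norm_triangle_ineq) simp
  also have "\<dots> \<le> 8 * norm x ^ 4 + 8 * norm y ^ 4" by (rule sum_fourth_le)
  finally show ?thesis .
qed

lemma mean_le_distr_iff:
  assumes g: "g \<in> measurable M N" and f: "f \<in> borel_measurable N" and nn: "\<And>y. 0 \<le> f y"
  shows "mean_le (distr M N g) f a \<longleftrightarrow> mean_le M (\<lambda>x. f (g x)) a"
  using assms by (simp add: mean_le_def integrable_distr_eq integral_distr)

lemma integral_pmf_of_nat_interval:
  fixes f :: "nat \<Rightarrow> 'b::{banach, second_countable_topology}"
  assumes "0 < n"
  shows "(\<integral>j. f j \<partial>measure_pmf (pmf_of_set {1..n})) = (1 / real n) *\<^sub>R (\<Sum>j=1..n. f j)"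
  using assms
  by (subst integral_measure_pmf[of "{1..n}"]) (auto simp: scaleR_sum_right)

lemma mean_le_pmf_of_nat_interval:
  assumes n: "0 < n" and f: "\<And>j. 0 \<le> f j" and le: "(1 / real n) * (\<Sum>j=1..n. f j) \<le> a"
  shows "mean_le (measure_pmf (pmf_of_set {1..n})) f a"
  using f le integral_pmf_of_nat_interval[OF n, of f] n
  by (auto simp: mean_le_def intro!: integrable_measure_pmf_finite)

text \<open>Sampling an index uniformly means sampling from the empirical distribution of \<open>y 1, \<dots>, y n\<close>. Points
  in the same cell are at distance at most \<open>\<delta>\<close>, except in cell 0. Pairs in different cells, or in cell 0, have
  probability at most \<open>v\<close>, and for them the fourth power of the distance is split at the level \<open>R\<close>.\<close>

lemma empirical_coupling:
  fixes F :: "'h::{real_normed_vector, second_countable_topology} measure" and y :: "nat \<Rightarrow> 'h" and c :: "'h \<Rightarrow> nat"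
  defines "tail \<equiv> \<lambda>R x::'h. if norm x > R then norm x ^ 4 else 0"
  assumes F: "prob_space F" "sets F = sets borel" and n: "0 < n"
    and c: "c \<in> measurable borel (count_space UNIV)" and cm: "\<And>x. c x \<le> m"
    and close: "\<And>x x'. c x = c x' \<Longrightarrow> c x \<noteq> 0 \<Longrightarrow> dist x x' \<le> \<delta>"
    and T: "mean_le F (tail R) T" and \<delta>: "0 \<le> \<delta>" and R: "0 \<le> R"
    and v: "measure F {x. c x = 0} + (\<Sum>i\<le>m. \<bar>measure F {x. c x = i} - real (card {j\<in>{1..n}. c (y j) = i}) / real n\<bar>) \<le> v"
  obtains \<pi> where "sets \<pi> = sets (borel \<Otimes>\<^sub>M count_space UNIV)" "prob_space \<pi>"
    "distr \<pi> borel fst = F" "distr \<pi> (count_space UNIV) snd = measure_pmf (pmf_of_set {1..n})"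
    "mean_le \<pi> (\<lambda>z. norm (fst z - y (snd z)) ^ 4)
      (\<delta> ^ 4 + 16 * R ^ 4 * v + 8 * T + 8 * ((1 / real n) * (\<Sum>j=1..n. tail R (y j))))"
proof -
  interpret F: prob_space F by fact
  let ?G = "measure_pmf (pmf_of_set {1..n})"
  have sp: "space F = UNIV" using sets_eq_imp_space_eq[OF F(2)] by simp
  have cF: "c \<in> measurable F (count_space UNIV)" using c measurable_cong_sets[OF F(2) refl] by blast
  have q: "measure ?G {j\<in>space ?G. c (y j) = i} = real (card {j\<in>{1..n}. c (y j) = i}) / real n" for i
  proof -
    have "{1..n} \<inter> {j\<in>space ?G. c (y j) = i} = {j\<in>{1..n}. c (y j) = i}" by auto
    then show ?thesis using n by (subst measure_pmf_of_set) auto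
  qed
  obtain \<pi> where \<pi>: "sets \<pi> = sets (F \<Otimes>\<^sub>M ?G)" "prob_space \<pi>" "distr \<pi> F fst = F" "distr \<pi> ?G snd = ?G"
    "emeasure \<pi> {z\<in>space \<pi>. c (fst z) \<noteq> c (y (snd z))}
      \<le> ennreal (\<Sum>i\<le>m. \<bar>measure F {x\<in>space F. c x = i} - measure ?G {j\<in>space ?G. c (y j) = i}\<bar>)"
    using cell_coupling[OF F(1) measure_pmf.prob_space_axioms cF, of "\<lambda>j. c (y j)" "pmf_of_set {1..n}" m] cm by auto
  interpret \<pi>: prob_space \<pi> by fact
  have sets: "sets \<pi> = sets (borel \<Otimes>\<^sub>M count_space UNIV)"
    unfolding \<pi>(1) by (rule sets_pair_measure_cong) (auto simp: F(2))
  have space: "space \<pi> = UNIV" using sets_eq_imp_space_eq[OF sets] by (simp add: space_pair_measure)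
  have fst_m [measurable]: "fst \<in> measurable \<pi> borel" and snd_m [measurable]: "snd \<in> measurable \<pi> (count_space UNIV)"
    unfolding measurable_cong_sets[OF sets refl] by measurable
  have d1: "distr \<pi> borel fst = F" using \<pi>(3) by (subst (asm) distr_cong[OF refl F(2) refl])
  have d2: "distr \<pi> (count_space UNIV) snd = ?G" using \<pi>(4) by (subst (asm) distr_cong[of \<pi> \<pi> ?G "count_space UNIV"]) auto
  have y_m [measurable]: "(\<lambda>z. y (snd z)) \<in> borel_measurable \<pi>" by (rule measurable_compose[OF snd_m]) simp
  have tail_m: "tail R \<in> borel_measurable borel" unfolding tail_def by measurable
  define bad where "bad = {z. c (fst z) \<noteq> c (y (snd z))} \<union> {z. c (fst z) = 0}"
  have cf [measurable]: "(\<lambda>z. c (fst z)) \<in> measurable \<pi> (count_space UNIV)" by (rule measurable_compose[OF fst_m c])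
  have cy [measurable]: "(\<lambda>z. c (y (snd z))) \<in> measurable \<pi> (count_space UNIV)" by (rule measurable_compose[OF y_m c])
  have b1: "{z. c (fst z) \<noteq> c (y (snd z))} \<in> sets \<pi>" and b2: "{z. c (fst z) = 0} \<in> sets \<pi>"
  proof -
    have "(\<lambda>z. (c (fst z), c (y (snd z)))) \<in> measurable \<pi> (count_space UNIV \<Otimes>\<^sub>M count_space UNIV)"
      by (rule measurable_Pair[OF cf cy])
    then have "(\<lambda>z. (c (fst z), c (y (snd z)))) \<in> measurable \<pi> (count_space (UNIV :: (nat \<times> nat) set))"
      by (simp add: pair_measure_countable)
    from measurable_sets[OF this, of "{(i, j). i \<noteq> j}"]
    show "{z. c (fst z) \<noteq> c (y (snd z))} \<in> sets \<pi>" by (simp add: space vimage_def)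
    show "{z. c (fst z) = 0} \<in> sets \<pi>" using measurable_sets[OF cf, of "{0}"] by (simp add: space vimage_def)
  qed
  have bad_m [measurable]: "bad \<in> sets \<pi>" unfolding bad_def by (intro sets.Un b1 b2)
  have "\<pi>.prob bad \<le> v"
  proof -
    have "\<pi>.prob bad \<le> \<pi>.prob {z. c (fst z) \<noteq> c (y (snd z))} + \<pi>.prob {z. c (fst z) = 0}"
      unfolding bad_def by (rule measure_Un_le[OF b1 b2])
    moreover have "\<pi>.prob {z. c (fst z) \<noteq> c (y (snd z))}
      \<le> (\<Sum>i\<le>m. \<bar>measure F {x. c x = i} - real (card {j\<in>{1..n}. c (y j) = i}) / real n\<bar>)"
      using \<pi>(5) unfolding q by (simp add: space sp \<pi>.emeasure_eq_measure sum_nonneg)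
    moreover have "\<pi>.prob {z. c (fst z) = 0} = measure F {x. c x = 0}"
    proof -
      have "{x. c x = 0} \<in> sets (borel :: 'h measure)" using measurable_sets[OF c, of "{0}"] by (simp add: vimage_def)
      then show ?thesis unfolding d1[symmetric] by (subst measure_distr) (auto simp: vimage_def space)
    qed
    ultimately show ?thesis using v by linarith
  qed
  then have mbad: "mean_le \<pi> (\<lambda>z. indicator bad z) v"
    by (auto simp: mean_le_def space \<pi>.emeasure_eq_measure less_top intro!: integrable_real_indicator)
  have mT: "mean_le \<pi> (\<lambda>z. tail R (fst z)) T"
    using T unfolding d1[symmetric] by (subst (asm) mean_le_distr_iff[OF fst_m tail_m]) (auto simp: tail_def)
  have "mean_le ?G (\<lambda>j. tail R (y j)) ((1 / real n) * (\<Sum>j=1..n. tail R (y j)))"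
    by (rule mean_le_pmf_of_nat_interval[OF n]) (auto simp: tail_def)
  then have mY: "mean_le \<pi> (\<lambda>z. tail R (y (snd z))) ((1 / real n) * (\<Sum>j=1..n. tail R (y j)))"
    unfolding d2[symmetric] by (subst (asm) mean_le_distr_iff[OF snd_m]) (auto simp: tail_def)
  have "mean_le \<pi> (\<lambda>z. \<delta> ^ 4 + 16 * R ^ 4 * indicator bad z + 8 * tail R (fst z) + 8 * tail R (y (snd z)))
     (\<delta> ^ 4 + 16 * R ^ 4 * v + 8 * T + 8 * ((1 / real n) * (\<Sum>j=1..n. tail R (y j))))"
    by (intro mean_le_add mean_le_cmult \<pi>.mean_le_const mbad mT mY) (use \<delta> R in auto)
  then have "mean_le \<pi> (\<lambda>z. norm (fst z - y (snd z)) ^ 4)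
      (\<delta> ^ 4 + 16 * R ^ 4 * v + 8 * T + 8 * ((1 / real n) * (\<Sum>j=1..n. tail R (y j))))"
  proof (rule mean_le_mono)
    fix z
    have t0: "0 \<le> tail R x" for x by (simp add: tail_def)
    show "norm (fst z - y (snd z)) ^ 4 \<le> \<delta> ^ 4 + 16 * R ^ 4 * indicator bad z + 8 * tail R (fst z) + 8 * tail R (y (snd z))"
    proof (cases "z \<in> bad")
      case False
      then have "dist (fst z) (y (snd z)) \<le> \<delta>" by (intro close) (auto simp: bad_def)
      then have "norm (fst z - y (snd z)) ^ 4 \<le> \<delta> ^ 4" by (intro power_mono) (auto simp: dist_norm)
      then show ?thesis using False t0[of "fst z"] t0[of "y (snd z)"] by simp
    next
      case True
      have t: "norm x ^ 4 \<le> R ^ 4 + tail R x" for x :: 'h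
        using R by (auto simp: tail_def intro: power_mono)
      have "norm (fst z - y (snd z)) ^ 4 \<le> 8 * norm (fst z) ^ 4 + 8 * norm (y (snd z)) ^ 4"
        using norm_add_fourth_le[of "fst z" "- y (snd z)"] by simp
      also have "\<dots> \<le> 8 * (R ^ 4 + tail R (fst z)) + 8 * (R ^ 4 + tail R (y (snd z)))"
        by (intro add_mono mult_left_mono t) auto
      also have "\<dots> \<le> \<delta> ^ 4 + 16 * R ^ 4 + 8 * tail R (fst z) + 8 * tail R (y (snd z))"
        using zero_le_power[OF \<delta>, of 4] unfolding distrib_left by linarith
      finally show ?thesis using True by simp
    qed
  qed auto
  then show ?thesis using that sets \<pi>(2) d1 d2 by blast
qed

lemma measurable_C_hat_diff:
  fixes z :: "'b \<Rightarrow> nat \<Rightarrow> 'h::{real_inner, second_countable_topology}"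
  assumes z: "\<And>t. t \<le> n \<Longrightarrow> (\<lambda>\<omega>. z \<omega> t) \<in> borel_measurable M"
  shows "(\<lambda>\<omega>. C_hat n (z \<omega>) - K) \<in> borel_measurable M"
proof -
  define z' where "z' \<omega> t = (if t \<le> n then z \<omega> t else 0)" for \<omega> t
  have "(\<lambda>\<omega>. z' \<omega> t) \<in> borel_measurable M" for t
    using z[of t] by (cases "t \<le> n") (simp_all add: z'_def)
  then have z': "z' \<in> borel_measurable M" by (rule measurable_coordinatewise_then_product)
  have "continuous_on UNIV (\<lambda>x. C_hat n x - K)"
    unfolding C_hat_def by (intro continuous_intros tensor.continuous_on continuous_on_product_coordinates)
  then have "(\<lambda>x. C_hat n x - K) \<in> borel_measurable borel" by (rule borel_measurable_continuous_onI)
  from measurable_compose[OF z' this] have "(\<lambda>\<omega>. C_hat n (z' \<omega>) - K) \<in> borel_measurable M" .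
  moreover have "C_hat n (z' \<omega>) = C_hat n (z \<omega>)" for \<omega>
    by (auto simp: C_hat_def z'_def intro!: sum.cong)
  ultimately show ?thesis by simp
qed

lemma (in prob_space) distr_indep_sequence:
  assumes ind: "indep_vars (\<lambda>_. borel) Z I" and I: "I \<noteq> {}"
    and rv: "\<And>i. Z i \<in> borel_measurable M" and law: "\<And>i. i \<in> I \<Longrightarrow> distr M borel (Z i) = D i"
  shows "distr M (PiM I (\<lambda>_. borel)) (\<lambda>\<omega>. \<lambda>i\<in>I. Z i \<omega>) = PiM I D"
proof -
  have "distr M (PiM I (\<lambda>_. borel)) (\<lambda>\<omega>. \<lambda>i\<in>I. Z i \<omega>) = PiM I (\<lambda>i. distr M borel (Z i))"
    using indep_vars_iff_distr_eq_PiM[OF I, where M' = "\<lambda>_. borel" and X = Z] ind rv by simp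
  also have "\<dots> = PiM I D" using law by (intro PiM_cong) auto
  finally show ?thesis .
qed

text \<open>The path of the bootstrap process is a function of the innovations at times \<open>1, \<dots>, n\<close> only; any
  independent sequence with the same marginals has the law of the bootstrap estimate.\<close>

lemma (in prob_space) distr_bootstrap:
  fixes E :: "nat \<Rightarrow> 'a \<Rightarrow> 'h::{real_inner, second_countable_topology}" and Q K :: "'h \<Rightarrow>\<^sub>L 'h" and G :: "'h pmf"
  assumes ind: "indep_vars (\<lambda>_. borel) E {1..n}" and rv: "\<And>i. E i \<in> borel_measurable M"
    and law: "\<And>i. i \<in> {1..n} \<Longrightarrow> distr M borel (E i) = distr (measure_pmf G) borel (\<lambda>x. x)" and n: "0 < n"
  shows "distr M borel (\<lambda>\<omega>. C_hat n (boot_path Q x0 (\<lambda>i. E i \<omega>)) - K)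
    = distr (measure_pmf (Pi_pmf {1..n} 0 (\<lambda>_. G))) borel (\<lambda>e. C_hat n (boot_path Q x0 e) - K)"
proof -
  let ?Pi = "measure_pmf (Pi_pmf {1..n} 0 (\<lambda>_. G))" and ?B = "PiM {1..n} (\<lambda>_. borel :: 'h measure)"
  define h where "h f = C_hat n (boot_path Q x0 f) - K" for f
  have path: "boot_path Q x0 (restrict f {1..n}) t = boot_path Q x0 f t" if "t \<le> n" for f t
    using that by (induction t) auto
  have C: "C_hat n (boot_path Q x0 (restrict f {1..n})) = C_hat n (boot_path Q x0 f)" for f
    unfolding C_hat_def by (intro arg_cong[of _ _ "\<lambda>x. (1 / real n) *\<^sub>R x"] sum.cong refl)
      (simp add: path del: boot_path.simps One_nat_def)
  have h: "h (restrict f {1..n}) = h f" for f unfolding h_def C ..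
  have hm: "h \<in> borel_measurable ?B"
    unfolding h_def[abs_def]
  proof (rule measurable_C_hat_diff)
    fix t assume "t \<le> n"
    then show "(\<lambda>f. boot_path Q x0 f t) \<in> borel_measurable ?B"
    proof (induction t)
      case (Suc t)
      have 1: "(\<lambda>f. boot_path Q x0 f t) \<in> borel_measurable ?B" using Suc by simp
      have "(\<lambda>f. Q (boot_path Q x0 f t)) \<in> borel_measurable ?B"
        by (rule measurable_compose[OF 1]) (auto intro!: borel_measurable_continuous_onI continuous_intros)
      moreover have "(\<lambda>f. f (Suc t)) \<in> borel_measurable ?B"
        using Suc.prems by (intro measurable_component_singleton) auto
      ultimately show ?case by simp
    qed simp
  qed
  have ne: "{1..n} \<noteq> {}" using n by auto
  have L: "distr M ?B (\<lambda>\<omega>. \<lambda>i\<in>{1..n}. E i \<omega>) = PiM {1..n} (\<lambda>_. distr (measure_pmf G) borel (\<lambda>x. x))"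
    by (rule distr_indep_sequence[OF ind ne rv law])
  note Pi = measure_pmf.prob_space_axioms[of "Pi_pmf {1..n} 0 (\<lambda>_. G)"]
  have "prob_space.indep_vars ?Pi (\<lambda>_. borel) (\<lambda>i f. (\<lambda>x. x) (f i)) {1..n}"
    by (rule prob_space.indep_vars_compose2[OF Pi indep_vars_Pi_pmf]) auto
  then have ind': "prob_space.indep_vars ?Pi (\<lambda>_. borel) (\<lambda>i f. f i) {1..n}" by simp
  have law': "distr ?Pi borel (\<lambda>f. f i) = distr (measure_pmf G) borel (\<lambda>x. x)" if "i \<in> {1..n}" for i
  proof -
    have "measure_pmf G = distr ?Pi (count_space UNIV) (\<lambda>f. f i)"
      using Pi_pmf_component[of "{1..n}" i 0 "\<lambda>_. G"] that by (simp add: map_pmf_rep_eq[symmetric])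
    then show ?thesis by (simp add: distr_distr comp_def)
  qed
  have R: "distr ?Pi ?B (\<lambda>f. \<lambda>i\<in>{1..n}. f i) = PiM {1..n} (\<lambda>_. distr (measure_pmf G) borel (\<lambda>x. x))"
    by (rule prob_space.distr_indep_sequence[OF Pi ind' ne _ law']) auto
  have m1: "(\<lambda>\<omega>. \<lambda>i\<in>{1..n}. E i \<omega>) \<in> measurable M ?B" by (intro measurable_restrict rv)
  have m2: "(\<lambda>f. \<lambda>i\<in>{1..n}. f i) \<in> measurable ?Pi ?B" by (auto simp: space_PiM)
  have "distr M borel (\<lambda>\<omega>. h (\<lambda>i. E i \<omega>)) = distr (distr M ?B (\<lambda>\<omega>. \<lambda>i\<in>{1..n}. E i \<omega>)) borel h"
    unfolding distr_distr[OF hm m1] by (simp only: comp_def h)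
  also have "\<dots> = distr (distr ?Pi ?B (\<lambda>f. \<lambda>i\<in>{1..n}. f i)) borel h" unfolding L R ..
  also have "\<dots> = distr ?Pi borel h" unfolding distr_distr[OF hm m2] by (simp only: comp_def h)
  finally show ?thesis by (simp add: h_def[abs_def])
qed

text \<open>The constant that results from the bounds of the coupled path locale: 4 comes from squaring a
  sum of four terms, \<open>9 * \<kappa> ^ 4\<close> the square of its factor \<open>3 * \<kappa>\<^sup>2\<close>, 248 and 10 are the constants of
  \<open>noise_coupling\<close> and \<open>cross_sum_coupling\<close>, and \<open>4 * (1 + m)\<^sup>2\<close> bounds \<open>theta\<close> for the comparison with the path 0.\<close>

definition boot_const :: "real \<Rightarrow> real \<Rightarrow> real" where
  "boot_const \<rho> m = (let \<kappa> = 1 / (1 - \<rho>); q = (\<kappa> ^ 4 * (1 + m))\<^sup>2 * \<kappa>\<^sup>2 in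
     4 * (9 * \<kappa> ^ 4 * (248 * (q * (4 * (1 + m)\<^sup>2))) + \<kappa>\<^sup>2 * (248 * q) + \<kappa>\<^sup>2 + 10 * q))"

text \<open>The product of copies of the coupling \<open>\<pi>\<close> of the innovation laws carries the process and its bootstrap
  version at once. The error of the autocovariance is in both cases the same Lipschitz function of the operator, of
  the centered noise and of the cross sum, by \<open>stationarity_perturbation\<close>, and these are close by
  \<open>noise_coupling\<close> and \<open>cross_sum_coupling\<close>. The factor of \<open>\<eta>\<close> is the noise of the process itself; it is bounded
  by a second instance of the locale in which the second path is 0.\<close>

lemma bootstrap_bound:
  fixes \<Psi> \<Psi>' Q p \<Gamma> S1 :: "'h::{real_inner, banach, second_countable_topology} \<Rightarrow>\<^sub>L 'h"
    and B :: "'h set" and \<mu>0 F :: "'h measure" and \<pi> :: "('h \<times> nat) measure" and x :: "nat \<Rightarrow> 'h"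
  assumes B: "orthonormal_basis B"
    and \<mu>0: "prob_space \<mu>0" "sets \<mu>0 = sets borel" "mean_le \<mu>0 (\<lambda>x. norm x ^ 4) m"
    and F: "prob_space F" "sets F = sets borel" "mean_le F (\<lambda>x. norm x ^ 4) m" "(\<integral>x. x \<partial>F) = 0"
    and S1: "\<And>u. (\<integral>x. (x \<bullet> u) *\<^sub>R x \<partial>F) = S1 u"
    and \<pi>: "prob_space \<pi>" "sets \<pi> = sets (borel \<Otimes>\<^sub>M count_space UNIV)" "distr \<pi> borel fst = F"
      "distr \<pi> (count_space UNIV) snd = measure_pmf (pmf_of_set {1..n})"
      "mean_le \<pi> (\<lambda>z. norm (fst z - centered_residual n Q x (snd z)) ^ 4) (\<tau>\<^sup>2)"
    and x0: "norm x0 ^ 4 \<le> m" and res: "(1 / real n) * (\<Sum>j=1..n. norm (centered_residual n Q x j) ^ 4) \<le> m"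
    and \<rho>: "0 \<le> \<rho>" "\<rho> < 1" and \<Psi>: "norm \<Psi> \<le> \<rho>" and Q: "norm Q \<le> \<rho>" and PQ: "norm (\<Psi> - Q) \<le> \<eta>" and \<tau>: "0 < \<tau>"
    and adj: "\<And>u w. \<Psi> u \<bullet> w = u \<bullet> \<Psi>' w" and \<Gamma>: "\<Gamma> = (\<Psi> o\<^sub>L \<Gamma> o\<^sub>L \<Psi>') + S1"
    and normal: "C_hat n x o\<^sub>L p = Q o\<^sub>L Gamma_hat n x" and proj: "\<And>u w. p u \<bullet> w = u \<bullet> p w" "Q o\<^sub>L p = Q"
    and n: "0 < n"
  shows "ennreal (real n) * mallows_sq
      (distr (PiM UNIV (\<lambda>i::nat. if i = 0 then \<mu>0 else F)) borel (\<lambda>e. C_hat n (boot_path \<Psi> (e 0) e) - (\<Psi> o\<^sub>L \<Gamma>)))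
      (distr (measure_pmf (Pi_pmf {1..n} 0 (\<lambda>_. F_hat n Q x))) borel (\<lambda>e. C_hat n (boot_path Q x0 e) - (C_hat n x o\<^sub>L p)))
    \<le> ennreal (boot_const \<rho> m * (\<eta>\<^sup>2 + \<tau> + \<tau>\<^sup>2 + 1 / real n + real n * (norm (cov_bias n Q x))\<^sup>2))"
proof -
  let ?G = "measure_pmf (pmf_of_set {1..n})" and ?cr = "centered_residual n Q x"
  interpret \<mu>0: prob_space \<mu>0 by fact
  interpret F: prob_space F by fact
  interpret \<pi>: prob_space \<pi> by fact
  have fst_m: "fst \<in> measurable \<pi> borel" and snd_m: "snd \<in> measurable \<pi> (count_space UNIV)"
    unfolding measurable_cong_sets[OF \<pi>(2) refl] by measurable
  have cr_m: "(\<lambda>z. ?cr (snd z)) \<in> borel_measurable \<pi>" by (rule measurable_compose[OF snd_m]) simp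
  have cm: "fst \<in> borel_measurable (borel :: ('h \<times> 'h) measure)" "snd \<in> borel_measurable (borel :: ('h \<times> 'h) measure)"
    by (auto intro!: borel_measurable_continuous_onI continuous_intros)
  define J where "J z = (fst z, ?cr (snd z))" for z :: "'h \<times> nat"
  have J: "J \<in> measurable \<pi> borel"
    unfolding J_def[abs_def] borel_prod[symmetric] using fst_m cr_m by measurable
  have J0: "(\<lambda>y. (y, x0)) \<in> measurable \<mu>0 borel"
    unfolding measurable_cong_sets[OF \<mu>0(2) refl] by (intro borel_measurable_continuous_onI continuous_intros)
  \<comment> \<open>the joint laws of the inputs; the bootstrap process starts at the constant \<open>x0\<close>\<close>
  define D where "D i = (if i = 0 then distr \<mu>0 borel (\<lambda>y. (y, x0)) else distr \<pi> borel J)" for i :: nat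
  have D: "prob_space (D i)" "sets (D i) = sets borel" for i
    by (simp_all add: D_def \<mu>0.prob_space_distr[OF J0] \<pi>.prob_space_distr[OF J])
  define N where "N = PiM UNIV D"
  interpret N: prob_space N unfolding N_def by (intro prob_space_PiM D)
  have setsN: "sets N = sets (PiM UNIV (\<lambda>_::nat. borel :: ('h \<times> 'h) measure))"
    unfolding N_def by (intro sets_PiM_cong refl D)
  have coord [measurable]: "(\<lambda>\<omega>. \<omega> i) \<in> borel_measurable N" for i
    unfolding measurable_cong_sets[OF setsN refl] by (rule measurable_component_singleton) simp
  have lawD: "distr N borel (\<lambda>\<omega>. \<omega> i) = D i" for i
  proof -
    have "distr N borel (\<lambda>\<omega>. \<omega> i) = distr N (D i) (\<lambda>\<omega>. \<omega> i)" by (rule distr_cong) (simp_all add: D)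
    then show ?thesis unfolding N_def using distr_PiM_component[of UNIV D i] D by simp
  qed
  have ind0: "N.indep_vars (\<lambda>_. borel) (\<lambda>i \<omega>. \<omega> i) UNIV"
  proof (subst N.indep_vars_iff_distr_eq_PiM)
    have "distr N (PiM UNIV (\<lambda>_. borel)) (\<lambda>x. \<lambda>i\<in>UNIV. x i) = distr N N (\<lambda>x. x)"
      by (rule distr_cong) (simp_all add: setsN restrict_def)
    also have "\<dots> = N" by simp
    also have "\<dots> = PiM UNIV (\<lambda>i. distr N borel (\<lambda>\<omega>. \<omega> i))" unfolding lawD by (rule N_def)
    finally show "distr N (PiM UNIV (\<lambda>_. borel)) (\<lambda>x. \<lambda>i\<in>UNIV. x i) = PiM UNIV (\<lambda>i. distr N borel (\<lambda>\<omega>. \<omega> i))" .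
  qed simp_all
  define \<zeta> where "\<zeta> i \<omega> = (if i = 0 then (fst (\<omega> i), x0) else \<omega> i)" for i and \<omega> :: "nat \<Rightarrow> 'h \<times> 'h"
  define \<zeta>' where "\<zeta>' i \<omega> = (fst (\<omega> i), 0 :: 'h)" for i and \<omega> :: "nat \<Rightarrow> 'h \<times> 'h"
  have ind: "N.indep_vars (\<lambda>_. borel) \<zeta> UNIV"
  proof -
    have "N.indep_vars (\<lambda>_. borel) (\<lambda>i \<omega>. (\<lambda>z. if i = 0 then (fst z, x0) else z) (\<omega> i)) UNIV"
    proof (rule N.indep_vars_compose2[OF ind0])
      fix i :: nat
      show "(\<lambda>z. if i = 0 then (fst z, x0) else z) \<in> measurable borel (borel :: ('h \<times> 'h) measure)"
        by (cases "i = 0") (auto intro!: borel_measurable_continuous_onI continuous_intros)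
    qed
    then show ?thesis by (simp add: \<zeta>_def[abs_def])
  qed
  have ind': "N.indep_vars (\<lambda>_. borel) \<zeta>' UNIV"
  proof -
    have "N.indep_vars (\<lambda>_. borel) (\<lambda>i \<omega>. (\<lambda>z. (fst z, 0)) (\<omega> i)) UNIV"
      by (rule N.indep_vars_compose2[OF ind0]) (auto intro!: borel_measurable_continuous_onI continuous_intros)
    then show ?thesis by (simp add: \<zeta>'_def[abs_def])
  qed
  have law1: "distr N borel (\<lambda>\<omega>. fst (\<omega> i)) = (if i = 0 then \<mu>0 else F)" for i
  proof -
    have "distr N borel (\<lambda>\<omega>. fst (\<omega> i)) = distr (D i) borel fst"
      unfolding lawD[symmetric] by (subst distr_distr[OF cm(1) coord]) (simp add: comp_def)
    also have "\<dots> = (if i = 0 then \<mu>0 else F)"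
    proof (cases "i = 0")
      case True
      then have "distr (D i) borel fst = distr \<mu>0 borel (\<lambda>y. y)"
        unfolding D_def using distr_distr[OF cm(1) J0] by (simp add: comp_def)
      also have "\<dots> = \<mu>0" using \<mu>0(2) by (simp add: distr_cong[OF refl \<mu>0(2)[symmetric] refl])
      finally show ?thesis using True by simp
    next
      case False
      then show ?thesis unfolding D_def using distr_distr[OF cm(1) J] by (simp add: comp_def J_def \<pi>(3))
    qed
    finally show ?thesis .
  qed
  have law2: "distr N borel (\<lambda>\<omega>. snd (\<omega> i)) = distr ?G borel ?cr" if "i \<noteq> 0" for i
  proof -
    have "distr N borel (\<lambda>\<omega>. snd (\<omega> i)) = distr (D i) borel snd"
      unfolding lawD[symmetric] by (subst distr_distr[OF cm(2) coord]) (simp add: comp_def)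
    also have "\<dots> = distr \<pi> borel (\<lambda>z. ?cr (snd z))"
      unfolding D_def using that distr_distr[OF cm(2) J] by (simp add: comp_def J_def)
    also have "\<dots> = distr ?G borel ?cr"
      unfolding \<pi>(4)[symmetric] by (subst distr_distr[OF _ snd_m]) (simp_all add: comp_def)
    finally show ?thesis .
  qed
  have f1 [measurable]: "(\<lambda>\<omega>. fst (\<omega> i)) \<in> borel_measurable N" for i by (rule measurable_compose[OF coord cm(1)])
  have f2 [measurable]: "(\<lambda>\<omega>. snd (\<omega> i)) \<in> borel_measurable N" for i by (rule measurable_compose[OF coord cm(2)])
  have n4: "(\<lambda>y::'h. norm y ^ 4) \<in> borel_measurable borel" by measurable
  have quad: "(\<lambda>y::'h. (y \<bullet> u) *\<^sub>R y) \<in> borel_measurable borel" for u by measurable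
  have mom1: "mean_le N (\<lambda>\<omega>. norm (fst (\<omega> i)) ^ 4) m" for i
    using mean_le_distr_iff[OF f1[of i] n4, of m] law1[of i] \<mu>0(3) F(3) by (cases "i = 0") simp_all
  have mom2: "mean_le N (\<lambda>\<omega>. norm (snd (\<omega> i)) ^ 4) m" if "i \<noteq> 0" for i
  proof -
    have "mean_le ?G (\<lambda>j. norm (?cr j) ^ 4) m" by (rule mean_le_pmf_of_nat_interval[OF n _ res]) simp
    then have "mean_le (distr ?G borel ?cr) (\<lambda>y. norm y ^ 4) m" by (subst mean_le_distr_iff[OF _ n4]) simp_all
    then show ?thesis using mean_le_distr_iff[OF f2[of i] n4, of m] law2[OF that] by simp
  qed
  have mean1: "(\<integral>\<omega>. fst (\<omega> i) \<partial>N) = 0" "(\<integral>\<omega>. (fst (\<omega> i) \<bullet> u) *\<^sub>R fst (\<omega> i) \<partial>N) = S1 u" if "i \<noteq> 0" for i u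
    using integral_distr[OF f1[of i], of "\<lambda>y. y"] integral_distr[OF f1[of i] quad, of u] law1[of i] that F(4) S1[of u] by simp_all
  have mean2: "(\<integral>\<omega>. snd (\<omega> i) \<partial>N) = 0" "(\<integral>\<omega>. (snd (\<omega> i) \<bullet> u) *\<^sub>R snd (\<omega> i) \<partial>N) = residual_cov n Q x u" if "i \<noteq> 0" for i u
  proof -
    have "(\<integral>\<omega>. snd (\<omega> i) \<partial>N) = (\<integral>j. ?cr j \<partial>?G)"
      using integral_distr[OF f2[of i], of "\<lambda>y. y"] integral_distr[of ?cr ?G borel "\<lambda>y. y"] law2[OF that] by simp
    then show "(\<integral>\<omega>. snd (\<omega> i) \<partial>N) = 0"
      unfolding integral_pmf_of_nat_interval[OF n] centered_residual_sum[OF n] by simp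
    have "(\<integral>\<omega>. (snd (\<omega> i) \<bullet> u) *\<^sub>R snd (\<omega> i) \<partial>N) = (\<integral>j. (?cr j \<bullet> u) *\<^sub>R ?cr j \<partial>?G)"
      using integral_distr[OF f2[of i] quad, of u] integral_distr[OF _ quad, of ?cr ?G u] law2[OF that] by simp
    then show "(\<integral>\<omega>. (snd (\<omega> i) \<bullet> u) *\<^sub>R snd (\<omega> i) \<partial>N) = residual_cov n Q x u"
      unfolding integral_pmf_of_nat_interval[OF n]
      by (simp add: residual_cov_def blinfun.scaleR_left blinfun.sum_left)
  qed
  have d4: "(\<lambda>z::'h \<times> 'h. norm (fst z - snd z) ^ 4) \<in> borel_measurable borel"
    by (intro borel_measurable_continuous_onI continuous_intros)
  have mdiff: "mean_le N (\<lambda>\<omega>. norm (fst (\<omega> i) - snd (\<omega> i)) ^ 4) (\<tau>\<^sup>2)" if "i \<noteq> 0" for i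
  proof -
    have "mean_le (distr \<pi> borel J) (\<lambda>z. norm (fst z - snd z) ^ 4) (\<tau>\<^sup>2)"
      using \<pi>(5) by (subst mean_le_distr_iff[OF J d4]) (simp_all add: J_def)
    then show ?thesis using mean_le_distr_iff[OF coord[of i] d4, of "\<tau>\<^sup>2"] lawD[of i] that by (simp add: D_def)
  qed
  have m0: "0 \<le> m" by (rule mean_leD(5)[OF F(3)])
  have mx0: "mean_le N (\<lambda>_. norm x0 ^ 4) m" using mean_le_weaken[OF N.mean_le_const x0] by simp
  have mz: "mean_le N (\<lambda>_. 0) a" if "0 \<le> a" for a using mean_le_weaken[OF N.mean_le_const that] by simp
  interpret C: coupled_path N \<zeta> \<Psi> Q S1 "residual_cov n Q x" B \<rho> m \<tau> \<eta>
  proof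
    show "mean_le N (\<lambda>\<omega>. norm (snd (\<zeta> t \<omega>)) ^ 4) m" for t
      using mom2[of t] mx0 by (cases "t = 0") (simp_all add: \<zeta>_def)
    show "mean_le N (\<lambda>\<omega>. norm (fst (\<zeta> t \<omega>)) ^ 4) m" for t
      using mom1[of t] by (cases "t = 0") (simp_all add: \<zeta>_def)
  qed (use B ind \<rho> \<Psi> Q PQ \<tau> mean1 mean2 mdiff in \<open>simp_all add: \<zeta>_def\<close>)
  have m2: "1 + m \<le> (1 + m)\<^sup>2"
  proof -
    have "1 * (1 + m) \<le> (1 + m) * (1 + m)" using m0 by (intro mult_right_mono) auto
    then show ?thesis by (simp only: power2_eq_square mult_1)
  qed
  then have m1: "m \<le> (1 + m)\<^sup>2" by linarith
  interpret S: coupled_path N \<zeta>' \<Psi> 0 S1 0 B \<rho> m "1 + m" \<rho>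
  proof
    show "mean_le N (\<lambda>\<omega>. norm (fst (\<zeta>' t \<omega>) - snd (\<zeta>' t \<omega>)) ^ 4) ((1 + m)\<^sup>2)" for t
      using mean_le_weaken[OF mom1 m1] by (simp add: \<zeta>'_def)
  qed (use B ind' \<rho> \<Psi> m0 mean1 mom1 mz[OF m0] in \<open>simp_all add: \<zeta>'_def\<close>)
  have "S.e1 \<omega> i = C.e1 \<omega> i" for \<omega> i by (simp add: S.e1_def C.e1_def \<zeta>_def \<zeta>'_def)
  then have Se1: "S.e1 = C.e1" by (intro ext)
  have "S.X \<omega> = C.X \<omega>" for \<omega> by (simp only: S.X_def C.X_def Se1)
  then have SX: "S.e1 = C.e1" "S.X = C.X" using Se1 by auto
  have S0: "S.e2 \<omega> = (\<lambda>_. 0)" for \<omega> by (simp add: S.e2_def[abs_def] \<zeta>'_def)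
  have SY: "S.Y \<omega> t = 0" for \<omega> t by (cases t) (simp_all add: S.Y_def S0)
  have noise0: "noise n 0 (S.Y \<omega>) (S.e2 \<omega>) = 0" for \<omega>
    by (simp add: noise_def cross_sum_def S0 SY tensor.zero_right tensor.zero_left)
  define q where "q = C.L\<^sup>2 * C.kap\<^sup>2"
  define V where "V \<omega> = noise n \<Psi> (C.X \<omega>) (C.e1 \<omega>) - S1" for \<omega>
  define W where "W \<omega> = (noise n \<Psi> (C.X \<omega>) (C.e1 \<omega>) - S1) - (noise n Q (C.Y \<omega>) (C.e2 \<omega>) - residual_cov n Q x)" for \<omega>
  define U where "U \<omega> = cross_sum n (C.X \<omega>) (C.e1 \<omega>) - cross_sum n (C.Y \<omega>) (C.e2 \<omega>)" for \<omega>
  define R where "R = cov_bias n Q x"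
  define th where "th = \<eta>\<^sup>2 + \<tau> + \<tau>\<^sup>2 + 1 / real n"
  have th: "C.theta n = th" by (simp add: C.theta_def th_def)
  have q0: "0 \<le> q" by (simp add: q_def)
  have mV: "mean_le N (\<lambda>\<omega>. real n * (norm (V \<omega>))\<^sup>2) (248 * (q * (4 * (1 + m)\<^sup>2)))"
  proof (rule mean_le_weaken)
    show "mean_le N (\<lambda>\<omega>. real n * (norm (V \<omega>))\<^sup>2) (248 * (q * S.theta n))"
      using S.noise_coupling[OF n] unfolding noise0 SX V_def q_def by (simp only: diff_self diff_zero)
    have "\<rho>\<^sup>2 \<le> 1" using \<rho> by (simp add: power_le_one)
    moreover have "1 / real n \<le> 1" using n by simp
    ultimately have "S.theta n \<le> 4 * (1 + m)\<^sup>2"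
      using m0 m2 unfolding S.theta_def by linarith
    then show "248 * (q * S.theta n) \<le> 248 * (q * (4 * (1 + m)\<^sup>2))" using q0 by (intro mult_left_mono) auto
  qed
  have mW: "mean_le N (\<lambda>\<omega>. real n * (norm (W \<omega>))\<^sup>2) (248 * (q * th))"
    using C.noise_coupling[OF n] by (simp add: W_def q_def th)
  have mU: "mean_le N (\<lambda>\<omega>. real n * (norm (U \<omega>))\<^sup>2) (10 * (q * th))"
    using C.cross_sum_coupling[OF n] by (simp add: U_def q_def th)
  obtain Q' :: "'h \<Rightarrow>\<^sub>L 'h" where adjQ: "\<And>u w. Q u \<bullet> w = u \<bullet> Q' w" by (rule adjoint_exists[of Q]) blast
  have Xrec: "C.X \<omega> (Suc t) = \<Psi> (C.X \<omega> t) + C.e1 \<omega> (Suc t)" and Yrec: "C.Y \<omega> (Suc t) = Q (C.Y \<omega> t) + C.e2 \<omega> (Suc t)" for \<omega> t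
    by (simp_all add: C.X_def C.Y_def)
  define A1 where "A1 \<omega> = C_hat n (C.X \<omega>) - (\<Psi> o\<^sub>L \<Gamma>)" for \<omega>
  define A2 where "A2 \<omega> = C_hat n (C.Y \<omega>) - (C_hat n x o\<^sub>L p)" for \<omega>
  have main: "norm (A1 \<omega> - A2 \<omega>) \<le> 3 * \<eta> * C.kap\<^sup>2 * norm (V \<omega>) + C.kap * (norm (W \<omega>) + norm R) + norm (U \<omega>)" for \<omega>
  proof -
    \<comment> \<open>the errors of the empirical covariances solve the stationarity equations of the two processes, with
      the centered noises \<open>V\<close> and \<open>V'\<close>\<close>
    define H where "H = Gamma_hat n (C.X \<omega>) - \<Gamma>"
    define H' where "H' = Gamma_hat n (C.Y \<omega>) - Gamma_hat n x"
    define V' where "V' = noise n Q (C.Y \<omega>) (C.e2 \<omega>) - residual_cov n Q x - R"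
    have "H = (\<Psi> o\<^sub>L H o\<^sub>L \<Psi>') + V \<omega>"
    proof (rule blinfun_eqI)
      fix u
      have "Gamma_hat n (C.X \<omega>) u = \<Psi> (Gamma_hat n (C.X \<omega>) (\<Psi>' u)) + noise n \<Psi> (C.X \<omega>) (C.e1 \<omega>) u"
        using arg_cong[OF Gamma_hat_autoregression[of n "C.X \<omega>" \<Psi> "C.e1 \<omega>" \<Psi>', OF Xrec adj], of "\<lambda>A. A u"]
        by (simp add: blinfun.add_left)
      moreover have "\<Gamma> u = \<Psi> (\<Gamma> (\<Psi>' u)) + S1 u"
        using arg_cong[OF \<Gamma>, of "\<lambda>A. A u"] by (simp add: blinfun.add_left)
      ultimately show "H u = ((\<Psi> o\<^sub>L H o\<^sub>L \<Psi>') + V \<omega>) u"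
        by (simp add: H_def V_def blinfun.diff_left blinfun.add_left blinfun.diff_right)
    qed
    moreover have "H' = (Q o\<^sub>L H' o\<^sub>L Q') + V'"
    proof (rule blinfun_eqI)
      fix u
      have "Gamma_hat n (C.Y \<omega>) u = Q (Gamma_hat n (C.Y \<omega>) (Q' u)) + noise n Q (C.Y \<omega>) (C.e2 \<omega>) u"
        using arg_cong[OF Gamma_hat_autoregression[of n "C.Y \<omega>" Q "C.e2 \<omega>" Q', OF Yrec adjQ], of "\<lambda>A. A u"]
        by (simp add: blinfun.add_left)
      moreover have "Gamma_hat n x u = Q (Gamma_hat n x (Q' u)) + residual_cov n Q x u + R u"
        using arg_cong[OF Gamma_hat_bootstrap_stationarity[OF n adjQ normal proj], of "\<lambda>A. A u"]
        by (simp add: blinfun.add_left R_def)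
      ultimately show "H' u = ((Q o\<^sub>L H' o\<^sub>L Q') + V') u"
        by (simp add: H'_def V'_def blinfun.diff_left blinfun.add_left blinfun.diff_right)
    qed
    ultimately have "norm ((\<Psi> o\<^sub>L H) - (Q o\<^sub>L H') + U \<omega>)
      \<le> 3 * \<eta> * C.kap\<^sup>2 * norm (V \<omega>) + C.kap * norm (V \<omega> - V') + norm (U \<omega>)"
      unfolding C.kap_def by (rule stationarity_perturbation[OF _ _ adj adjQ \<rho> \<Psi> Q PQ])
    moreover have "A1 \<omega> - A2 \<omega> = (\<Psi> o\<^sub>L H) - (Q o\<^sub>L H') + U \<omega>"
      unfolding A1_def A2_def normal C_hat_autoregression[of n "C.X \<omega>" \<Psi> "C.e1 \<omega>", OF Xrec]
        C_hat_autoregression[of n "C.Y \<omega>" Q "C.e2 \<omega>", OF Yrec]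
      by (rule blinfun_eqI) (simp add: H_def H'_def U_def blinfun.diff_left blinfun.add_left blinfun.diff_right)
    moreover have "C.kap * norm (V \<omega> - V') \<le> C.kap * (norm (W \<omega>) + norm R)"
    proof (rule mult_left_mono)
      have "V \<omega> - V' = W \<omega> + R" by (simp add: V_def V'_def W_def)
      then show "norm (V \<omega> - V') \<le> norm (W \<omega>) + norm R" by (simp add: norm_triangle_ineq)
    qed (use C.kap in simp)
    ultimately show ?thesis by simp
  qed
  have bound: "mean_le N (\<lambda>\<omega>. real n * (norm (A1 \<omega> - A2 \<omega>))\<^sup>2) (boot_const \<rho> m * (th + real n * (norm R)\<^sup>2))"
  proof -
    let ?r = "real n * (norm R)\<^sup>2"
    have "mean_le N (\<lambda>\<omega>. 4 * (9 * \<eta>\<^sup>2 * C.kap ^ 4 * (real n * (norm (V \<omega>))\<^sup>2) + C.kap\<^sup>2 * (real n * (norm (W \<omega>))\<^sup>2)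
        + C.kap\<^sup>2 * ?r + real n * (norm (U \<omega>))\<^sup>2))
      (4 * (9 * \<eta>\<^sup>2 * C.kap ^ 4 * (248 * (q * (4 * (1 + m)\<^sup>2))) + C.kap\<^sup>2 * (248 * (q * th)) + C.kap\<^sup>2 * ?r + 10 * (q * th)))"
      using C.kap by (intro mean_le_cmult mean_le_add mV mW mU N.mean_le_const) auto
    then show ?thesis
    proof (rule mean_le_mono)
      have sq4: "(a + b + c + d)\<^sup>2 \<le> 4 * (a\<^sup>2 + b\<^sup>2 + c\<^sup>2 + d\<^sup>2)" for a b c d :: real
        using norm_add4_sq_le[of a b c d] by simp
      fix \<omega>
      have "(norm (A1 \<omega> - A2 \<omega>))\<^sup>2
        \<le> (3 * \<eta> * C.kap\<^sup>2 * norm (V \<omega>) + C.kap * norm (W \<omega>) + C.kap * norm R + norm (U \<omega>))\<^sup>2"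
        using main[of \<omega>] by (intro power_mono) (simp_all add: algebra_simps)
      also have "\<dots> \<le> 4 * ((3 * \<eta> * C.kap\<^sup>2 * norm (V \<omega>))\<^sup>2 + (C.kap * norm (W \<omega>))\<^sup>2 + (C.kap * norm R)\<^sup>2 + (norm (U \<omega>))\<^sup>2)"
        by (rule sq4)
      also have "\<dots> = 4 * (9 * \<eta>\<^sup>2 * C.kap ^ 4 * (norm (V \<omega>))\<^sup>2 + C.kap\<^sup>2 * (norm (W \<omega>))\<^sup>2 + C.kap\<^sup>2 * (norm R)\<^sup>2 + (norm (U \<omega>))\<^sup>2)"
        by (simp add: power_mult_distrib)
      finally have "real n * (norm (A1 \<omega> - A2 \<omega>))\<^sup>2 \<le> real n * \<dots>" by (rule mult_left_mono) simp
      then show "real n * (norm (A1 \<omega> - A2 \<omega>))\<^sup>2 \<le> 4 * (9 * \<eta>\<^sup>2 * C.kap ^ 4 * (real n * (norm (V \<omega>))\<^sup>2)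
        + C.kap\<^sup>2 * (real n * (norm (W \<omega>))\<^sup>2) + C.kap\<^sup>2 * ?r + real n * (norm (U \<omega>))\<^sup>2)"
        by (simp add: algebra_simps)
    next
      show "(\<lambda>\<omega>. real n * (norm (A1 \<omega> - A2 \<omega>))\<^sup>2) \<in> borel_measurable N"
        by (intro borel_measurable_times borel_measurable_power borel_measurable_norm_blinfun)
          (simp_all add: A1_def A2_def C_hat_def blinfun.scaleR_left blinfun.diff_left blinfun.sum_left)
    next
      define a where "a = 9 * C.kap ^ 4 * (248 * (q * (4 * (1 + m)\<^sup>2)))"
      have c: "boot_const \<rho> m = 4 * (a + C.kap\<^sup>2 * (248 * q) + C.kap\<^sup>2 + 10 * q)"
        by (simp add: boot_const_def Let_def a_def q_def C.kap_def C.L_def)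
      have a0: "0 \<le> a" using q0 by (simp add: a_def)
      have th0: "0 \<le> th" "\<eta>\<^sup>2 \<le> th" using \<tau> by (simp_all add: th_def)
      have r0: "0 \<le> ?r" by simp
      have e: "\<eta>\<^sup>2 \<le> th + ?r" "th \<le> th + ?r" "?r \<le> th + ?r" using th0 r0 by linarith+
      have "4 * (9 * \<eta>\<^sup>2 * C.kap ^ 4 * (248 * (q * (4 * (1 + m)\<^sup>2))) + C.kap\<^sup>2 * (248 * (q * th)) + C.kap\<^sup>2 * ?r + 10 * (q * th))
        = 4 * (a * \<eta>\<^sup>2 + C.kap\<^sup>2 * (248 * q) * th + C.kap\<^sup>2 * ?r + 10 * q * th)"
        by (simp add: a_def)
      also have "\<dots> \<le> 4 * (a * (th + ?r) + C.kap\<^sup>2 * (248 * q) * (th + ?r) + C.kap\<^sup>2 * (th + ?r) + 10 * q * (th + ?r))"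
        by (intro mult_left_mono add_mono e) (use a0 q0 in auto)
      also have "\<dots> = boot_const \<rho> m * (th + ?r)" unfolding c by (simp add: algebra_simps)
      finally show "4 * (9 * \<eta>\<^sup>2 * C.kap ^ 4 * (248 * (q * (4 * (1 + m)\<^sup>2))) + C.kap\<^sup>2 * (248 * (q * th)) + C.kap\<^sup>2 * ?r + 10 * (q * th))
        \<le> boot_const \<rho> m * (th + ?r)" .
    qed simp
  qed
  have A1m: "A1 \<in> borel_measurable N" and A2m: "A2 \<in> borel_measurable N"
    unfolding A1_def[abs_def] A2_def[abs_def] by (intro measurable_C_hat_diff C.rv12)+
  have Am: "(\<lambda>\<omega>. norm (A1 \<omega> - A2 \<omega>)) \<in> borel_measurable N"
    by (rule borel_measurable_norm_blinfun)
      (simp_all add: A1_def A2_def C_hat_def blinfun.scaleR_left blinfun.diff_left blinfun.sum_left)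
  have dist1: "distr N borel A1 = distr (PiM UNIV (\<lambda>i::nat. if i = 0 then \<mu>0 else F)) borel
      (\<lambda>e. C_hat n (boot_path \<Psi> (e 0) e) - (\<Psi> o\<^sub>L \<Gamma>))"
  proof -
    let ?B = "PiM UNIV (\<lambda>_::nat. borel :: 'h measure)"
    have "N.indep_vars (\<lambda>_. borel) (\<lambda>i \<omega>. fst (\<omega> i)) UNIV"
      by (rule N.indep_vars_compose2[OF ind0]) (rule cm)
    then have L: "distr N ?B (\<lambda>\<omega>. \<lambda>i\<in>UNIV. fst (\<omega> i)) = PiM UNIV (\<lambda>i. if i = 0 then \<mu>0 else F)"
      by (rule N.distr_indep_sequence) (simp_all add: law1)
    have e1: "C.e1 \<omega> = (\<lambda>i\<in>UNIV. fst (\<omega> i))" for \<omega> by (simp add: C.e1_def[abs_def] \<zeta>_def fun_eq_iff)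
    have h: "(\<lambda>e. C_hat n (boot_path \<Psi> (e 0) e) - (\<Psi> o\<^sub>L \<Gamma>)) \<in> borel_measurable ?B"
      by (intro measurable_C_hat_diff measurable_boot_path measurable_component_singleton) simp_all
    have g: "(\<lambda>\<omega>. \<lambda>i\<in>UNIV. fst (\<omega> i)) \<in> measurable N ?B" by (intro measurable_restrict f1)
    show ?thesis
      unfolding L[symmetric] distr_distr[OF h g] by (simp add: comp_def A1_def[abs_def] C.X_def e1[symmetric])
  qed
  have dist2: "distr N borel A2 = distr (measure_pmf (Pi_pmf {1..n} 0 (\<lambda>_. F_hat n Q x))) borel
      (\<lambda>e. C_hat n (boot_path Q x0 e) - (C_hat n x o\<^sub>L p))"
  proof -
    have i: "N.indep_vars (\<lambda>_. borel) (\<lambda>i \<omega>. snd (\<omega> i)) {1..n}"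
      by (rule N.indep_vars_subset[OF N.indep_vars_compose2[OF ind0]]) (rule cm, simp)
    have e2: "C.e2 \<omega> i = (if i = 0 then x0 else snd (\<omega> i))" for \<omega> i
      unfolding C.e2_def \<zeta>_def by simp
    have Y: "C.Y \<omega> = boot_path Q x0 (\<lambda>i. snd (\<omega> i))" for \<omega>
    proof
      show "C.Y \<omega> t = boot_path Q x0 (\<lambda>i. snd (\<omega> i)) t" for t
        unfolding C.Y_def by (induction t) (simp_all add: e2)
    qed
    have "distr N borel (\<lambda>\<omega>. snd (\<omega> i)) = distr (measure_pmf (F_hat n Q x)) borel (\<lambda>x. x)" if "i \<in> {1..n}" for i
      using law2[of i] that by (simp add: F_hat_def map_pmf_rep_eq distr_distr comp_def)
    from N.distr_bootstrap[OF i f2 this n, of Q x0 "C_hat n x o\<^sub>L p"]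
    show ?thesis by (simp add: A2_def[abs_def] Y)
  qed
  have "ennreal (real n) * mallows_sq (distr N borel A1) (distr N borel A2)
    \<le> ennreal (real n) * (\<integral>\<^sup>+\<omega>. ennreal ((norm (A1 \<omega> - A2 \<omega>))\<^sup>2) \<partial>N)"
    by (intro mult_left_mono mallows_sq_le_of_coupling N.prob_space_axioms A1m A2m Am) simp
  also have "\<dots> = (\<integral>\<^sup>+\<omega>. ennreal (real n * (norm (A1 \<omega> - A2 \<omega>))\<^sup>2) \<partial>N)"
    using Am by (subst nn_integral_cmult[symmetric]) (auto simp: ennreal_mult)
  also have "\<dots> \<le> ennreal (boot_const \<rho> m * (th + real n * (norm R)\<^sup>2))"
    by (rule mean_le_nn_integral[OF bound])
  finally show ?thesis unfolding dist1 dist2 th_def R_def .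
qed

section \<open>The stationary autoregression\<close>

lemma boot_path_closed_form:
  fixes A :: "'h::real_inner \<Rightarrow>\<^sub>L 'h"
  shows "boot_path A (e 0) e t = (\<Sum>j\<le>t. (blinfun_apply A ^^ j) (e (t - j)))"
proof (induction t)
  case (Suc t)
  have "(\<Sum>j\<le>Suc t. (blinfun_apply A ^^ j) (e (Suc t - j))) = e (Suc t) + (\<Sum>j\<le>t. A ((blinfun_apply A ^^ j) (e (t - j))))"
    by (subst sum.atMost_Suc_shift) simp
  also have "(\<Sum>j\<le>t. A ((blinfun_apply A ^^ j) (e (t - j)))) = A (boot_path A (e 0) e t)"
    unfolding Suc.IH by (simp add: blinfun.sum_right)
  finally show ?case by simp
qed simp

lemma norm_blinfun_funpow:
  fixes A :: "'h::real_normed_vector \<Rightarrow>\<^sub>L 'h"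
  shows "norm ((blinfun_apply A ^^ j) x) \<le> norm A ^ j * norm x"
proof (induction j)
  case (Suc j)
  have "norm ((blinfun_apply A ^^ Suc j) x) \<le> norm A * norm ((blinfun_apply A ^^ j) x)"
    by (simp add: norm_blinfun)
  also have "\<dots> \<le> norm A * (norm A ^ j * norm x)" by (intro mult_left_mono Suc) simp
  finally show ?case by (simp add: mult.assoc)
qed simp

lemma blinfun_funpow_add:
  fixes A :: "'h::real_normed_vector \<Rightarrow>\<^sub>L 'h"
  shows "(blinfun_apply A ^^ j) (x + y) = (blinfun_apply A ^^ j) x + (blinfun_apply A ^^ j) y"
  by (induction j) (simp_all add: blinfun.add_right)

lemma measurable_blinfun_apply:
  fixes A :: "'h::{real_normed_vector, second_countable_topology} \<Rightarrow>\<^sub>L 'h"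
  assumes "f \<in> borel_measurable M" shows "(\<lambda>\<omega>. A (f \<omega>)) \<in> borel_measurable M"
  by (rule measurable_compose[OF assms]) (auto intro!: borel_measurable_continuous_onI continuous_intros)

lemma measurable_blinfun_funpow:
  fixes A :: "'h::{real_normed_vector, second_countable_topology} \<Rightarrow>\<^sub>L 'h"
  assumes "f \<in> borel_measurable M" shows "(\<lambda>\<omega>. (blinfun_apply A ^^ j) (f \<omega>)) \<in> borel_measurable M"
  using assms by (induction j) (simp_all add: measurable_blinfun_apply)

lemma AE_summable_of_means:
  fixes f :: "nat \<Rightarrow> 'a \<Rightarrow> real"
  assumes f: "\<And>j. mean_le M (f j) (b j)" and b: "summable b"
  shows "AE \<omega> in M. summable (\<lambda>j. f j \<omega>)"
proof -
  have [measurable]: "f j \<in> borel_measurable M" for j by (rule mean_leD[OF f])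
  have "(\<integral>\<^sup>+\<omega>. (\<Sum>j. ennreal (f j \<omega>)) \<partial>M) = (\<Sum>j. \<integral>\<^sup>+\<omega>. ennreal (f j \<omega>) \<partial>M)"
    by (rule nn_integral_suminf) measurable
  also have "\<dots> \<le> (\<Sum>j. ennreal (b j))" by (intro suminf_le mean_le_nn_integral f) auto
  also have "\<dots> = ennreal (\<Sum>j. b j)" by (rule suminf_ennreal2) (auto intro: mean_leD(5)[OF f] b)
  finally have "(\<integral>\<^sup>+\<omega>. (\<Sum>j. ennreal (f j \<omega>)) \<partial>M) \<noteq> \<infinity>"
    by (auto simp: top_unique)
  then have "AE \<omega> in M. (\<Sum>j. ennreal (f j \<omega>)) \<noteq> \<infinity>" by (intro nn_integral_PInf_AE) measurable
  then show ?thesis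
    using AE_space
  proof eventually_elim
    case (elim \<omega>)
    then show ?case using mean_leD(3)[OF f] by (intro summable_suminf_not_top) auto
  qed
qed

lemma integrable_quadratic:
  fixes Y Z :: "'a \<Rightarrow> 'h::{real_inner, banach, second_countable_topology}"
  assumes [measurable]: "Y \<in> borel_measurable M" "Z \<in> borel_measurable M"
    and Y: "integrable M (\<lambda>\<omega>. (norm (Y \<omega>))\<^sup>2)" and Z: "integrable M (\<lambda>\<omega>. (norm (Z \<omega>))\<^sup>2)"
  shows "integrable M (\<lambda>\<omega>. (Y \<omega> \<bullet> u) *\<^sub>R Z \<omega>)" "integrable M (\<lambda>\<omega>. norm (tensor (Y \<omega>) (Z \<omega>)))"
proof -
  have i: "integrable M (\<lambda>\<omega>. norm (Y \<omega>) * norm (Z \<omega>))"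
    by (rule integrable_inner_of_square) (use Y Z in simp_all)
  then have "integrable M (\<lambda>\<omega>. norm u * (norm (Y \<omega>) * norm (Z \<omega>)))" by simp
  then show "integrable M (\<lambda>\<omega>. (Y \<omega> \<bullet> u) *\<^sub>R Z \<omega>)"
  proof (rule Bochner_Integration.integrable_bound)
    show "AE \<omega> in M. norm ((Y \<omega> \<bullet> u) *\<^sub>R Z \<omega>) \<le> norm (norm u * (norm (Y \<omega>) * norm (Z \<omega>)))"
    proof (rule AE_I2)
      fix \<omega>
      have "\<bar>Y \<omega> \<bullet> u\<bar> * norm (Z \<omega>) \<le> (norm (Y \<omega>) * norm u) * norm (Z \<omega>)"
        by (intro mult_right_mono Cauchy_Schwarz_ineq2) simp
      then show "norm ((Y \<omega> \<bullet> u) *\<^sub>R Z \<omega>) \<le> norm (norm u * (norm (Y \<omega>) * norm (Z \<omega>)))"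
        by (simp add: mult_ac abs_mult)
    qed
  qed simp
  show "integrable M (\<lambda>\<omega>. norm (tensor (Y \<omega>) (Z \<omega>)))"
  proof (rule Bochner_Integration.integrable_bound[OF i])
    show "(\<lambda>\<omega>. norm (tensor (Y \<omega>) (Z \<omega>))) \<in> borel_measurable M"
      by (rule borel_measurable_norm_blinfun) simp
    show "AE \<omega> in M. norm (norm (tensor (Y \<omega>) (Z \<omega>))) \<le> norm (norm (Y \<omega>) * norm (Z \<omega>))"
      using norm_tensor_le by (intro AE_I2) (auto simp: abs_mult)
  qed
qed

lemma op_expectation_tensor:
  fixes Y Z :: "'a \<Rightarrow> 'h::{real_inner, banach, second_countable_topology}"
  assumes "Y \<in> borel_measurable M" "Z \<in> borel_measurable M"
    "integrable M (\<lambda>\<omega>. (norm (Y \<omega>))\<^sup>2)" "integrable M (\<lambda>\<omega>. (norm (Z \<omega>))\<^sup>2)"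
  shows "op_expectation M (\<lambda>\<omega>. tensor (Y \<omega>) (Z \<omega>)) u = (\<integral>\<omega>. (Y \<omega> \<bullet> u) *\<^sub>R Z \<omega> \<partial>M)"
  by (subst op_expectation_apply) (simp_all add: integrable_quadratic[OF assms])

text \<open>A stationary autoregression over the integers. The Hilbert-Schmidt norms of random operators are
  computed in the basis \<open>B\<close>.\<close>

locale far1 = prob_space M for M :: "'a measure" +
  fixes X eps :: "int \<Rightarrow> 'a \<Rightarrow> 'h::{real_inner, banach, second_countable_topology}" and \<Psi> :: "'h \<Rightarrow>\<^sub>L 'h" and B :: "'h set"
  assumes X_meas [measurable]: "\<And>t. X t \<in> borel_measurable M"
    and X_law: "\<And>t. distr M borel (X t) = distr M borel (X 0)"
    and X_int: "\<And>t. integrable M (X t)"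
    and AR: "\<And>t. AE \<omega> in M. X (t + 1) \<omega> = \<Psi> (X t \<omega>) + eps (t + 1) \<omega>"
    and eps_indep: "indep_vars (\<lambda>_. borel) eps UNIV"
    and eps_law: "\<And>s t. distr M borel (eps s) = distr M borel (eps t)"
    and eps_mean: "\<And>t. (\<integral>\<omega>. eps t \<omega> \<partial>M) = 0"
    and eps_mom: "\<And>t. integrable M (\<lambda>\<omega>. norm (eps t \<omega>) ^ 4)"
    and Psi_norm: "norm \<Psi> < 1"
    and basis: "orthonormal_basis B"
begin

text \<open>The state at time 0 and the later innovations determine the path at times \<open>0, 1, \<dots>\<close>. As a series in the
  innovations up to time 0, the state is independent of the later ones.\<close>

definition F where "F = distr M borel (eps 0)"
definition state0 where "state0 \<omega> = (\<Sum>j. (blinfun_apply \<Psi> ^^ j) (eps (- int j) \<omega>))"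
definition Z where "Z i \<omega> = (if i = 0 then state0 \<omega> else eps (int i) \<omega>)"
definition path where "path \<omega> = boot_path \<Psi> (Z 0 \<omega>) (\<lambda>i. Z i \<omega>)"
definition me where "me = (\<integral>\<omega>. norm (eps 0 \<omega>) ^ 4 \<partial>M)"
definition m4 where "m4 = (1 / (1 - norm \<Psi>)) ^ 4 * me"

lemma eps_meas [measurable]: "eps t \<in> borel_measurable M"
  using eps_indep by (auto simp: indep_vars_def)

lemma F: "prob_space F" "sets F = sets borel" "space F = UNIV"
  unfolding F_def by (auto intro: prob_space_distr)

lemma mean_le_eps_iff:
  assumes "f \<in> borel_measurable borel" "\<And>x. 0 \<le> f x"
  shows "mean_le M (\<lambda>\<omega>. f (eps t \<omega>)) a \<longleftrightarrow> mean_le F f a"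
proof -
  have "F = distr M borel (eps t)" unfolding F_def by (rule eps_law)
  then show ?thesis using mean_le_distr_iff[OF eps_meas[of t] assms] by simp
qed

lemma eps_fourth: "mean_le M (\<lambda>\<omega>. norm (eps t \<omega>) ^ 4) me"
proof -
  have "mean_le M (\<lambda>\<omega>. norm (eps 0 \<omega>) ^ 4) me" using eps_mom[of 0] by (simp add: mean_le_def me_def)
  then show ?thesis using mean_le_eps_iff[of "\<lambda>x. norm x ^ 4"] by simp
qed

lemma me_le: "0 \<le> me" "me \<le> m4"
proof -
  show "0 \<le> me" by (rule mean_leD(5)[OF eps_fourth])
  moreover have "1 \<le> 1 / (1 - norm \<Psi>)" using Psi_norm by simp
  ultimately have "1 * me \<le> (1 / (1 - norm \<Psi>)) ^ 4 * me" by (intro mult_right_mono one_le_power)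
  then show "me \<le> m4" by (simp add: m4_def)
qed

lemma eps_first: "mean_le M (\<lambda>\<omega>. norm (eps t \<omega>)) (2 + me)"
proof -
  have le: "y \<le> 2 + y ^ 4" for y :: real
  proof -
    have "0 \<le> (y - 1/2)\<^sup>2" by simp
    then have "y \<le> y\<^sup>2 + 1" by (simp add: power2_eq_square algebra_simps)
    then show ?thesis using square_le_fourth[of y] by linarith
  qed
  show ?thesis
    by (rule mean_le_mono[OF mean_le_add[OF mean_le_const[of 2] eps_fourth[of t]]]) (auto simp: le)
qed

lemma eps_integrable: "integrable M (eps t)"
  using mean_leD(1)[OF eps_first[of t]] by (simp add: integrable_norm_iff)

lemma X0_expansion:
  "AE \<omega> in M. X 0 \<omega> = (blinfun_apply \<Psi> ^^ k) (X (- int k) \<omega>) + (\<Sum>j<k. (blinfun_apply \<Psi> ^^ j) (eps (- int j) \<omega>))"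
proof (induction k)
  case (Suc k)
  have "AE \<omega> in M. X (- int k) \<omega> = \<Psi> (X (- int (Suc k)) \<omega>) + eps (- int k) \<omega>"
    using AR[of "- int (Suc k)"] by simp
  with Suc show ?case
  proof eventually_elim
    case (elim \<omega>)
    have "(blinfun_apply \<Psi> ^^ k) (X (- int k) \<omega>)
      = (blinfun_apply \<Psi> ^^ Suc k) (X (- int (Suc k)) \<omega>) + (blinfun_apply \<Psi> ^^ k) (eps (- int k) \<omega>)"
      unfolding elim(2) blinfun_funpow_add funpow_Suc_right comp_def ..
    then show ?case using elim(1) by (simp add: add.assoc)
  qed
qed simp

lemma summable_power_Psi: "summable (\<lambda>j. norm \<Psi> ^ j * c)"
  by (intro summable_mult2 summable_geometric) (use Psi_norm in simp)

lemma AE_summable_state0: "AE \<omega> in M. summable (\<lambda>j. (blinfun_apply \<Psi> ^^ j) (eps (- int j) \<omega>))"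
proof -
  have "AE \<omega> in M. summable (\<lambda>j. norm \<Psi> ^ j * norm (eps (- int j) \<omega>))"
    by (rule AE_summable_of_means[OF mean_le_cmult[OF eps_first] summable_power_Psi]) simp
  then show ?thesis
  proof eventually_elim
    case (elim \<omega>)
    then have "summable (\<lambda>j. norm ((blinfun_apply \<Psi> ^^ j) (eps (- int j) \<omega>)))"
      by (rule summable_comparison_test'[where N = 0]) (simp add: norm_blinfun_funpow)
    then show ?case by (rule summable_norm_cancel)
  qed
qed

text \<open>The recursion expresses \<open>X 0\<close> by \<open>k\<close> innovations and the \<open>k\<close>-th power of \<open>\<Psi>\<close> applied to \<open>X (- k)\<close>. By
  stationarity, the mean norm of this last term is summable in \<open>k\<close>, so it vanishes almost surely in the limit.\<close>

lemma X0_eq_state0: "AE \<omega> in M. X 0 \<omega> = state0 \<omega>"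
proof -
  define c where "c = (\<integral>\<omega>. norm (X 0 \<omega>) \<partial>M)"
  have "mean_le M (\<lambda>\<omega>. norm (X t \<omega>)) c" for t
  proof -
    have "mean_le M (\<lambda>\<omega>. norm (X 0 \<omega>)) c" using X_int[of 0] by (simp add: mean_le_def c_def)
    then show ?thesis
      using mean_le_distr_iff[OF X_meas[of 0], of norm c] mean_le_distr_iff[OF X_meas[of t], of norm c] X_law[of t] by simp
  qed
  then have "AE \<omega> in M. summable (\<lambda>k. norm \<Psi> ^ k * norm (X (- int k) \<omega>))"
    by (intro AE_summable_of_means[OF mean_le_cmult summable_power_Psi]) auto
  moreover have "AE \<omega> in M. \<forall>k. X 0 \<omega> = (blinfun_apply \<Psi> ^^ k) (X (- int k) \<omega>) + (\<Sum>j<k. (blinfun_apply \<Psi> ^^ j) (eps (- int j) \<omega>))"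
    unfolding AE_all_countable using X0_expansion by blast
  ultimately show ?thesis
    using AE_summable_state0
  proof eventually_elim
    case (elim \<omega>)
    have "(\<lambda>k. (blinfun_apply \<Psi> ^^ k) (X (- int k) \<omega>)) \<longlonglongrightarrow> 0"
      by (rule Lim_null_comparison[OF _ summable_LIMSEQ_zero[OF elim(1)]]) (simp add: norm_blinfun_funpow)
    moreover have "(\<lambda>k. \<Sum>j<k. (blinfun_apply \<Psi> ^^ j) (eps (- int j) \<omega>)) \<longlonglongrightarrow> state0 \<omega>"
      unfolding state0_def by (rule summable_LIMSEQ[OF elim(3)])
    ultimately have "(\<lambda>k. (blinfun_apply \<Psi> ^^ k) (X (- int k) \<omega>) + (\<Sum>j<k. (blinfun_apply \<Psi> ^^ j) (eps (- int j) \<omega>))) \<longlonglongrightarrow> 0 + state0 \<omega>"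
      by (rule tendsto_add)
    then have "(\<lambda>k::nat. X 0 \<omega>) \<longlonglongrightarrow> state0 \<omega>" using elim(2) by simp
    then show ?case by (simp add: LIMSEQ_const_iff)
  qed
qed

lemma Z_meas [measurable]: "Z i \<in> borel_measurable M"
proof (cases "i = 0")
  case True
  have "state0 \<in> borel_measurable M"
    unfolding state0_def[abs_def] by (intro borel_measurable_suminf measurable_blinfun_funpow eps_meas)
  then show ?thesis using True by (simp add: Z_def[abs_def])
qed (simp add: Z_def[abs_def])

lemma path_0: "path \<omega> 0 = Z 0 \<omega>" and path_Suc: "path \<omega> (Suc t) = \<Psi> (path \<omega> t) + eps (int (Suc t)) \<omega>"
  by (simp_all add: path_def Z_def)

lemma X_eq_path: "AE \<omega> in M. \<forall>t. X (int t) \<omega> = path \<omega> t"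
proof -
  have "AE \<omega> in M. \<forall>t. X (int t + 1) \<omega> = \<Psi> (X (int t) \<omega>) + eps (int t + 1) \<omega>"
    unfolding AE_all_countable using AR by blast
  with X0_eq_state0 show ?thesis
  proof eventually_elim
    case (elim \<omega>)
    show ?case
    proof
      fix t show "X (int t) \<omega> = path \<omega> t"
      proof (induction t)
        case (Suc t)
        have "X (int (Suc t)) \<omega> = \<Psi> (X (int t) \<omega>) + eps (int (Suc t)) \<omega>"
          using elim(2)[rule_format, of t] by (simp add: add.commute)
        then show ?case by (simp add: path_Suc Suc)
      qed (simp add: path_0 Z_def elim)
    qed
  qed
qed

lemma Z_indep: "indep_vars (\<lambda>_. borel) Z UNIV"
proof -
  define K where "K i = (if i = 0 then {..0} else {int i})" for i :: nat
  define G where "G i f = (if i = 0 then (\<Sum>j. (blinfun_apply \<Psi> ^^ j) (f (- int j))) else f (int i))"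
    for i :: nat and f :: "int \<Rightarrow> 'h"
  have r: "indep_vars (\<lambda>i. PiM (K i) (\<lambda>_. borel)) (\<lambda>i \<omega>. restrict (\<lambda>t. eps t \<omega>) (K i)) UNIV"
    by (rule indep_vars_restrict[OF eps_indep]) (auto simp: K_def disjoint_family_on_def)
  have "indep_vars (\<lambda>_. borel) (\<lambda>i \<omega>. G i (restrict (\<lambda>t. eps t \<omega>) (K i))) UNIV"
  proof (rule indep_vars_compose2[OF r])
    fix i :: nat
    show "G i \<in> measurable (PiM (K i) (\<lambda>_. borel)) borel"
    proof (cases "i = 0")
      case True
      have "(\<lambda>f. f (- int j)) \<in> borel_measurable (PiM {..0} (\<lambda>_. borel :: 'h measure))" for j
        by (rule measurable_component_singleton) simp
      then have "(\<lambda>f. \<Sum>j. (blinfun_apply \<Psi> ^^ j) (f (- int j))) \<in> borel_measurable (PiM {..0} (\<lambda>_. borel))"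
        by (intro borel_measurable_suminf measurable_blinfun_funpow)
      then show ?thesis using True by (simp add: G_def[abs_def] K_def)
    next
      case False
      have "(\<lambda>f. f (int i)) \<in> borel_measurable (PiM {int i} (\<lambda>_. borel :: 'h measure))"
        by (rule measurable_component_singleton) simp
      then show ?thesis using False by (simp add: G_def[abs_def] K_def)
    qed
  qed
  moreover have "(\<lambda>\<omega>. G i (restrict (\<lambda>t. eps t \<omega>) (K i))) = Z i" for i
    by (auto simp: G_def K_def Z_def state0_def fun_eq_iff)
  ultimately show ?thesis by simp
qed

text \<open>For the state at time 0 this is Fatou's lemma for the partial sums of the series, which are states of
  an autoregression started \<open>k\<close> steps earlier.\<close>

lemma Z_fourth: "mean_le M (\<lambda>\<omega>. norm (Z i \<omega>) ^ 4) m4"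
proof (cases "i = 0")
  case False
  then show ?thesis using mean_le_weaken[OF eps_fourth me_le(2)] by (simp add: Z_def)
next
  case True
  define T where "T k \<omega> = (\<Sum>j\<le>k. (blinfun_apply \<Psi> ^^ j) (eps (- int j) \<omega>))" for k \<omega>
  have T: "mean_le M (\<lambda>\<omega>. norm (T k \<omega>) ^ 4) m4" for k
  proof -
    have "T k \<omega> = boot_path \<Psi> (eps (int 0 - int k) \<omega>) (\<lambda>i. eps (int i - int k) \<omega>) k" for \<omega>
      unfolding boot_path_closed_form[of \<Psi> "\<lambda>i. eps (int i - int k) \<omega>"] T_def
      by (intro sum.cong refl) (simp add: of_nat_diff)
    then show ?thesis
      using boot_path_fourth_moment[of "\<lambda>\<omega> i. eps (int i - int k) \<omega>" me \<Psi> "norm \<Psi>" k] eps_fourth Psi_norm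
      by (simp add: m4_def)
  qed
  have Tm: "T k \<in> borel_measurable M" for k
    unfolding T_def[abs_def] by (intro borel_measurable_sum measurable_blinfun_funpow eps_meas)
  have lim: "AE \<omega> in M. ennreal (norm (state0 \<omega>) ^ 4) = liminf (\<lambda>k. ennreal (norm (T k \<omega>) ^ 4))"
    using AE_summable_state0
  proof eventually_elim
    case (elim \<omega>)
    have "(\<lambda>k. T k \<omega>) \<longlonglongrightarrow> state0 \<omega>" unfolding T_def state0_def by (rule summable_LIMSEQ'[OF elim])
    then have "(\<lambda>k. ennreal (norm (T k \<omega>) ^ 4)) \<longlonglongrightarrow> ennreal (norm (state0 \<omega>) ^ 4)"
      by (intro tendsto_ennrealI tendsto_power tendsto_norm)
    then show ?case by (rule lim_imp_Liminf[OF sequentially_bot, symmetric])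
  qed
  have "(\<integral>\<^sup>+\<omega>. ennreal (norm (state0 \<omega>) ^ 4) \<partial>M) = (\<integral>\<^sup>+\<omega>. liminf (\<lambda>k. ennreal (norm (T k \<omega>) ^ 4)) \<partial>M)"
    by (rule nn_integral_cong_AE[OF lim])
  also have "\<dots> \<le> liminf (\<lambda>k. \<integral>\<^sup>+\<omega>. ennreal (norm (T k \<omega>) ^ 4) \<partial>M)"
    using Tm by (intro nn_integral_liminf) measurable
  also have "\<dots> \<le> liminf (\<lambda>k::nat. ennreal m4)" by (intro Liminf_mono always_eventually allI mean_le_nn_integral T)
  also have "\<dots> = ennreal m4" by (simp add: Liminf_const)
  finally have "mean_le M (\<lambda>\<omega>. norm (Z 0 \<omega>) ^ 4) m4"
    using me_le measurable_compose[OF Z_meas[of 0], of "\<lambda>x. norm x ^ 4"] by (intro mean_leI_nn) (auto simp: Z_def)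
  then show ?thesis using True by simp
qed

definition S1 where "S1 = op_expectation M (\<lambda>\<omega>. tensor (eps 1 \<omega>) (eps 1 \<omega>))"

lemma eps_square: "mean_le M (\<lambda>\<omega>. (norm (eps t \<omega>))\<^sup>2) (1 + me)"
  by (rule mean_le_mono[OF mean_le_add[OF mean_le_const[of 1] eps_fourth[of t]]]) (auto simp: square_le_fourth)

lemma F_moments: "mean_le F (\<lambda>x. norm x ^ 4) m4" "(\<integral>x. x \<partial>F) = 0" "(\<integral>x. (x \<bullet> u) *\<^sub>R x \<partial>F) = S1 u"
  "\<And>t. (\<integral>\<omega>. (eps t \<omega> \<bullet> u) *\<^sub>R eps t \<omega> \<partial>M) = S1 u"
proof -
  show "mean_le F (\<lambda>x. norm x ^ 4) m4"
    using mean_le_weaken[OF eps_fourth[of 0] me_le(2)] mean_le_eps_iff[of "\<lambda>x. norm x ^ 4" 0] by simp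
  show "(\<integral>x. x \<partial>F) = 0" unfolding F_def using eps_mean[of 0] by (subst integral_distr) auto
  have FQ: "(\<integral>x. (x \<bullet> u) *\<^sub>R x \<partial>F) = (\<integral>\<omega>. (eps t \<omega> \<bullet> u) *\<^sub>R eps t \<omega> \<partial>M)" for t
    unfolding F_def eps_law[of 0 t] by (subst integral_distr) auto
  have "S1 u = (\<integral>\<omega>. (eps 1 \<omega> \<bullet> u) *\<^sub>R eps 1 \<omega> \<partial>M)"
    unfolding S1_def by (rule op_expectation_tensor) (simp_all add: mean_leD(1)[OF eps_square])
  then show *: "(\<integral>x. (x \<bullet> u) *\<^sub>R x \<partial>F) = S1 u" using FQ[of 1] by simp
  show "(\<integral>\<omega>. (eps t \<omega> \<bullet> u) *\<^sub>R eps t \<omega> \<partial>M) = S1 u" for t using FQ[of t] * by simp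
qed

lemma m4_nonneg: "0 \<le> m4" using me_le by simp

text \<open>Coupled with the path 0, the bounds on differences become bounds for the path itself.\<close>

sublocale C: coupled_path M "\<lambda>i \<omega>. (Z i \<omega>, 0)" \<Psi> 0 S1 0 B "norm \<Psi>" m4 "1 + m4" "norm \<Psi>"
proof
  have z: "mean_le M (\<lambda>_. 0) a" if "0 \<le> a" for a using mean_le_weaken[OF mean_le_const that] by simp
  show "orthonormal_basis B" by (rule basis)
  show "indep_vars (\<lambda>_. borel) (\<lambda>i \<omega>. (Z i \<omega>, 0 :: 'h)) UNIV"
    by (rule indep_vars_compose2[OF Z_indep, where Y = "\<lambda>_ x. (x, 0)"])
      (auto intro!: borel_measurable_continuous_onI continuous_intros)
  show "(\<integral>\<omega>. fst (Z t \<omega>, 0 :: 'h) \<partial>M) = 0" if "1 \<le> t" for t using that eps_mean by (simp add: Z_def)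
  show "mean_le M (\<lambda>\<omega>. norm (fst (Z t \<omega>, 0 :: 'h)) ^ 4) m4" for t using Z_fourth by simp
  show "mean_le M (\<lambda>\<omega>. norm (snd (Z t \<omega>, 0 :: 'h)) ^ 4) m4" for t using z[OF m4_nonneg] by simp
  have "1 * (1 + m4) \<le> (1 + m4) * (1 + m4)" using m4_nonneg by (intro mult_right_mono) auto
  then have "1 + m4 \<le> (1 + m4)\<^sup>2" by (simp only: power2_eq_square mult_1)
  then show "mean_le M (\<lambda>\<omega>. norm (fst (Z t \<omega>, 0 :: 'h) - snd (Z t \<omega>, 0 :: 'h)) ^ 4) ((1 + m4)\<^sup>2)" for t
    using mean_le_weaken[OF Z_fourth[of t], of "(1 + m4)\<^sup>2"] by simp
  show "(\<integral>\<omega>. (fst (Z t \<omega>, 0 :: 'h) \<bullet> x) *\<^sub>R fst (Z t \<omega>, 0 :: 'h) \<partial>M) = S1 x" if "1 \<le> t" for t x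
    using that F_moments(4)[of "int t" x] by (simp add: Z_def)
qed (use Psi_norm m4_nonneg in simp_all)

lemma C_conv: "C.e1 \<omega> i = Z i \<omega>" "C.X \<omega> = path \<omega>" "C.e2 \<omega> i = 0" "C.Y \<omega> i = 0"
proof -
  show e: "C.e1 \<omega> i = Z i \<omega>" "C.e2 \<omega> i = 0" for i by (simp_all add: C.e1_def C.e2_def)
  then have "C.e1 \<omega> = (\<lambda>i. Z i \<omega>)" by auto
  then show "C.X \<omega> = path \<omega>" by (simp add: C.X_def path_def)
  show "C.Y \<omega> i = 0" by (cases i) (simp_all add: C.Y_def e)
qed

lemma path_moments: "mean_le M (\<lambda>\<omega>. norm (path \<omega> t) ^ 4) C.L" "mean_le M (\<lambda>\<omega>. (norm (path \<omega> t))\<^sup>2) C.L"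
  using C.XY_moments(1,3)[of t] by (simp_all add: C_conv)

lemma Z0_eps1_indep: "indep_var borel (Z 0) borel (eps 1)"
proof -
  have "indep_var borel (\<lambda>\<omega>. fst (Z 0 \<omega>, 0 :: 'h)) borel (\<lambda>\<omega>. fst (Z (Suc 0) \<omega>, 0 :: 'h))"
    by (rule C.past_indep[OF C.past_fst_snd(1)[OF order_refl]])
      (auto intro!: borel_measurable_continuous_onI continuous_intros)
  then show ?thesis by (simp add: Z_def[abs_def] One_nat_def)
qed

lemma cross_zero:
  "integrable M (\<lambda>\<omega>. (Z 0 \<omega> \<bullet> a) *\<^sub>R eps 1 \<omega>)" "(\<integral>\<omega>. (Z 0 \<omega> \<bullet> a) *\<^sub>R eps 1 \<omega> \<partial>M) = 0"
  "integrable M (\<lambda>\<omega>. (eps 1 \<omega> \<bullet> a) *\<^sub>R Z 0 \<omega>)" "(\<integral>\<omega>. (eps 1 \<omega> \<bullet> a) *\<^sub>R Z 0 \<omega> \<partial>M) = 0"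
proof -
  have Z2: "integrable M (\<lambda>\<omega>. (norm (Z 0 \<omega>))\<^sup>2)" using mean_leD(1)[OF path_moments(2)[of 0]] by (simp add: path_0)
  note e2 = mean_leD(1)[OF eps_square[of 1]]
  show i: "integrable M (\<lambda>\<omega>. (Z 0 \<omega> \<bullet> a) *\<^sub>R eps 1 \<omega>)" "integrable M (\<lambda>\<omega>. (eps 1 \<omega> \<bullet> a) *\<^sub>R Z 0 \<omega>)"
    by (intro integrable_quadratic Z2 e2 Z_meas eps_meas)+
  have zero: "(\<integral>\<omega>. ((Z 0 \<omega> \<bullet> b) *\<^sub>R w) \<bullet> eps 1 \<omega> \<partial>M) = 0" for b w
  proof (rule indep_zero_mean(2))
    have "indep_var borel ((\<lambda>z. (z \<bullet> b) *\<^sub>R w) \<circ> Z 0) borel ((\<lambda>x. x) \<circ> eps 1)"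
      by (rule indep_var_compose[OF Z0_eps1_indep]) auto
    then show "indep_var borel (\<lambda>\<omega>. (Z 0 \<omega> \<bullet> b) *\<^sub>R w) borel (eps 1)" by (simp add: comp_def)
    have "integrable M (Z 0)" by (rule integrable_of_square[OF Z_meas Z2])
    then show "integrable M (\<lambda>\<omega>. (Z 0 \<omega> \<bullet> b) *\<^sub>R w)" by simp
  qed (simp_all add: eps_integrable eps_mean)
  show "(\<integral>\<omega>. (Z 0 \<omega> \<bullet> a) *\<^sub>R eps 1 \<omega> \<partial>M) = 0"
  proof (rule vector_eq_ldot[THEN iffD1], rule allI)
    fix w
    have "w \<bullet> (\<integral>\<omega>. (Z 0 \<omega> \<bullet> a) *\<^sub>R eps 1 \<omega> \<partial>M) = (\<integral>\<omega>. w \<bullet> ((Z 0 \<omega> \<bullet> a) *\<^sub>R eps 1 \<omega>) \<partial>M)"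
      by (rule integral_inner_right[symmetric]) (rule i)
    then show "w \<bullet> (\<integral>\<omega>. (Z 0 \<omega> \<bullet> a) *\<^sub>R eps 1 \<omega> \<partial>M) = w \<bullet> 0" using zero[of a w] by simp
  qed
  show "(\<integral>\<omega>. (eps 1 \<omega> \<bullet> a) *\<^sub>R Z 0 \<omega> \<partial>M) = 0"
  proof (rule vector_eq_ldot[THEN iffD1], rule allI)
    fix w
    have "w \<bullet> (\<integral>\<omega>. (eps 1 \<omega> \<bullet> a) *\<^sub>R Z 0 \<omega> \<partial>M) = (\<integral>\<omega>. w \<bullet> ((eps 1 \<omega> \<bullet> a) *\<^sub>R Z 0 \<omega>) \<partial>M)"
      by (rule integral_inner_right[symmetric]) (rule i)
    also have "\<dots> = (\<integral>\<omega>. ((Z 0 \<omega> \<bullet> w) *\<^sub>R a) \<bullet> eps 1 \<omega> \<partial>M)"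
      by (intro Bochner_Integration.integral_cong) (simp_all add: inner_commute mult.commute)
    finally show "w \<bullet> (\<integral>\<omega>. (eps 1 \<omega> \<bullet> a) *\<^sub>R Z 0 \<omega> \<partial>M) = w \<bullet> 0" using zero[of w a] by simp
  qed
qed

definition Gam where "Gam = op_expectation M (\<lambda>\<omega>. tensor (X 0 \<omega>) (X 0 \<omega>))"

lemma X01: "AE \<omega> in M. X 0 \<omega> = Z 0 \<omega>" "AE \<omega> in M. X 1 \<omega> = \<Psi> (Z 0 \<omega>) + eps 1 \<omega>"
  using X_eq_path
proof (eventually_elim)
  case (elim \<omega>)
  then show "X 0 \<omega> = Z 0 \<omega>" using path_0[of \<omega>] by (metis of_nat_0)
next
  show "AE \<omega> in M. X 1 \<omega> = \<Psi> (Z 0 \<omega>) + eps 1 \<omega>"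
    using X_eq_path
  proof eventually_elim
    case (elim \<omega>)
    have "X (int (Suc 0)) \<omega> = path \<omega> (Suc 0)" using elim by blast
    then show ?case by (simp add: path_Suc path_0)
  qed
qed

lemma X_square: "integrable M (\<lambda>\<omega>. (norm (X t \<omega>))\<^sup>2)"
proof -
  have sq: "(\<lambda>x::'h. (norm x)\<^sup>2) \<in> borel_measurable borel" by measurable
  have "mean_le M (\<lambda>\<omega>. (norm (X 0 \<omega>))\<^sup>2) C.L"
  proof -
    have i: "integrable M (\<lambda>\<omega>. (norm (X 0 \<omega>))\<^sup>2) \<longleftrightarrow> integrable M (\<lambda>\<omega>. (norm (path \<omega> 0))\<^sup>2)"
      by (rule integrable_cong_AE) (use X01(1) in \<open>auto simp: path_0\<close>)
    have "(\<integral>\<omega>. (norm (X 0 \<omega>))\<^sup>2 \<partial>M) = (\<integral>\<omega>. (norm (path \<omega> 0))\<^sup>2 \<partial>M)"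
      by (rule integral_cong_AE) (use X01(1) in \<open>auto simp: path_0\<close>)
    then show ?thesis using path_moments(2)[of 0] i by (simp add: mean_le_def)
  qed
  then have "mean_le M (\<lambda>\<omega>. (norm (X t \<omega>))\<^sup>2) C.L"
    using mean_le_distr_iff[OF X_meas[of 0] sq] mean_le_distr_iff[OF X_meas[of t] sq] X_law[of t] by simp
  then show ?thesis by (rule mean_leD)
qed

lemma Gam_apply: "Gam u = (\<integral>\<omega>. (X t \<omega> \<bullet> u) *\<^sub>R X t \<omega> \<partial>M)" "Gam u = (\<integral>\<omega>. (Z 0 \<omega> \<bullet> u) *\<^sub>R Z 0 \<omega> \<partial>M)"
proof -
  have 0: "Gam u = (\<integral>\<omega>. (X 0 \<omega> \<bullet> u) *\<^sub>R X 0 \<omega> \<partial>M)"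
    unfolding Gam_def by (rule op_expectation_tensor) (simp_all add: X_square)
  have q: "(\<lambda>x::'h. (x \<bullet> u) *\<^sub>R x) \<in> borel_measurable borel" by measurable
  have "(\<integral>\<omega>. (X 0 \<omega> \<bullet> u) *\<^sub>R X 0 \<omega> \<partial>M) = (\<integral>x. (x \<bullet> u) *\<^sub>R x \<partial>distr M borel (X 0))"
    by (rule integral_distr[OF X_meas q, symmetric])
  also have "\<dots> = (\<integral>\<omega>. (X t \<omega> \<bullet> u) *\<^sub>R X t \<omega> \<partial>M)"
    unfolding X_law[of t, symmetric] by (rule integral_distr[OF X_meas q])
  finally show "Gam u = (\<integral>\<omega>. (X t \<omega> \<bullet> u) *\<^sub>R X t \<omega> \<partial>M)" using 0 by simp
  show "Gam u = (\<integral>\<omega>. (Z 0 \<omega> \<bullet> u) *\<^sub>R Z 0 \<omega> \<partial>M)"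
    unfolding 0 by (rule integral_cong_AE) (use X01(1) in auto)
qed

lemma Gam_symmetric: "Gam u \<bullet> w = u \<bullet> Gam w"
proof -
  have i: "integrable M (\<lambda>\<omega>. (X 0 \<omega> \<bullet> a) *\<^sub>R X 0 \<omega>)" for a by (intro integrable_quadratic X_square X_meas)
  have "Gam u \<bullet> w = (\<integral>\<omega>. ((X 0 \<omega> \<bullet> u) *\<^sub>R X 0 \<omega>) \<bullet> w \<partial>M)"
    unfolding Gam_apply(1)[of u 0] by (rule integral_inner_left[symmetric]) (rule i)
  also have "\<dots> = (\<integral>\<omega>. u \<bullet> ((X 0 \<omega> \<bullet> w) *\<^sub>R X 0 \<omega>) \<partial>M)"
    by (intro Bochner_Integration.integral_cong) (simp_all add: inner_commute mult.commute)
  also have "\<dots> = u \<bullet> Gam w"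
    unfolding Gam_apply(1)[of w 0] by (rule integral_inner_right) (rule i)
  finally show ?thesis .
qed

lemma ZZ_integrable: "integrable M (\<lambda>\<omega>. (Z 0 \<omega> \<bullet> u) *\<^sub>R Z 0 \<omega>)"
  using mean_leD(1)[OF path_moments(2)[of 0]] by (intro integrable_quadratic Z_meas) (simp_all add: path_0)

lemma integral_blinfun: "integrable M f \<Longrightarrow> (\<integral>\<omega>. \<Psi> (f \<omega>) \<partial>M) = \<Psi> (\<integral>\<omega>. f \<omega> \<partial>M)"
  by (rule integral_bounded_linear) (auto intro: blinfun.bounded_linear_right)

lemma integrable_blinfun: "integrable M f \<Longrightarrow> integrable M (\<lambda>\<omega>. \<Psi> (f \<omega>))"
  by (rule integrable_bounded_linear) (auto intro: blinfun.bounded_linear_right)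

text \<open>Second moments of both sides of \<open>X 1 = \<Psi> (X 0) + eps 1\<close>, where the mixed terms vanish by
  independence.\<close>

lemma Gam_stationary:
  fixes \<Psi>' :: "'h \<Rightarrow>\<^sub>L 'h"
  assumes adj: "\<And>u w. \<Psi> u \<bullet> w = u \<bullet> \<Psi>' w"
  shows "Gam = (\<Psi> o\<^sub>L Gam o\<^sub>L \<Psi>') + S1"
proof (rule blinfun_eqI)
  fix u
  define a where "a = \<Psi>' u"
  have "Gam u = (\<integral>\<omega>. (X 1 \<omega> \<bullet> u) *\<^sub>R X 1 \<omega> \<partial>M)" by (rule Gam_apply)
  also have "\<dots> = (\<integral>\<omega>. \<Psi> ((Z 0 \<omega> \<bullet> a) *\<^sub>R Z 0 \<omega>) + (Z 0 \<omega> \<bullet> a) *\<^sub>R eps 1 \<omega>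
      + \<Psi> ((eps 1 \<omega> \<bullet> u) *\<^sub>R Z 0 \<omega>) + (eps 1 \<omega> \<bullet> u) *\<^sub>R eps 1 \<omega> \<partial>M)"
  proof (rule integral_cong_AE)
    show "AE \<omega> in M. (X 1 \<omega> \<bullet> u) *\<^sub>R X 1 \<omega> = \<Psi> ((Z 0 \<omega> \<bullet> a) *\<^sub>R Z 0 \<omega>) + (Z 0 \<omega> \<bullet> a) *\<^sub>R eps 1 \<omega>
      + \<Psi> ((eps 1 \<omega> \<bullet> u) *\<^sub>R Z 0 \<omega>) + (eps 1 \<omega> \<bullet> u) *\<^sub>R eps 1 \<omega>"
      using X01(2)
    proof eventually_elim
      case (elim \<omega>)
      have s: "\<Psi> z \<bullet> u = z \<bullet> a" for z by (simp add: adj a_def)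
      show ?case unfolding elim inner_add_left s by (simp add: blinfun.scaleR_right algebra_simps)
    qed
  qed (auto intro!: borel_measurable_add measurable_blinfun_apply)
  also have "\<dots> = \<Psi> (Gam a) + 0 + \<Psi> 0 + S1 u"
  proof -
    have e: "integrable M (\<lambda>\<omega>. (eps 1 \<omega> \<bullet> u) *\<^sub>R eps 1 \<omega>)"
      by (intro integrable_quadratic eps_meas mean_leD(1)[OF eps_square])
    note i = integrable_blinfun[OF ZZ_integrable[of a]] cross_zero(1)[of a] integrable_blinfun[OF cross_zero(3)[of u]] e
    show ?thesis
      using i by (simp add: integral_blinfun[OF ZZ_integrable] integral_blinfun[OF cross_zero(3)]
          cross_zero(2,4) F_moments(4) Gam_apply(2)[symmetric])
  qed
  finally show "Gam u = ((\<Psi> o\<^sub>L Gam o\<^sub>L \<Psi>') + S1) u" by (simp add: a_def blinfun.add_left)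
qed

lemma lag_cov: "op_expectation M (\<lambda>\<omega>. tensor (X 0 \<omega>) (X 1 \<omega>)) = (\<Psi> o\<^sub>L Gam)"
proof (rule blinfun_eqI)
  fix u
  have "op_expectation M (\<lambda>\<omega>. tensor (X 0 \<omega>) (X 1 \<omega>)) u = (\<integral>\<omega>. (X 0 \<omega> \<bullet> u) *\<^sub>R X 1 \<omega> \<partial>M)"
    by (rule op_expectation_tensor) (simp_all add: X_square)
  also have "\<dots> = (\<integral>\<omega>. \<Psi> ((Z 0 \<omega> \<bullet> u) *\<^sub>R Z 0 \<omega>) + (Z 0 \<omega> \<bullet> u) *\<^sub>R eps 1 \<omega> \<partial>M)"
  proof (rule integral_cong_AE)
    show "AE \<omega> in M. (X 0 \<omega> \<bullet> u) *\<^sub>R X 1 \<omega> = \<Psi> ((Z 0 \<omega> \<bullet> u) *\<^sub>R Z 0 \<omega>) + (Z 0 \<omega> \<bullet> u) *\<^sub>R eps 1 \<omega>"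
      using X01
    proof eventually_elim
      case (elim \<omega>)
      then show ?case by (simp add: blinfun.scaleR_right algebra_simps)
    qed
  qed (auto intro!: borel_measurable_add measurable_blinfun_apply)
  also have "\<dots> = \<Psi> (Gam u)"
    using integrable_blinfun[OF ZZ_integrable[of u]] cross_zero(1)[of u]
    by (simp add: integral_blinfun[OF ZZ_integrable] cross_zero(2) Gam_apply(2)[symmetric])
  finally show "op_expectation M (\<lambda>\<omega>. tensor (X 0 \<omega>) (X 1 \<omega>)) u = (\<Psi> o\<^sub>L Gam) u" by simp
qed

end

section \<open>Empirical innovations\<close>

context far1
begin

lemma eps_pair_indep:
  fixes f :: "'h \<Rightarrow> 'b::topological_space"
  assumes f: "f \<in> borel_measurable borel" and st: "s \<noteq> t"
  shows "indep_var borel (\<lambda>\<omega>. f (eps s \<omega>)) borel (\<lambda>\<omega>. f (eps t \<omega>))"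
proof -
  have c: "(\<lambda>g. f (g r)) \<in> measurable (PiM {r} (\<lambda>_. borel)) borel" for r :: int
    by (rule measurable_compose[where f = "\<lambda>g. g r" and g = f, OF measurable_component_singleton f]) simp
  have "indep_var (PiM {s} (\<lambda>_. borel)) (\<lambda>\<omega>. restrict (\<lambda>i. eps i \<omega>) {s})
      (PiM {t} (\<lambda>_. borel)) (\<lambda>\<omega>. restrict (\<lambda>i. eps i \<omega>) {t})"
    by (rule indep_var_restrict[OF eps_indep]) (use st in auto)
  from indep_var_compose[OF this c c] show ?thesis by (simp add: comp_def)
qed

text \<open>Pairwise independent centered variables are orthogonal in \<open>L\<^sup>2\<close>.\<close>

lemma centered_average:
  fixes f :: "'h \<Rightarrow> 'b::{real_inner, banach, second_countable_topology}"
  assumes f [measurable]: "f \<in> borel_measurable borel" and sq: "mean_le F (\<lambda>x. (norm (f x))\<^sup>2) a"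
    and mean: "(\<integral>x. f x \<partial>F) = 0" and n: "0 < n"
  shows "mean_le M (\<lambda>\<omega>. real n * (norm ((1 / real n) *\<^sub>R (\<Sum>t<n. f (eps (int (Suc t)) \<omega>))))\<^sup>2) a"
proof -
  have fe [measurable]: "(\<lambda>\<omega>. f (eps t \<omega>)) \<in> borel_measurable M" for t
    by (rule measurable_compose[OF eps_meas f])
  have L2: "mean_le M (\<lambda>\<omega>. (norm (f (eps t \<omega>)))\<^sup>2) a" for t
    using mean_le_eps_iff[of "\<lambda>x. (norm (f x))\<^sup>2" t] sq by simp
  have int: "integrable M (\<lambda>\<omega>. f (eps t \<omega>))" for t
    by (rule integrable_of_square[OF fe mean_leD(1)[OF L2]])
  have zero: "(\<integral>\<omega>. f (eps t \<omega>) \<partial>M) = 0" for t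
  proof -
    have "F = distr M borel (eps t)" unfolding F_def by (rule eps_law)
    then show ?thesis using mean integral_distr[OF eps_meas[of t] f] by simp
  qed
  have "(\<integral>\<omega>. f (eps (int (Suc s)) \<omega>) \<bullet> f (eps (int (Suc t)) \<omega>) \<partial>M) = 0" if "s < t" for s t
    by (rule indep_zero_mean(2)[OF eps_pair_indep[OF f] int int zero]) (use that in simp)
  then have *: "integrable M (\<lambda>\<omega>. (norm (\<Sum>t<n. f (eps (int (Suc t)) \<omega>)))\<^sup>2)"
    "(\<integral>\<omega>. (norm (\<Sum>t<n. f (eps (int (Suc t)) \<omega>)))\<^sup>2 \<partial>M) = (\<Sum>t<n. \<integral>\<omega>. (norm (f (eps (int (Suc t)) \<omega>)))\<^sup>2 \<partial>M)"
    using integral_norm_sq_sum_orthogonal[of n "\<lambda>t \<omega>. f (eps (int (Suc t)) \<omega>)" M] mean_leD(1)[OF L2] by simp_all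
  have "(\<Sum>t<n. \<integral>\<omega>. (norm (f (eps (int (Suc t)) \<omega>)))\<^sup>2 \<partial>M) \<le> (\<Sum>t<n. a)"
    by (intro sum_mono mean_leD(4)[OF L2])
  then have "mean_le M (\<lambda>\<omega>. (norm (\<Sum>t<n. f (eps (int (Suc t)) \<omega>)))\<^sup>2) (real n * a)"
    using * by (simp add: mean_le_def)
  then have "mean_le M (\<lambda>\<omega>. (1 / real n) * (norm (\<Sum>t<n. f (eps (int (Suc t)) \<omega>)))\<^sup>2) ((1 / real n) * (real n * a))"
    by (rule mean_le_cmult) simp
  then show ?thesis using n by (simp add: power_mult_distrib power2_eq_square)
qed

text \<open>Cover all but a small part of the law by finitely many cells of diameter at most \<open>\<delta>\<close>. The empirical
  frequencies of the cells are close to their probabilities by Chebyshev's inequality, and the average of the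
  fourth powers above the truncation level is small by Markov's inequality.\<close>

lemma empirical_coupling_prob:
  assumes \<gamma>: "0 < \<gamma>" and \<epsilon>: "0 < \<epsilon>"
  shows "\<forall>\<^sub>F n in sequentially. \<exists>A\<in>sets M. emeasure M (space M - A) \<le> ennreal \<epsilon> \<and>
    (\<forall>\<omega>\<in>A. \<exists>\<pi>. sets \<pi> = sets (borel \<Otimes>\<^sub>M count_space UNIV) \<and> prob_space \<pi> \<and> distr \<pi> borel fst = F \<and>
      distr \<pi> (count_space UNIV) snd = measure_pmf (pmf_of_set {1..n}) \<and>
      mean_le \<pi> (\<lambda>z. norm (fst z - eps (int (snd z)) \<omega>) ^ 4) \<gamma>)"
proof -
  interpret F: prob_space F by (rule F)
  define tail where "tail R x = (if norm x > R then norm x ^ 4 else 0)" for R and x :: 'h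
  have tm [measurable]: "tail R \<in> borel_measurable borel" for R unfolding tail_def[abs_def] by measurable
  have tF [measurable]: "tail R \<in> borel_measurable F" for R
    using tm measurable_cong_sets[OF F(2) refl] by blast
  \<comment> \<open>The four terms of the bound of \<open>empirical_coupling\<close> are made at most \<open>\<gamma> / 4\<close> each. The second
    part of the minimum gives the probability \<open>\<epsilon> / 2\<close> in Markov's inequality.\<close>
  define t0 where "t0 = min (\<gamma> / 32) (\<gamma> * \<epsilon> / 64)"
  have t0: "0 < t0" "t0 \<le> \<gamma> / 32" "t0 \<le> \<gamma> * \<epsilon> / 64" using \<gamma> \<epsilon> by (auto simp: t0_def)
  have "(\<lambda>N. \<integral>x. tail (real N) x \<partial>F) \<longlonglongrightarrow> (\<integral>x. 0 \<partial>F)"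
  proof (rule integral_dominated_convergence[where w = "\<lambda>x. norm x ^ 4"])
    show "AE x in F. (\<lambda>N. tail (real N) x) \<longlonglongrightarrow> 0"
    proof (rule AE_I2)
      fix x :: 'h
      obtain N0 :: nat where "norm x \<le> real N0" using real_arch_simple by blast
      then have "\<forall>\<^sub>F N in sequentially. tail (real N) x = 0"
        unfolding eventually_sequentially by (intro exI[of _ N0]) (auto simp: tail_def)
      then show "(\<lambda>N. tail (real N) x) \<longlonglongrightarrow> 0" by (rule tendsto_eventually)
    qed
    show "AE x in F. norm (tail (real N) x) \<le> norm x ^ 4" for N by (auto simp: tail_def)
  qed (use mean_leD(1)[OF F_moments(1)] in simp_all)
  then have "\<forall>\<^sub>F N in sequentially. (\<integral>x. tail (real N) x \<partial>F) < t0"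
    using t0(1) by (intro order_tendstoD(2)) simp_all
  then obtain R' :: nat where R': "(\<integral>x. tail (real R') x \<partial>F) < t0" by (auto simp: eventually_sequentially)
  define R where "R = real R'"
  have tail_int: "integrable F (tail R)"
    by (rule Bochner_Integration.integrable_bound[OF mean_leD(1)[OF F_moments(1)] tF]) (auto simp: tail_def)
  have T: "mean_le F (tail R) t0" using R' tail_int by (auto simp: mean_le_def R_def tail_def)
  define \<delta> where "\<delta> = min 1 (\<gamma> / 4)"
  have \<delta>: "0 < \<delta>" "\<delta> ^ 4 \<le> \<gamma> / 4"
  proof -
    show "0 < \<delta>" using \<gamma> by (simp add: \<delta>_def)
    then have "\<delta> ^ 4 \<le> \<delta> ^ 1" by (intro power_decreasing) (auto simp: \<delta>_def)
    then show "\<delta> ^ 4 \<le> \<gamma> / 4" by (simp add: \<delta>_def)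
  qed
  define v where "v = \<gamma> / (64 * (R ^ 4 + 1))"
  have R4: "0 \<le> R ^ 4" by (simp add: R_def)
  have v: "0 < v" using \<gamma> R4 by (simp add: v_def add_nonneg_pos)
  have v16: "16 * R ^ 4 * v \<le> \<gamma> / 4"
  proof -
    have "16 * R ^ 4 * v \<le> 16 * (R ^ 4 + 1) * v" using v by (intro mult_right_mono) auto
    also have "\<dots> = \<gamma> / 4" using R4 proof -
      have "0 < R ^ 4 + 1" using R4 by linarith
      then show ?thesis by (simp add: v_def field_simps)
    qed
    finally show ?thesis .
  qed
  obtain D :: "'h set" where D: "countable D" "\<And>U. open U \<Longrightarrow> U \<noteq> {} \<Longrightarrow> \<exists>d\<in>D. d \<in> U"
    using countable_dense_setE by blast
  have "D \<noteq> {}" using D(2)[of UNIV] by auto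
  define d where "d = from_nat_into D"
  have dense: "\<exists>i. dist x (d i) < \<delta> / 2" for x
  proof -
    obtain y where "y \<in> D" "y \<in> ball x (\<delta> / 2)" using D(2)[of "ball x (\<delta> / 2)"] \<delta> by auto
    moreover obtain i where "d i = y" using from_nat_into_surj[OF D(1) \<open>y \<in> D\<close>] by (auto simp: d_def)
    ultimately show ?thesis by auto
  qed
  define E where "E N = {x. \<forall>i<N. \<not> dist x (d i) < \<delta> / 2}" for N :: nat
  have Em [measurable]: "E N \<in> sets borel" for N
  proof -
    have "E N = (\<Inter>i\<in>{..<N}. {x. \<delta> / 2 \<le> dist x (d i)})" by (auto simp: E_def not_less)
    moreover have "closed (\<Inter>i\<in>{..<N}. {x. \<delta> / 2 \<le> dist x (d i)})"
      by (intro closed_INT ballI closed_Collect_le continuous_intros)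
    ultimately show ?thesis by simp
  qed
  have "(\<lambda>N. measure F (E N)) \<longlonglongrightarrow> measure F (\<Inter>N. E N)"
    by (rule F.finite_Lim_measure_decseq) (auto simp: F(2) decseq_def E_def)
  moreover have "(\<Inter>N. E N) = {}" using dense unfolding E_def by blast
  ultimately have "\<forall>\<^sub>F N in sequentially. measure F (E N) < v / 2"
    using v by (intro order_tendstoD(2)) auto
  then obtain N where N: "measure F (E N) < v / 2" by (auto simp: eventually_sequentially)
  \<comment> \<open>the index of the first ball that contains \<open>x\<close>, shifted by one; cell 0 is the rest\<close>
  define c where "c x = (if \<exists>i<N. dist x (d i) < \<delta> / 2 then Suc (LEAST i. dist x (d i) < \<delta> / 2) else 0)" for x
  have c_meas [measurable]: "c \<in> measurable borel (count_space UNIV)" unfolding c_def[abs_def] by measurable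
  have c0: "{x. c x = 0} = E N" by (auto simp: c_def E_def)
  have cN: "c x \<le> N" for x
  proof (cases "\<exists>i<N. dist x (d i) < \<delta> / 2")
    case True
    then obtain i where i: "i < N" "dist x (d i) < \<delta> / 2" by blast
    then have "(LEAST i. dist x (d i) < \<delta> / 2) \<le> i" by (intro Least_le)
    then show ?thesis using i True by (simp add: c_def)
  qed (auto simp: c_def)
  have close: "dist x x' \<le> \<delta>" if "c x = c x'" "c x \<noteq> 0" for x x'
  proof -
    define i where "i = c x - 1"
    have a: "dist y (d (c y - 1)) < \<delta> / 2" if "c y \<noteq> 0" for y
      using that LeastI_ex[OF dense[of y]] by (auto simp: c_def split: if_splits)
    have "dist x (d i) < \<delta> / 2" "dist x' (d i) < \<delta> / 2" using a[of x] a[of x'] that by (simp_all add: i_def)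
    then show ?thesis using dist_triangle_half_l[of x "d i" \<delta> x'] by simp
  qed
  define p where "p i = measure F {x. c x = i}" for i
  define g where "g i x = of_bool (c x = i) - p i" for i x
  have gm [measurable]: "g i \<in> borel_measurable borel" for i unfolding g_def[abs_def] by measurable
  have cs: "{x. c x = i} \<in> sets F" for i
    using measurable_sets[OF c_meas, of "{i}"] by (simp add: F(2) vimage_def)
  have ind_int: "integrable F (\<lambda>x. of_bool (c x = i) :: real)" "(\<integral>x. of_bool (c x = i) \<partial>F) = p i" for i
  proof -
    have e: "(\<lambda>x. of_bool (c x = i) :: real) = indicator {x. c x = i}" by (auto simp: indicator_def)
    show "integrable F (\<lambda>x. of_bool (c x = i) :: real)" "(\<integral>x. of_bool (c x = i) \<partial>F) = p i"
      unfolding e using cs F.emeasure_finite[of "{x. c x = i}"]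
      by (auto simp: p_def F(3) less_top[symmetric] intro!: integrable_real_indicator)
  qed
  have g0: "(\<integral>x. g i x \<partial>F) = 0" for i
    unfolding g_def using ind_int[of i] F.prob_space by simp
  have p01: "0 \<le> p i" "p i \<le> 1" for i by (simp_all add: p_def F.prob_le_1)
  have g1: "mean_le F (\<lambda>x. (norm (g i x))\<^sup>2) 1" for i
  proof (rule mean_le_mono[OF F.mean_le_const[of 1]])
    show "(\<lambda>x. (norm (g i x))\<^sup>2) \<in> borel_measurable F" unfolding measurable_cong_sets[OF F(2) refl] by measurable
    show "(norm (g i x))\<^sup>2 \<le> 1" for x
    proof -
      have "\<bar>g i x\<bar> \<le> 1" using p01[of i] by (auto simp: g_def)
      then show ?thesis by (simp add: abs_square_le_1)
    qed
  qed simp_all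
  define s where "s = v / (2 * real (Suc N))"
  have s: "0 < s" "real (Suc N) * s = v / 2" using v by (simp_all add: s_def del: of_nat_Suc)
  have "(\<lambda>n. (real (Suc N) / s\<^sup>2) * (1 / real n)) \<longlonglongrightarrow> (real (Suc N) / s\<^sup>2) * 0" by (intro tendsto_intros lim_1_over_n)
  then have "\<forall>\<^sub>F n in sequentially. (real (Suc N) / s\<^sup>2) * (1 / real n) < \<epsilon> / 2"
    by (rule order_tendstoD(2)) (use \<epsilon> in simp)
  then show ?thesis
    using eventually_gt_at_top[of 0]
  proof eventually_elim
    case (elim n)
    then have n: "0 < n" by simp
    define Dv where "Dv i \<omega> = (1 / real n) *\<^sub>R (\<Sum>t<n. g i (eps (int (Suc t)) \<omega>))" for i \<omega>
    define Sq where "Sq \<omega> = (\<Sum>i\<le>N. (Dv i \<omega>)\<^sup>2)" for \<omega>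
    define TA where "TA \<omega> = (1 / real n) * (\<Sum>j=1..n. tail R (eps (int j) \<omega>))" for \<omega>
    have "mean_le M (\<lambda>\<omega>. (Dv i \<omega>)\<^sup>2) (1 / real n)" for i
      using mean_le_cmult[OF centered_average[OF gm g1 g0 n, of i], of "1 / real n"] n by (simp add: Dv_def power_divide)
    then have "mean_le M Sq (\<Sum>i\<le>N. 1 / real n)" unfolding Sq_def[abs_def] by (rule mean_le_sum)
    then have mSq: "mean_le M Sq (real (Suc N) * (1 / real n))" by simp
    have mT: "mean_le M (\<lambda>\<omega>. tail R (eps t \<omega>)) t0" for t
      using mean_le_eps_iff[OF tm, of R t t0] T by (simp add: tail_def)
    have "mean_le M TA ((1 / real n) * (\<Sum>j=1..n. t0))"
      unfolding TA_def[abs_def] by (intro mean_le_cmult mean_le_sum mT) simp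
    then have mTA: "mean_le M TA t0" using n by simp
    define A where "A = {\<omega>\<in>space M. Sq \<omega> \<le> s\<^sup>2 \<and> TA \<omega> \<le> \<gamma> / 32}"
    have [measurable]: "Sq \<in> borel_measurable M" "TA \<in> borel_measurable M" by (rule mean_leD[OF mSq] mean_leD[OF mTA])+
    have A: "A \<in> sets M" unfolding A_def by measurable
    have "space M - A = {\<omega>\<in>space M. Sq \<omega> > s\<^sup>2} \<union> {\<omega>\<in>space M. TA \<omega> > \<gamma> / 32}" by (auto simp: A_def)
    then have "emeasure M (space M - A) \<le> emeasure M {\<omega>\<in>space M. Sq \<omega> > s\<^sup>2} + emeasure M {\<omega>\<in>space M. TA \<omega> > \<gamma> / 32}"
      by (simp add: emeasure_subadditive)
    also have "\<dots> \<le> ennreal ((real (Suc N) * (1 / real n)) / s\<^sup>2) + ennreal (t0 / (\<gamma> / 32))"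
      by (intro add_mono mean_le_markov mSq mTA) (use s \<gamma> in auto)
    also have "\<dots> \<le> ennreal (\<epsilon> / 2) + ennreal (\<epsilon> / 2)"
    proof (intro add_mono ennreal_leI)
      show "(real (Suc N) * (1 / real n)) / s\<^sup>2 \<le> \<epsilon> / 2" using elim(1) by (simp add: mult.commute)
      show "t0 / (\<gamma> / 32) \<le> \<epsilon> / 2" using t0(3) \<gamma> by (simp add: field_simps)
    qed
    also have "\<dots> = ennreal \<epsilon>" using \<epsilon> by (subst ennreal_plus[symmetric]) auto
    finally have PA: "emeasure M (space M - A) \<le> ennreal \<epsilon>" .
    show ?case
    proof (intro bexI[OF _ A] conjI PA ballI)
      fix \<omega> assume \<omega>: "\<omega> \<in> A"
      have freq: "real (card {j\<in>{1..n}. c (eps (int j) \<omega>) = i}) / real n - p i = Dv i \<omega>" for i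
      proof -
        have "(\<Sum>t<n. g i (eps (int (Suc t)) \<omega>)) = (\<Sum>j=1..n. g i (eps (int j) \<omega>))" by (rule sum_1_Suc[symmetric])
        also have "\<dots> = (\<Sum>j=1..n. of_bool (c (eps (int j) \<omega>) = i)) - real n * p i"
          by (simp add: g_def sum_subtractf)
        also have "(\<Sum>j=1..n. of_bool (c (eps (int j) \<omega>) = i)) = real (card {j\<in>{1..n}. c (eps (int j) \<omega>) = i})"
          by (simp add: of_bool_def sum.If_cases Int_def)
        finally show ?thesis using n by (simp add: Dv_def diff_divide_distrib)
      qed
      have "\<bar>p i - real (card {j\<in>{1..n}. c (eps (int j) \<omega>) = i}) / real n\<bar> \<le> s" if "i \<le> N" for i
      proof -
        have "(Dv i \<omega>)\<^sup>2 \<le> Sq \<omega>" unfolding Sq_def by (rule member_le_sum) (use that in auto)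
        also have "\<dots> \<le> s\<^sup>2" using \<omega> by (simp add: A_def)
        finally have "\<bar>Dv i \<omega>\<bar> \<le> s" using s by (simp add: abs_le_square_iff[symmetric])
        then show ?thesis using freq[of i] by linarith
      qed
      then have "(\<Sum>i\<le>N. \<bar>p i - real (card {j\<in>{1..n}. c (eps (int j) \<omega>) = i}) / real n\<bar>) \<le> (\<Sum>i\<le>N. s)"
        by (intro sum_mono) auto
      also have "\<dots> = v / 2" using s(2) by simp
      finally have vv: "measure F {x. c x = 0} + (\<Sum>i\<le>N. \<bar>measure F {x. c x = i} - real (card {j\<in>{1..n}. c (eps (int j) \<omega>) = i}) / real n\<bar>) \<le> v"
        using N unfolding c0 p_def by linarith
      have R0: "0 \<le> R" by (simp add: R_def)
      obtain \<pi> where \<pi>: "sets \<pi> = sets (borel \<Otimes>\<^sub>M count_space UNIV)" "prob_space \<pi>"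
        "distr \<pi> borel fst = F" "distr \<pi> (count_space UNIV) snd = measure_pmf (pmf_of_set {1..n})"
        "mean_le \<pi> (\<lambda>z. norm (fst z - eps (int (snd z)) \<omega>) ^ 4)
          (\<delta> ^ 4 + 16 * R ^ 4 * v + 8 * t0 + 8 * ((1 / real n) * (\<Sum>j=1..n. if norm (eps (int j) \<omega>) > R then norm (eps (int j) \<omega>) ^ 4 else 0)))"
        using empirical_coupling[OF F(1,2) n c_meas cN close T[unfolded tail_def[abs_def]] less_imp_le[OF \<delta>(1)] R0 vv] by blast
      have "TA \<omega> \<le> \<gamma> / 32" using \<omega> by (simp add: A_def)
      then have "\<delta> ^ 4 + 16 * R ^ 4 * v + 8 * t0 + 8 * ((1 / real n) * (\<Sum>j=1..n. if norm (eps (int j) \<omega>) > R then norm (eps (int j) \<omega>) ^ 4 else 0)) \<le> \<gamma>"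
        using \<delta>(2) v16 t0(2) unfolding TA_def tail_def by linarith
      then show "\<exists>\<pi>. sets \<pi> = sets (borel \<Otimes>\<^sub>M count_space UNIV) \<and> prob_space \<pi> \<and> distr \<pi> borel fst = F \<and>
        distr \<pi> (count_space UNIV) snd = measure_pmf (pmf_of_set {1..n}) \<and>
        mean_le \<pi> (\<lambda>z. norm (fst z - eps (int (snd z)) \<omega>) ^ 4) \<gamma>"
        using \<pi> mean_le_weaken[OF \<pi>(5)] by blast
    qed
  qed
qed

section \<open>Bounds on the data\<close>

text \<open>All quantities of the data that have to be bounded in probability, except the distance of the empirical
  innovation law, are collected in one random variable, whose mean is bounded in \<open>n\<close>.\<close>

definition data_size where
  "data_size n \<omega> = (1 / (1 - norm \<Psi>))\<^sup>2 * (real n * (norm (noise n \<Psi> (path \<omega>) (\<lambda>i. Z i \<omega>) - S1))\<^sup>2)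
     + real n * (norm (cross_sum n (path \<omega>) (\<lambda>i. Z i \<omega>)))\<^sup>2
     + (1 / real n) * (\<Sum>t<n. norm (path \<omega> t) ^ 4) + (1 / real n) * (\<Sum>j=1..n. norm (eps (int j) \<omega>) ^ 4)
     + real n * (norm ((1 / real n) *\<^sub>R (\<Sum>t<n. eps (int (Suc t)) \<omega>)))\<^sup>2
     + norm (path \<omega> 0) ^ 4 + norm (path \<omega> n) ^ 4"

lemma data_size_bounded: "\<exists>c. \<forall>n>0. mean_le M (data_size n) c"
proof -
  define q where "q = C.L\<^sup>2 * C.kap\<^sup>2"
  define th where "th = 4 * (1 + m4)\<^sup>2"
  have e1: "C.e1 \<omega> = (\<lambda>i. Z i \<omega>)" "C.e2 \<omega> = (\<lambda>_. 0)" "C.Y \<omega> = (\<lambda>_. 0)" for \<omega>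
    by (rule ext, simp add: C_conv)+
  have "mean_le M (data_size n) ((1 / (1 - norm \<Psi>))\<^sup>2 * (248 * (q * th)) + 10 * (q * th) + C.L + me + (1 + me) + C.L + C.L)"
    if n: "0 < n" for n
  proof -
    have th: "C.theta n \<le> th"
    proof -
      have "1 * (1 + m4) \<le> (1 + m4) * (1 + m4)" using m4_nonneg by (intro mult_right_mono) auto
      then have "1 + m4 \<le> (1 + m4)\<^sup>2" by (simp only: power2_eq_square mult_1)
      moreover have "(norm \<Psi>)\<^sup>2 \<le> 1" using Psi_norm by (simp add: power_le_one)
      moreover have "1 / real n \<le> 1" using n by simp
      ultimately show ?thesis using m4_nonneg unfolding C.theta_def th_def by linarith
    qed
    have qth: "q * C.theta n \<le> q * th" by (intro mult_left_mono th) (simp add: q_def)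
    have noise0: "noise n 0 (\<lambda>_. 0) (\<lambda>_. 0) = (0 :: 'h \<Rightarrow>\<^sub>L 'h)" "cross_sum n (\<lambda>_. 0) (\<lambda>_. 0) = (0 :: 'h \<Rightarrow>\<^sub>L 'h)"
      by (simp_all add: noise_def cross_sum_def tensor.zero_right tensor.zero_left)
    have "mean_le M (\<lambda>\<omega>. real n * (norm (noise n \<Psi> (path \<omega>) (\<lambda>i. Z i \<omega>) - S1))\<^sup>2) (248 * (q * C.theta n))"
      using C.noise_coupling[OF n] unfolding e1 C_conv(2) noise0 q_def by (simp only: diff_self diff_zero)
    then have 1: "mean_le M (\<lambda>\<omega>. real n * (norm (noise n \<Psi> (path \<omega>) (\<lambda>i. Z i \<omega>) - S1))\<^sup>2) (248 * (q * th))"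
      by (rule mean_le_weaken) (use qth in simp)
    have "mean_le M (\<lambda>\<omega>. real n * (norm (cross_sum n (path \<omega>) (\<lambda>i. Z i \<omega>)))\<^sup>2) (10 * (q * C.theta n))"
      using C.cross_sum_coupling[OF n] unfolding e1 C_conv(2) noise0 q_def by (simp only: diff_self diff_zero)
    then have 2: "mean_le M (\<lambda>\<omega>. real n * (norm (cross_sum n (path \<omega>) (\<lambda>i. Z i \<omega>)))\<^sup>2) (10 * (q * th))"
      by (rule mean_le_weaken) (use qth in simp)
    have "mean_le M (\<lambda>\<omega>. (1 / real n) * (\<Sum>t<n. norm (path \<omega> t) ^ 4)) ((1 / real n) * (\<Sum>t<n. C.L))"
      by (intro mean_le_cmult mean_le_sum path_moments) simp
    then have 3: "mean_le M (\<lambda>\<omega>. (1 / real n) * (\<Sum>t<n. norm (path \<omega> t) ^ 4)) C.L" using n by simp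
    have "mean_le M (\<lambda>\<omega>. (1 / real n) * (\<Sum>j=1..n. norm (eps (int j) \<omega>) ^ 4)) ((1 / real n) * (\<Sum>j=1..n. me))"
      by (intro mean_le_cmult mean_le_sum eps_fourth) simp
    then have 4: "mean_le M (\<lambda>\<omega>. (1 / real n) * (\<Sum>j=1..n. norm (eps (int j) \<omega>) ^ 4)) me" using n by simp
    have "mean_le F (\<lambda>x. (norm x)\<^sup>2) (1 + me)"
      using eps_square[of 0] mean_le_eps_iff[of "\<lambda>x. (norm x)\<^sup>2" 0] by simp
    from centered_average[of "\<lambda>x. x", OF _ this F_moments(2) n]
    have 5: "mean_le M (\<lambda>\<omega>. real n * (norm ((1 / real n) *\<^sub>R (\<Sum>t<n. eps (int (Suc t)) \<omega>)))\<^sup>2) (1 + me)" by simp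
    show ?thesis
      unfolding data_size_def[abs_def]
      by (intro mean_le_add mean_le_cmult[OF 1] 2 3 4 5 path_moments) simp
  qed
  then show ?thesis by blast
qed

end

text \<open>The residual at time \<open>t + 1\<close> differs from the innovation by \<open>(\<Psi> - Q) (x t)\<close>. The mean residual is of order
  \<open>1 / sqrt n\<close> because the mean of the innovations is, and with it the mean \<open>ax\<close> of the path: averaging the
  recursion gives \<open>ax = \<Psi> ax\<close> up to the mean innovation and a boundary term of order \<open>1 / n\<close>.\<close>

lemma residual_bounds:
  fixes \<Psi> Q :: "'h::{real_inner, banach} \<Rightarrow>\<^sub>L 'h" and x e :: "nat \<Rightarrow> 'h"
  assumes n: "0 < n" and ar: "\<And>t. t < n \<Longrightarrow> x (Suc t) = \<Psi> (x t) + e (Suc t)" and \<Psi>: "norm \<Psi> < 1"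
    and PQ: "norm (\<Psi> - Q) \<le> \<eta>" "\<eta> \<le> 1"
    and E: "real n * (norm ((1 / real n) *\<^sub>R (\<Sum>t<n. e (Suc t))))\<^sup>2 \<le> K"
    and X4: "(1 / real n) * (\<Sum>t<n. norm (x t) ^ 4) \<le> K" and x0: "norm (x 0) ^ 4 \<le> K" and xn: "norm (x n) ^ 4 \<le> K"
  defines "b \<equiv> (sqrt K + 1 / (1 - norm \<Psi>) * (sqrt K + 2 * (1 + K)))\<^sup>2"
  shows "(norm (residual_mean n Q x))\<^sup>2 \<le> b / real n"
    "(1 / real n) * (\<Sum>j=1..n. norm (e j - centered_residual n Q x j) ^ 4) \<le> 8 * \<eta> ^ 4 * K + 8 * b\<^sup>2 / real n"
    "real n * (norm (cov_bias n Q x))\<^sup>2 \<le> (b + 2 * (1 + K))\<^sup>2 / real n"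
proof -
  define \<kappa> where "\<kappa> = 1 / (1 - norm \<Psi>)"
  define ae where "ae = (1 / real n) *\<^sub>R (\<Sum>t<n. e (Suc t))"
  define ax where "ax = (1 / real n) *\<^sub>R (\<Sum>t<n. x t)"
  define rm where "rm = residual_mean n Q x"
  have K: "0 \<le> K" using x0 zero_le_power[OF norm_ge_zero, of "x 0" 4] by linarith
  have \<kappa>: "0 < \<kappa>" "\<kappa> * (1 - norm \<Psi>) = 1" using \<Psi> by (simp_all add: \<kappa>_def)
  have \<eta>: "0 \<le> \<eta>" using PQ(1) norm_ge_zero order_trans by blast
  define r where "r = 1 / sqrt (real n)"
  have r: "0 < r" "r\<^sup>2 = 1 / real n" "1 / real n \<le> r"
  proof -
    show "0 < r" using n by (simp add: r_def)
    show r2: "r\<^sup>2 = 1 / real n" by (simp add: r_def power_divide)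
    have "r \<le> 1" using n by (simp add: r_def)
    then have "r * r \<le> r * 1" using \<open>0 < r\<close> by (intro mult_left_mono) auto
    then show "1 / real n \<le> r" unfolding r2[symmetric] power2_eq_square by simp
  qed
  have le1K: "y \<le> 1 + K" if "y ^ 4 \<le> K" "0 \<le> y" for y :: real
  proof (cases "y \<le> 1")
    case False
    then have "y ^ 1 \<le> y ^ 4" by (intro power_increasing) auto
    then show ?thesis using that by simp
  qed (use K in simp)
  have nae: "norm ae \<le> sqrt K * r"
  proof (rule power2_le_imp_le)
    show "(norm ae)\<^sup>2 \<le> (sqrt K * r)\<^sup>2" using E n K by (simp add: ae_def[symmetric] power_mult_distrib r(2) field_simps)
  qed (use K r in simp)
  have shift: "(\<Sum>t<n. x (Suc t)) = (\<Sum>t<n. x t) - x 0 + x n" by (induction n) auto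
  have "(\<Sum>t<n. x (Suc t)) = \<Psi> (\<Sum>t<n. x t) + (\<Sum>t<n. e (Suc t))"
    by (simp add: ar sum.distrib blinfun.sum_right)
  then have "(\<Sum>t<n. x t) = \<Psi> (\<Sum>t<n. x t) + (\<Sum>t<n. e (Suc t)) + (x 0 - x n)" using shift by (simp add: algebra_simps)
  then have "(1 / real n) *\<^sub>R (\<Sum>t<n. x t) = (1 / real n) *\<^sub>R (\<Psi> (\<Sum>t<n. x t) + (\<Sum>t<n. e (Suc t)) + (x 0 - x n))" by (rule arg_cong)
  then have "ax = \<Psi> ax + ae + (1 / real n) *\<^sub>R (x 0 - x n)"
    unfolding ax_def ae_def blinfun.scaleR_right scaleR_add_right .
  then have "norm ax \<le> norm (\<Psi> ax) + norm ae + norm ((1 / real n) *\<^sub>R (x 0 - x n))"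
    by (metis norm_add_leD norm_triangle_ineq norm_triangle_le order_refl add_mono)
  moreover have "norm (\<Psi> ax) \<le> norm \<Psi> * norm ax" by (rule norm_blinfun)
  moreover have "norm ((1 / real n) *\<^sub>R (x 0 - x n)) \<le> r * (2 * (1 + K))"
  proof -
    have "norm (x 0 - x n) \<le> 2 * (1 + K)"
      using norm_triangle_ineq4[of "x 0" "x n"] le1K[OF x0] le1K[OF xn] by simp
    then have "(1 / real n) * norm (x 0 - x n) \<le> r * (2 * (1 + K))" using r by (intro mult_mono) auto
    then show ?thesis by simp
  qed
  ultimately have "norm ax \<le> norm \<Psi> * norm ax + sqrt K * r + r * (2 * (1 + K))" using nae by linarith
  then have "(1 - norm \<Psi>) * norm ax \<le> sqrt K * r + r * (2 * (1 + K))" unfolding left_diff_distrib by linarith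
  then have "\<kappa> * ((1 - norm \<Psi>) * norm ax) \<le> \<kappa> * (sqrt K * r + r * (2 * (1 + K)))" using \<kappa> by (intro mult_left_mono) auto
  also have "\<kappa> * ((1 - norm \<Psi>) * norm ax) = norm ax" unfolding mult.assoc[symmetric] \<kappa>(2) by simp
  also have "\<kappa> * (sqrt K * r + r * (2 * (1 + K))) = \<kappa> * (sqrt K + 2 * (1 + K)) * r" by algebra
  finally have nax: "norm ax \<le> \<kappa> * (sqrt K + 2 * (1 + K)) * r" .
  have res: "residual Q x (Suc t) = e (Suc t) + (\<Psi> - Q) (x t)" if "t < n" for t
    by (simp add: residual_def ar[OF that] blinfun.diff_left)
  have "rm = ae + (\<Psi> - Q) ax"
  proof -
    have "(\<Sum>i=1..n. residual Q x i) = (\<Sum>t<n. e (Suc t)) + (\<Psi> - Q) (\<Sum>t<n. x t)"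
      unfolding sum_1_Suc by (simp add: res sum.distrib blinfun.sum_right)
    then show ?thesis by (simp add: rm_def residual_mean_def ae_def ax_def scaleR_add_right blinfun.scaleR_right)
  qed
  then have "norm rm \<le> norm ae + norm ((\<Psi> - Q) ax)" by (simp add: norm_triangle_ineq)
  also have "norm ((\<Psi> - Q) ax) \<le> 1 * norm ax"
    using order_trans[OF norm_blinfun mult_right_mono[of "norm (\<Psi> - Q)" 1 "norm ax"]] PQ by simp
  finally have "norm rm \<le> sqrt K * r + \<kappa> * (sqrt K + 2 * (1 + K)) * r" using nae nax by linarith
  also have "\<dots> = (sqrt K + \<kappa> * (sqrt K + 2 * (1 + K))) * r" by algebra
  finally have "norm rm \<le> (sqrt K + \<kappa> * (sqrt K + 2 * (1 + K))) * r" .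
  then have "(norm rm)\<^sup>2 \<le> ((sqrt K + \<kappa> * (sqrt K + 2 * (1 + K))) * r)\<^sup>2" by (intro power_mono) auto
  then show rm2: "(norm (residual_mean n Q x))\<^sup>2 \<le> b / real n"
    by (simp add: rm_def b_def \<kappa>_def power_mult_distrib r(2))
  have rm4: "norm rm ^ 4 \<le> b\<^sup>2 / real n"
  proof -
    have "norm rm ^ 4 = ((norm rm)\<^sup>2)\<^sup>2" by simp
    also have "\<dots> \<le> (b / real n)\<^sup>2" using rm2 by (intro power_mono) (auto simp: rm_def)
    also have "\<dots> = b\<^sup>2 / real n * (1 / real n)" by (simp add: power2_eq_square)
    also have "\<dots> \<le> b\<^sup>2 / real n * 1" using n by (intro mult_left_mono) auto
    finally show ?thesis by simp
  qed
  have "norm (e (Suc t) - centered_residual n Q x (Suc t)) ^ 4 \<le> 8 * (b\<^sup>2 / real n) + 8 * \<eta> ^ 4 * norm (x t) ^ 4" if "t < n" for t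
  proof -
    have "e (Suc t) - centered_residual n Q x (Suc t) = rm + (- ((\<Psi> - Q) (x t)))"
      using res[OF that] by (simp add: centered_residual_def rm_def residual_mean_def)
    then have "norm (e (Suc t) - centered_residual n Q x (Suc t)) ^ 4 \<le> 8 * norm rm ^ 4 + 8 * norm ((\<Psi> - Q) (x t)) ^ 4"
      using norm_add_fourth_le[of rm "- ((\<Psi> - Q) (x t))"] by simp
    moreover have "norm ((\<Psi> - Q) (x t)) ^ 4 \<le> (\<eta> * norm (x t)) ^ 4"
      using order_trans[OF norm_blinfun mult_right_mono[OF PQ(1)]] by (intro power_mono) auto
    ultimately show ?thesis using rm4 by (simp add: power_mult_distrib)
  qed
  then have "(\<Sum>j=1..n. norm (e j - centered_residual n Q x j) ^ 4) \<le> (\<Sum>t<n. 8 * (b\<^sup>2 / real n) + 8 * \<eta> ^ 4 * norm (x t) ^ 4)"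
    unfolding sum_1_Suc by (intro sum_mono) auto
  then have "(1 / real n) * (\<Sum>j=1..n. norm (e j - centered_residual n Q x j) ^ 4)
    \<le> (1 / real n) * (\<Sum>t<n. 8 * (b\<^sup>2 / real n) + 8 * \<eta> ^ 4 * norm (x t) ^ 4)" by (rule mult_left_mono) simp
  also have "\<dots> = 8 * (b\<^sup>2 / real n) + 8 * \<eta> ^ 4 * ((1 / real n) * (\<Sum>t<n. norm (x t) ^ 4))"
    using n by (simp add: sum.distrib sum_distrib_left[symmetric] add_divide_distrib)
  also have "\<dots> \<le> 8 * (b\<^sup>2 / real n) + 8 * \<eta> ^ 4 * K" using X4 \<eta> by (intro add_left_mono mult_left_mono) auto
  finally show "(1 / real n) * (\<Sum>j=1..n. norm (e j - centered_residual n Q x j) ^ 4) \<le> 8 * \<eta> ^ 4 * K + 8 * b\<^sup>2 / real n"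
    by simp
  have tt: "norm (tensor y y) \<le> (norm y)\<^sup>2" for y :: 'h using norm_tensor_le[of y y] by (simp add: power2_eq_square)
  have sq: "(norm y)\<^sup>2 \<le> 1 + K" if "norm y ^ 4 \<le> K" for y :: 'h using square_le_fourth[of "norm y"] that by linarith
  have "norm (cov_bias n Q x) \<le> norm (tensor rm rm) + norm ((1 / real n) *\<^sub>R (tensor (x 0) (x 0) - tensor (x n) (x n)))"
    unfolding cov_bias_def rm_def by (rule norm_triangle_ineq)
  also have "norm (tensor rm rm) \<le> b / real n" using tt[of rm] rm2 by (simp add: rm_def)
  also have "norm ((1 / real n) *\<^sub>R (tensor (x 0) (x 0) - tensor (x n) (x n))) \<le> (1 / real n) * (2 * (1 + K))"
  proof -
    have "norm (tensor (x 0) (x 0) - tensor (x n) (x n)) \<le> 2 * (1 + K)"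
      using order_trans[OF norm_triangle_ineq4 add_mono[OF order_trans[OF tt sq[OF x0]] order_trans[OF tt sq[OF xn]]]] by simp
    then have "(1 / real n) * norm (tensor (x 0) (x 0) - tensor (x n) (x n)) \<le> (1 / real n) * (2 * (1 + K))" by (rule mult_left_mono) simp
    then show ?thesis by simp
  qed
  finally have "norm (cov_bias n Q x) \<le> (b + 2 * (1 + K)) / real n" by (simp add: add_divide_distrib)
  then have "(norm (cov_bias n Q x))\<^sup>2 \<le> ((b + 2 * (1 + K)) / real n)\<^sup>2" by (intro power_mono) auto
  then have "real n * (norm (cov_bias n Q x))\<^sup>2 \<le> real n * ((b + 2 * (1 + K)) / real n)\<^sup>2" by (rule mult_left_mono) simp
  also have "\<dots> = (b + 2 * (1 + K))\<^sup>2 / real n" using n by (simp add: power_divide power2_eq_square)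
  finally show "real n * (norm (cov_bias n Q x))\<^sup>2 \<le> (b + 2 * (1 + K))\<^sup>2 / real n" .
qed

lemma Gamma_dagger_Pi_hat:
  assumes "eigen_listing A l v"
  shows "Gamma_dagger k l v o\<^sub>L Pi_hat k v = Gamma_dagger k l v"
  by (rule blinfun_eqI) (auto simp: Gamma_dagger_apply Pi_hat_inner[OF assms] intro!: sum.cong)

lemma boot_const_nonneg:
  assumes "0 \<le> m" shows "0 \<le> boot_const \<rho> m"
  unfolding boot_const_def Let_def by (intro mult_nonneg_nonneg add_nonneg_nonneg zero_le_power2 zero_le_even_power) (use assms in auto)

lemma eventually_inverse_le:
  assumes "0 < (d::real)" shows "\<forall>\<^sub>F n in sequentially. c * (1 / real n) \<le> d"
proof -
  have "(\<lambda>n. c * (1 / real n)) \<longlonglongrightarrow> c * 0" by (intro tendsto_intros lim_1_over_n)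
  then have "\<forall>\<^sub>F n in sequentially. c * (1 / real n) < d" by (rule order_tendstoD(2)) (use assms in simp)
  then show ?thesis by eventually_elim simp
qed

context far1
begin

text \<open>The stochastic part of the argument ends here: for data that satisfy finitely many bounds, the distance
  is small, whichever eigenvectors are listed. This form is adapted to the fact that eigenvectors need
  not depend measurably on the data. The rate \<open>\<tau>\<close> of the innovations is chosen first, from the constant of
  \<open>bootstrap_bound\<close>; then the distance \<open>\<eta>\<close> of the operators, as it enters the distance of residuals and
  innovations, and the quality \<open>\<gamma>\<close> of the empirical coupling.\<close>

lemma bootstrap_close_on_good_data:
  fixes lam :: "nat \<Rightarrow> real" and k :: "nat \<Rightarrow> nat"
  assumes HS: "hilbert_schmidt \<Psi>" and inj: "\<And>x. Gam x = 0 \<Longrightarrow> x = 0"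
    and ev: "\<And>j. 1 \<le> j \<Longrightarrow> eigenvalue Gam (lam j)"
    and dec: "\<And>j. 1 \<le> j \<Longrightarrow> lam (j + 1) < lam j" and pos: "\<And>j. 1 \<le> j \<Longrightarrow> 0 < lam j"
    and k1: "\<And>n. 1 \<le> k n" and klim: "filterlim k at_top sequentially"
    and rate: "(\<lambda>n. 1 / lam (k n) / sqrt (real n)) \<longlonglongrightarrow> 0"
    and K: "0 \<le> K" and \<delta>: "0 < \<delta>"
  shows "\<exists>\<gamma>>0. \<forall>\<^sub>F n in sequentially. \<forall>\<omega> x l v z0.
    (\<forall>t\<le>n. x t = path \<omega> t) \<longrightarrow> data_size n \<omega> \<le> K \<longrightarrow>
    (\<exists>\<pi>. sets \<pi> = sets (borel \<Otimes>\<^sub>M count_space UNIV) \<and> prob_space \<pi> \<and> distr \<pi> borel fst = F \<and>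
      distr \<pi> (count_space UNIV) snd = measure_pmf (pmf_of_set {1..n}) \<and>
      mean_le \<pi> (\<lambda>z. norm (fst z - eps (int (snd z)) \<omega>) ^ 4) \<gamma>) \<longrightarrow>
    norm z0 \<le> K \<longrightarrow> eigen_listing (Gamma_hat n x) l v \<longrightarrow>
    ennreal (real n) * mallows_sq
      (distr (PiM UNIV (\<lambda>i::nat. if i = 0 then distr M borel (Z 0) else F)) borel
        (\<lambda>e. C_hat n (boot_path \<Psi> (e 0) e) - (\<Psi> o\<^sub>L Gam)))
      (boot_law n x (k n) l v z0) \<le> ennreal \<delta>"
proof -
  obtain \<Psi>' :: "'h \<Rightarrow>\<^sub>L 'h" where adj: "\<And>u w. \<Psi> u \<bullet> w = u \<bullet> \<Psi>' w" using adjoint_exists[of \<Psi>] by metis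
  define \<rho> where "\<rho> = (1 + norm \<Psi>) / 2"
  have \<rho>: "0 \<le> \<rho>" "\<rho> < 1" "norm \<Psi> \<le> \<rho>" using Psi_norm by (simp_all add: \<rho>_def)
  define m where "m = m4 + K ^ 4 + 8 * K + 8"
  have m: "m4 \<le> m" "K ^ 4 \<le> m" "8 * K + 8 \<le> m" "0 \<le> m" using m4_nonneg K by (auto simp: m_def)
  define b where "b = (sqrt K + 1 / (1 - norm \<Psi>) * (sqrt K + 2 * (1 + K)))\<^sup>2"
  define b' where "b' = (b + 2 * (1 + K))\<^sup>2"
  define Kc where "Kc = boot_const \<rho> m"
  have Kc: "0 \<le> Kc" unfolding Kc_def by (rule boot_const_nonneg[OF m(4)])
  define \<tau> where "\<tau> = min 1 (\<delta> / (8 * (Kc + 1)))"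
  have \<tau>: "0 < \<tau>" "\<tau> \<le> 1" "\<tau> \<le> \<delta> / (8 * (Kc + 1))" using Kc \<delta> by (auto simp: \<tau>_def)
  have \<tau>2: "\<tau>\<^sup>2 \<le> \<tau>" "0 < \<tau>\<^sup>2" using \<tau> by (simp_all add: power2_eq_square mult_left_le)
  have Kc\<tau>: "Kc * \<tau> \<le> \<delta> / 8"
  proof -
    have "(Kc + 1) * \<tau> \<le> (Kc + 1) * (\<delta> / (8 * (Kc + 1)))" using \<tau>(3) Kc by (intro mult_left_mono) auto
    also have "\<dots> = \<delta> / 8" using Kc by (simp add: divide_simps)
    finally show ?thesis using \<tau>(1) by (simp add: distrib_right)
  qed
  define \<eta> where "\<eta> = min (min ((1 - norm \<Psi>) / 2) \<tau>) (\<tau>\<^sup>2 / (192 * (K + 1)))"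
  have \<eta>: "0 < \<eta>" "\<eta> \<le> (1 - norm \<Psi>) / 2" "\<eta> \<le> \<tau>" "\<eta> \<le> \<tau>\<^sup>2 / (192 * (K + 1))"
  proof -
    show "0 < \<eta>" using K \<tau>2(2) \<tau>(1) Psi_norm by (simp add: \<eta>_def)
    show "\<eta> \<le> (1 - norm \<Psi>) / 2" "\<eta> \<le> \<tau>" "\<eta> \<le> \<tau>\<^sup>2 / (192 * (K + 1))" unfolding \<eta>_def by linarith+
  qed
  have \<eta>1: "\<eta> \<le> 1" using \<eta>(3) \<tau>(2) by simp
  have \<eta>2: "\<eta>\<^sup>2 \<le> \<tau>"
  proof -
    have "\<eta>\<^sup>2 \<le> \<eta>" using \<eta>(1) \<eta>1 by (simp add: power2_eq_square mult_left_le)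
    then show ?thesis using \<eta>(3) by simp
  qed
  have \<eta>4: "64 * (\<eta> ^ 4 * K) \<le> \<tau>\<^sup>2 / 3"
  proof -
    have "\<eta> ^ 4 \<le> \<eta> ^ 1" using \<eta>(1) \<eta>1 by (intro power_decreasing) auto
    then have "\<eta> ^ 4 * K \<le> \<eta> * (K + 1)" using K \<eta>(1) by (intro mult_mono) auto
    also have "\<dots> \<le> \<tau>\<^sup>2 / (192 * (K + 1)) * (K + 1)" using \<eta>(4) K by (intro mult_right_mono) auto
    also have "\<dots> = \<tau>\<^sup>2 / 192" using K by (simp add: divide_simps)
    finally show ?thesis by simp
  qed
  \<comment> \<open>By \<open>norm_add_fourth_le\<close> the coupling of innovations and residuals has fourth moment at most 8 times
    the sum of \<open>\<gamma>\<close> and of the bound of \<open>residual_bounds\<close>; each of the three resulting terms is at most \<open>\<tau>\<^sup>2 / 3\<close>.\<close>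
  define \<gamma> where "\<gamma> = \<tau>\<^sup>2 / 24"
  have "0 < \<gamma>" using \<tau>2 by (simp add: \<gamma>_def)
  have consistent: "\<forall>\<^sub>F n in sequentially. \<forall>x l v. eigen_listing (Gamma_hat n x) l v \<longrightarrow>
    real n * (norm (Gamma_hat n x - Gam))\<^sup>2 \<le> 1 + K \<longrightarrow>
    real n * (norm (C_hat n x - (\<Psi> o\<^sub>L Gamma_hat n x)))\<^sup>2 \<le> 1 + K \<longrightarrow>
    (1 / real n) * (\<Sum>t<n. (norm (x t))\<^sup>2) \<le> 1 + K \<longrightarrow>
      norm (Psi_hat n x (k n) l v - \<Psi>) \<le> \<eta> \<and>
      C_hat n x o\<^sub>L Pi_hat (k n) v = Psi_hat n x (k n) l v o\<^sub>L Gamma_hat n x"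
    by (rule Psi_hat_consistent[OF HS Gam_symmetric inj ev dec pos k1 klim rate _ \<eta>(1)]) (use K in auto)
  have n1: "\<forall>\<^sub>F n in sequentially. 64 * b\<^sup>2 * (1 / real n) \<le> \<tau>\<^sup>2 / 3"
    by (rule eventually_inverse_le) (use \<tau>2 in simp)
  have n2: "\<forall>\<^sub>F n in sequentially. Kc * (1 + b') * (1 / real n) \<le> \<delta> / 4"
    by (rule eventually_inverse_le) (use \<delta> in simp)
  show ?thesis
  proof (rule exI[of _ \<gamma>], rule conjI[OF \<open>0 < \<gamma>\<close>])
    show "\<forall>\<^sub>F n in sequentially. \<forall>\<omega> x l v z0.
    (\<forall>t\<le>n. x t = path \<omega> t) \<longrightarrow> data_size n \<omega> \<le> K \<longrightarrow>
    (\<exists>\<pi>. sets \<pi> = sets (borel \<Otimes>\<^sub>M count_space UNIV) \<and> prob_space \<pi> \<and> distr \<pi> borel fst = F \<and>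
      distr \<pi> (count_space UNIV) snd = measure_pmf (pmf_of_set {1..n}) \<and>
      mean_le \<pi> (\<lambda>z. norm (fst z - eps (int (snd z)) \<omega>) ^ 4) \<gamma>) \<longrightarrow>
    norm z0 \<le> K \<longrightarrow> eigen_listing (Gamma_hat n x) l v \<longrightarrow>
    ennreal (real n) * mallows_sq
      (distr (PiM UNIV (\<lambda>i::nat. if i = 0 then distr M borel (Z 0) else F)) borel
        (\<lambda>e. C_hat n (boot_path \<Psi> (e 0) e) - (\<Psi> o\<^sub>L Gam)))
      (boot_law n x (k n) l v z0) \<le> ennreal \<delta>"
      using consistent n1 n2 eventually_gt_at_top[of 0]
    proof (eventually_elim, intro allI impI)
      fix n \<omega> l and x v :: "nat \<Rightarrow> 'h" and z0 :: 'h
      assume cons: "\<forall>x l v. eigen_listing (Gamma_hat n x) l v \<longrightarrow>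
        real n * (norm (Gamma_hat n x - Gam))\<^sup>2 \<le> 1 + K \<longrightarrow>
        real n * (norm (C_hat n x - (\<Psi> o\<^sub>L Gamma_hat n x)))\<^sup>2 \<le> 1 + K \<longrightarrow>
        (1 / real n) * (\<Sum>t<n. (norm (x t))\<^sup>2) \<le> 1 + K \<longrightarrow>
          norm (Psi_hat n x (k n) l v - \<Psi>) \<le> \<eta> \<and>
          C_hat n x o\<^sub>L Pi_hat (k n) v = Psi_hat n x (k n) l v o\<^sub>L Gamma_hat n x"
        and n1: "64 * b\<^sup>2 * (1 / real n) \<le> \<tau>\<^sup>2 / 3" and n2: "Kc * (1 + b') * (1 / real n) \<le> \<delta> / 4"
        and n: "0 < n" and xp: "\<forall>t\<le>n. x t = path \<omega> t" and size: "data_size n \<omega> \<le> K"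
        and ex: "\<exists>\<pi>. sets \<pi> = sets (borel \<Otimes>\<^sub>M count_space UNIV) \<and> prob_space \<pi> \<and> distr \<pi> borel fst = F \<and>
          distr \<pi> (count_space UNIV) snd = measure_pmf (pmf_of_set {1..n}) \<and>
          mean_le \<pi> (\<lambda>z. norm (fst z - eps (int (snd z)) \<omega>) ^ 4) \<gamma>"
        and z0: "norm z0 \<le> K" and L: "eigen_listing (Gamma_hat n x) l v"
      obtain \<pi> where \<pi>: "sets \<pi> = sets (borel \<Otimes>\<^sub>M count_space UNIV)" "prob_space \<pi>" "distr \<pi> borel fst = F"
        "distr \<pi> (count_space UNIV) snd = measure_pmf (pmf_of_set {1..n})"
        "mean_le \<pi> (\<lambda>z. norm (fst z - eps (int (snd z)) \<omega>) ^ 4) \<gamma>" using ex by blast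
      define e where "e i = Z i \<omega>" for i
      have e_eps: "e j = eps (int j) \<omega>" if "1 \<le> j" for j using that by (simp add: e_def Z_def)
      define T1 where "T1 = (1 / (1 - norm \<Psi>))\<^sup>2 * (real n * (norm (noise n \<Psi> x e - S1))\<^sup>2)"
      define T2 where "T2 = real n * (norm (cross_sum n x e))\<^sup>2"
      define T3 where "T3 = (1 / real n) * (\<Sum>t<n. norm (x t) ^ 4)"
      define T4 where "T4 = (1 / real n) * (\<Sum>j=1..n. norm (e j) ^ 4)"
      define T5 where "T5 = real n * (norm ((1 / real n) *\<^sub>R (\<Sum>t<n. e (Suc t))))\<^sup>2"
      have "noise n \<Psi> x e = noise n \<Psi> (path \<omega>) (\<lambda>i. Z i \<omega>)" "cross_sum n x e = cross_sum n (path \<omega>) (\<lambda>i. Z i \<omega>)"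
        "(\<Sum>t<n. norm (x t) ^ 4) = (\<Sum>t<n. norm (path \<omega> t) ^ 4)"
        "(\<Sum>j=1..n. norm (e j) ^ 4) = (\<Sum>j=1..n. norm (eps (int j) \<omega>) ^ 4)"
        "(\<Sum>t<n. e (Suc t)) = (\<Sum>t<n. eps (int (Suc t)) \<omega>)"
        using xp by (simp_all add: noise_def cross_sum_def e_def Z_def cong: sum.cong_simp)
      then have "data_size n \<omega> = T1 + T2 + T3 + T4 + T5 + norm (x 0) ^ 4 + norm (x n) ^ 4"
        unfolding T1_def T2_def T3_def T4_def T5_def data_size_def using xp by simp
      moreover have "0 \<le> T1" "0 \<le> T2" "0 \<le> T3" "0 \<le> T4" "0 \<le> T5" "0 \<le> norm (x 0) ^ 4" "0 \<le> norm (x n) ^ 4"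
        unfolding T1_def T2_def T3_def T4_def T5_def by (simp_all add: sum_nonneg)
      ultimately have T: "T1 \<le> K" "T2 \<le> K" "T3 \<le> K" "T4 \<le> K" "T5 \<le> K" "norm (x 0) ^ 4 \<le> K" "norm (x n) ^ 4 \<le> K"
        using size by linarith+
      have ar: "x (Suc t) = \<Psi> (x t) + e (Suc t)" if "t < n" for t
        using that xp by (simp add: path_Suc e_eps)
      define Q where "Q = Psi_hat n x (k n) l v"
      define p where "p = Pi_hat (k n) v"
      have "norm (Q - \<Psi>) \<le> \<eta> \<and> C_hat n x o\<^sub>L p = Q o\<^sub>L Gamma_hat n x"
        unfolding Q_def p_def
      proof (rule cons[rule_format, OF L])
        define H where "H = Gamma_hat n x - Gam"
        have G: "Gamma_hat n x = (\<Psi> o\<^sub>L Gamma_hat n x o\<^sub>L \<Psi>') + noise n \<Psi> x e"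
          by (rule Gamma_hat_autoregression[OF _ adj]) (rule ar)
        have g: "Gamma_hat n x u = \<Psi> (Gamma_hat n x (\<Psi>' u)) + noise n \<Psi> x e u" for u
          using arg_cong[OF G, of "\<lambda>A. blinfun_apply A u"]
          by (simp add: blinfun.add_left)
        have s: "Gam u = \<Psi> (Gam (\<Psi>' u)) + S1 u" for u
          using arg_cong[OF Gam_stationary[OF adj], of "\<lambda>A. blinfun_apply A u"]
          by (simp add: blinfun.add_left)
        have "H = (\<Psi> o\<^sub>L H o\<^sub>L \<Psi>') + (noise n \<Psi> x e - S1)"
        proof (rule blinfun_eqI)
          fix u
          show "H u = ((\<Psi> o\<^sub>L H o\<^sub>L \<Psi>') + (noise n \<Psi> x e - S1)) u"
            using g[of u] s[of u] by (simp add: H_def blinfun.add_left blinfun.diff_left blinfun.diff_right)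
        qed
        then have "norm H \<le> 1 / (1 - norm \<Psi>) * norm (noise n \<Psi> x e - S1)"
          by (rule stationarity_norm_le[OF _ adj]) (use Psi_norm in auto)
        then have "(norm H)\<^sup>2 \<le> (1 / (1 - norm \<Psi>) * norm (noise n \<Psi> x e - S1))\<^sup>2" by (intro power_mono) auto
        then have "real n * (norm H)\<^sup>2 \<le> real n * (1 / (1 - norm \<Psi>) * norm (noise n \<Psi> x e - S1))\<^sup>2"
          by (rule mult_left_mono) simp
        also have "\<dots> = T1" unfolding T1_def power_mult_distrib by (simp only: mult_ac)
        finally show "real n * (norm (Gamma_hat n x - Gam))\<^sup>2 \<le> 1 + K" using T(1) by (simp add: H_def)
        have "C_hat n x - (\<Psi> o\<^sub>L Gamma_hat n x) = cross_sum n x e"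
          using C_hat_autoregression[of n x \<Psi> e] ar by simp
        then show "real n * (norm (C_hat n x - (\<Psi> o\<^sub>L Gamma_hat n x)))\<^sup>2 \<le> 1 + K" using T(2) by (simp add: T2_def)
        have "(\<Sum>t<n. (norm (x t))\<^sup>2) \<le> (\<Sum>t<n. 1 + norm (x t) ^ 4)" by (intro sum_mono square_le_fourth)
        then have "(1 / real n) * (\<Sum>t<n. (norm (x t))\<^sup>2) \<le> (1 / real n) * (\<Sum>t<n. 1 + norm (x t) ^ 4)"
          by (rule mult_left_mono) simp
        also have "\<dots> = 1 + T3" unfolding T3_def sum.distrib distrib_left using n by simp
        finally show "(1 / real n) * (\<Sum>t<n. (norm (x t))\<^sup>2) \<le> 1 + K" using T(3) by simp
      qed
      then have Q\<Psi>: "norm (\<Psi> - Q) \<le> \<eta>" and normal: "C_hat n x o\<^sub>L p = Q o\<^sub>L Gamma_hat n x"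
        by (simp_all add: norm_minus_commute)
      have Qp: "Q o\<^sub>L p = Q"
        unfolding Q_def p_def Psi_hat_def blinfun_compose_assoc Gamma_dagger_Pi_hat[OF L] ..
      have nQ: "norm Q \<le> \<rho>"
      proof -
        have "norm Q \<le> norm \<Psi> + norm (\<Psi> - Q)" using norm_triangle_sub[of Q \<Psi>] by (simp add: norm_minus_commute)
        then show ?thesis using Q\<Psi> \<eta>(2) by (simp add: \<rho>_def)
      qed
      define cr where "cr = centered_residual n Q x"
      define d where "d j = norm (e j - cr j) ^ 4" for j
      note rb = residual_bounds[where x = x and e = e and \<Psi> = \<Psi>, OF n ar Psi_norm Q\<Psi> \<eta>1 T(5)[unfolded T5_def] T(3)[unfolded T3_def] T(6,7), folded b_def]
      have "8 * ((1 / real n) * (\<Sum>j=1..n. d j)) \<le> 64 * (\<eta> ^ 4 * K) + 64 * b\<^sup>2 * (1 / real n)"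
        using rb(2) by (simp add: d_def cr_def)
      then have d8: "8 * ((1 / real n) * (\<Sum>j=1..n. d j)) \<le> 2 * (\<tau>\<^sup>2 / 3)" using \<eta>4 n1 by linarith
      have fst_m: "fst \<in> measurable \<pi> borel" and snd_m: "snd \<in> measurable \<pi> (count_space UNIV)"
        unfolding measurable_cong_sets[OF \<pi>(1) refl] by measurable
      have cr_m: "(\<lambda>z. cr (snd z)) \<in> borel_measurable \<pi>" by (rule measurable_compose[OF snd_m]) simp
      define d' where "d' j = norm (eps (int j) \<omega> - cr j) ^ 4" for j
      have "(\<Sum>j=1..n. d' j) = (\<Sum>j=1..n. d j)" by (intro sum.cong) (simp_all add: d_def d'_def e_eps)
      then have "mean_le (measure_pmf (pmf_of_set {1..n})) d' ((1 / real n) * (\<Sum>j=1..n. d j))"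
        by (intro mean_le_pmf_of_nat_interval n) (simp_all add: d'_def)
      then have snd_mean: "mean_le \<pi> (\<lambda>z. d' (snd z)) ((1 / real n) * (\<Sum>j=1..n. d j))"
        unfolding \<pi>(4)[symmetric] using mean_le_distr_iff[OF snd_m, of d'] by (simp add: d'_def)
      have coupling: "mean_le \<pi> (\<lambda>z. norm (fst z - centered_residual n Q x (snd z)) ^ 4) (\<tau>\<^sup>2)"
      proof (rule mean_le_mono[OF mean_le_add[OF mean_le_cmult[OF \<pi>(5), of 8] mean_le_cmult[OF snd_mean, of 8]]])
        show "(\<lambda>z. norm (fst z - centered_residual n Q x (snd z)) ^ 4) \<in> borel_measurable \<pi>"
          unfolding cr_def[symmetric] using fst_m cr_m by measurable
        show "norm (fst z - centered_residual n Q x (snd z)) ^ 4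
          \<le> 8 * norm (fst z - eps (int (snd z)) \<omega>) ^ 4 + 8 * d' (snd z)" for z
          using norm_add_fourth_le[of "fst z - eps (int (snd z)) \<omega>" "eps (int (snd z)) \<omega> - cr (snd z)"]
          by (simp add: d'_def cr_def)
        show "8 * \<gamma> + 8 * ((1 / real n) * (\<Sum>j=1..n. d j)) \<le> \<tau>\<^sup>2" using d8 unfolding \<gamma>_def by linarith
      qed simp_all
      have res: "(1 / real n) * (\<Sum>j=1..n. norm (centered_residual n Q x j) ^ 4) \<le> m"
      proof -
        have "norm (cr j) ^ 4 \<le> 8 * norm (e j) ^ 4 + 8 * d j" for j
          using norm_add_fourth_le[of "e j" "- (e j - cr j)"] unfolding norm_minus_cancel d_def by simp
        then have "(\<Sum>j=1..n. norm (cr j) ^ 4) \<le> (\<Sum>j=1..n. 8 * norm (e j) ^ 4 + 8 * d j)" by (rule sum_mono)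
        then have "(1 / real n) * (\<Sum>j=1..n. norm (cr j) ^ 4) \<le> (1 / real n) * (\<Sum>j=1..n. 8 * norm (e j) ^ 4 + 8 * d j)"
          by (rule mult_left_mono) simp
        also have "\<dots> = 8 * T4 + 8 * ((1 / real n) * (\<Sum>j=1..n. d j))"
          by (simp add: T4_def sum.distrib sum_distrib_left[symmetric] distrib_left add_divide_distrib)
        also have "\<dots> \<le> 8 * K + 8" using T(4) d8 \<tau>2(1) \<tau>(2) by linarith
        finally show ?thesis using m(3) by (simp add: cr_def)
      qed
      have zm: "norm z0 ^ 4 \<le> m" using power_mono[OF z0 norm_ge_zero, of 4] m(2) by linarith
      have mu: "prob_space (distr M borel (Z 0))" "sets (distr M borel (Z 0)) = sets borel"
        "mean_le (distr M borel (Z 0)) (\<lambda>x. norm x ^ 4) m"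
        using mean_le_distr_iff[OF Z_meas[of 0], of "\<lambda>x. norm x ^ 4" m] mean_le_weaken[OF Z_fourth[of 0] m(1)]
        by (auto intro: prob_space_distr)
      have F4: "mean_le F (\<lambda>x. norm x ^ 4) m" by (rule mean_le_weaken[OF F_moments(1) m(1)])
      have "ennreal (real n) * mallows_sq
        (distr (PiM UNIV (\<lambda>i::nat. if i = 0 then distr M borel (Z 0) else F)) borel
          (\<lambda>e. C_hat n (boot_path \<Psi> (e 0) e) - (\<Psi> o\<^sub>L Gam)))
        (boot_law n x (k n) l v z0)
        \<le> ennreal (boot_const \<rho> m * (\<eta>\<^sup>2 + \<tau> + \<tau>\<^sup>2 + 1 / real n + real n * (norm (cov_bias n Q x))\<^sup>2))"
        unfolding boot_law_def Q_def[symmetric] p_def[symmetric]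
        by (rule bootstrap_bound[OF basis mu F(1,2) F4 F_moments(2,3) \<pi>(2,1,3,4) coupling zm res \<rho>(1,2,3) nQ Q\<Psi>
            \<tau>(1) adj Gam_stationary[OF adj] normal _ Qp n]) (simp add: p_def Pi_hat_symmetric)
      also have "\<dots> \<le> ennreal \<delta>"
      proof (rule ennreal_leI)
        have "\<eta>\<^sup>2 + \<tau> + \<tau>\<^sup>2 + 1 / real n + real n * (norm (cov_bias n Q x))\<^sup>2 \<le> 3 * \<tau> + (1 + b') * (1 / real n)"
          using \<eta>2 \<tau>2(1) rb(3) unfolding b'_def[symmetric] distrib_right by simp
        then have "Kc * (\<eta>\<^sup>2 + \<tau> + \<tau>\<^sup>2 + 1 / real n + real n * (norm (cov_bias n Q x))\<^sup>2)
          \<le> Kc * (3 * \<tau> + (1 + b') * (1 / real n))" using Kc by (rule mult_left_mono)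
        also have "\<dots> = 3 * (Kc * \<tau>) + Kc * (1 + b') * (1 / real n)" by (simp add: distrib_left)
        also have "\<dots> \<le> \<delta>" using Kc\<tau> n2 \<delta> by linarith
        finally show "boot_const \<rho> m * (\<eta>\<^sup>2 + \<tau> + \<tau>\<^sup>2 + 1 / real n + real n * (norm (cov_bias n Q x))\<^sup>2) \<le> \<delta>"
          by (simp add: Kc_def)
      qed
      finally show "ennreal (real n) * mallows_sq
        (distr (PiM UNIV (\<lambda>i::nat. if i = 0 then distr M borel (Z 0) else F)) borel
          (\<lambda>e. C_hat n (boot_path \<Psi> (e 0) e) - (\<Psi> o\<^sub>L Gam)))
        (boot_law n x (k n) l v z0) \<le> ennreal \<delta>" .
    qed
  qed
qed

end

section \<open>Convergence in probability\<close>

lemma threshold_rate: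
  fixes f :: "nat \<Rightarrow> real"
  assumes f: "f \<in> O(\<lambda>n. real n powr (1/4) / ln (real n) powr \<beta>)" and \<beta>: "0 \<le> \<beta>"
  shows "(\<lambda>n. f n / sqrt (real n)) \<longlonglongrightarrow> 0"
proof -
  obtain c where c: "0 < c" "\<forall>\<^sub>F n in sequentially. norm (f n) \<le> c * norm (real n powr (1/4) / ln (real n) powr \<beta>)"
    using landau_o.bigE[OF f] by blast
  have "(\<lambda>n. c * real n powr - (1/4)) \<longlonglongrightarrow> c * 0"
    by (intro tendsto_intros tendsto_neg_powr filterlim_real_sequentially) simp
  then have lim: "(\<lambda>n. c * real n powr - (1/4)) \<longlonglongrightarrow> 0" by simp
  show ?thesis
  proof (rule Lim_null_comparison[OF _ lim])
    show "\<forall>\<^sub>F n in sequentially. norm (f n / sqrt (real n)) \<le> c * real n powr - (1/4)"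
      using c(2) eventually_ge_at_top[of 3]
    proof eventually_elim
      case (elim n)
      have "exp 1 \<le> real n" using elim(2) exp_le by simp
      then have "1 \<le> ln (real n)" using elim(2) by (subst ln_ge_iff) auto
      then have "1 \<le> ln (real n) powr \<beta>" using \<beta> by (rule ge_one_powr_ge_zero)
      then have "real n powr (1/4) / ln (real n) powr \<beta> \<le> real n powr (1/4) / 1"
        by (intro divide_left_mono) auto
      then have "c * norm (real n powr (1/4) / ln (real n) powr \<beta>) \<le> c * real n powr (1/4)"
        using c(1) by (intro mult_left_mono) auto
      with elim(1) have "norm (f n) \<le> c * real n powr (1/4)" by linarith
      then have "norm (f n) / sqrt (real n) \<le> c * real n powr (1/4) / sqrt (real n)" by (rule divide_right_mono) simp
      also have "\<dots> = c * real n powr - (1/4)"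
      proof -
        have "real n powr (1/4) = real n powr - (1/4) * real n powr (1/2)" by (simp add: powr_add[symmetric])
        also have "real n powr (1/2) = sqrt (real n)" by (simp add: powr_half_sqrt)
        finally show ?thesis using elim(2) by simp
      qed
      finally show ?case by simp
    qed
  qed
qed

lemma tendsto_zero_ennrealI:
  fixes f :: "nat \<Rightarrow> ennreal"
  assumes "\<And>\<epsilon>. 0 < \<epsilon> \<Longrightarrow> \<forall>\<^sub>F n in sequentially. f n \<le> ennreal \<epsilon>"
  shows "f \<longlonglongrightarrow> 0"
proof (rule order_tendstoI)
  fix a :: ennreal assume "0 < a"
  then obtain b where b: "0 < b" "b < a" using dense by blast
  then have "b < \<top>" using order_less_le_trans by fastforce
  then have "b = ennreal (enn2real b)" "0 < enn2real b" using b by (simp_all add: enn2real_positive_iff)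
  then show "\<forall>\<^sub>F n in sequentially. f n < a" using assms[of "enn2real b"] b(2) by (auto elim!: eventually_mono)
qed simp

context far1
begin

text \<open>Almost surely, the data are the path with the independent inputs \<open>Z\<close>.\<close>

lemma law_C_hat:
  "distr M borel (\<lambda>\<omega>. C_hat n (sample X n \<omega>) - D)
    = distr (PiM UNIV (\<lambda>i::nat. if i = 0 then distr M borel (Z 0) else F)) borel
        (\<lambda>e. C_hat n (boot_path \<Psi> (e 0) e) - D)"
proof -
  let ?P = "PiM UNIV (\<lambda>_::nat. borel :: 'h measure)"
  define h where "h e = C_hat n (boot_path \<Psi> (e 0) e) - D" for e :: "nat \<Rightarrow> 'h"
  have "distr M ?P (\<lambda>\<omega>. \<lambda>i\<in>UNIV. Z i \<omega>) = PiM UNIV (\<lambda>i. if i = 0 then distr M borel (Z 0) else F)"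
  proof (rule distr_indep_sequence[OF Z_indep _ Z_meas])
    fix i :: nat
    have "distr M borel (eps (int i)) = F" unfolding F_def by (rule eps_law)
    then show "distr M borel (Z i) = (if i = 0 then distr M borel (Z 0) else F)"
      by (simp add: Z_def[abs_def])
  qed simp
  then have law: "distr M ?P (\<lambda>\<omega> i. Z i \<omega>) = PiM UNIV (\<lambda>i. if i = 0 then distr M borel (Z 0) else F)"
    by (simp add: restrict_def)
  have hm: "h \<in> borel_measurable ?P"
    unfolding h_def[abs_def] by (intro measurable_C_hat_diff measurable_boot_path measurable_component_singleton) simp
  have Zm: "(\<lambda>\<omega> i. Z i \<omega>) \<in> measurable M ?P"
    by (rule measurable_PiM_single') (auto simp: space_PiM)
  have "distr M borel (\<lambda>\<omega>. C_hat n (sample X n \<omega>) - D) = distr M borel (\<lambda>\<omega>. h (\<lambda>i. Z i \<omega>))"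
  proof (rule distr_cong_AE)
    show "AE \<omega> in M. C_hat n (sample X n \<omega>) - D = h (\<lambda>i. Z i \<omega>)"
      using X_eq_path
    proof eventually_elim
      case (elim \<omega>)
      have "C_hat n (sample X n \<omega>) = C_hat n (path \<omega>)"
        unfolding C_hat_def using elim by (intro arg_cong[where f = "\<lambda>A. _ *\<^sub>R A"] sum.cong) (auto simp: sample_def)
      then show ?case by (simp add: h_def path_def)
    qed
    show "(\<lambda>\<omega>. C_hat n (sample X n \<omega>) - D) \<in> borel_measurable M"
      by (rule measurable_C_hat_diff) (simp add: sample_def X_meas)
    show "(\<lambda>\<omega>. h (\<lambda>i. Z i \<omega>)) \<in> borel_measurable M" by (rule measurable_compose[OF Zm hm])
  qed simp_all
  also have "\<dots> = distr (distr M ?P (\<lambda>\<omega> i. Z i \<omega>)) borel h"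
    unfolding distr_distr[OF hm Zm] by (simp add: comp_def)
  finally show ?thesis unfolding law h_def[abs_def] .
qed

end

theorem theorem4p3:
  fixes M :: "'a measure"
    and X eps :: "int \<Rightarrow> 'a \<Rightarrow> 'h::{real_inner, banach, second_countable_topology}"
    and \<Psi> \<Gamma> C :: "'h \<Rightarrow>\<^sub>L 'h"
    and lam :: "nat \<Rightarrow> real"
    and k :: "nat \<Rightarrow> nat"
    and lamhat :: "nat \<Rightarrow> (nat \<Rightarrow> 'h) \<Rightarrow> nat \<Rightarrow> real"
    and vhat :: "nat \<Rightarrow> (nat \<Rightarrow> 'h) \<Rightarrow> nat \<Rightarrow> 'h"
    and x0 :: "nat \<Rightarrow> (nat \<Rightarrow> 'h) \<Rightarrow> 'h"
  assumes "prob_space M"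
    and stationary: "strictly_stationary M X"
    and FAR: "\<forall>t. AE \<omega> in M. X (t + 1) \<omega> = blinfun_apply \<Psi> (X t \<omega>) + eps (t + 1) \<omega>"
    and X_mean: "\<forall>t. integrable M (X t) \<and> (\<integral>\<omega>. X t \<omega> \<partial>M) = 0"
    and \<Gamma>: "\<Gamma> = op_expectation M (\<lambda>\<omega>. tensor (X 0 \<omega>) (X 0 \<omega>))"
    and C: "C = op_expectation M (\<lambda>\<omega>. tensor (X 0 \<omega>) (X 1 \<omega>))"
    \<comment> \<open>(i)\<close>
    and eps_iid: "iid M eps"
    and eps_mean: "\<forall>t. integrable M (eps t) \<and> (\<integral>\<omega>. eps t \<omega> \<partial>M) = 0"
    and eps_moment: "\<forall>t. integrable M (\<lambda>\<omega>. (norm (eps t \<omega>)) ^ 4)"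
    \<comment> \<open>(ii)\<close>
    and \<Psi>_HS: "hilbert_schmidt \<Psi>"
    and \<Psi>_norm: "norm \<Psi> < 1"
    \<comment> \<open>(iii)\<close>
    and lam_eigenvalues: "{\<mu>. eigenvalue \<Gamma> \<mu>} = lam ` {1..}"
    and lam_decreasing: "\<forall>j\<ge>1. lam (j + 1) < lam j"
    and lam_pos: "\<forall>j\<ge>1. 0 < lam j"
    and lam_mult: "\<forall>j\<ge>1. dim (eigenspace \<Gamma> (lam j)) = 1"
    \<comment> \<open>eigenvalues and orthonormal eigenvectors of the empirical covariance operator\<close>
    and hat: "\<forall>n\<ge>1. \<forall>\<omega>\<in>space M.
      eigen_listing (Gamma_hat n (sample X n \<omega>)) (lamhat n (sample X n \<omega>)) (vhat n (sample X n \<omega>))"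
    \<comment> \<open>the initial value of the bootstrap process, a function of the data\<close>
    and x0: "bounded_in_prob M (\<lambda>n \<omega>. x0 n (sample X n \<omega>))"
    and k_pos: "\<forall>n. 1 \<le> k n"
    and k_lim: "filterlim k at_top sequentially"
    and rate1: "(\<lambda>n. real (k n) / real n * (\<Sum>j=1..k n. 1 / (spectral_gap lam j)\<^sup>2)) \<longlonglongrightarrow> 0"
    and rate2: "\<exists>\<beta>>1/2. (\<lambda>n. 1 / lam (k n)) \<in> O(\<lambda>n. real n powr (1/4) / ln (real n) powr \<beta>)"
    and rate3: "\<exists>\<beta>>1. (\<lambda>n. 1 / lam (k n) * (\<Sum>j=1..k n. 1 / spectral_gap lam j))
      \<in> O(\<lambda>n. real n powr (1/4) / ln (real n) powr \<beta>)"
  shows "tendsto_zero_in_prob M (\<lambda>n \<omega>.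
    ennreal (real n) *
      mallows_sq
        (distr M borel (\<lambda>\<omega>'. C_hat n (sample X n \<omega>') - C))
        (boot_law n (sample X n \<omega>) (k n) (lamhat n (sample X n \<omega>)) (vhat n (sample X n \<omega>))
          (x0 n (sample X n \<omega>))))"
proof -
  interpret M: prob_space M by fact
  obtain B :: "'h set" where B: "orthonormal_basis B" using \<Psi>_HS unfolding hilbert_schmidt_def by blast
  have X_meas: "X t \<in> borel_measurable M" for t using stationary by (simp add: strictly_stationary_def)
  have X_law: "distr M borel (X t) = distr M borel (X 0)" for t
  proof -
    let ?P = "PiM UNIV (\<lambda>_::int. borel :: 'h measure)"
    have m: "(\<lambda>\<omega> s. X (s + h) \<omega>) \<in> measurable M ?P" for h
      by (rule measurable_PiM_single') (auto simp: space_PiM X_meas)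
    have c: "(\<lambda>f. f 0) \<in> borel_measurable ?P" by (rule measurable_component_singleton) simp
    have p: "distr M borel (X h) = distr (distr M ?P (\<lambda>\<omega> s. X (s + h) \<omega>)) borel (\<lambda>f. f 0)" for h
      unfolding distr_distr[OF c m] by (simp add: comp_def)
    have "distr M ?P (\<lambda>\<omega> s. X (s + t) \<omega>) = distr M ?P (\<lambda>\<omega> s. X (s + 0) \<omega>)"
      using stationary by (simp add: strictly_stationary_def)
    then show ?thesis using p[of t] p[of 0] by simp
  qed
  have indep: "M.indep_vars (\<lambda>_. borel) eps UNIV" and eps_law: "distr M borel (eps s) = distr M borel (eps t)" for s t
    using eps_iid by (simp_all add: iid_def)
  interpret A: far1 M X eps \<Psi> B
    by unfold_locales (use X_meas X_law X_mean FAR indep eps_law eps_mean eps_moment \<Psi>_norm B in simp_all)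
  have Gam: "A.Gam = \<Gamma>" by (simp add: A.Gam_def \<Gamma>)
  have C': "C = \<Psi> o\<^sub>L A.Gam" unfolding C by (rule A.lag_cov)
  have ev: "eigenvalue A.Gam (lam j)" if "1 \<le> j" for j
    using lam_eigenvalues that unfolding Gam by (metis (mono_tags, lifting) atLeast_iff image_eqI mem_Collect_eq)
  have inj: "x = 0" if "A.Gam x = 0" for x
  proof (rule ccontr)
    assume "x \<noteq> 0"
    then have "eigenvalue \<Gamma> 0" using that unfolding Gam eigenvalue_def by (intro exI[of _ x]) simp
    then have "0 \<in> lam ` {1..}" using lam_eigenvalues by blast
    then show False using lam_pos by force
  qed
  obtain \<beta> where "1 / 2 < \<beta>" and O: "(\<lambda>n. 1 / lam (k n)) \<in> O(\<lambda>n. real n powr (1/4) / ln (real n) powr \<beta>)"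
    using rate2 by blast
  then have "0 \<le> \<beta>" by linarith
  from threshold_rate[OF O this] have rate: "(\<lambda>n. 1 / lam (k n) / sqrt (real n)) \<longlonglongrightarrow> 0" .
  define Y where "Y n \<omega> = ennreal (real n) *
      mallows_sq
        (distr M borel (\<lambda>\<omega>'. C_hat n (sample X n \<omega>') - C))
        (boot_law n (sample X n \<omega>) (k n) (lamhat n (sample X n \<omega>)) (vhat n (sample X n \<omega>))
          (x0 n (sample X n \<omega>)))" for n \<omega>
  have "(\<lambda>n. outer_measure_of M {\<omega>\<in>space M. Y n \<omega> > ennreal \<delta>}) \<longlonglongrightarrow> 0" if \<delta>: "0 < \<delta>" for \<delta>
  proof (rule tendsto_zero_ennrealI)
    fix \<epsilon> :: real assume \<epsilon>: "0 < \<epsilon>"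
    then have "\<epsilon> / 3 > 0" by simp
    obtain c where c: "\<And>n. 0 < n \<Longrightarrow> mean_le M (A.data_size n) c" using A.data_size_bounded by blast
    obtain K2 where K2: "\<forall>\<^sub>F n in sequentially.
        outer_measure_of M {\<omega>\<in>space M. norm (x0 n (sample X n \<omega>)) > K2} \<le> ennreal (\<epsilon> / 3)"
      using x0 \<open>\<epsilon> / 3 > 0\<close> unfolding bounded_in_prob_def by blast
    \<comment> \<open>the bound for the data, exceeded with probability at most \<open>\<epsilon> / 3\<close>, and for the initial value\<close>
    define K where "K = max 1 (max K2 (3 * c / \<epsilon>))"
    have K: "0 < K" "K2 \<le> K" "3 * c / \<epsilon> \<le> K" by (simp_all add: K_def)
    obtain \<gamma> where \<gamma>: "0 < \<gamma>" and close: "\<forall>\<^sub>F n in sequentially. \<forall>\<omega> x l v z0.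
        (\<forall>t\<le>n. x t = A.path \<omega> t) \<longrightarrow> A.data_size n \<omega> \<le> K \<longrightarrow>
        (\<exists>\<pi>. sets \<pi> = sets (borel \<Otimes>\<^sub>M count_space UNIV) \<and> prob_space \<pi> \<and> distr \<pi> borel fst = A.F \<and>
          distr \<pi> (count_space UNIV) snd = measure_pmf (pmf_of_set {1..n}) \<and>
          mean_le \<pi> (\<lambda>z. norm (fst z - eps (int (snd z)) \<omega>) ^ 4) \<gamma>) \<longrightarrow>
        norm z0 \<le> K \<longrightarrow> eigen_listing (Gamma_hat n x) l v \<longrightarrow>
        ennreal (real n) * mallows_sq
          (distr (PiM UNIV (\<lambda>i::nat. if i = 0 then distr M borel (A.Z 0) else A.F)) borel
            (\<lambda>e. C_hat n (boot_path \<Psi> (e 0) e) - (\<Psi> o\<^sub>L A.Gam)))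
          (boot_law n x (k n) l v z0) \<le> ennreal \<delta>"
      using A.bootstrap_close_on_good_data[of lam k K \<delta>, OF \<Psi>_HS inj ev
        lam_decreasing[rule_format] lam_pos[rule_format] k_pos[rule_format] k_lim rate less_imp_le[OF K(1)] \<delta>]
      by blast
    show "\<forall>\<^sub>F n in sequentially. outer_measure_of M {\<omega>\<in>space M. Y n \<omega> > ennreal \<delta>} \<le> ennreal \<epsilon>"
      using K2 close A.empirical_coupling_prob[OF \<gamma> \<open>\<epsilon> / 3 > 0\<close>] eventually_gt_at_top[of 0]
    proof eventually_elim
      case (elim n)
      then have n: "0 < n" by simp
      \<comment> \<open>The exceptional events are enclosed in measurable sets: too large an initial value, a poor empirical
        coupling, and data that do not agree with the path.\<close>
      obtain E where E: "E \<in> sets M" "{\<omega>\<in>space M. norm (x0 n (sample X n \<omega>)) > K2} \<subseteq> E" "emeasure M E \<le> ennreal (\<epsilon> / 3)"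
        using outer_measure_of_attain[of "{\<omega>\<in>space M. norm (x0 n (sample X n \<omega>)) > K2}" M] elim(1) by auto
      obtain G where G: "G \<in> sets M" "emeasure M (space M - G) \<le> ennreal (\<epsilon> / 3)"
        "\<And>\<omega>. \<omega> \<in> G \<Longrightarrow> \<exists>\<pi>. sets \<pi> = sets (borel \<Otimes>\<^sub>M count_space UNIV) \<and> prob_space \<pi> \<and> distr \<pi> borel fst = A.F \<and>
          distr \<pi> (count_space UNIV) snd = measure_pmf (pmf_of_set {1..n}) \<and>
          mean_le \<pi> (\<lambda>z. norm (fst z - eps (int (snd z)) \<omega>) ^ 4) \<gamma>"
        using elim(3) by blast
      obtain N where N: "N \<in> sets M" "emeasure M N = 0" "{\<omega>\<in>space M. \<not> (\<forall>t. X (int t) \<omega> = A.path \<omega> t)} \<subseteq> N"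
        using AE_E[OF A.X_eq_path] by blast
      define S where "S = {\<omega>\<in>space M. A.data_size n \<omega> > K}"
      have S: "S \<in> sets M" using mean_leD(2)[OF c[OF n]] by (simp add: S_def)
      have "emeasure M S \<le> ennreal (c / K)" unfolding S_def by (rule M.mean_le_markov[OF c[OF n] K(1)])
      also have "\<dots> \<le> ennreal (\<epsilon> / 3)" using K(1,3) \<epsilon> by (intro ennreal_leI) (simp add: field_simps)
      finally have PS: "emeasure M S \<le> ennreal (\<epsilon> / 3)" .
      have "{\<omega>\<in>space M. Y n \<omega> > ennreal \<delta>} \<subseteq> (S \<union> E) \<union> ((space M - G) \<union> N)"
      proof
        fix \<omega> assume w: "\<omega> \<in> {\<omega>\<in>space M. Y n \<omega> > ennreal \<delta>}"
        show "\<omega> \<in> (S \<union> E) \<union> ((space M - G) \<union> N)"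
        proof (rule ccontr)
          assume "\<omega> \<notin> (S \<union> E) \<union> ((space M - G) \<union> N)"
          then have notin: "\<omega> \<in> space M" "\<omega> \<notin> S" "\<omega> \<notin> E" "\<omega> \<in> G" "\<omega> \<notin> N" using w by auto
          have "Y n \<omega> \<le> ennreal \<delta>"
            unfolding Y_def C' A.law_C_hat
          proof (rule elim(2)[rule_format])
            have "\<forall>t. X (int t) \<omega> = A.path \<omega> t" using notin N(3) by blast
            then show "sample X n \<omega> t = A.path \<omega> t" if "t \<le> n" for t using that by (simp add: sample_def)
            show "A.data_size n \<omega> \<le> K" using notin by (simp add: S_def)
            have "norm (x0 n (sample X n \<omega>)) \<le> K2" using notin E(2) by force
            then show "norm (x0 n (sample X n \<omega>)) \<le> K" using K(2) by simp
            show "eigen_listing (Gamma_hat n (sample X n \<omega>)) (lamhat n (sample X n \<omega>)) (vhat n (sample X n \<omega>))"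
              using hat n notin(1) by simp
          qed (rule G(3)[OF notin(4)])
          then show False using w leD by blast
        qed
      qed
      then have "outer_measure_of M {\<omega>\<in>space M. Y n \<omega> > ennreal \<delta>} \<le> outer_measure_of M ((S \<union> E) \<union> ((space M - G) \<union> N))"
        by (rule outer_measure_of_mono)
      also have "\<dots> = emeasure M ((S \<union> E) \<union> ((space M - G) \<union> N))" using S E G N by simp
      also have "\<dots> \<le> emeasure M (S \<union> E) + emeasure M ((space M - G) \<union> N)"
        using S E G N by (intro emeasure_subadditive) auto
      also have "\<dots> \<le> (emeasure M S + emeasure M E) + (emeasure M (space M - G) + emeasure M N)"
        using S E G N by (intro add_mono emeasure_subadditive) auto
      also have "\<dots> \<le> (ennreal (\<epsilon> / 3) + ennreal (\<epsilon> / 3)) + (ennreal (\<epsilon> / 3) + 0)"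
        using PS E(3) G(2) N(2) by (intro add_mono) auto
      also have "\<dots> = ennreal \<epsilon>" using \<epsilon> by (simp add: ennreal_plus[symmetric] del: ennreal_plus)
      finally show ?case .
    qed
  qed
  then show ?thesis unfolding tendsto_zero_in_prob_def Y_def by blast
qed

end
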